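(* Let $\Omega$ be an eventually outward quiver of type $D_\infty$, and let $\mathrm{Reps}(\Omega)$ be the category of all (possibly infinite-dimensional) representations of $\Omega$ over a fixed field $\mathbb{F}$. Then $\mathrm{Reps}(\Omega)$ is of unique type and infinite Krull-Schmidt. Moreover every indecomposable representation of $\Omega$ is FLEI, and taking dimension vectors gives a bijection between the isomorphism classes of indecomposable representations of $\Omega$ and the positive roots of $\Omega$.
   Context: A quiver $\Omega=(\Omega_0,\Omega_1)$ is a (possibly infinite) set $\Omega_0$ of vertices and a set $\Omega_1$ of ordered pairs of vertices (arrows); for $a=(i,j)$, $s(a)=i$ is the source and $t(a)=j$ the target. A quiver is of type $D_\infty$ if its underlying graph has vertices $u,u',v_1,v_2,v_3,\dots$ and edges $u-v_1$, $u'-v_1$, and $v_j-v_{j+1}$ for $j\ge 1$ (with arbitrary orientation). Paths and connected components refer to the underlying undirected graph. A journey is an undirected path (no repeated vertices or arrows) that is finite, or infinite in one direction, with a chosen starting vertex, called its source. A quiver is eventually outward if every journey contains at most finitely many arrows that point towards the source of that journey. A representation $V$ of $\Omega$ assigns to each vertex $i$ an $\mathbb{F}$-vector space $V(i)$ (of arbitrary dimension) and to each arrow $a$ a linear map $V(a):V(s(a))\to V(t(a))$; morphisms are families of linear maps $f(i)$ commuting with the arrow maps. The dimension vector of $V$ is $i\mapsto \dim V(i)$. $V$ is FLEI if every $V(i)$ is finite-dimensional and $V(a)$ is an isomorphism for all but finitely many arrows $a$. $\mathrm{Reps}(\Omega)$ is of unique type if indecomposables with the same dimension vector are isomorphic.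 A category is infinite Krull-Schmidt if every object is a (possibly infinite) direct sum of indecomposable objects and, given two such decompositions of an object, there is a bijection between the two sets of summands taking each indecomposable to an isomorphic one. The root space of $\Omega$ is the set of functions $n:\Omega_0\to\mathbb{Z}$ such that $n_{s(a)}=n_{t(a)}$ for all but finitely many arrows $a$. A subquiver $\Omega'$ of $\Omega$ (not necessarily full) is IC if no connected component of $\Omega$ contains more than one connected component of $\Omega'$. For a finite subquiver $\Omega'$ put $\langle n,n\rangle_{\Omega'}=\sum_{i\in\Omega'_0}n_i^2-\sum_{a\in\Omega'_1}n_{s(a)}n_{t(a)}$. The Tits form $\langle n,n\rangle_\Omega$ is the limit, in $\mathbb{Z}\cup\{\pm\infty\}$ (subspace topology from the extended reals), of the net $\Omega'\mapsto\langle n,n\rangle_{\Omega'}$ over the set of finite IC subquivers of $\Omega$ directed by inclusion. A positive root of $\Omega$ is an element $n$ of the root space with $n_i\ge 0$ for all $i$ and $\langle n,n\rangle_\Omega=1$. *)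

theory Defs
  imports "HOL-Library.FuncSet" "HOL-Library.Extended_Nat" "HOL-Library.Extended_Real"
begin

section \<open>Quivers\<close>

record 'v quiver =
  verts :: "'v set"
  arrows :: "('v \<times> 'v) set"

definition quiver :: "'v quiver \<Rightarrow> bool" where
  "quiver Q \<longleftrightarrow> arrows Q \<subseteq> verts Q \<times> verts Q"

text \<open>The bijection says that every edge of the graph carries exactly one arrow, in either of
  the two directions, and that there are no further arrows.\<close>

definition type_D_infinity :: "'v quiver \<Rightarrow> bool" where
  "type_D_infinity Q \<longleftrightarrow> quiver Q \<and>
     (\<exists>u u' v. u \<noteq> u' \<and> inj_on v {1::nat..} \<and> u \<notin> v ` {1..} \<and> u' \<notin> v ` {1..} \<and>
        verts Q = {u, u'} \<union> v ` {1..} \<and>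
        bij_betw (\<lambda>(i, j). {i, j}) (arrows Q)
          ({{u, v 1}, {u', v 1}} \<union> {{v j, v (j + 1)} | j. 1 \<le> j}))"

text \<open>A journey with \<open>N\<close> arrows (\<open>N = \<infinity>\<close> allowed), vertices \<open>p 0, p 1, \<dots>\<close> and arrows
  \<open>e 0, e 1, \<dots>\<close>; its source is \<open>p 0\<close>.\<close>

definition journey :: "'v quiver \<Rightarrow> enat \<Rightarrow> (nat \<Rightarrow> 'v) \<Rightarrow> (nat \<Rightarrow> 'v \<times> 'v) \<Rightarrow> bool" where
  "journey Q N p e \<longleftrightarrow>
     (\<forall>k. enat k \<le> N \<longrightarrow> p k \<in> verts Q) \<and> inj_on p {k. enat k \<le> N} \<and>
     (\<forall>k. enat k < N \<longrightarrow>
        e k \<in> arrows Q \<and> (e k = (p k, p (Suc k)) \<or> e k = (p (Suc k), p k))) \<and>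
     inj_on e {k. enat k < N}"

definition eventually_outward :: "'v quiver \<Rightarrow> bool" where
  "eventually_outward Q \<longleftrightarrow>
     (\<forall>N p e. journey Q N p e \<longrightarrow> finite {e k | k. enat k < N \<and> e k = (p (Suc k), p k)})"


section \<open>Roots\<close>

definition root_space :: "'v quiver \<Rightarrow> ('v \<Rightarrow> int) set" where
  "root_space Q = {n \<in> verts Q \<rightarrow>\<^sub>E UNIV. finite {a \<in> arrows Q. n (fst a) \<noteq> n (snd a)}}"

definition subquiver :: "'v quiver \<Rightarrow> 'v quiver \<Rightarrow> bool" where
  "subquiver Q' Q \<longleftrightarrow> quiver Q' \<and> verts Q' \<subseteq> verts Q \<and> arrows Q' \<subseteq> arrows Q"

definition components :: "'v quiver \<Rightarrow> 'v set set" where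
  "components Q =
     verts Q // {(i, j) \<in> verts Q \<times> verts Q. (i, j) \<in> (arrows Q \<union> (arrows Q)\<inverse>)\<^sup>*}"

definition IC :: "'v quiver \<Rightarrow> 'v quiver \<Rightarrow> bool" where
  "IC Q' Q \<longleftrightarrow>
     (\<forall>C \<in> components Q. \<forall>D \<in> components Q'. \<forall>D' \<in> components Q'.
        D \<subseteq> C \<longrightarrow> D' \<subseteq> C \<longrightarrow> D = D')"

definition finite_IC_subquivers :: "'v quiver \<Rightarrow> 'v quiver set" where
  "finite_IC_subquivers Q =
     {Q'. subquiver Q' Q \<and> finite (verts Q') \<and> finite (arrows Q') \<and> IC Q' Q}"

text \<open>The section filter of the set of finite IC subquivers directed by inclusion.\<close>

definition finite_IC_at_top :: "'v quiver \<Rightarrow> 'v quiver filter" where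
  "finite_IC_at_top Q =
     (INF Q' \<in> finite_IC_subquivers Q.
        principal {Q'' \<in> finite_IC_subquivers Q. subquiver Q' Q''})"

definition finite_tits_form :: "'v quiver \<Rightarrow> ('v \<Rightarrow> int) \<Rightarrow> int" where
  "finite_tits_form Q n = (\<Sum>i \<in> verts Q. (n i)\<^sup>2) - (\<Sum>a \<in> arrows Q. n (fst a) * n (snd a))"

text \<open>The value of the Tits form is a limit, so it is given as a relation between \<open>n\<close> and the
  value. As \<open>\<int> \<union> {\<plusminus>\<infinity>}\<close> is closed in the extended reals, taking the limit there
  is the same as taking it in the subspace.\<close>

definition has_tits_form :: "'v quiver \<Rightarrow> ('v \<Rightarrow> int) \<Rightarrow> ereal \<Rightarrow> bool" where
  "has_tits_form Q n t \<longleftrightarrow>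
     ((\<lambda>Q'. ereal (real_of_int (finite_tits_form Q' n))) \<longlongrightarrow> t) (finite_IC_at_top Q)"

definition positive_roots :: "'v quiver \<Rightarrow> ('v \<Rightarrow> int) set" where
  "positive_roots Q = {n \<in> root_space Q. (\<forall>i \<in> verts Q. 0 \<le> n i) \<and> has_tits_form Q n 1}"


section \<open>Representations\<close>

text \<open>The spaces of a representation are subspaces of an ambient vector space over the field
  \<open>'a\<close>, namely the type \<open>'b\<close> with scalar multiplication \<open>scale\<close>. The ambient space is arbitrary,
  so this is no restriction: any family of vector spaces embeds into its direct sum. Only for the
  existence of a representation with a given dimension vector does the ambient space have to be
  large; an infinite-dimensional one contains spaces of all finite dimensions. The values
  of \<open>vspace\<close> off the vertices, of \<open>amap\<close> off the arrows, and of \<open>amap a\<close> off the space at the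
  source of \<open>a\<close> are irrelevant.\<close>

record ('v, 'b) quiver_rep =
  vspace :: "'v \<Rightarrow> 'b set"
  amap :: "'v \<times> 'v \<Rightarrow> 'b \<Rightarrow> 'b"

context
  fixes scale :: "'a::field \<Rightarrow> 'b::ab_group_add \<Rightarrow> 'b"
begin

definition linear_between :: "'b set \<Rightarrow> 'b set \<Rightarrow> ('b \<Rightarrow> 'b) \<Rightarrow> bool" where
  "linear_between U W f \<longleftrightarrow> f \<in> U \<rightarrow> W \<and>
     (\<forall>x \<in> U. \<forall>y \<in> U. f (x + y) = f x + f y) \<and> (\<forall>c. \<forall>x \<in> U. f (scale c x) = scale c (f x))"

definition finite_dim :: "'b set \<Rightarrow> bool" where
  "finite_dim U \<longleftrightarrow> (\<exists>B. finite B \<and> module.span scale B = U)"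

text \<open>Equality of dimensions as cardinals, also for infinite-dimensional spaces.\<close>

definition same_dim :: "'b set \<Rightarrow> 'b set \<Rightarrow> bool" where
  "same_dim U W \<longleftrightarrow>
     (\<exists>B C h. \<not> module.dependent scale B \<and> module.span scale B = U \<and>
        \<not> module.dependent scale C \<and> module.span scale C = W \<and>
        bij_betw h B C)"

definition quiver_rep :: "'v quiver \<Rightarrow> ('v, 'b) quiver_rep \<Rightarrow> bool" where
  "quiver_rep Q V \<longleftrightarrow>
     (\<forall>i \<in> verts Q. module.subspace scale (vspace V i)) \<and>
     (\<forall>a \<in> arrows Q. linear_between (vspace V (fst a)) (vspace V (snd a)) (amap V a))"

definition morphism ::
  "'v quiver \<Rightarrow> ('v, 'b) quiver_rep \<Rightarrow> ('v, 'b) quiver_rep \<Rightarrow> ('v \<Rightarrow> 'b \<Rightarrow> 'b) \<Rightarrow> bool" where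
  "morphism Q V W f \<longleftrightarrow>
     (\<forall>i \<in> verts Q. linear_between (vspace V i) (vspace W i) (f i)) \<and>
     (\<forall>a \<in> arrows Q. \<forall>x \<in> vspace V (fst a).
        f (snd a) (amap V a x) = amap W a (f (fst a) x))"

definition isomorphic ::
  "'v quiver \<Rightarrow> ('v, 'b) quiver_rep \<Rightarrow> ('v, 'b) quiver_rep \<Rightarrow> bool" where
  "isomorphic Q V W \<longleftrightarrow>
     (\<exists>f g. morphism Q V W f \<and> morphism Q W V g \<and>
        (\<forall>i \<in> verts Q. (\<forall>x \<in> vspace V i. g i (f i x) = x) \<and>
                        (\<forall>y \<in> vspace W i. f i (g i y) = y)))"

definition zero_rep :: "'v quiver \<Rightarrow> ('v, 'b) quiver_rep \<Rightarrow> bool" where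
  "zero_rep Q V \<longleftrightarrow> (\<forall>i \<in> verts Q. vspace V i = {0})"

definition subrep :: "'v quiver \<Rightarrow> ('v, 'b) quiver_rep \<Rightarrow> ('v, 'b) quiver_rep \<Rightarrow> bool" where
  "subrep Q U V \<longleftrightarrow> quiver_rep Q U \<and> (\<forall>i \<in> verts Q. vspace U i \<subseteq> vspace V i) \<and>
     (\<forall>a \<in> arrows Q. \<forall>x \<in> vspace U (fst a). amap U a x = amap V a x)"

text \<open>\<open>V\<close> is the internal direct sum of its subrepresentations \<open>W k\<close>, \<open>k \<in> K\<close>.\<close>

definition direct_sum ::
  "'v quiver \<Rightarrow> ('v, 'b) quiver_rep \<Rightarrow> 'k set \<Rightarrow> ('k \<Rightarrow> ('v, 'b) quiver_rep) \<Rightarrow> bool" where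
  "direct_sum Q V K W \<longleftrightarrow>
     (\<forall>k \<in> K. subrep Q (W k) V) \<and>
     (\<forall>i \<in> verts Q.
        vspace V i = {\<Sum>k \<in> F. x k | F x. finite F \<and> F \<subseteq> K \<and> (\<forall>k \<in> F. x k \<in> vspace (W k) i)} \<and>
        (\<forall>F x. finite F \<longrightarrow> F \<subseteq> K \<longrightarrow> (\<forall>k \<in> F. x k \<in> vspace (W k) i) \<longrightarrow>
           (\<Sum>k \<in> F. x k) = 0 \<longrightarrow> (\<forall>k \<in> F. x k = 0)))"

definition indecomposable :: "'v quiver \<Rightarrow> ('v, 'b) quiver_rep \<Rightarrow> bool" where
  "indecomposable Q V \<longleftrightarrow> quiver_rep Q V \<and> \<not> zero_rep Q V \<and>
     (\<forall>W. direct_sum Q V {0, 1::nat} W \<longrightarrow> zero_rep Q (W 0) \<or> zero_rep Q (W 1))"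

text \<open>The summands are indexed by themselves. Indecomposables are nonzero, so no
  subrepresentation can occur twice among them.\<close>

definition indecomposable_decomposition ::
  "'v quiver \<Rightarrow> ('v, 'b) quiver_rep \<Rightarrow> ('v, 'b) quiver_rep set \<Rightarrow> bool" where
  "indecomposable_decomposition Q V S \<longleftrightarrow>
     direct_sum Q V S (\<lambda>U. U) \<and> (\<forall>U \<in> S. indecomposable Q U)"

definition infinite_krull_schmidt :: "'v quiver \<Rightarrow> bool" where
  "infinite_krull_schmidt Q \<longleftrightarrow>
     (\<forall>V. quiver_rep Q V \<longrightarrow>
        (\<exists>S. indecomposable_decomposition Q V S) \<and>
        (\<forall>S T. indecomposable_decomposition Q V S \<longrightarrow> indecomposable_decomposition Q V T \<longrightarrow>
           (\<exists>h. bij_betw h S T \<and> (\<forall>U \<in> S. isomorphic Q U (h U)))))"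

definition unique_type :: "'v quiver \<Rightarrow> bool" where
  "unique_type Q \<longleftrightarrow>
     (\<forall>V W. indecomposable Q V \<longrightarrow> indecomposable Q W \<longrightarrow>
        (\<forall>i \<in> verts Q. same_dim (vspace V i) (vspace W i)) \<longrightarrow> isomorphic Q V W)"

definition FLEI :: "'v quiver \<Rightarrow> ('v, 'b) quiver_rep \<Rightarrow> bool" where
  "FLEI Q V \<longleftrightarrow> (\<forall>i \<in> verts Q. finite_dim (vspace V i)) \<and>
     finite {a \<in> arrows Q. \<not> bij_betw (amap V a) (vspace V (fst a)) (vspace V (snd a))}"

text \<open>Only meaningful when all spaces are finite-dimensional, as \<open>dim\<close> is \<open>0\<close> on
  infinite-dimensional spaces.\<close>

definition dim_vector :: "'v quiver \<Rightarrow> ('v, 'b) quiver_rep \<Rightarrow> 'v \<Rightarrow> int" where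
  "dim_vector Q V = (\<lambda>i \<in> verts Q. int (vector_space.dim scale (vspace V i)))"

definition indecomposable_classes :: "'v quiver \<Rightarrow> ('v, 'b) quiver_rep set set" where
  "indecomposable_classes Q =
     {V. indecomposable Q V} //
     {(V, W). indecomposable Q V \<and> indecomposable Q W \<and> isomorphic Q V W}"

text \<open>Isomorphic representations have equal dimension vectors, so the image of an isomorphism
  class is a singleton.\<close>

definition class_dim_vector :: "'v quiver \<Rightarrow> ('v, 'b) quiver_rep set \<Rightarrow> 'v \<Rightarrow> int" where
  "class_dim_vector Q C = the_elem (dim_vector Q ` C)"

end

end

theory Submission
  imports Defs
begin

text \<open>Write the vertices of the line as \<open>w 0, w 1, \<dots>\<close>, so that \<open>w 0\<close> is the vertex where the two
arms \<open>u\<close>, \<open>u'\<close> are attached. The proof classifies the indecomposables by an explicit direct sum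
decomposition of an arbitrary representation \<open>V\<close>.

Transporting \<open>{0}\<close> and \<open>V (w k)\<close>, for all \<open>k \<ge> j\<close>, back along the line from \<open>w k\<close> to \<open>w j\<close> gives
subspaces of \<open>V (w j)\<close>. They form a chain, and because all but finitely many arrows point outwards
the chain is well-ordered by inclusion: far out on the line it is an increasing sequence of kernels
topped by the whole space, and each further step back applies a monotone operation and adds \<open>{0}\<close> and the
whole space. Well-ordered chains admit adapted bases in spaces of any dimension: in a maximal
adapted independent set nothing is missing, since otherwise a vector from the least member
not yet spanned could be added (\<open>adapted_basis_extend\<close>, \<open>common_adapted_basis\<close>).

At \<open>w 0\<close> there are, besides the chain, two further subspaces, the images or kernels of the two arms.
Two subspaces and one well-ordered chain still have a common normal form
(\<open>two_subspaces_and_chain\<close>): a basis consisting of single vectors and of pairs \<open>c\<close>, \<open>c + \<beta> c\<close>, where \<open>c\<close>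
lies in one of the subspaces, \<open>\<beta> c\<close> in the other, and some member of the chain contains \<open>c + \<beta> c\<close> but not \<open>c\<close>.
An adapted basis at \<open>w j\<close> continues to one at \<open>w (j + 1)\<close> (\<open>step_outward\<close>, \<open>step_inward\<close>), and so
each basis vector leaves a thread along the line. The representation is the direct sum of
the subrepresentations spanned by one thread, by a pair of threads, or by a left-over vector at
the end of an arm (\<open>root_brick_decomposition\<close>).

These summands are of two kinds, thin ones with spaces of dimension at most one and thick ones with
some spaces of dimension two. Their only endomorphisms are scalars (\<open>root_brick_brick\<close>), hence
they are indecomposable, and by the decomposition they are all the
indecomposables (\<open>indecomposable_iff_root_brick\<close>). They can be read off from their dimension vectors, which gives
unique type, and they are visibly FLEI.

For the uniqueness of decompositions into bricks, the number of summands isomorphic to a brick \<open>B\<close> is the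
dimension of the space of morphisms \<open>B \<rightarrow> V\<close> modulo those killed by every morphism \<open>V \<rightarrow> B\<close>
(\<open>brick_multiplicity\<close>), which does not mention the decomposition.

Finally, if \<open>n\<close> is constant on the line from \<open>w M\<close> on, its Tits form \<open>q\<close> satisfies
\<open>4 q = (2 n\<^sub>u - n\<^sub>0)\<^sup>2 + (2 n\<^sub>u\<^sub>' - n\<^sub>0)\<^sup>2 + 2 \<Sigma>\<close>, where \<open>\<Sigma>\<close> is the sum of the squares of
\<open>n\<^sub>j - n\<^sub>j\<^sub>+\<^sub>1\<close> for \<open>j < M\<close> and of \<open>n\<^sub>M\<close> (\<open>four_line_form\<close>). For \<open>q = 1\<close> this leaves
at most two steps of size one along the line, and the nonnegative solutions are exactly the dimension
vectors of the thin and thick bricks (\<open>root_cases\<close>, \<open>thin_vector_root\<close>, \<open>thick_vector_root\<close>).\<close>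

section \<open>Bases adapted to well-ordered chains\<close>

locale ambient_space = vector_space scale
  for scale :: "'f::field \<Rightarrow> 'b::ab_group_add \<Rightarrow> 'b"
begin

sublocale vsp: vector_space_pair scale scale ..

lemma linear_between_extend:
  assumes "subspace U" "linear_between scale U W f"
  shows "\<exists>g. Vector_Spaces.linear scale scale g \<and> (\<forall>x\<in>U. g x = f x)"
proof -
  obtain B where B: "independent B" "B \<subseteq> U" "U \<subseteq> span B"
    using maximal_independent_subset by blast
  obtain g where g: "Vector_Spaces.linear scale scale g" "\<forall>x\<in>B. g x = f x"
    using vsp.linear_independent_extend[OF B(1)] by blast
  interpret g: Vector_Spaces.linear scale scale g by (rule g(1))
  have fadd: "f (x + y) = f x + f y" if "x \<in> U" "y \<in> U" for x y
    using assms(2) that unfolding linear_between_def by blast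
  have fsc: "f (scale c x) = scale c (f x)" if "x \<in> U" for x c
    using assms(2) that unfolding linear_between_def by blast
  have f0: "f 0 = 0" using fsc[of 0 0] subspace_0[OF assms(1)] by simp
  have "g x = f x \<and> x \<in> U" if "x \<in> span B" for x
    using that
  proof (induction rule: span_induct_alt)
    case base
    then show ?case using f0 g.zero subspace_0[OF assms(1)] by simp
  next
    case (step c x y)
    then have "x \<in> U" "g x = f x" using B(2) g(2) by auto
    then show ?case using step fadd fsc g.add g.scale subspace_scale[OF assms(1)] subspace_add[OF assms(1)]
      by simp
  qed
  then show ?thesis using g(1) B(3) by blast
qed

lemma in_span_subset_iff_representation:
  assumes "independent X" "Y \<subseteq> X" "x \<in> span X"
  shows "x \<in> span Y \<longleftrightarrow> (\<forall>b. representation X x b \<noteq> 0 \<longrightarrow> b \<in> Y)"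
proof
  assume "x \<in> span Y"
  then have "representation X x = representation Y x"
    using representation_extend[OF assms(1) _ assms(2)] by blast
  then show "\<forall>b. representation X x b \<noteq> 0 \<longrightarrow> b \<in> Y"
    using representation_ne_zero by metis
next
  assume *: "\<forall>b. representation X x b \<noteq> 0 \<longrightarrow> b \<in> Y"
  have "(\<Sum>b | representation X x b \<noteq> 0. scale (representation X x b) b) = x"
    using sum_nonzero_representation_eq[OF assms(1,3)] .
  moreover have "(\<Sum>b | representation X x b \<noteq> 0. scale (representation X x b) b) \<in> span Y"
    by (intro span_sum span_scale span_base) (use * in auto)
  ultimately show "x \<in> span Y" by simp
qed

lemma span_Int_of_independent:
  assumes "independent X" "Y \<subseteq> X" "Z \<subseteq> X"
  shows "span Y \<inter> span Z = span (Y \<inter> Z)"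
proof
  show "span (Y \<inter> Z) \<subseteq> span Y \<inter> span Z" by (simp add: span_mono)
  show "span Y \<inter> span Z \<subseteq> span (Y \<inter> Z)"
  proof
    fix x assume x: "x \<in> span Y \<inter> span Z"
    then have "x \<in> span X" using span_mono[OF assms(2)] by auto
    then show "x \<in> span (Y \<inter> Z)"
      using x in_span_subset_iff_representation[OF assms(1)] assms
      by (metis IntD1 IntD2 IntI le_infI1)
  qed
qed

text \<open>Well-ordering is required in the form in which it is used: every nonempty set of members has a least one. In
particular any two members are comparable.\<close>

definition wchain :: "'b set \<Rightarrow> 'b set set \<Rightarrow> bool" where
  "wchain W R \<longleftrightarrow> W \<in> R \<and> (\<forall>F\<in>R. subspace F \<and> F \<subseteq> W) \<and>
     (\<forall>S\<subseteq>R. S \<noteq> {} \<longrightarrow> (\<exists>F\<in>S. \<forall>G\<in>S. F \<subseteq> G))"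

definition adapted :: "'b set \<Rightarrow> 'b set set \<Rightarrow> bool" where
  "adapted X R \<longleftrightarrow> (\<forall>F\<in>R. span X \<inter> F \<subseteq> span (X \<inter> F))"

lemma adaptedD: "adapted X R \<Longrightarrow> F \<in> R \<Longrightarrow> x \<in> span X \<Longrightarrow> x \<in> F \<Longrightarrow> x \<in> span (X \<inter> F)"
  unfolding adapted_def by blast

lemma wchain_subspace: "wchain W R \<Longrightarrow> F \<in> R \<Longrightarrow> subspace F"
  and wchain_subset: "wchain W R \<Longrightarrow> F \<in> R \<Longrightarrow> F \<subseteq> W"
  and wchain_top: "wchain W R \<Longrightarrow> W \<in> R"
  unfolding wchain_def by auto

lemma wchain_least:
  assumes "wchain W R" "F0 \<in> R" "P F0"
  obtains F where "F \<in> R" "P F" "\<And>G. G \<in> R \<Longrightarrow> P G \<Longrightarrow> F \<subseteq> G"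
proof -
  have "{F\<in>R. P F} \<subseteq> R" "{F\<in>R. P F} \<noteq> {}" using assms by auto
  then obtain F where "F\<in>{F\<in>R. P F}" "\<forall>G\<in>{F\<in>R. P F}. F \<subseteq> G"
    using assms(1) unfolding wchain_def by metis
  then show ?thesis using that by blast
qed

lemma wchain_linear:
  assumes "wchain W R" "F \<in> R" "G \<in> R"
  shows "F \<subseteq> G \<or> G \<subseteq> F"
proof -
  obtain H where "H\<in>R" "H = F \<or> H = G" "\<And>K. K \<in> R \<Longrightarrow> K = F \<or> K = G \<Longrightarrow> H \<subseteq> K"
    using wchain_least[OF assms(1,2), of "\<lambda>H. H = F \<or> H = G"] by blast
  then show ?thesis using assms by blast
qed

lemma wchain_finite_max:
  assumes "wchain W R" "finite \<F>" "\<F> \<subseteq> R" "\<F> \<noteq> {}"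
  shows "\<exists>F\<in>\<F>. \<forall>G\<in>\<F>. G \<subseteq> F"
  using assms(2,4,3)
proof (induction rule: finite_ne_induct)
  case (insert F \<F>)
  then obtain G where G: "G\<in>\<F>" "\<forall>H\<in>\<F>. H \<subseteq> G" by auto
  have "F \<subseteq> G \<or> G \<subseteq> F" using wchain_linear[OF assms(1)] insert.prems G(1) by blast
  then show ?case
  proof
    assume "F \<subseteq> G" then show ?thesis using G by blast
  next
    assume "G \<subseteq> F" then show ?thesis using G by blast
  qed
qed auto

lemma wchain_image_mono:
  assumes "wchain W R" "\<And>F G. F \<in> R \<Longrightarrow> G \<in> R \<Longrightarrow> F \<subseteq> G \<Longrightarrow> st F \<subseteq> st G"
    "\<And>F. F \<in> R \<Longrightarrow> subspace (st F)"
  shows "wchain (st W) (st ` R)"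
  unfolding wchain_def
proof (intro conjI ballI allI impI)
  show "st W \<in> st ` R" using wchain_top[OF assms(1)] by blast
next
  fix F assume "F \<in> st ` R"
  then obtain G where G: "G \<in> R" "F = st G" by blast
  then show "subspace F" "F \<subseteq> st W"
    using assms(2)[OF G(1) wchain_top[OF assms(1)] wchain_subset[OF assms(1) G(1)]] assms(3) by auto
next
  fix S assume S: "S \<subseteq> st ` R" "S \<noteq> {}"
  then obtain F0 where "F0 \<in> R" "st F0 \<in> S" by blast
  then obtain F where F: "F\<in>R" "st F \<in> S" "\<And>G. G \<in> R \<Longrightarrow> st G \<in> S \<Longrightarrow> F \<subseteq> G"
    using wchain_least[OF assms(1), of F0 "\<lambda>F. st F \<in> S"] by blast
  show "\<exists>F\<in>S. \<forall>G\<in>S. F \<subseteq> G"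
  proof (intro bexI ballI)
    fix G assume "G \<in> S"
    then obtain G' where "G' \<in> R" "G = st G'" using S by blast
    then show "st F \<subseteq> G" using F \<open>G \<in> S\<close> assms(2) by blast
  qed (rule F)
qed

lemma wchain_insert_bot:
  assumes "wchain W R" "subspace Z" "\<And>F. F \<in> R \<Longrightarrow> Z \<subseteq> F"
  shows "wchain W (insert Z R)"
  unfolding wchain_def
proof (intro conjI ballI allI impI)
  show "W \<in> insert Z R" using wchain_top[OF assms(1)] by blast
  fix F assume "F \<in> insert Z R"
  then show "subspace F" "F \<subseteq> W"
    using assms(2) assms(3)[OF wchain_top[OF assms(1)]] wchain_subspace[OF assms(1)] wchain_subset[OF assms(1)] by auto
next
  fix S assume S: "S \<subseteq> insert Z R" "S \<noteq> {}"
  show "\<exists>F\<in>S. \<forall>G\<in>S. F \<subseteq> G"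
  proof (cases "Z \<in> S")
    case True then show ?thesis using assms(3) S by (intro bexI[of _ Z]) auto
  next
    case False then have "S \<subseteq> R" using S by blast
    then show ?thesis using assms(1) S(2) unfolding wchain_def by blast
  qed
qed

lemma wchain_insert_top:
  assumes "wchain W R" "subspace Z" "W \<subseteq> Z"
  shows "wchain Z (insert Z R)"
  unfolding wchain_def
proof (intro conjI ballI allI impI)
  show "Z \<in> insert Z R" by blast
  fix F assume "F \<in> insert Z R"
  then show "subspace F" "F \<subseteq> Z"
    using assms(2,3) wchain_subspace[OF assms(1)] wchain_subset[OF assms(1)] by auto
next
  fix S assume S: "S \<subseteq> insert Z R" "S \<noteq> {}"
  show "\<exists>F\<in>S. \<forall>G\<in>S. F \<subseteq> G"
  proof (cases "S = {Z}")
    case True then show ?thesis by blast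
  next
    case False
    then have "S \<inter> R \<noteq> {}" using S by blast
    then obtain F where F: "F \<in> S \<inter> R" "\<forall>G\<in>S\<inter>R. F \<subseteq> G"
      using assms(1) unfolding wchain_def by (metis inf.cobounded2)
    have "F \<subseteq> Z" using F wchain_subset[OF assms(1)] assms(3) by blast
    then have "\<forall>G\<in>S. F \<subseteq> G" using F(2) S by blast
    then show ?thesis using F by blast
  qed
qed

lemma wchain_trivial: "subspace W \<Longrightarrow> wchain W {{0}, W}"
proof (rule wchain_insert_bot)
  assume "subspace W"
  then show "wchain W {W}" unfolding wchain_def by (auto simp: subset_singleton_iff)
qed (auto intro: subspace_0)

lemma span_Union_chain:
  assumes "\<C> \<noteq> {}" "\<And>X Y. X \<in> \<C> \<Longrightarrow> Y \<in> \<C> \<Longrightarrow> X \<subseteq> Y \<or> Y \<subseteq> X" "x \<in> span (\<Union>\<C>)"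
  shows "\<exists>X\<in>\<C>. x \<in> span X"
  using assms(3)
proof (induction rule: span_induct_alt)
  case base
  then show ?case using assms(1) span_zero by blast
next
  case (step c x y)
  then obtain X Y where XY: "X \<in> \<C>" "x \<in> X" "Y \<in> \<C>" "y \<in> span Y" by blast
  show ?case
  proof (cases "X \<subseteq> Y")
    case True
    then have "scale c x + y \<in> span Y" using XY by (intro span_add span_scale) (auto intro: span_base)
    then show ?thesis using XY by blast
  next
    case False
    then have "Y \<subseteq> X" using assms(2) XY by blast
    then have "scale c x + y \<in> span X" using XY span_mono[of Y X] by (intro span_add span_scale) (auto intro: span_base)
    then show ?thesis using XY by blast
  qed
qed

lemma independent_Union_chain:
  assumes "\<And>X Y. X \<in> \<C> \<Longrightarrow> Y \<in> \<C> \<Longrightarrow> X \<subseteq> Y \<or> Y \<subseteq> X" "\<And>X. X \<in> \<C> \<Longrightarrow> independent X"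
  shows "independent (\<Union>\<C>)"
  using independent_Union_directed[of \<C>] assms by blast

text \<open>The new vectors may be prescribed to come from a set \<open>Y\<close>, provided \<open>Y\<close> is large enough inside each
member of the chain. This is what later allows a basis to respect, besides the chain, a second subspace.\<close>

lemma adapted_basis_extend:
  assumes R: "wchain W R" and X0: "independent X0" "X0 \<subseteq> W" "adapted X0 R"
    and Y: "\<And>F. F \<in> R \<Longrightarrow> F \<subseteq> span (X0 \<union> (F \<inter> Y))"
  shows "\<exists>S. S \<subseteq> Y \<and> X0 \<inter> S = {} \<and> independent (X0 \<union> S) \<and> span (X0 \<union> S) = W \<and> adapted (X0 \<union> S) R"
proof -
  define P where "P = {X. X0 \<subseteq> X \<and> X \<subseteq> X0 \<union> (W \<inter> Y) \<and> independent X \<and> adapted X R}"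
  have subW: "subspace W" using R wchain_subspace wchain_top by blast
  have "\<exists>M\<in>P. \<forall>X\<in>P. M \<subseteq> X \<longrightarrow> X = M"
  proof (rule subset_Zorn_nonempty)
    show "P \<noteq> {}" using X0 unfolding P_def by blast
    fix \<C> assume C: "\<C> \<noteq> {}" "subset.chain P \<C>"
    then have lin: "\<And>X Y. X \<in> \<C> \<Longrightarrow> Y \<in> \<C> \<Longrightarrow> X \<subseteq> Y \<or> Y \<subseteq> X" and sub: "\<C> \<subseteq> P"
      unfolding subset.chain_def by blast+
    show "\<Union>\<C> \<in> P"
      unfolding P_def
    proof (intro CollectI conjI)
      show "X0 \<subseteq> \<Union>\<C>" using C sub unfolding P_def by blast
      show "\<Union>\<C> \<subseteq> X0 \<union> W \<inter> Y" using sub unfolding P_def by blast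
      show "independent (\<Union>\<C>)" by (rule independent_Union_chain[OF lin]) (use sub P_def in auto)
      show "adapted (\<Union>\<C>) R" unfolding adapted_def
      proof (intro ballI subsetI)
        fix F x assume F: "F \<in> R" "x \<in> span (\<Union>\<C>) \<inter> F"
        then obtain X where X: "X \<in> \<C>" "x \<in> span X" using span_Union_chain[OF C(1) lin] by blast
        then have "x \<in> span (X \<inter> F)" using F sub unfolding P_def adapted_def by blast
        then show "x \<in> span (\<Union>\<C> \<inter> F)" using span_mono[of "X \<inter> F" "\<Union>\<C> \<inter> F"] X by blast
      qed
    qed
  qed
  then obtain M where M: "X0 \<subseteq> M" "M \<subseteq> X0 \<union> (W \<inter> Y)" "independent M" "adapted M R"
    and max: "\<And>X. X \<in> P \<Longrightarrow> M \<subseteq> X \<Longrightarrow> X = M" unfolding P_def by auto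
  have MW: "span M \<subseteq> W" using M X0 subW by (intro span_minimal) auto
  have "W \<subseteq> span M"
  proof (rule ccontr)
    assume "\<not> W \<subseteq> span M"
    then obtain F where F: "F \<in> R" "\<not> F \<subseteq> span M" and least: "\<And>G. G \<in> R \<Longrightarrow> \<not> G \<subseteq> span M \<Longrightarrow> F \<subseteq> G"
      using wchain_least[OF R wchain_top[OF R], of "\<lambda>F. \<not> F \<subseteq> span M"] by blast
    have "\<not> F \<inter> Y \<subseteq> span M"
    proof
      assume "F \<inter> Y \<subseteq> span M"
      then have "span (X0 \<union> F \<inter> Y) \<subseteq> span M" using M(1) span_superset by (intro span_minimal) auto
      then show False using Y[OF F(1)] F(2) by blast
    qed
    then obtain x where x: "x \<in> F" "x \<in> Y" "x \<notin> span M" by blast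
    have "insert x M \<in> P" unfolding P_def
    proof (intro CollectI conjI)
      show "X0 \<subseteq> insert x M" using M by blast
      show "insert x M \<subseteq> X0 \<union> W \<inter> Y" using M x wchain_subset[OF R F(1)] by blast
      show "independent (insert x M)" using independent_insertI x M by blast
      show "adapted (insert x M) R" unfolding adapted_def
      proof (intro ballI subsetI)
        fix G y assume G: "G \<in> R" "y \<in> span (insert x M) \<inter> G"
        then obtain k where k: "y - scale k x \<in> span M" using span_breakdown_eq by blast
        show "y \<in> span (insert x M \<inter> G)"
        proof (cases "y \<in> span M")
          case True
          then have "y \<in> span (M \<inter> G)" using adaptedD[OF M(4)] G by blast
          then show ?thesis using span_mono[of "M \<inter> G" "insert x M \<inter> G"] by blast
        next
          case False
          then have "F \<subseteq> G" using least G by blast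
          then have xG: "x \<in> G" using x by blast
          then have "y - scale k x \<in> G"
            using wchain_subspace[OF R G(1)] subspace_diff subspace_scale G by blast
          then have "y - scale k x \<in> span (M \<inter> G)" using adaptedD[OF M(4)] G k by blast
          then have 1: "y - scale k x \<in> span (insert x M \<inter> G)" using span_mono[of "M \<inter> G" "insert x M \<inter> G"] by blast
          have 2: "scale k x \<in> span (insert x M \<inter> G)" using xG by (intro span_scale span_base) auto
          show ?thesis using span_add[OF 1 2] by simp
        qed
      qed
    qed
    then have "insert x M = M" using max by blast
    then show False using x span_base by blast
  qed
  moreover have "M = X0 \<union> (M - X0)" using M by blast
  ultimately show ?thesis using M MW by (intro exI[of _ "M - X0"]) auto
qed

text \<open>Adaptedness alone is not enough for Zorn's lemma here: a vector in general position could be chosen first and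
would then exclude a basis that respects both chains. The condition \<open>H \<subseteq> span X \<or> X \<subseteq> H\<close> for all \<open>H \<in> R1\<close> forces the members of \<open>R1\<close> to be exhausted
one after the other, and it survives unions of chains.\<close>

lemma common_adapted_basis:
  assumes R1: "wchain W R1" and R2: "wchain W R2"
  shows "\<exists>X. X \<subseteq> W \<and> independent X \<and> span X = W \<and> (\<forall>F\<in>R1. \<forall>G\<in>R2. F \<inter> G \<subseteq> span (X \<inter> F \<inter> G))"
proof -
  define P where "P = {X. X \<subseteq> W \<and> independent X \<and> (\<forall>H\<in>R1. H \<subseteq> span X \<or> X \<subseteq> H) \<and>
    (\<forall>F\<in>R1. \<forall>G\<in>R2. span X \<inter> F \<inter> G \<subseteq> span (X \<inter> F \<inter> G))}"
  have subW: "subspace W" using R1 wchain_subspace wchain_top by blast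
  have "\<exists>M\<in>P. \<forall>X\<in>P. M \<subseteq> X \<longrightarrow> X = M"
  proof (rule subset_Zorn_nonempty)
    have "{} \<in> P" unfolding P_def using independent_empty by auto
    then show "P \<noteq> {}" by blast
    fix \<C> assume C: "\<C> \<noteq> {}" "subset.chain P \<C>"
    then have lin: "\<And>X Y. X \<in> \<C> \<Longrightarrow> Y \<in> \<C> \<Longrightarrow> X \<subseteq> Y \<or> Y \<subseteq> X" and sub: "\<C> \<subseteq> P"
      unfolding subset.chain_def by blast+
    show "\<Union>\<C> \<in> P"
      unfolding P_def
    proof (intro CollectI conjI ballI)
      show "\<Union>\<C> \<subseteq> W" using sub unfolding P_def by blast
      show "independent (\<Union>\<C>)" by (rule independent_Union_chain[OF lin]) (use sub P_def in auto)
      fix H assume H: "H \<in> R1"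
      show "H \<subseteq> span (\<Union>\<C>) \<or> \<Union>\<C> \<subseteq> H"
      proof (cases "\<exists>X\<in>\<C>. H \<subseteq> span X")
        case True
        then show ?thesis using span_mono[of _ "\<Union>\<C>"] by (metis Union_upper order.trans)
      next
        case False
        then show ?thesis using sub H unfolding P_def by blast
      qed
    next
      fix F G assume F: "F \<in> R1" "G \<in> R2"
      show "span (\<Union> \<C>) \<inter> F \<inter> G \<subseteq> span (\<Union> \<C> \<inter> F \<inter> G)"
      proof
        fix x assume x: "x \<in> span (\<Union>\<C>) \<inter> F \<inter> G"
        then obtain X where X: "X \<in> \<C>" "x \<in> span X" using span_Union_chain[OF C(1) lin] by blast
        then have "x \<in> span (X \<inter> F \<inter> G)" using F x sub unfolding P_def by blast
        then show "x \<in> span (\<Union>\<C> \<inter> F \<inter> G)" using span_mono[of "X \<inter> F \<inter> G" "\<Union>\<C> \<inter> F \<inter> G"] X by blast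
      qed
    qed
  qed
  then obtain M where MP: "M \<in> P" and max: "\<And>X. X \<in> P \<Longrightarrow> M \<subseteq> X \<Longrightarrow> X = M" by blast
  have M: "M \<subseteq> W" "independent M" "\<And>H. H \<in> R1 \<Longrightarrow> H \<subseteq> span M \<or> M \<subseteq> H"
      "\<And>F G x. F \<in> R1 \<Longrightarrow> G \<in> R2 \<Longrightarrow> x \<in> span M \<Longrightarrow> x \<in> F \<Longrightarrow> x \<in> G \<Longrightarrow> x \<in> span (M \<inter> F \<inter> G)"
    using MP unfolding P_def by blast+
  have MW: "span M \<subseteq> W" using M subW by (intro span_minimal) auto
  have "W \<subseteq> span M"
  proof (rule ccontr)
    assume "\<not> W \<subseteq> span M"
    then obtain F where F: "F \<in> R1" "\<not> F \<subseteq> span M" and least: "\<And>G. G \<in> R1 \<Longrightarrow> \<not> G \<subseteq> span M \<Longrightarrow> F \<subseteq> G"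
      using wchain_least[OF R1 wchain_top[OF R1], of "\<lambda>F. \<not> F \<subseteq> span M"] by blast
    have "\<not> F \<inter> W \<subseteq> span M" using F wchain_subset[OF R1 F(1)] by blast
    then obtain G where G: "G \<in> R2" "\<not> F \<inter> G \<subseteq> span M" and least': "\<And>K. K \<in> R2 \<Longrightarrow> \<not> F \<inter> K \<subseteq> span M \<Longrightarrow> G \<subseteq> K"
      using wchain_least[OF R2 wchain_top[OF R2], of "\<lambda>G. \<not> F \<inter> G \<subseteq> span M"] by blast
    (* F is the member being filled up, so the next vector is taken from the smallest trace on F. *)
    have MF: "M \<subseteq> F" using M(3) F by blast
    obtain x where x: "x \<in> F" "x \<in> G" "x \<notin> span M" using G by blast
    have "insert x M \<in> P" unfolding P_def
    proof (intro CollectI conjI ballI)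
      show "insert x M \<subseteq> W" using M x wchain_subset[OF R1 F(1)] by blast
      show "independent (insert x M)" using independent_insertI x M by blast
      fix H assume H: "H \<in> R1"
      show "H \<subseteq> span (insert x M) \<or> insert x M \<subseteq> H"
        using least[OF H] span_mono[of M "insert x M"] x(1) MF by blast
    next
      fix H K assume H: "H \<in> R1" "K \<in> R2"
      show "span (insert x M) \<inter> H \<inter> K \<subseteq> span (insert x M \<inter> H \<inter> K)"
      proof
        fix y assume y: "y \<in> span (insert x M) \<inter> H \<inter> K"
        then obtain k where k: "y - scale k x \<in> span M" using span_breakdown_eq by blast
        show "y \<in> span (insert x M \<inter> H \<inter> K)"
        proof (cases "y \<in> span M")
          case True
          then have "y \<in> span (M \<inter> H \<inter> K)" using M(4) H y by blast
          then show ?thesis using span_mono[of "M \<inter> H \<inter> K" "insert x M \<inter> H \<inter> K"] by blast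
        next
          case False
          then have FH: "F \<subseteq> H" using least H y by blast
          have "span (insert x M) \<subseteq> F" using MF x wchain_subspace[OF R1 F(1)] by (intro span_minimal) auto
          then have "\<not> F \<inter> K \<subseteq> span M" using False y by blast
          then have "G \<subseteq> K" using least' H by blast
          then have xG: "x \<in> H" "x \<in> K" using x FH by auto
          then have "y - scale k x \<in> H" "y - scale k x \<in> K"
            using wchain_subspace[OF R1 H(1)] wchain_subspace[OF R2 H(2)] subspace_diff subspace_scale y by blast+
          then have "y - scale k x \<in> span (M \<inter> H \<inter> K)" using M(4) H k by blast
          then have 1: "y - scale k x \<in> span (insert x M \<inter> H \<inter> K)" using span_mono[of "M \<inter> H \<inter> K" "insert x M \<inter> H \<inter> K"] by blast
          have 2: "scale k x \<in> span (insert x M \<inter> H \<inter> K)" using xG by (intro span_scale span_base) auto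
          show ?thesis using span_add[OF 1 2] by simp
        qed
      qed
    qed
    then have "insert x M = M" using max by blast
    then show False using x span_base by blast
  qed
  then have sM: "span M = W" using MW by blast
  have "F \<inter> G \<subseteq> span (M \<inter> F \<inter> G)" if "F \<in> R1" "G \<in> R2" for F G
    using M(4)[OF that] wchain_subset[OF R1 that(1)] sM by blast
  then show ?thesis using M(1,2) sM by blast
qed

end

section \<open>Continuing adapted bases along a linear map\<close>

context ambient_space
begin

lemma in_span_imageE:
  assumes "x \<in> span (g ` I)"
  obtains T c where "finite T" "T \<subseteq> I" "\<And>i. i \<in> T \<Longrightarrow> c i \<noteq> 0" "x = (\<Sum>i\<in>T. scale (c i) (g i))"
proof -
  have "\<exists>T c. finite T \<and> T \<subseteq> I \<and> x = (\<Sum>i\<in>T. scale (c i) (g i))"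
    using assms
  proof (induction rule: span_induct_alt)
    case base
    then show ?case by (intro exI[of _ "{}"]) auto
  next
    case (step r y z)
    then obtain i T c where i: "i \<in> I" "y = g i" and T: "finite T" "T \<subseteq> I" "z = (\<Sum>i\<in>T. scale (c i) (g i))" by blast
    show ?case
    proof (intro exI conjI)
      show "finite (insert i T)" "insert i T \<subseteq> I" using T i by auto
      have 1: "scale r y = (\<Sum>j\<in>insert i T. scale (if j = i then r else 0) (g j))"
        using T(1) i(2) by (subst sum.remove[of _ i]) (auto intro!: sum.neutral)
      have 2: "z = (\<Sum>j\<in>insert i T. scale (if j \<in> T then c j else 0) (g j))"
        unfolding T(3) by (intro sum.mono_neutral_cong_left) (use T in auto)
      show "scale r y + z = (\<Sum>j\<in>insert i T. scale ((if j = i then r else 0) + (if j \<in> T then c j else 0)) (g j))"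
        unfolding scale_left_distrib sum.distrib using 1 2 by simp
    qed
  qed
  then obtain T c where T: "finite T" "T \<subseteq> I" "x = (\<Sum>i\<in>T. scale (c i) (g i))" by blast
  show ?thesis
  proof (rule that[of "{i\<in>T. c i \<noteq> 0}" c])
    show "x = (\<Sum>i\<in>{i\<in>T. c i \<noteq> 0}. scale (c i) (g i))"
      unfolding T(3) by (intro sum.mono_neutral_right) (use T in auto)
  qed (use T in auto)
qed

text \<open>Independence modulo a subspace, tested on combinations with nonzero coefficients. In this form the index set \<open>T\<close> of a
combination can be attacked directly, and it also covers repetitions in the family \<open>g\<close>.\<close>

lemma independent_Un_imageI:
  assumes "independent C"
    and indep: "\<And>T c. finite T \<Longrightarrow> T \<subseteq> I \<Longrightarrow> \<forall>i\<in>T. c i \<noteq> 0 \<Longrightarrow> (\<Sum>i\<in>T. scale (c i) (g i)) \<in> span C \<Longrightarrow> T = {}"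
  shows "inj_on g I" "C \<inter> g ` I = {}" "independent (C \<union> g ` I)"
proof -
  show inj: "inj_on g I"
  proof (rule inj_onI, rule ccontr)
    fix i j assume ij: "i \<in> I" "j \<in> I" "g i = g j" "i \<noteq> j"
    have "{i, j} = {}"
      by (rule indep[where c = "\<lambda>k. if k = i then 1 else - 1"]) (use ij in \<open>auto simp: scale_minus_left span_zero\<close>)
    then show False by simp
  qed
  show disj: "C \<inter> g ` I = {}"
  proof (rule ccontr)
    assume "C \<inter> g ` I \<noteq> {}"
    then obtain i where i: "i \<in> I" "g i \<in> C" by blast
    have "{i} = {}" by (rule indep[where c = "\<lambda>k. 1"]) (use i in \<open>auto intro: span_base\<close>)
    then show False by simp
  qed
  show "independent (C \<union> g ` I)"
  proof
    assume "dependent (C \<union> g ` I)"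
    then obtain t u where t: "finite t" "t \<subseteq> C \<union> g ` I" "(\<Sum>v\<in>t. scale (u v) v) = 0" "\<exists>v\<in>t. u v \<noteq> 0"
      unfolding dependent_explicit by blast
    define T where "T = {i\<in>I. g i \<in> t \<and> u (g i) \<noteq> 0}"
    have fT: "finite T"
    proof (rule finite_imageD)
      show "finite (g ` T)" by (rule finite_subset[OF _ t(1)]) (auto simp: T_def)
      show "inj_on g T" using inj by (rule inj_on_subset) (auto simp: T_def)
    qed
    have 1: "(\<Sum>v\<in>t \<inter> g ` I. scale (u v) v) = (\<Sum>i\<in>T. scale (u (g i)) (g i))"
    proof -
      have "(\<Sum>i\<in>T. scale (u (g i)) (g i)) = (\<Sum>v\<in>g ` T. scale (u v) v)"
        using inj by (subst sum.reindex) (auto simp: T_def intro: inj_on_subset)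
      also have "\<dots> = (\<Sum>v\<in>t \<inter> g ` I. scale (u v) v)"
        by (intro sum.mono_neutral_left) (use t in \<open>auto simp: T_def\<close>)
      finally show ?thesis by simp
    qed
    have 2: "(\<Sum>v\<in>t. scale (u v) v) = (\<Sum>v\<in>t \<inter> C. scale (u v) v) + (\<Sum>v\<in>t \<inter> g ` I. scale (u v) v)"
    proof -
      have eq: "(t \<inter> C) \<union> (t \<inter> g ` I) = t" using t(2) by blast
      have "finite (t \<inter> C)" "finite (t \<inter> g ` I)" "(t \<inter> C) \<inter> (t \<inter> g ` I) = {}" using t(1) disj by auto
      from sum.union_disjoint[OF this, of "\<lambda>v. scale (u v) v"] show ?thesis unfolding eq .
    qed
    have "(\<Sum>i\<in>T. scale (u (g i)) (g i)) = - (\<Sum>v\<in>t \<inter> C. scale (u v) v)"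
      using 1 2 t(3) by (metis add.commute eq_neg_iff_add_eq_0)
    also have "\<dots> \<in> span C" by (intro span_neg span_sum span_scale span_base) auto
    finally have sum_C: "(\<Sum>i\<in>T. scale (u (g i)) (g i)) \<in> span C" .
    have "T \<subseteq> I" "\<forall>i\<in>T. u (g i) \<noteq> 0" unfolding T_def by auto
    from indep[OF fT this sum_C] have T: "T = {}" .
    then have "(\<Sum>v\<in>t \<inter> C. scale (u v) v) = 0" using 1 2 t(3) by (metis add.right_neutral sum.empty)
    then have "u v = 0" if "v \<in> t \<inter> C" for v
      using independentD[OF assms(1), of "t \<inter> C"] t(1) that by auto
    moreover have "u v = 0" if "v \<in> t \<inter> g ` I" for v using T that unfolding T_def by auto
    ultimately show False using t(2,4) by blast
  qed
qed

lemma adapted_basis_extend_any: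
  assumes "wchain W R" "independent X0" "X0 \<subseteq> W" "adapted X0 R"
  shows "\<exists>S. X0 \<inter> S = {} \<and> independent (X0 \<union> S) \<and> span (X0 \<union> S) = W \<and> adapted (X0 \<union> S) R"
proof -
  have "F \<subseteq> span (X0 \<union> (F \<inter> UNIV))" for F using span_superset[of "X0 \<union> F"] by auto
  then show ?thesis using adapted_basis_extend[OF assms, of UNIV] by blast
qed

text \<open>The kernel of \<open>\<phi>\<close> is the preimage of \<open>{0}\<close>, a member of the chain; hence \<open>B\<close> contains a basis of the kernel and
the other members of \<open>B\<close> have independent images.\<close>

lemma step_outward:
  assumes R': "wchain P' R'" "{0} \<in> R'"
    and phi: "Vector_Spaces.linear scale scale \<phi>" "\<phi> ` P \<subseteq> P'"
    and B: "independent B" "span B = P" "adapted B ((\<lambda>F. {x\<in>P. \<phi> x \<in> F}) ` R')"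
  shows "inj_on \<phi> {b\<in>B. \<phi> b \<noteq> 0}"
    and "\<exists>N. (\<phi> ` B - {0}) \<inter> N = {} \<and> independent ((\<phi> ` B - {0}) \<union> N) \<and>
           span ((\<phi> ` B - {0}) \<union> N) = P' \<and> adapted ((\<phi> ` B - {0}) \<union> N) R'"
proof -
  interpret phi: Vector_Spaces.linear scale scale \<phi> by (rule phi(1))
  define Bk where "Bk = {b\<in>B. \<phi> b = 0}"
  define Bn where "Bn = {b\<in>B. \<phi> b \<noteq> 0}"
  have sub: "span Bn \<subseteq> P" using span_mono[of Bn B] B(2) Bn_def by auto
  have ker: "x \<in> span Bk" if "x \<in> P" "\<phi> x = 0" for x
  proof -
    have "x \<in> span (B \<inter> {x\<in>P. \<phi> x \<in> {0}})"
      by (rule adaptedD[OF B(3)]) (use that R'(2) B(2) in auto)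
    moreover have "B \<inter> {x\<in>P. \<phi> x \<in> {0}} \<subseteq> Bk" unfolding Bk_def by auto
    ultimately show ?thesis using span_mono by blast
  qed
  have inj: "inj_on \<phi> (span Bn)"
    unfolding phi.inj_on_iff_eq_0[OF subspace_span]
  proof (intro ballI impI)
    fix x assume x: "x \<in> span Bn" "\<phi> x = 0"
    then have "x \<in> span Bk \<inter> span Bn" using ker sub by blast
    also have "\<dots> = span (Bk \<inter> Bn)" by (rule span_Int_of_independent[OF B(1)]) (auto simp: Bk_def Bn_def)
    also have "Bk \<inter> Bn = {}" unfolding Bk_def Bn_def by auto
    finally show "x = 0" by simp
  qed
  show "inj_on \<phi> {b\<in>B. \<phi> b \<noteq> 0}"
    using inj span_superset[of Bn] unfolding Bn_def by (rule inj_on_subset)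
  have indBn: "independent Bn" using B(1) independent_mono[of B Bn] unfolding Bn_def by auto
  have eq: "\<phi> ` B - {0} = \<phi> ` Bn" unfolding Bn_def by auto
  have ind: "independent (\<phi> ` Bn)" using phi.independent_injective_image[OF indBn inj] .
  have ad: "adapted (\<phi> ` Bn) R'" unfolding adapted_def
  proof (intro ballI subsetI)
    fix F y assume F: "F \<in> R'" "y \<in> span (\<phi> ` Bn) \<inter> F"
    then obtain x where x: "x \<in> span Bn" "y = \<phi> x" unfolding phi.span_image by blast
    then have "x \<in> {x\<in>P. \<phi> x \<in> F}" using F sub by auto
    then have "x \<in> span (B \<inter> {x\<in>P. \<phi> x \<in> F})" using adaptedD[OF B(3), of "{x\<in>P. \<phi> x \<in> F}" x] F(1) B(2) by blast
    then have "y \<in> span (\<phi> ` (B \<inter> {x\<in>P. \<phi> x \<in> F}))" unfolding phi.span_image x(2) by blast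
    also have "\<dots> = span (\<phi> ` (B \<inter> {x\<in>P. \<phi> x \<in> F}) - {0})" by simp
    also have "\<dots> \<subseteq> span (\<phi> ` Bn \<inter> F)" by (intro span_mono) (auto simp: Bn_def)
    finally show "y \<in> span (\<phi> ` Bn \<inter> F)" .
  qed
  have subP: "\<phi> ` Bn \<subseteq> P'" using phi(2) sub span_superset by blast
  obtain N where N: "\<phi> ` Bn \<inter> N = {}" "independent (\<phi> ` Bn \<union> N)" "span (\<phi> ` Bn \<union> N) = P'" "adapted (\<phi> ` Bn \<union> N) R'"
    using adapted_basis_extend_any[OF R'(1) ind subP ad] by blast
  then show "\<exists>N. (\<phi> ` B - {0}) \<inter> N = {} \<and> independent ((\<phi> ` B - {0}) \<union> N) \<and>
           span ((\<phi> ` B - {0}) \<union> N) = P' \<and> adapted ((\<phi> ` B - {0}) \<union> N) R'" unfolding eq by blast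
qed

text \<open>Here the basis vectors in the image of \<open>\<gamma>\<close> are lifted, and the vectors without a lift get \<open>s b = 0\<close>. A lift is chosen in the least member of
\<open>R'\<close> whose image contains the vector, so that it lies in every member that can contain a lift.\<close>

lemma step_inward:
  assumes R': "wchain P' R'"
    and ga: "Vector_Spaces.linear scale scale \<gamma>" "\<gamma> ` P' \<subseteq> P"
    and B: "independent B" "span B = P" "adapted B ((`) \<gamma> ` R')"
  shows "\<exists>s N. s 0 = 0 \<and> (\<forall>b\<in>B. s b \<noteq> 0 \<longrightarrow> \<gamma> (s b) = b) \<and> (\<forall>n\<in>N. \<gamma> n = 0) \<and>
           (\<forall>b\<in>B. \<forall>F\<in>R'. b \<in> \<gamma> ` F \<longrightarrow> s b \<noteq> 0 \<and> s b \<in> F) \<and>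
           inj_on s {b\<in>B. s b \<noteq> 0} \<and>
           (s ` B - {0}) \<inter> N = {} \<and> independent ((s ` B - {0}) \<union> N) \<and>
           span ((s ` B - {0}) \<union> N) = P' \<and> adapted ((s ` B - {0}) \<union> N) R'"
proof -
  interpret ga: Vector_Spaces.linear scale scale \<gamma> by (rule ga(1))
  have subP': "subspace P'" using R' wchain_subspace wchain_top by blast
  define K where "K = {x. \<gamma> x = 0} \<inter> P'"
  have subK: "subspace {x. \<gamma> x = 0}" by (rule ga.subspace_kernel)
  have wK: "wchain K ((\<inter>) {x. \<gamma> x = 0} ` R')" unfolding K_def
    by (rule wchain_image_mono[OF R']) (auto intro: subspace_inter subK wchain_subspace[OF R'])
  obtain N where N: "independent N" "span N = K" "adapted N ((\<inter>) {x. \<gamma> x = 0} ` R')"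
    using adapted_basis_extend_any[OF wK, of "{}"] independent_empty
    by (auto simp: adapted_def span_zero)
  have "\<exists>y. \<gamma> y = b \<and> (\<forall>F\<in>R'. b \<in> \<gamma> ` F \<longrightarrow> y \<in> F)" if b: "b \<in> \<gamma> ` P'" for b
  proof -
    obtain F where F: "F \<in> R'" "b \<in> \<gamma> ` F" "\<And>G. G \<in> R' \<Longrightarrow> b \<in> \<gamma> ` G \<Longrightarrow> F \<subseteq> G"
      using wchain_least[OF R' wchain_top[OF R'], of "\<lambda>F. b \<in> \<gamma> ` F"] b by blast
    then obtain y where y: "y \<in> F" "\<gamma> y = b" by blast
    then have "\<forall>G\<in>R'. b \<in> \<gamma> ` G \<longrightarrow> y \<in> G" using F(3) by blast
    then show ?thesis using y(2) by blast
  qed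
  then obtain l where l: "\<And>b. b \<in> \<gamma> ` P' \<Longrightarrow> \<gamma> (l b) = b"
      "\<And>b F. b \<in> \<gamma> ` P' \<Longrightarrow> F \<in> R' \<Longrightarrow> b \<in> \<gamma> ` F \<Longrightarrow> l b \<in> F" by metis
  define s where "s b = (if b \<in> B \<inter> \<gamma> ` P' then l b else 0)" for b
  have B0: "0 \<notin> B" using B(1) dependent_zero by blast
  have s0: "s 0 = 0" using B0 unfolding s_def by simp
  have s1: "\<gamma> (s b) = b" if "b \<in> B" "s b \<noteq> 0" for b using that l unfolding s_def by (auto split: if_splits)
  have s2: "s b \<noteq> 0 \<and> s b \<in> F" if "b \<in> B" "F \<in> R'" "b \<in> \<gamma> ` F" for b F
  proof -
    have "b \<in> \<gamma> ` P'" using that wchain_subset[OF R'] by blast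
    then have "s b = l b" "\<gamma> (l b) = b" "l b \<in> F" using that l unfolding s_def by auto
    then show ?thesis using B0 that ga.zero by metis
  qed
  define I where "I = {b\<in>B. s b \<noteq> 0}"
  have eq: "s ` B - {0} = s ` I" unfolding I_def by auto
  have indep: "T = {}" if T: "finite T" "T \<subseteq> I" "\<forall>i\<in>T. c i \<noteq> 0" "(\<Sum>i\<in>T. scale (c i) (s i)) \<in> span N" for T c
  proof -
    have "\<gamma> (\<Sum>i\<in>T. scale (c i) (s i)) = 0" using T(4) N(2) unfolding K_def by auto
    moreover have "\<gamma> (\<Sum>i\<in>T. scale (c i) (s i)) = (\<Sum>i\<in>T. scale (c i) i)"
      unfolding ga.sum ga.scale by (intro sum.cong refl) (use T(2) s1 I_def in auto)
    ultimately have "c i = 0" if "i \<in> T" for i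
      using independentD[OF B(1) T(1), of c i] T(2) that unfolding I_def by auto
    then show ?thesis using T(3) by blast
  qed
  have U: "inj_on s I" "N \<inter> s ` I = {}" "independent (N \<union> s ` I)"
    by (rule independent_Un_imageI[OF N(1)]; erule (3) indep)+
  have N0: "\<gamma> n = 0" if "n \<in> N" for n using that N(2) span_base unfolding K_def by blast
  define X where "X = s ` I \<union> N"
  have spanF: "F \<subseteq> span (X \<inter> F)" if F: "F \<in> R'" for F
  proof
    fix x assume x: "x \<in> F"
    have "\<gamma> x \<in> span B" using B(2) ga(2) x wchain_subset[OF R' F] by blast
    then have "\<gamma> x \<in> span (B \<inter> \<gamma> ` F)" using adaptedD[OF B(3), of "\<gamma> ` F" "\<gamma> x"] F x by blast
    moreover have "B \<inter> \<gamma> ` F = \<gamma> ` (s ` (B \<inter> \<gamma> ` F))"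
      unfolding image_image using s1 s2[OF _ F] by (force intro!: image_eqI)
    ultimately obtain w where w: "w \<in> span (s ` (B \<inter> \<gamma> ` F))" "\<gamma> w = \<gamma> x"
      using ga.span_image by (metis imageE)
    have 1: "s ` (B \<inter> \<gamma> ` F) \<subseteq> X \<inter> F" using s2[OF _ F] unfolding X_def I_def by auto
    then have wF: "w \<in> F" using w(1) span_minimal[of "s ` (B \<inter> \<gamma> ` F)" F] wchain_subspace[OF R' F] by blast
    have xw: "x - w \<in> {x. \<gamma> x = 0} \<inter> F" using x wF w(2) subspace_diff[OF wchain_subspace[OF R' F]] by (simp add: ga.diff)
    then have "x - w \<in> span N" using N(2) wchain_subset[OF R' F] unfolding K_def by blast
    then have "x - w \<in> span (N \<inter> ({x. \<gamma> x = 0} \<inter> F))" using adaptedD[OF N(3)] xw F by blast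
    then have 2: "x - w \<in> span (X \<inter> F)" using span_mono[of "N \<inter> ({x. \<gamma> x = 0} \<inter> F)" "X \<inter> F"] unfolding X_def by blast
    have "w \<in> span (X \<inter> F)" using w(1) 1 span_mono by blast
    then show "x \<in> span (X \<inter> F)" using 2 span_add by fastforce
  qed
  have XP: "X \<subseteq> P'"
  proof -
    have "s b \<in> P'" if "b \<in> B" "s b \<noteq> 0" for b
    proof -
      have "b \<in> \<gamma> ` P'" using that unfolding s_def by (auto split: if_splits)
      then show ?thesis using s2 that wchain_top[OF R'] by blast
    qed
    moreover have "N \<subseteq> P'" using N(2) span_superset K_def by blast
    ultimately show ?thesis unfolding X_def I_def by auto
  qed
  have "span X = P'"
    using span_minimal[OF XP subP'] spanF[OF wchain_top[OF R']] span_mono[of "X \<inter> P'" X] by blast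
  moreover have "adapted X R'" unfolding adapted_def using spanF by blast
  moreover have "independent X" "s ` I \<inter> N = {}" using U unfolding X_def by (auto simp: Un_commute)
  ultimately have "(s ` B - {0}) \<inter> N = {}" "independent ((s ` B - {0}) \<union> N)"
           "span ((s ` B - {0}) \<union> N) = P'" "adapted ((s ` B - {0}) \<union> N) R'" unfolding eq X_def by auto
  moreover have "inj_on s {b\<in>B. s b \<noteq> 0}" using U(1) unfolding I_def .
  moreover have "\<forall>b\<in>B. s b \<noteq> 0 \<longrightarrow> \<gamma> (s b) = b" "\<forall>n\<in>N. \<gamma> n = 0"
      "\<forall>b\<in>B. \<forall>F\<in>R'. b \<in> \<gamma> ` F \<longrightarrow> s b \<noteq> 0 \<and> s b \<in> F"
    using s1 s2 N0 by blast+
  ultimately show ?thesis using s0 by (intro exI[of _ s] exI[of _ N] conjI)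
qed

end

section \<open>Two subspaces and a chain\<close>

context ambient_space
begin

text \<open>The map \<open>1 + N\<close> is invertible on the span of \<open>X\<close> because \<open>N\<close> squares to zero there.\<close>

lemma independent_change_by_square_zero:
  assumes X: "independent X" and N: "Vector_Spaces.linear scale scale N"
    and sq: "\<And>x. x \<in> X \<Longrightarrow> N (N x) = 0"
  shows "inj_on (\<lambda>x. x + N x) X" "independent ((\<lambda>x. x + N x) ` X)"
proof -
  interpret N: Vector_Spaces.linear scale scale N by (rule N)
  have lin: "Vector_Spaces.linear scale scale (\<lambda>x. x + N x)"
    by (intro vsp.linear_compose_add N module_hom_ident[unfolded module_hom_iff_linear])
  interpret T: Vector_Spaces.linear scale scale "\<lambda>x. x + N x" by (rule lin)
  have sq': "N (N x) = 0" if "x \<in> span X" for x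
    using that by (induction rule: span_induct_alt) (auto simp: N.add N.scale sq)
  have inj: "inj_on (\<lambda>x. x + N x) (span X)"
    unfolding T.inj_on_iff_eq_0[OF subspace_span]
  proof (intro ballI impI)
    fix x assume x: "x \<in> span X" "x + N x = 0"
    then have "N (x + N x) = 0" by simp
    then have "N x = 0" using sq'[OF x(1)] by (simp add: N.add)
    then show "x = 0" using x(2) by simp
  qed
  then show "independent ((\<lambda>x. x + N x) ` X)" by (rule T.independent_injective_image[OF X])
  show "inj_on (\<lambda>x. x + N x) X" using inj span_superset by (rule inj_on_subset)
qed

text \<open>Choose a basis of \<open>A\<close> adapted to \<open>D = A \<inter> B\<close>, to the traces \<open>F \<inter> A\<close>, and to the projections of \<open>F \<inter> (A + B)\<close> to \<open>A\<close> along \<open>B\<close>.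
The last of these are taken as the subspaces \<open>(F + B) \<inter> A\<close>, so that no quotient by \<open>D\<close> is needed. For a basis vector
\<open>c\<close> outside \<open>D\<close> let \<open>F\<close> be the least member of the chain with \<open>c \<in> F + B\<close>. Either \<open>c \<in> F\<close>, and \<open>c\<close> is a single vector; or \<open>c \<notin> F\<close> but
\<open>c + \<beta> c \<in> F\<close> for some \<open>\<beta> c \<in> B\<close>, and then \<open>c\<close> and \<open>c + \<beta> c\<close> form a pair. The vectors obtained so far
are independent and adapted to the chain; they are completed first by vectors of \<open>B\<close> to a basis of \<open>A + B\<close>,
then by arbitrary vectors. In the result \<open>S\<close> is the set of single vectors and \<open>C\<close> contains the first member of each pair.\<close>

lemma two_subspaces_and_chain:
  assumes A: "subspace A" "A \<subseteq> E" and B: "subspace B" "B \<subseteq> E" and R: "wchain E R" "{0} \<in> R"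
  obtains S C \<beta> where
    "independent (S \<union> C \<union> (\<lambda>c. c + \<beta> c) ` C)" "span (S \<union> C \<union> (\<lambda>c. c + \<beta> c) ` C) = E"
    "adapted (S \<union> C \<union> (\<lambda>c. c + \<beta> c) ` C) R"
    "inj_on (\<lambda>c. c + \<beta> c) C" "S \<inter> C = {}" "(S \<union> C) \<inter> (\<lambda>c. c + \<beta> c) ` C = {}"
    "A \<subseteq> span (S \<inter> A \<union> C)" "B \<subseteq> span (S \<inter> B \<union> \<beta> ` C)"
    "\<And>c. c \<in> C \<Longrightarrow> c \<in> A \<and> c \<notin> B \<and> \<beta> c \<in> B \<and> \<beta> c \<notin> A"
    "\<And>c. c \<in> C \<Longrightarrow> \<exists>F\<in>R. c + \<beta> c \<in> F \<and> c \<notin> F"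
proof -
  have subE: "subspace E" using R wchain_subspace wchain_top by blast
  note subR = wchain_subspace[OF R(1)]
  note leE = wchain_subset[OF R(1)]
  define D where "D = A \<inter> B"
  have subD: "subspace D" unfolding D_def using A B subspace_inter by blast
  define pA where "pA F = {x + y |x y. x \<in> F \<and> y \<in> B} \<inter> A" for F
  have pAI: "a \<in> pA F" if "a \<in> A" "a + b \<in> F" "b \<in> B" for a b F
  proof -
    have "a = (a + b) + (- b)" "- b \<in> B" using that B(1) subspace_neg by auto
    then show ?thesis unfolding pA_def using that by blast
  qed
  have pAD: "\<exists>b\<in>B. a + b \<in> F" if a: "a \<in> pA F" for a F
  proof -
    obtain x y where "x \<in> F" "y \<in> B" "a = x + y" using a unfolding pA_def by blast
    then show ?thesis using B(1) subspace_neg by (intro bexI[of _ "- y"]) auto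
  qed
  have pA_mono: "pA F \<subseteq> pA G" if "F \<subseteq> G" for F G using that unfolding pA_def by blast
  have pAE: "pA E = A"
    using pAI[of _ 0 E] A(2) subspace_0[OF B(1)] by (auto simp: pA_def)
  have w1: "wchain A (insert D (pA ` R))"
  proof (rule wchain_insert_bot)
    have "wchain (pA E) (pA ` R)"
    proof (rule wchain_image_mono[OF R(1)])
      show "subspace (pA F)" if "F \<in> R" for F
        unfolding pA_def by (intro subspace_inter subspace_sums A B subR that)
    qed (rule pA_mono)
    then show "wchain A (pA ` R)" unfolding pAE .
    show "D \<subseteq> F" if FR: "F \<in> pA ` R" for F
    proof
      fix d assume d: "d \<in> D"
      obtain G where G: "G \<in> R" "F = pA G" using FR by blast
      show "d \<in> F" unfolding G(2) by (rule pAI[of _ "- d"])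
        (use d subspace_0[OF subR[OF G(1)]] subspace_neg[OF B(1)] in \<open>auto simp: D_def\<close>)
    qed
  qed (rule subD)
  have w2: "wchain A ((\<lambda>F. F \<inter> A) ` R)"
  proof -
    have "E \<inter> A = A" using A(2) by blast
    then show ?thesis using wchain_image_mono[OF R(1), of "\<lambda>F. F \<inter> A"] subspace_inter subR A(1)
      by (metis (no_types, lifting) inf_mono order_refl)
  qed
  obtain CA where CA: "CA \<subseteq> A" "independent CA" "span CA = A"
    and ad0: "\<forall>F\<in>insert D (pA ` R). \<forall>G\<in>(\<lambda>F. F \<inter> A) ` R. F \<inter> G \<subseteq> span (CA \<inter> F \<inter> G)"
    using common_adapted_basis[OF w1 w2] by metis
  note ad = bspec[OF bspec[OF ad0]]
  have adD: "D \<inter> F \<subseteq> span (CA \<inter> D \<inter> F)" if "F \<in> R" for F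
  proof -
    have "D \<inter> (F \<inter> A) = D \<inter> F" "CA \<inter> D \<inter> (F \<inter> A) = CA \<inter> D \<inter> F" unfolding D_def by auto
    note eqs = this
    have "D \<in> insert D (pA ` R)" "F \<inter> A \<in> (\<lambda>F. F \<inter> A) ` R"
      using that wchain_top[OF R(1)] pAE by blast+
    from ad[OF this] show ?thesis unfolding eqs .
  qed
  have adP: "pA F \<subseteq> span (CA \<inter> pA F)" if "F \<in> R" for F
  proof -
    have "pA F \<inter> (E \<inter> A) = pA F" "CA \<inter> pA F \<inter> (E \<inter> A) = CA \<inter> pA F" using A(2) unfolding pA_def by auto
    note eqs = this
    have "pA F \<in> insert D (pA ` R)" "E \<inter> A \<in> (\<lambda>F. F \<inter> A) ` R"
      using that wchain_top[OF R(1)] pAE by blast+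
    from ad[OF this] show ?thesis unfolding eqs .
  qed
  have adA: "F \<inter> A \<subseteq> span (CA \<inter> F)" if "F \<in> R" for F
  proof -
    have "A \<inter> (F \<inter> A) = F \<inter> A" "CA \<inter> A \<inter> (F \<inter> A) = CA \<inter> F" using CA(1) by auto
    note eqs = this
    have "A \<in> insert D (pA ` R)" "F \<inter> A \<in> (\<lambda>F. F \<inter> A) ` R"
      using that wchain_top[OF R(1)] pAE by blast+
    from ad[OF this] show ?thesis unfolding eqs .
  qed
  have "\<exists>F\<in>R. c \<in> pA F \<and> (\<forall>G\<in>R. c \<in> pA G \<longrightarrow> F \<subseteq> G)" if cCA: "c \<in> CA" for c
  proof -
    obtain F where "F \<in> R" "c \<in> pA F" "\<And>G. G \<in> R \<Longrightarrow> c \<in> pA G \<Longrightarrow> F \<subseteq> G"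
      using wchain_least[OF R(1) wchain_top[OF R(1)], of "\<lambda>F. c \<in> pA F"] cCA CA(1) pAE by blast
    then show ?thesis by blast
  qed
  then obtain ix where ix: "\<And>c. c \<in> CA \<Longrightarrow> ix c \<in> R" "\<And>c. c \<in> CA \<Longrightarrow> c \<in> pA (ix c)"
      "\<And>c F. c \<in> CA \<Longrightarrow> F \<in> R \<Longrightarrow> c \<in> pA F \<Longrightarrow> ix c \<subseteq> F"
    by metis
  obtain \<beta> where \<beta>: "\<And>c. c \<in> CA \<Longrightarrow> \<beta> c \<in> B" "\<And>c. c \<in> CA \<Longrightarrow> c + \<beta> c \<in> ix c"
    using pAD[OF ix(2)] by metis
  define f where "f c = c + \<beta> c" for c
  define C where "C = {c\<in>CA. c \<notin> D \<and> c \<notin> ix c}"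
  have CCA: "C \<subseteq> CA" unfolding C_def by auto
  have f_ix: "f c \<in> ix c" if "c \<in> C" for c using \<beta>(2) that CCA unfolding f_def by auto
  have self_pA: "c \<in> pA F" if "c \<in> A" "c \<in> F" for c F
    by (rule pAI[of _ 0]) (use that subspace_0[OF B(1)] in auto)
  have spanCAD: "span (CA \<inter> D) = D"
  proof
    show "span (CA \<inter> D) \<subseteq> D" by (rule span_minimal) (auto simp: subD)
    show "D \<subseteq> span (CA \<inter> D)" using adD[OF wchain_top[OF R(1)]] A(2) CA(1)
      by (metis D_def Int_absorb2 inf.coboundedI1 inf_assoc)
  qed
  (* The chain members occupied by c + beta c are smaller than those occupied by c. So if F misses some c in T,
     then the largest index H of such a c contains the whole sum, hence c itself, contrary to the choice of C. *)
  have key: "T \<subseteq> F" if d: "d \<in> D" and T: "finite T" "T \<subseteq> C" "\<forall>c\<in>T. n c \<noteq> 0" and F: "F \<in> R"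
    and z: "d + (\<Sum>c\<in>T. scale (n c) (\<beta> c)) \<in> F" for d T n F
  proof (rule ccontr)
    assume "\<not> T \<subseteq> F"
    define T0 where "T0 = T - F"
    have T0CA: "T0 \<subseteq> CA" using T(2) CCA unfolding T0_def by auto
    have T0: "T0 \<noteq> {}" using \<open>\<not> T \<subseteq> F\<close> unfolding T0_def by auto
    have fin: "finite (insert F (ix ` T0))" using T(1) by (simp add: T0_def)
    have inR: "insert F (ix ` T0) \<subseteq> R" using F ix(1) T0CA by blast
    obtain H where H: "H \<in> insert F (ix ` T0)" "\<forall>G\<in>insert F (ix ` T0). G \<subseteq> H"
      using wchain_finite_max[OF R(1) fin inR insert_not_empty] by blast
    have HR: "H \<in> R" using H(1) F ix(1)[OF subsetD[OF T0CA]] by blast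
    have fH: "f c \<in> H" if c: "c \<in> T" for c
    proof (cases "c \<in> F")
      case True
      then have "c \<in> pA F" using self_pA c T(2) CCA CA(1) by blast
      then have "ix c \<subseteq> F" using ix(3) c T(2) CCA F by blast
      then show ?thesis using f_ix c T(2) H(2) by blast
    next
      case False
      then show ?thesis using f_ix c T(2) H(2) unfolding T0_def by blast
    qed
    define y where "y = (\<Sum>c\<in>T. scale (n c) c) - d"
    have "y = (\<Sum>c\<in>T. scale (n c) (f c)) - (d + (\<Sum>c\<in>T. scale (n c) (\<beta> c)))"
      unfolding y_def f_def scale_right_distrib sum.distrib by simp
    also have "\<dots> \<in> H"
      using z H(2) fH subR[OF HR] by (intro subspace_diff subspace_sum subspace_scale) auto
    finally have yH: "y \<in> H" .
    have "y \<in> A" unfolding y_def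
      using d D_def T(2) CCA CA(1) by (intro subspace_diff subspace_sum subspace_scale A(1)) auto
    then have ysp: "y \<in> span (CA \<inter> H)" using adA[OF HR] yH by blast
    have TH: "c \<in> H" if c: "c \<in> T" for c
    proof (rule ccontr)
      assume cH: "c \<notin> H"
      have cCA: "c \<in> CA" "c \<notin> D" using c T(2) unfolding C_def by auto
      have 1: "y \<in> span (CA - {c})" using ysp cH span_mono[of "CA \<inter> H" "CA - {c}"] by blast
      have 2: "d \<in> span (CA - {c})" using d spanCAD cCA span_mono[of "CA \<inter> D" "CA - {c}"] by blast
      have 3: "(\<Sum>c\<in>T - {c}. scale (n c) c) \<in> span (CA - {c})"
        using T(2) CCA by (intro span_sum span_scale span_base) auto
      have "scale (n c) c = y + d - (\<Sum>c\<in>T - {c}. scale (n c) c)"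
        unfolding y_def using sum.remove[OF T(1) c, of "\<lambda>c. scale (n c) c"] by simp
      also have "\<dots> \<in> span (CA - {c})" using 1 2 3 by (intro span_diff span_add)
      finally have "scale (inverse (n c)) (scale (n c) c) \<in> span (CA - {c})" by (rule span_scale)
      then have "c \<in> span (CA - {c})" using T(3) c by simp
      then show False using CA(2) cCA unfolding dependent_def by blast
    qed
    show False
    proof (cases "H = F")
      case True
      then show False using TH T0 unfolding T0_def by blast
    next
      case False
      then obtain c where "c \<in> T0" "H = ix c" using H(1) by blast
      then show False using TH T(2) unfolding C_def T0_def by blast
    qed
  qed
  have C0: "0 \<notin> CA" using CA(2) dependent_zero by blast
  have inter: "T = {}" if T: "finite T" "T \<subseteq> C" "\<forall>c\<in>T. n c \<noteq> 0" "(\<Sum>c\<in>T. scale (n c) (f c)) \<in> span CA" for T n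
  proof -
    have 1: "(\<Sum>c\<in>T. scale (n c) (\<beta> c)) = (\<Sum>c\<in>T. scale (n c) (f c)) - (\<Sum>c\<in>T. scale (n c) c)"
      unfolding f_def scale_right_distrib sum.distrib by simp
    have "(\<Sum>c\<in>T. scale (n c) c) \<in> A"
      using T(2) CCA CA(1) by (intro subspace_sum subspace_scale A(1)) auto
    then have "(\<Sum>c\<in>T. scale (n c) (\<beta> c)) \<in> A"
      unfolding 1 using T(4) CA(3) subspace_diff[OF A(1)] by blast
    moreover have "(\<Sum>c\<in>T. scale (n c) (\<beta> c)) \<in> B"
      using T(2) CCA \<beta>(1) by (intro subspace_sum subspace_scale B(1)) auto
    ultimately have "- (\<Sum>c\<in>T. scale (n c) (\<beta> c)) \<in> D" using subspace_neg[OF subD] unfolding D_def by blast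
    from key[OF this T(1-3) R(2)] have "T \<subseteq> {0}" by simp
    then show ?thesis using T(2) CCA C0 by blast
  qed
  have X0: "inj_on f C" "CA \<inter> f ` C = {}" "independent (CA \<union> f ` C)"
    by (rule independent_Un_imageI[OF CA(2)]; erule (3) inter)+
  define X0 where "X0 = CA \<union> f ` C"
  define W where "W = {x + y |x y. x \<in> A \<and> y \<in> B}"
  have subW: "subspace W" unfolding W_def by (intro subspace_sums A B)
  have AW: "A \<subseteq> W" unfolding W_def using subspace_0[OF B(1)] by force
  have BW: "B \<subseteq> W" unfolding W_def using subspace_0[OF A(1)] by force
  have WE: "W \<subseteq> E" unfolding W_def using A(2) B(2) subspace_add[OF subE] by blast
  have wW: "wchain W ((\<lambda>F. F \<inter> W) ` R)"
  proof -
    have "E \<inter> W = W" using WE by blast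
    then show ?thesis using wchain_image_mono[OF R(1), of "\<lambda>F. F \<inter> W"] subspace_inter subR subW
      by (metis (no_types, lifting) inf_mono order_refl)
  qed
  (* Modulo B, every vector of F in A + B is a combination of vectors of X0 that lie in F. *)
  have lift: "\<exists>w\<in>span (X0 \<inter> F). z - w \<in> F \<inter> B" if F: "F \<in> R" and z: "z \<in> F" "z \<in> W" for F z
  proof -
    obtain a b where ab: "z = a + b" "a \<in> A" "b \<in> B" using z unfolding W_def by blast
    have "a \<in> pA F" using pAI ab z by blast
    then have "a \<in> span (CA \<inter> pA F)" using adP[OF F] by blast
    then have "\<exists>w\<in>span (X0 \<inter> F). a - w \<in> B"
    proof (induction rule: span_induct_alt)
      case base
      show ?case using span_zero subspace_0[OF B(1)] by (intro bexI[of _ 0]) auto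
    next
      case (step r c y)
      then obtain w where w: "w \<in> span (X0 \<inter> F)" "y - w \<in> B" by blast
      have ixF: "ix c \<subseteq> F" using ix(3) step(1) F by blast
      have "\<exists>v\<in>span (X0 \<inter> F). c - v \<in> B"
      proof (cases "c \<in> D")
        case True
        then show ?thesis using span_zero by (intro bexI[of _ 0]) (auto simp: D_def)
      next
        case False
        show ?thesis
        proof (cases "c \<in> ix c")
          case True
          then show ?thesis using ixF step(1) subspace_0[OF B(1)]
            by (intro bexI[of _ c]) (auto simp: X0_def intro: span_base)
        next
          case nix: False
          then have "c \<in> C" using False step(1) unfolding C_def by auto
          then have "f c \<in> X0 \<inter> F" using f_ix ixF unfolding X0_def by blast
          moreover have "c - f c \<in> B" using \<beta>(1) step(1) subspace_neg[OF B(1)] unfolding f_def by auto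
          ultimately show ?thesis using span_base by blast
        qed
      qed
      then obtain v where v: "v \<in> span (X0 \<inter> F)" "c - v \<in> B" by blast
      have "(scale r c + y) - (scale r v + w) = scale r (c - v) + (y - w)"
        by (simp add: scale_right_diff_distrib)
      also have "\<dots> \<in> B" using v w by (intro subspace_add subspace_scale B(1))
      finally show ?case using v w by (intro bexI[of _ "scale r v + w"] span_add span_scale) auto
    qed
    then obtain w where w: "w \<in> span (X0 \<inter> F)" "a - w \<in> B" by blast
    have "z - w = (a - w) + b" using ab by simp
    then have "z - w \<in> B" using subspace_add[OF B(1) w(2) ab(3)] by metis
    moreover have "w \<in> F" using w span_minimal[of "X0 \<inter> F" F] subR[OF F] by blast
    ultimately show ?thesis using w z subspace_diff[OF subR[OF F]] by blast
  qed
  have X0W: "X0 \<subseteq> W"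
    unfolding X0_def f_def using CA(1) AW BW CCA \<beta>(1) subspace_add[OF subW] by blast
  have adX0: "adapted X0 ((\<lambda>F. F \<inter> W) ` R)" unfolding adapted_def
  proof (intro ballI subsetI)
    fix F' y assume F': "F' \<in> (\<lambda>F. F \<inter> W) ` R" "y \<in> span X0 \<inter> F'"
    then obtain F where F: "F \<in> R" "F' = F \<inter> W" by blast
    have eq: "X0 \<inter> F' = X0 \<inter> F" using F X0W by blast
    obtain w where w: "w \<in> span (X0 \<inter> F)" "y - w \<in> F \<inter> B" using lift[OF F(1), of y] F' F by blast
    have "w \<in> span X0" using w(1) span_mono[of "X0 \<inter> F" X0] by blast
    then have "y - w \<in> span (CA \<union> f ` C)" using F'(2) span_diff unfolding X0_def by blast
    then obtain a g where ag: "y - w = a + g" "a \<in> A" "g \<in> span (f ` C)" unfolding span_Un CA(3) by blast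
    obtain T n where T: "finite T" "T \<subseteq> C" "\<forall>c\<in>T. n c \<noteq> 0" "g = (\<Sum>c\<in>T. scale (n c) (f c))"
      using in_span_imageE[OF ag(3)] by metis
    define d where "d = a + (\<Sum>c\<in>T. scale (n c) c)"
    have yd: "y - w = d + (\<Sum>c\<in>T. scale (n c) (\<beta> c))"
      unfolding ag(1) T(4) d_def f_def scale_right_distrib sum.distrib by simp
    (* The A-component d of y - w lies in B as well, so key applies to y - w. *)
    have "d \<in> A" unfolding d_def
      using ag(2) T(2) CCA CA(1) by (intro subspace_add subspace_sum subspace_scale A(1)) auto
    moreover have "d \<in> B"
    proof -
      have "d = (y - w) - (\<Sum>c\<in>T. scale (n c) (\<beta> c))" using yd by simp
      moreover have "(\<Sum>c\<in>T. scale (n c) (\<beta> c)) \<in> B"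
        using T(2) CCA \<beta>(1) by (intro subspace_sum subspace_scale B(1)) auto
      ultimately show ?thesis using w(2) subspace_diff[OF B(1)] by (metis IntD2)
    qed
    ultimately have dD: "d \<in> D" unfolding D_def by blast
    have TF: "T \<subseteq> F" using key[OF dD T(1-3) F(1)] yd w(2) by simp
    have TX: "c \<in> X0 \<inter> F \<and> f c \<in> X0 \<inter> F" if "c \<in> T" for c
    proof -
      have "ix c \<subseteq> F" using ix(3) self_pA that T(2) CCA CA(1) TF F(1) by blast
      then show ?thesis using that TF T(2) CCA f_ix unfolding X0_def by blast
    qed
    have bs: "(\<Sum>c\<in>T. scale (n c) (\<beta> c)) \<in> span (X0 \<inter> F)"
    proof -
      have "(\<Sum>c\<in>T. scale (n c) (\<beta> c)) = (\<Sum>c\<in>T. scale (n c) (f c - c))" unfolding f_def by simp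
      also have "\<dots> \<in> span (X0 \<inter> F)" using TX by (intro span_sum span_scale span_diff span_base) auto
      finally show ?thesis .
    qed
    moreover have "d \<in> span (X0 \<inter> F)"
    proof -
      have "d = (y - w) - (\<Sum>c\<in>T. scale (n c) (\<beta> c))" using yd by simp
      also have "\<dots> \<in> F"
        using w(2) bs span_minimal[of "X0 \<inter> F" F] subR[OF F(1)] subspace_diff by blast
      finally have "d \<in> span (CA \<inter> D \<inter> F)" using adD[OF F(1)] dD by blast
      then show ?thesis using span_mono[of "CA \<inter> D \<inter> F" "X0 \<inter> F"] unfolding X0_def by blast
    qed
    ultimately have "y - w \<in> span (X0 \<inter> F)" unfolding yd by (intro span_add)
    then have "(y - w) + w \<in> span (X0 \<inter> F)" using w(1) by (intro span_add)
    then show "y \<in> span (X0 \<inter> F')" unfolding eq by simp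
  qed
  have covB: "F \<subseteq> span (X0 \<union> (F \<inter> B))" if FR: "F \<in> (\<lambda>F. F \<inter> W) ` R" for F
  proof
    fix z assume z: "z \<in> F"
    obtain G where G: "G \<in> R" "F = G \<inter> W" using FR by blast
    obtain w where w: "w \<in> span (X0 \<inter> G)" "z - w \<in> G \<inter> B" using lift[OF G(1), of z] z G(2) by blast
    then have "z - w \<in> F \<inter> B" using G(2) BW by blast
    then have "z - w \<in> span (X0 \<union> (F \<inter> B))" by (intro span_base UnI2)
    moreover have "w \<in> span (X0 \<union> (F \<inter> B))" using w(1) span_mono[of "X0 \<inter> G" "X0 \<union> (F \<inter> B)"] by blast
    ultimately have "(z - w) + w \<in> span (X0 \<union> (F \<inter> B))" by (rule span_add)
    then show "z \<in> span (X0 \<union> (F \<inter> B))" by simp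
  qed
  obtain SB where SB: "SB \<subseteq> B" "X0 \<inter> SB = {}" "independent (X0 \<union> SB)" "span (X0 \<union> SB) = W"
      "adapted (X0 \<union> SB) ((\<lambda>F. F \<inter> W) ` R)"
    using adapted_basis_extend[OF wW X0(3)[folded X0_def] X0W adX0 covB] by metis
  define X1 where "X1 = X0 \<union> SB"
  have X1W: "X1 \<subseteq> W" using SB(4) span_superset unfolding X1_def by blast
  have adX1: "adapted X1 R" unfolding adapted_def
  proof (intro ballI subsetI)
    fix F y assume F: "F \<in> R" "y \<in> span X1 \<inter> F"
    have "y \<in> F \<inter> W" using F SB(4) unfolding X1_def by blast
    then have "y \<in> span (X1 \<inter> (F \<inter> W))"
      using adaptedD[OF SB(5)] F unfolding X1_def by blast
    then show "y \<in> span (X1 \<inter> F)" using span_mono[of "X1 \<inter> (F \<inter> W)" "X1 \<inter> F"] by blast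
  qed
  obtain S0 where S0: "X1 \<inter> S0 = {}" "independent (X1 \<union> S0)" "span (X1 \<union> S0) = E" "adapted (X1 \<union> S0) R"
    using adapted_basis_extend_any[OF R(1) SB(3)[folded X1_def] _ adX1] X1W WE by blast
  define S where "S = (CA - C) \<union> SB \<union> S0"
  have Xeq: "S \<union> C \<union> f ` C = X1 \<union> S0" unfolding S_def X1_def X0_def using CCA by blast
  have fC: "c \<notin> B \<and> \<beta> c \<notin> A" if "c \<in> C" for c
  proof
    show "c \<notin> B" using that CCA CA(1) unfolding C_def D_def by blast
    show "\<beta> c \<notin> A"
    proof
      assume "\<beta> c \<in> A"
      then have "f c \<in> span CA" unfolding f_def CA(3) using that CCA CA(1) subspace_add[OF A(1)] by blast
      then have "{c} = {}" by (intro inter[of _ "\<lambda>_. 1"]) (use that in auto)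
      then show False by simp
    qed
  qed
  show ?thesis
  proof (rule that[of S C \<beta>, folded f_def])
    show "independent (S \<union> C \<union> f ` C)" "span (S \<union> C \<union> f ` C) = E" "adapted (S \<union> C \<union> f ` C) R"
      unfolding Xeq by (fact S0)+
    show "inj_on f C" by (fact X0)
    show SC: "S \<inter> C = {}" unfolding S_def using CCA SB(2) S0(1) unfolding X1_def X0_def by blast
    show "(S \<union> C) \<inter> f ` C = {}" unfolding S_def using CCA SB(2) S0(1) X0(2) unfolding X1_def X0_def by blast
    have "CA \<subseteq> S \<inter> A \<union> C" unfolding S_def using CA(1) by blast
    then show "A \<subseteq> span (S \<inter> A \<union> C)" using CA(3) span_mono by blast
    show "c \<in> A \<and> c \<notin> B \<and> \<beta> c \<in> B \<and> \<beta> c \<notin> A" if "c \<in> C" for c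
      using fC that CCA CA(1) \<beta>(1) by blast
    show "\<exists>F\<in>R. f c \<in> F \<and> c \<notin> F" if "c \<in> C" for c
      using f_ix[OF that] ix(1) that CCA unfolding C_def by blast
    show "B \<subseteq> span (S \<inter> B \<union> \<beta> ` C)"
    proof
      fix b assume b: "b \<in> B"
      (* Replacing c + beta c by beta c separates the generators into vectors of A outside D and vectors of B. *)
      define Z where "Z = (CA - D) \<union> ((CA \<inter> D) \<union> SB \<union> \<beta> ` C)"
      have "X1 \<subseteq> span Z"
      proof
        fix x assume "x \<in> X1"
        then consider "x \<in> Z" | c where "c \<in> C" "x = c + \<beta> c" unfolding X1_def X0_def Z_def f_def by blast
        then show "x \<in> span Z"
        proof cases
          case (2 c)
          then have "c \<in> Z" "\<beta> c \<in> Z" unfolding Z_def C_def by auto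
          then show ?thesis using 2 span_add span_base by blast
        qed (rule span_base)
      qed
      then have "W \<subseteq> span Z" using SB(4) span_minimal[OF _ subspace_span] unfolding X1_def by metis
      then have "b \<in> span Z" using b BW by blast
      then obtain a1 b1 where ab: "b = a1 + b1" "a1 \<in> span (CA - D)" "b1 \<in> span ((CA \<inter> D) \<union> SB \<union> \<beta> ` C)"
        unfolding Z_def span_Un[of "CA - D"] by blast
      have "(CA \<inter> D) \<union> SB \<union> \<beta> ` C \<subseteq> B" using SB(1) \<beta>(1) CCA unfolding D_def by blast
      then have "b1 \<in> B" using ab(3) span_minimal[OF _ B(1)] by blast
      then have "a1 \<in> B" using ab(1) b subspace_diff[OF B(1), of b b1] by simp
      moreover have "a1 \<in> A" using ab(2) span_mono[of "CA - D" CA] CA(3) by blast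
      ultimately have "a1 \<in> span (CA \<inter> D)" using spanCAD unfolding D_def by blast
      then have "a1 \<in> span ((CA - D) \<inter> (CA \<inter> D))"
        using ab(2) span_Int_of_independent[OF CA(2), of "CA - D" "CA \<inter> D"] by blast
      then have "a1 = 0" by (simp add: Diff_Int_distrib2 Int_commute inf_left_commute)
      then have "b = b1" using ab(1) by simp
      have "(CA \<inter> D) \<union> SB \<union> \<beta> ` C \<subseteq> S \<inter> B \<union> \<beta> ` C"
        using SB(1) unfolding S_def C_def D_def by blast
      from subsetD[OF span_mono[OF this] ab(3)] show "b \<in> span (S \<inter> B \<union> \<beta> ` C)"
        unfolding \<open>b = b1\<close> .
    qed
  qed
qed

end

section \<open>Morphisms, direct sums and bricks\<close>

locale quiver_reps = ambient_space scale
  for scale :: "'f::field \<Rightarrow> 'b::ab_group_add \<Rightarrow> 'b" +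
  fixes Q :: "'v quiver"
  assumes quiver: "quiver Q"
begin

lemma arrow_verts: "a \<in> arrows Q \<Longrightarrow> fst a \<in> verts Q \<and> snd a \<in> verts Q"
  using quiver unfolding quiver_def by auto

lemma linear_betweenD:
  assumes "linear_between scale U W f"
  shows "x \<in> U \<Longrightarrow> f x \<in> W" "x \<in> U \<Longrightarrow> y \<in> U \<Longrightarrow> f (x + y) = f x + f y"
    "x \<in> U \<Longrightarrow> f (scale c x) = scale c (f x)"
  using assms unfolding linear_between_def by auto

lemma linear_between_sum:
  assumes "subspace U" "linear_between scale U W f" "\<And>k. k \<in> F \<Longrightarrow> x k \<in> U"
  shows "f (\<Sum>k\<in>F. x k) = (\<Sum>k\<in>F. f (x k))"
proof -
  obtain g where g: "Vector_Spaces.linear scale scale g" "\<forall>x\<in>U. g x = f x"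
    using linear_between_extend[OF assms(1,2)] by metis
  interpret g: Vector_Spaces.linear scale scale g by (rule g(1))
  have "(\<Sum>k\<in>F. x k) \<in> U" using assms(3) by (intro subspace_sum assms(1))
  then have "f (\<Sum>k\<in>F. x k) = g (\<Sum>k\<in>F. x k)" using g(2) by simp
  also have "\<dots> = (\<Sum>k\<in>F. f (x k))" unfolding g.sum by (rule sum.cong) (use g(2) assms(3) in auto)
  finally show ?thesis .
qed

lemma linear_between_zero: "subspace U \<Longrightarrow> linear_between scale U W f \<Longrightarrow> f 0 = 0"
  using linear_between_sum[of U W f "{}"] by simp

lemma linear_between_diff:
  assumes "subspace U" "linear_between scale U W f" "x \<in> U" "y \<in> U"
  shows "f (x - y) = f x - f y"
proof -
  have "x - y \<in> U" using assms subspace_diff by blast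
  then have "f ((x - y) + y) = f (x - y) + f y" using linear_betweenD(2)[OF assms(2)] assms(4) by blast
  then show ?thesis by simp
qed

lemma quiver_repD:
  assumes "quiver_rep scale Q V"
  shows "i \<in> verts Q \<Longrightarrow> subspace (vspace V i)"
    "a \<in> arrows Q \<Longrightarrow> linear_between scale (vspace V (fst a)) (vspace V (snd a)) (amap V a)"
  using assms unfolding quiver_rep_def by auto

lemma morphismD:
  assumes "morphism scale Q V W f"
  shows "i \<in> verts Q \<Longrightarrow> linear_between scale (vspace V i) (vspace W i) (f i)"
    "i \<in> verts Q \<Longrightarrow> x \<in> vspace V i \<Longrightarrow> f i x \<in> vspace W i"
    "a \<in> arrows Q \<Longrightarrow> x \<in> vspace V (fst a) \<Longrightarrow> f (snd a) (amap V a x) = amap W a (f (fst a) x)"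
  using assms unfolding morphism_def linear_between_def by auto

lemma morphismI:
  assumes "\<And>i. i \<in> verts Q \<Longrightarrow> linear_between scale (vspace V i) (vspace W i) (f i)"
    "\<And>a x. a \<in> arrows Q \<Longrightarrow> x \<in> vspace V (fst a) \<Longrightarrow> f (snd a) (amap V a x) = amap W a (f (fst a) x)"
  shows "morphism scale Q V W f"
  using assms unfolding morphism_def by auto

lemma linear_betweenI:
  assumes "\<And>x. x \<in> U \<Longrightarrow> f x \<in> W" "\<And>x y. x \<in> U \<Longrightarrow> y \<in> U \<Longrightarrow> f (x + y) = f x + f y"
    "\<And>c x. x \<in> U \<Longrightarrow> f (scale c x) = scale c (f x)"
  shows "linear_between scale U W f"
  using assms unfolding linear_between_def by auto

lemma linear_between_compose:
  assumes "linear_between scale U V f" "linear_between scale V W g"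
  shows "linear_between scale U W (\<lambda>x. g (f x))"
  by (rule linear_betweenI)
    (simp_all add: linear_betweenD[OF assms(1)] linear_betweenD[OF assms(2)])

lemma morphism_compose:
  assumes f: "morphism scale Q U V f" and g: "morphism scale Q V W g"
  shows "morphism scale Q U W (\<lambda>i x. g i (f i x))"
proof (rule morphismI)
  show "linear_between scale (vspace U i) (vspace W i) (\<lambda>x. g i (f i x))" if "i \<in> verts Q" for i
    using linear_between_compose morphismD(1)[OF f that] morphismD(1)[OF g that] .
  show "g (snd a) (f (snd a) (amap U a x)) = amap W a (g (fst a) (f (fst a) x))"
    if "a \<in> arrows Q" "x \<in> vspace U (fst a)" for a x
    using morphismD(3)[OF f that] morphismD(3)[OF g that(1)] morphismD(2)[OF f _ that(2)] arrow_verts[OF that(1)] by simp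
qed

lemma morphism_lincomb:
  assumes V: "quiver_rep scale Q V" and W: "quiver_rep scale Q W"
    and f: "morphism scale Q V W f" and g: "morphism scale Q V W g"
  shows "morphism scale Q V W (\<lambda>i x. f i x + scale c (g i x))"
proof (rule morphismI)
  fix i assume i: "i \<in> verts Q"
  note F = linear_betweenD[OF morphismD(1)[OF f i]] and G = linear_betweenD[OF morphismD(1)[OF g i]]
  have sub: "subspace (vspace W i)" using quiver_repD(1)[OF W i] .
  show "linear_between scale (vspace V i) (vspace W i) (\<lambda>x. f i x + scale c (g i x))"
  proof (rule linear_betweenI)
    show "f i x + scale c (g i x) \<in> vspace W i" if "x \<in> vspace V i" for x
      using F(1)[OF that] G(1)[OF that] subspace_add[OF sub] subspace_scale[OF sub] by blast
  qed (simp_all add: F G scale_right_distrib scale_left_commute algebra_simps)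
next
  fix a x assume a: "a \<in> arrows Q" and x: "x \<in> vspace V (fst a)"
  note L = linear_betweenD[OF quiver_repD(2)[OF W a]]
  have fx: "f (fst a) x \<in> vspace W (fst a)" and gx: "g (fst a) x \<in> vspace W (fst a)"
    using morphismD(2)[OF f _ x] morphismD(2)[OF g _ x] arrow_verts[OF a] by auto
  then have sgx: "scale c (g (fst a) x) \<in> vspace W (fst a)"
    using subspace_scale[OF quiver_repD(1)[OF W]] arrow_verts[OF a] by blast
  show "f (snd a) (amap V a x) + scale c (g (snd a) (amap V a x)) = amap W a (f (fst a) x + scale c (g (fst a) x))"
    unfolding L(2)[OF fx sgx] L(3)[OF gx] morphismD(3)[OF f a x] morphismD(3)[OF g a x] ..
qed

lemma morphism_scaled:
  assumes V: "quiver_rep scale Q V" and W: "quiver_rep scale Q W" and g: "morphism scale Q V W g"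
  shows "morphism scale Q V W (\<lambda>i x. scale c (g i x))"
  using morphism_lincomb[OF V W g g, of "c - 1"] by (simp add: scale_left_diff_distrib)

lemma morphism_sum:
  assumes V: "quiver_rep scale Q V" and W: "quiver_rep scale Q W"
    and f: "morphism scale Q V W f" and g: "finite F" "\<And>k. k \<in> F \<Longrightarrow> morphism scale Q V W (g k)"
  shows "morphism scale Q V W (\<lambda>i x. f i x + (\<Sum>k\<in>F. scale (c k) (g k i x)))"
  using g
proof (induction rule: finite_induct)
  case empty
  then show ?case using f by simp
next
  case (insert k F)
  have "morphism scale Q V W (\<lambda>i x. (f i x + (\<Sum>k\<in>F. scale (c k) (g k i x))) + scale (c k) (g k i x))"
    by (rule morphism_lincomb[OF V W]) (use insert in auto)
  then show ?case using insert.hyps by (simp add: add_ac)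
qed

lemma morphism_id: "morphism scale Q V V (\<lambda>i x. x)"
  by (intro morphismI linear_betweenI) auto

lemma subrepD:
  assumes "subrep scale Q U V"
  shows "quiver_rep scale Q U" "i \<in> verts Q \<Longrightarrow> x \<in> vspace U i \<Longrightarrow> x \<in> vspace V i"
    "a \<in> arrows Q \<Longrightarrow> x \<in> vspace U (fst a) \<Longrightarrow> amap U a x = amap V a x"
  using assms unfolding subrep_def by auto

lemma subrep_inclusion: "subrep scale Q U V \<Longrightarrow> morphism scale Q U V (\<lambda>i x. x)"
  by (intro morphismI linear_betweenI) (auto simp: subrep_def)

lemma isomorphic_refl: "isomorphic scale Q V V"
  unfolding isomorphic_def using morphism_id by blast

lemma isomorphic_sym: "isomorphic scale Q V W \<Longrightarrow> isomorphic scale Q W V"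
  unfolding isomorphic_def by blast

lemma isomorphic_trans:
  assumes "isomorphic scale Q U V" "isomorphic scale Q V W"
  shows "isomorphic scale Q U W"
proof -
  obtain f f' where f: "morphism scale Q U V f" "morphism scale Q V U f'"
     "\<forall>i\<in>verts Q. (\<forall>x\<in>vspace U i. f' i (f i x) = x) \<and> (\<forall>y\<in>vspace V i. f i (f' i y) = y)"
    using assms(1) unfolding isomorphic_def by blast
  obtain g g' where g: "morphism scale Q V W g" "morphism scale Q W V g'"
     "\<forall>i\<in>verts Q. (\<forall>x\<in>vspace V i. g' i (g i x) = x) \<and> (\<forall>y\<in>vspace W i. g i (g' i y) = y)"
    using assms(2) unfolding isomorphic_def by blast
  show ?thesis unfolding isomorphic_def
    by (intro exI[of _ "\<lambda>i x. g i (f i x)"] exI[of _ "\<lambda>i x. f' i (g' i x)"] conjI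
        morphism_compose[OF f(1) g(1)] morphism_compose[OF g(2) f(2)])
      (use f(3) g(3) morphismD(2)[OF f(1)] morphismD(2)[OF g(2)] in auto)
qed

definition projections where
  "projections V K W \<pi> \<longleftrightarrow> (\<forall>k\<in>K. morphism scale Q V (W k) (\<pi> k)) \<and>
     (\<forall>k\<in>K. \<forall>i\<in>verts Q. \<forall>x\<in>vspace (W k) i. \<pi> k i x = x) \<and>
     (\<forall>k\<in>K. \<forall>l\<in>K. l \<noteq> k \<longrightarrow> (\<forall>i\<in>verts Q. \<forall>x\<in>vspace (W l) i. \<pi> k i x = 0)) \<and>
     (\<forall>i\<in>verts Q. \<forall>x\<in>vspace V i. \<exists>F. finite F \<and> F \<subseteq> K \<and> (\<forall>k\<in>K - F. \<pi> k i x = 0) \<and> x = (\<Sum>k\<in>F. \<pi> k i x))"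

lemma projectionsD:
  assumes "projections V K W \<pi>"
  shows "k \<in> K \<Longrightarrow> morphism scale Q V (W k) (\<pi> k)"
    "k \<in> K \<Longrightarrow> i \<in> verts Q \<Longrightarrow> x \<in> vspace (W k) i \<Longrightarrow> \<pi> k i x = x"
    "k \<in> K \<Longrightarrow> l \<in> K \<Longrightarrow> l \<noteq> k \<Longrightarrow> i \<in> verts Q \<Longrightarrow> x \<in> vspace (W l) i \<Longrightarrow> \<pi> k i x = 0"
    "i \<in> verts Q \<Longrightarrow> x \<in> vspace V i \<Longrightarrow> \<exists>F. finite F \<and> F \<subseteq> K \<and> (\<forall>k\<in>K - F. \<pi> k i x = 0) \<and> x = (\<Sum>k\<in>F. \<pi> k i x)"
  using assms unfolding projections_def by blast+

text \<open>Components are unique, hence linear, and they commute with the arrow maps because these preserve the summands.\<close>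

lemma direct_sum_projections:
  assumes V: "quiver_rep scale Q V" and ds: "direct_sum scale Q V K W"
  shows "\<exists>\<pi>. projections V K W \<pi>"
proof -
  have subr: "subrep scale Q (W k) V" if "k \<in> K" for k using ds that unfolding direct_sum_def by blast
  define P where "P i x y \<longleftrightarrow> (\<forall>k. k \<notin> K \<longrightarrow> y k = 0) \<and> (\<forall>k\<in>K. y k \<in> vspace (W k) i) \<and>
     (\<exists>F. finite F \<and> F \<subseteq> K \<and> (\<forall>k. k \<notin> F \<longrightarrow> y k = 0) \<and> x = (\<Sum>k\<in>F. y k))" for i x and y :: "_ \<Rightarrow> 'b"
  have subW: "subspace (vspace (W k) i)" if "k \<in> K" "i \<in> verts Q" for k i
    using quiver_repD(1)[OF subrepD(1)[OF subr[OF that(1)]] that(2)] .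
  have ex: "\<exists>y. P i x y" if i: "i \<in> verts Q" and x: "x \<in> vspace V i" for i x
  proof -
    have "vspace V i = {\<Sum>k \<in> F. x k | F x. finite F \<and> F \<subseteq> K \<and> (\<forall>k \<in> F. x k \<in> vspace (W k) i)}"
      using ds i unfolding direct_sum_def by blast
    then obtain F z where F: "finite F" "F \<subseteq> K" "\<forall>k\<in>F. z k \<in> vspace (W k) i" "x = (\<Sum>k\<in>F. z k)"
      using x by auto
    show ?thesis
    proof (rule exI[of _ "\<lambda>k. if k \<in> F then z k else 0"])
      show "P i x (\<lambda>k. if k \<in> F then z k else 0)"
        unfolding P_def using F subspace_0[OF subW[OF _ i]] by (auto intro!: exI[of _ F])
    qed
  qed
  have lin: "P i (x + scale c x') (\<lambda>k. y k + scale c (y' k))" if i: "i \<in> verts Q" and P: "P i x y" "P i x' y'" for i x y x' y' c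
  proof -
    obtain F where F: "finite F" "F \<subseteq> K" "\<forall>k. k \<notin> F \<longrightarrow> y k = 0" "x = (\<Sum>k\<in>F. y k)" using P(1) unfolding P_def by blast
    obtain F' where F': "finite F'" "F' \<subseteq> K" "\<forall>k. k \<notin> F' \<longrightarrow> y' k = 0" "x' = (\<Sum>k\<in>F'. y' k)" using P(2) unfolding P_def by blast
    have 1: "x = (\<Sum>k\<in>F \<union> F'. y k)" unfolding F(4) by (rule sum.mono_neutral_left) (use F F' in auto)
    have 2: "x' = (\<Sum>k\<in>F \<union> F'. y' k)" unfolding F'(4) by (rule sum.mono_neutral_left) (use F F' in auto)
    have 3: "x + scale c x' = (\<Sum>k\<in>F \<union> F'. y k + scale c (y' k))"
      unfolding sum.distrib scale_sum_right[symmetric] 1[symmetric] 2[symmetric] ..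
    have 4: "y k + scale c (y' k) \<in> vspace (W k) i" if k: "k \<in> K" for k
    proof -
      have "y k \<in> vspace (W k) i" "y' k \<in> vspace (W k) i" using P k unfolding P_def by auto
      then show ?thesis using subspace_add[OF subW[OF k i]] subspace_scale[OF subW[OF k i]] by blast
    qed
    have 5: "y k + scale c (y' k) = 0" if "k \<notin> K" for k using P that unfolding P_def by simp
    show ?thesis unfolding P_def
    proof (intro conjI allI impI ballI exI[of _ "F \<union> F'"])
      show "finite (F \<union> F')" "F \<union> F' \<subseteq> K" using F F' by auto
      show "y k + scale c (y' k) = 0" if "k \<notin> F \<union> F'" for k using F(3) F'(3) that by simp
    qed (use 3 4 5 in auto)
  qed
  have zero: "y k = 0" if i: "i \<in> verts Q" and P: "P i 0 y" for i y k
  proof (cases "k \<in> K")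
    case True
    obtain F where F: "finite F" "F \<subseteq> K" "\<forall>k. k \<notin> F \<longrightarrow> y k = 0" "0 = (\<Sum>k\<in>F. y k)" using P unfolding P_def by blast
    have "\<forall>k\<in>F. y k \<in> vspace (W k) i" using P F(2) unfolding P_def by blast
    then have "\<forall>k\<in>F. y k = 0" using ds i F(1,2) F(4)[symmetric] unfolding direct_sum_def by blast
    then show ?thesis using F(3) by blast
  next
    case False
    then show ?thesis using P unfolding P_def by blast
  qed
  have uniq: "y = y'" if i: "i \<in> verts Q" and P: "P i x y" "P i x y'" for i x y y'
  proof
    fix k
    have "P i (x + scale (- 1) x) (\<lambda>k. y k + scale (- 1) (y' k))" by (rule lin[OF i P])
    then have "P i 0 (\<lambda>k. y k - y' k)" by simp
    from zero[OF i this, of k] show "y k = y' k" by simp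
  qed
  define \<pi> where "\<pi> k i x = (SOME y. P i x y) k" for k i x
  have P\<pi>: "P i x (\<lambda>k. \<pi> k i x)" if "i \<in> verts Q" "x \<in> vspace V i" for i x
    unfolding \<pi>_def using someI_ex[OF ex[OF that]] by simp
  have \<pi>I: "\<pi> k i x = y k" if "i \<in> verts Q" "x \<in> vspace V i" "P i x y" for i x y k
    using uniq[OF that(1) P\<pi>[OF that(1,2)] that(3)] by metis
  have subV: "subspace (vspace V i)" if "i \<in> verts Q" for i using quiver_repD(1)[OF V that] .
  show ?thesis unfolding projections_def
  proof (intro exI[of _ \<pi>] conjI ballI impI)
    fix k assume k: "k \<in> K"
    show "morphism scale Q V (W k) (\<pi> k)"
    proof (rule morphismI)
      fix i assume i: "i \<in> verts Q"
      show "linear_between scale (vspace V i) (vspace (W k) i) (\<pi> k i)"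
      proof (rule linear_betweenI)
        show "\<pi> k i x \<in> vspace (W k) i" if "x \<in> vspace V i" for x
          using P\<pi>[OF i that] k unfolding P_def by blast
        show "\<pi> k i (x + y) = \<pi> k i x + \<pi> k i y" if "x \<in> vspace V i" "y \<in> vspace V i" for x y
          using \<pi>I[OF i subspace_add[OF subV[OF i] that], of "\<lambda>k. \<pi> k i x + scale 1 (\<pi> k i y)" k]
            lin[OF i P\<pi>[OF i that(1)] P\<pi>[OF i that(2)], of 1] by simp
        show "\<pi> k i (scale c x) = scale c (\<pi> k i x)" if x: "x \<in> vspace V i" for c x
        proof -
          have "P i 0 (\<lambda>k. 0)" unfolding P_def using subspace_0[OF subW[OF _ i]] by (auto intro!: exI[of _ "{}"])
          from lin[OF i this P\<pi>[OF i x], of c] have "P i (scale c x) (\<lambda>k. scale c (\<pi> k i x))" by simp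
          from \<pi>I[OF i subspace_scale[OF subV[OF i] x] this] show ?thesis .
        qed
      qed
    next
      fix a x assume a: "a \<in> arrows Q" and x: "x \<in> vspace V (fst a)"
      have fa: "fst a \<in> verts Q" and sa: "snd a \<in> verts Q" using arrow_verts[OF a] by auto
      note Px = P\<pi>[OF fa x]
      note L = quiver_repD(2)[OF V a]
      have ax: "amap V a x \<in> vspace V (snd a)" using linear_betweenD(1)[OF L x] .
      have W1: "amap V a y \<in> vspace (W k) (snd a)" if "k \<in> K" "y \<in> vspace (W k) (fst a)" for k y
        using subrepD(3)[OF subr[OF that(1)] a that(2)] linear_betweenD(1)[OF quiver_repD(2)[OF subrepD(1)[OF subr[OF that(1)]] a] that(2)] by simp
      obtain F where F: "finite F" "F \<subseteq> K" "\<forall>k. k \<notin> F \<longrightarrow> \<pi> k (fst a) x = 0" "x = (\<Sum>k\<in>F. \<pi> k (fst a) x)" using Px unfolding P_def by blast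
      have a0: "amap V a 0 = 0" by (rule linear_between_zero[OF subV[OF fa] L])
      have mem: "\<pi> k (fst a) x \<in> vspace (W k) (fst a)" if "k \<in> K" for k using Px that unfolding P_def by blast
      have "P (snd a) (amap V a x) (\<lambda>k. amap V a (\<pi> k (fst a) x))" unfolding P_def
      proof (intro conjI allI impI ballI exI[of _ F] F(1,2))
        show "amap V a (\<pi> k (fst a) x) = 0" if "k \<notin> K" for k using a0 Px that unfolding P_def by metis
        show "amap V a (\<pi> k (fst a) x) = 0" if "k \<notin> F" for k using a0 F(3) that by metis
        show "amap V a (\<pi> k (fst a) x) \<in> vspace (W k) (snd a)" if "k \<in> K" for k using W1[OF that mem[OF that]] .
        have "amap V a (\<Sum>k\<in>F. \<pi> k (fst a) x) = (\<Sum>k\<in>F. amap V a (\<pi> k (fst a) x))"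
        proof (rule linear_between_sum[OF subV[OF fa] L])
          fix k assume "k \<in> F"
          then have "k \<in> K" using F(2) by blast
          then show "\<pi> k (fst a) x \<in> vspace V (fst a)" using subrepD(2)[OF subr fa mem] by blast
        qed
        then show "amap V a x = (\<Sum>k\<in>F. amap V a (\<pi> k (fst a) x))" using F(4) by simp
      qed
      from \<pi>I[OF sa ax this, of k] show "\<pi> k (snd a) (amap V a x) = amap (W k) a (\<pi> k (fst a) x)"
        using subrepD(3)[OF subr[OF k] a mem[OF k]] by simp
    qed
  next
    have single: "P i x (\<lambda>l. if l = k then x else 0)" if "k \<in> K" "i \<in> verts Q" "x \<in> vspace (W k) i" for k i x
      unfolding P_def using that subspace_0[OF subW[OF _ that(2)]] by (auto intro!: exI[of _ "{k}"])
    have inV: "x \<in> vspace V i" if "k \<in> K" "i \<in> verts Q" "x \<in> vspace (W k) i" for k i x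
      using subrepD(2)[OF subr[OF that(1)] that(2,3)] .
    show "\<pi> k i x = x" if "k \<in> K" "i \<in> verts Q" "x \<in> vspace (W k) i" for k i x
      using \<pi>I[OF that(2) inV[OF that] single[OF that], of k] by simp
    show "\<pi> k i x = 0" if "k \<in> K" "l \<in> K" "l \<noteq> k" "i \<in> verts Q" "x \<in> vspace (W l) i" for k l i x
      using \<pi>I[OF that(4) inV[OF that(2,4,5)] single[OF that(2,4,5)], of k] that(3) by simp
  next
    show "\<exists>F. finite F \<and> F \<subseteq> K \<and> (\<forall>k\<in>K - F. \<pi> k i x = 0) \<and> x = (\<Sum>k\<in>F. \<pi> k i x)" if "i \<in> verts Q" "x \<in> vspace V i" for i x
      using P\<pi>[OF that] unfolding P_def by blast
  qed
qed

text \<open>The endomorphisms of a brick usually are only required to form a division ring; here they have to be scalars.\<close>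

definition brick :: "('v, 'b) quiver_rep \<Rightarrow> bool" where
  "brick V \<longleftrightarrow> quiver_rep scale Q V \<and> \<not> zero_rep Q V \<and>
     (\<forall>f. morphism scale Q V V f \<longrightarrow> (\<exists>c. \<forall>i\<in>verts Q. \<forall>x\<in>vspace V i. f i x = scale c x))"

lemma nonzero_rep_witness:
  assumes "quiver_rep scale Q V" "\<not> zero_rep Q V"
  obtains i x where "i \<in> verts Q" "x \<in> vspace V i" "x \<noteq> 0"
proof -
  obtain i where i: "i \<in> verts Q" "vspace V i \<noteq> {0}" using assms(2) unfolding zero_rep_def by blast
  have "0 \<in> vspace V i" using subspace_0[OF quiver_repD(1)[OF assms(1) i(1)]] .
  then show ?thesis using that i by blast
qed

text \<open>The projection to one of two summands is a scalar that is the identity on that summand and zero on the other.\<close>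

lemma brick_indecomposable:
  assumes "brick V"
  shows "indecomposable scale Q V"
  unfolding indecomposable_def
proof (intro conjI allI impI)
  show V: "quiver_rep scale Q V" and "\<not> zero_rep Q V" using assms unfolding brick_def by auto
  fix W assume ds: "direct_sum scale Q V {0, 1::nat} W"
  have subr: "subrep scale Q (W k) V" if "k \<in> {0, 1}" for k using ds that unfolding direct_sum_def by blast
  obtain \<pi> where \<pi>': "projections V {0, 1} W \<pi>" using direct_sum_projections[OF V ds] by blast
  note \<pi> = projectionsD[OF \<pi>']
  have "morphism scale Q V V (\<lambda>i x. \<pi> 0 i x)"
    using morphism_compose[OF \<pi>(1)[of 0] subrep_inclusion[OF subr[of 0]]] by simp
  then obtain c where c: "\<forall>i\<in>verts Q. \<forall>x\<in>vspace V i. \<pi> 0 i x = scale c x"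
    using assms unfolding brick_def by blast
  show "zero_rep Q (W 0) \<or> zero_rep Q (W 1)"
  proof (rule ccontr)
    assume "\<not> (zero_rep Q (W 0) \<or> zero_rep Q (W 1))"
    then have nz: "\<not> zero_rep Q (W 0)" "\<not> zero_rep Q (W 1)" by auto
    obtain i x where x: "i \<in> verts Q" "x \<in> vspace (W 0) i" "x \<noteq> 0"
      using nonzero_rep_witness[OF subrepD(1)[OF subr[of 0]] nz(1)] by auto
    obtain j y where y: "j \<in> verts Q" "y \<in> vspace (W 1) j" "y \<noteq> 0"
      using nonzero_rep_witness[OF subrepD(1)[OF subr[of 1]] nz(2)] by auto
    have "scale c x = x" using c x \<pi>(2)[of 0 i x] subrepD(2)[OF subr[of 0] x(1,2)] by auto
    moreover have "scale c y = 0" using c y \<pi>(3)[of 0 1 j y] subrepD(2)[OF subr[of 1] y(1,2)] by auto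
    ultimately show False using x(3) y(3) by auto
  qed
qed

lemma direct_sum_twoI:
  assumes s0: "subrep scale Q (W 0) V" and s1: "subrep scale Q (W 1) V"
    and V: "quiver_rep scale Q V"
    and sum: "\<And>i x. i \<in> verts Q \<Longrightarrow> x \<in> vspace V i \<Longrightarrow> \<exists>y\<in>vspace (W 0) i. \<exists>z\<in>vspace (W 1) i. x = y + z"
    and int: "\<And>i x. i \<in> verts Q \<Longrightarrow> x \<in> vspace (W 0) i \<Longrightarrow> x \<in> vspace (W 1) i \<Longrightarrow> x = 0"
  shows "direct_sum scale Q V {0, 1::nat} W"
proof -
  have subr: "subrep scale Q (W k) V" if "k \<in> {0, 1}" for k using s0 s1 that by auto
  have subW: "subspace (vspace (W k) i)" if "k \<in> {0, 1}" "i \<in> verts Q" for k i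
    using quiver_repD(1)[OF subrepD(1)[OF subr[OF that(1)]] that(2)] .
  show ?thesis unfolding direct_sum_def
  proof (intro conjI ballI allI impI)
    show "subrep scale Q (W k) V" if "k \<in> {0, 1}" for k by (rule subr[OF that])
    fix i assume i: "i \<in> verts Q"
    show "vspace V i = {\<Sum>k\<in>F. x k |F x. finite F \<and> F \<subseteq> {0, 1} \<and> (\<forall>k\<in>F. x k \<in> vspace (W k) i)}"
    proof (intro equalityI subsetI)
      fix x assume "x \<in> vspace V i"
      then obtain y z where yz: "y \<in> vspace (W 0) i" "z \<in> vspace (W 1) i" "x = y + z" using sum i by blast
      then have "x = (\<Sum>k\<in>{0, 1::nat}. if k = 0 then y else z)" by simp
      moreover have "\<forall>k\<in>{0, 1::nat}. (if k = 0 then y else z) \<in> vspace (W k) i" using yz by simp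
      ultimately show "x \<in> {\<Sum>k\<in>F. x k |F x. finite F \<and> F \<subseteq> {0, 1} \<and> (\<forall>k\<in>F. x k \<in> vspace (W k) i)}"
        by (intro CollectI exI[of _ "{0, 1::nat}"] exI[of _ "\<lambda>k. if k = 0 then y else z"]) auto
    next
      fix x assume "x \<in> {\<Sum>k\<in>F. x k |F x. finite F \<and> F \<subseteq> {0, 1} \<and> (\<forall>k\<in>F. x k \<in> vspace (W k) i)}"
      then obtain F y where F: "F \<subseteq> {0, 1::nat}" "\<forall>k\<in>F. y k \<in> vspace (W k) i" "x = (\<Sum>k\<in>F. y k)" by blast
      show "x \<in> vspace V i" unfolding F(3)
        by (intro subspace_sum quiver_repD(1)[OF V i]) (meson F(1,2) subr subrepD(2) i subsetD)
    qed
  next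
    fix i F x k
    assume i: "i \<in> verts Q" and F: "finite F" "F \<subseteq> {0, 1::nat}" "\<forall>k\<in>F. x k \<in> vspace (W k) i" "(\<Sum>k\<in>F. x k) = 0" "k \<in> F"
    define y where "y k = (if k \<in> F then x k else 0)" for k
    have yW: "y 0 \<in> vspace (W 0) i" "y 1 \<in> vspace (W 1) i"
      using F(3) subspace_0[OF subW[OF _ i]] unfolding y_def by auto
    have "(\<Sum>k\<in>F. x k) = (\<Sum>k\<in>{0, 1::nat}. y k)"
      by (rule sum.mono_neutral_cong_left) (use F in \<open>auto simp: y_def\<close>)
    then have s: "y 0 + y 1 = 0" using F(4) by simp
    then have "y 0 = - y 1" by (simp add: eq_neg_iff_add_eq_0)
    then have "y 0 \<in> vspace (W 1) i" using subspace_neg[OF subW[of 1, OF _ i] yW(2)] by simp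
    then have "y 0 = 0" using int[OF i yW(1)] by blast
    then have "y 1 = 0" using s by simp
    have "k = 0 \<or> k = 1" using F(2,5) by blast
    then have "y k = 0" using \<open>y 0 = 0\<close> \<open>y 1 = 0\<close> by blast
    then show "x k = 0" using F(5) unfolding y_def by simp
  qed
qed

text \<open>The complement of \<open>W k\<close> in the direct sum is the kernel of the projection to \<open>W k\<close>.\<close>

lemma indecomposable_eq_summand:
  assumes ind: "indecomposable scale Q V" and ds: "direct_sum scale Q V K W" and k: "k \<in> K" and nz: "\<not> zero_rep Q (W k)"
    and i: "i \<in> verts Q"
  shows "vspace V i = vspace (W k) i"
proof -
  have V: "quiver_rep scale Q V" using ind unfolding indecomposable_def by blast
  have subr: "subrep scale Q (W k) V" using ds k unfolding direct_sum_def by blast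
  obtain \<pi> where \<pi>': "projections V K W \<pi>" using direct_sum_projections[OF V ds] by blast
  note \<pi>0 = projectionsD(1,2)[OF \<pi>']
  define p where "p = \<pi> k"
  have p: "morphism scale Q V (W k) p" "\<And>i x. i \<in> verts Q \<Longrightarrow> x \<in> vspace (W k) i \<Longrightarrow> p i x = x"
    using \<pi>0[OF k] unfolding p_def by auto
  define R :: "('v, 'b) quiver_rep" where "R = \<lparr>vspace = \<lambda>i. {x\<in>vspace V i. p i x = 0}, amap = amap V\<rparr>"
  have pl: "p i (x + y) = p i x + p i y" "p i (scale c x) = scale c (p i x)"
    if "i \<in> verts Q" "x \<in> vspace V i" "y \<in> vspace V i" for i x y c
    using linear_betweenD(2,3)[OF morphismD(1)[OF p(1) that(1)]] that by auto
  have p0: "p i 0 = 0" if "i \<in> verts Q" for i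
    using linear_between_zero[OF quiver_repD(1)[OF V that] morphismD(1)[OF p(1) that]] .
  have Rsub: "subspace (vspace R i)" if i: "i \<in> verts Q" for i
  proof -
    have S: "subspace (vspace V i)" by (rule quiver_repD(1)[OF V i])
    show ?thesis unfolding R_def
      using p0[OF i] pl[OF i] subspace_0[OF S] subspace_add[OF S] subspace_scale[OF S]
      by (intro subspaceI) auto
  qed
  have Rrep: "quiver_rep scale Q R" unfolding quiver_rep_def
  proof (intro conjI ballI Rsub)
    fix a assume a: "a \<in> arrows Q"
    note L = linear_betweenD[OF quiver_repD(2)[OF V a]]
    have W0: "amap (W k) a 0 = 0"
      using linear_between_zero[OF quiver_repD(1)[OF subrepD(1)[OF subr]] quiver_repD(2)[OF subrepD(1)[OF subr] a]]
        arrow_verts[OF a] by blast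
    show "linear_between scale (vspace R (fst a)) (vspace R (snd a)) (amap R a)"
    proof (rule linear_betweenI)
      fix x assume x: "x \<in> vspace R (fst a)"
      then have "x \<in> vspace V (fst a)" "p (fst a) x = 0" unfolding R_def by auto
      then show "amap R a x \<in> vspace R (snd a)"
        using L(1) morphismD(3)[OF p(1) a] W0 unfolding R_def by simp
    qed (use L in \<open>auto simp: R_def\<close>)
  qed
  have Rsubr: "subrep scale Q R V" unfolding subrep_def using Rrep by (auto simp: R_def)
  have "direct_sum scale Q V {0, 1::nat} (\<lambda>n. if n = 0 then W k else R)"
  proof (rule direct_sum_twoI)
    show "subrep scale Q (if (0::nat) = 0 then W k else R) V" "subrep scale Q (if (1::nat) = 0 then W k else R) V"
      using subr Rsubr by auto
    show "quiver_rep scale Q V" by (rule V)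
    fix i x assume i: "i \<in> verts Q"
    show "\<exists>y\<in>vspace (if (0::nat) = 0 then W k else R) i. \<exists>z\<in>vspace (if (1::nat) = 0 then W k else R) i. x = y + z" if x: "x \<in> vspace V i"
    proof -
      have pW: "p i x \<in> vspace (W k) i" by (rule morphismD(2)[OF p(1) i x])
      then have pV: "p i x \<in> vspace V i" by (rule subrepD(2)[OF subr i])
      have "p i (x - p i x) = p i x - p i (p i x)"
        by (rule linear_between_diff[OF quiver_repD(1)[OF V i] morphismD(1)[OF p(1) i] x pV])
      then have "p i (x - p i x) = 0" using p(2)[OF i pW] by simp
      then have "x - p i x \<in> vspace R i" using subspace_diff[OF quiver_repD(1)[OF V i] x pV] unfolding R_def by simp
      then show ?thesis using pW by (intro bexI[of _ "p i x"] bexI[of _ "x - p i x"]) auto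
    qed
    show "x = 0" if "x \<in> vspace (if (0::nat) = 0 then W k else R) i" "x \<in> vspace (if (1::nat) = 0 then W k else R) i"
      using that p(2)[OF i] unfolding R_def by auto
  qed
  then have "zero_rep Q R" using ind nz unfolding indecomposable_def by fastforce
  show ?thesis
  proof
    show "vspace (W k) i \<subseteq> vspace V i" using subrepD(2)[OF subr i] by blast
    show "vspace V i \<subseteq> vspace (W k) i"
    proof
      fix x assume x: "x \<in> vspace V i"
      have pW: "p i x \<in> vspace (W k) i" by (rule morphismD(2)[OF p(1) i x])
      then have pV: "p i x \<in> vspace V i" by (rule subrepD(2)[OF subr i])
      have "p i (x - p i x) = p i x - p i (p i x)"
        by (rule linear_between_diff[OF quiver_repD(1)[OF V i] morphismD(1)[OF p(1) i] x pV])
      then have "p i (x - p i x) = 0" using p(2)[OF i pW] by simp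
      then have "x - p i x \<in> vspace R i" using subspace_diff[OF quiver_repD(1)[OF V i] x pV] unfolding R_def by simp
      then have "x - p i x = 0" using \<open>zero_rep Q R\<close> i unfolding zero_rep_def by blast
      then show "x \<in> vspace (W k) i" using pW by simp
    qed
  qed
qed

end

section \<open>Uniqueness of decompositions into bricks\<close>

context ambient_space
begin

text \<open>Both families are bases of complements of \<open>D\<close> in the same space. A linear map \<open>\<rho>\<close> with kernel \<open>D\<close> turns them into two
bases of one space, without any assumption of finiteness.\<close>

lemma complements_equinumerous:
  assumes D: "subspace D"
    and indI: "\<And>T c. finite T \<Longrightarrow> T \<subseteq> I \<Longrightarrow> \<forall>i\<in>T. c i \<noteq> 0 \<Longrightarrow> (\<Sum>i\<in>T. scale (c i) (\<xi> i)) \<in> D \<Longrightarrow> T = {}"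
    and indJ: "\<And>T c. finite T \<Longrightarrow> T \<subseteq> J \<Longrightarrow> \<forall>i\<in>T. c i \<noteq> 0 \<Longrightarrow> (\<Sum>i\<in>T. scale (c i) (\<eta> i)) \<in> D \<Longrightarrow> T = {}"
    and eq: "span (D \<union> \<xi> ` I) = span (D \<union> \<eta> ` J)"
  shows "\<exists>h. bij_betw h I J"
proof -
  obtain CD where CD: "CD \<subseteq> D" "independent CD" "D \<subseteq> span CD"
    using maximal_independent_subset by metis
  have sCD: "span CD = D" using span_minimal[OF CD(1) D] CD(3) by (rule subset_antisym)
  have I: "inj_on \<xi> I" "CD \<inter> \<xi> ` I = {}" "independent (CD \<union> \<xi> ` I)"
    by (rule independent_Un_imageI[OF CD(2)]; unfold sCD; erule (3) indI)+
  obtain \<rho> where \<rho>: "Vector_Spaces.linear scale scale \<rho>" "\<forall>x\<in>CD \<union> \<xi> ` I. \<rho> x = (if x \<in> CD then 0 else x)"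
    using vsp.linear_independent_extend[OF I(3), of "\<lambda>x. if x \<in> CD then 0 else x"] by metis
  interpret \<rho>: Vector_Spaces.linear scale scale \<rho> by (rule \<rho>(1))
  have \<rho>D: "\<rho> x = 0" if "x \<in> D" for x
    using that unfolding sCD[symmetric] by (induction rule: span_induct_alt) (use \<rho>(2) in \<open>auto simp: \<rho>.add \<rho>.scale\<close>)
  have \<rho>I: "\<rho> x = x" if "x \<in> span (\<xi> ` I)" for x
    using that by (induction rule: span_induct_alt) (use \<rho>(2) I(2) in \<open>auto simp: \<rho>.add \<rho>.scale\<close>)
  have ker: "x \<in> D" if "x \<in> span (D \<union> \<xi> ` I)" "\<rho> x = 0" for x
  proof -
    have "x \<in> {x + y |x y. x \<in> span D \<and> y \<in> span (\<xi> ` I)}" using that(1) unfolding span_Un .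
    then obtain d y where dy: "d \<in> span D" "y \<in> span (\<xi> ` I)" "x = d + y" by blast
    have dD: "d \<in> D" using dy(1) D by (metis span_eq_iff)
    have "\<rho> x = y" using \<rho>D[OF dD] \<rho>I[OF dy(2)] dy(3) by (simp add: \<rho>.add)
    then show ?thesis using that(2) dy(3) dD by simp
  qed
  have inj: "inj_on (\<lambda>j. \<rho> (\<eta> j)) J \<and> independent ({} \<union> (\<lambda>j. \<rho> (\<eta> j)) ` J)"
  proof -
    have key: "T = {}" if T: "finite T" "T \<subseteq> J" "\<forall>i\<in>T. c i \<noteq> 0" "(\<Sum>i\<in>T. scale (c i) (\<rho> (\<eta> i))) \<in> span {}" for T c
    proof (rule indJ[OF T(1-3)], rule ker)
      show "(\<Sum>i\<in>T. scale (c i) (\<eta> i)) \<in> span (D \<union> \<xi> ` I)"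
        unfolding eq using T(2) by (intro span_sum span_scale span_base) auto
      show "\<rho> (\<Sum>i\<in>T. scale (c i) (\<eta> i)) = 0" using T(4) by (simp add: \<rho>.sum \<rho>.scale)
    qed
    have "inj_on (\<lambda>j. \<rho> (\<eta> j)) J" by (rule independent_Un_imageI(1)[OF independent_empty]; erule (3) key)
    moreover have "independent ({} \<union> (\<lambda>j. \<rho> (\<eta> j)) ` J)" by (rule independent_Un_imageI(3)[OF independent_empty]; erule (3) key)
    ultimately show ?thesis ..
  qed
  have im: "\<rho> ` span (D \<union> X) = span (\<rho> ` X)" for X
  proof -
    have "\<rho> ` span (D \<union> X) = span (\<rho> ` (D \<union> X))" by (rule \<rho>.span_image[symmetric])
    also have "\<rho> ` (D \<union> X) = \<rho> ` D \<union> \<rho> ` X" by (rule image_Un)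
    also have "\<rho> ` D = {0}" using \<rho>D subspace_0[OF D] by force
    also have "{0} \<union> \<rho> ` X = insert 0 (\<rho> ` X)" by simp
    finally show ?thesis by simp
  qed
  have "\<rho> ` \<xi> ` I = \<xi> ` I"
  proof -
    have "\<rho> (\<xi> i) = \<xi> i" if "i \<in> I" for i using \<rho>I[OF span_base] that by simp
    then show ?thesis by (force simp: image_image)
  qed
  then have spans: "span (\<xi> ` I) = span ((\<lambda>j. \<rho> (\<eta> j)) ` J)"
    using im[of "\<xi> ` I"] im[of "\<eta> ` J"] eq by (simp add: image_image)
  have indI': "independent (\<xi> ` I)" using independent_mono[OF I(3)] by simp
  obtain h where h: "bij_betw h (\<xi> ` I) ((\<lambda>j. \<rho> (\<eta> j)) ` J)"
    using bij_if_span_eq_span_bases[OF indI' _ spans] inj by auto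
  have b1: "bij_betw \<xi> I (\<xi> ` I)" using I(1) by (simp add: bij_betw_def)
  have b2: "bij_betw (\<lambda>j. \<rho> (\<eta> j)) J ((\<lambda>j. \<rho> (\<eta> j)) ` J)" using inj by (simp add: bij_betw_def)
  show ?thesis
    using bij_betw_trans[OF bij_betw_trans[OF b1 h] bij_betw_inv_into[OF b2]] by blast
qed

end

context quiver_reps
begin

text \<open>Morphisms \<open>B \<rightarrow> V\<close> are represented by their values at a fixed vector, which keeps them inside
the ambient space.\<close>

definition hom_values where
  "hom_values B V i x = {f i x | f. morphism scale Q B V f}"

definition annihilated_hom_values where
  "annihilated_hom_values B V i x = {f i x | f. morphism scale Q B V f \<and>
     (\<forall>g. morphism scale Q V B g \<longrightarrow> (\<forall>j\<in>verts Q. \<forall>y\<in>vspace B j. g j (f j y) = 0))}"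

lemma zero_morphism:
  assumes "quiver_rep scale Q V" "quiver_rep scale Q W"
  shows "morphism scale Q V W (\<lambda>i x. 0)"
proof (rule morphismI)
  show "linear_between scale (vspace V i) (vspace W i) (\<lambda>x. 0)" if "i \<in> verts Q" for i
    using subspace_0[OF quiver_repD(1)[OF assms(2) that]] by (intro linear_betweenI) auto
  show "0 = amap W a 0" if "a \<in> arrows Q" for a
    using linear_between_zero[OF quiver_repD(1)[OF assms(2)] quiver_repD(2)[OF assms(2) that]] arrow_verts[OF that] by simp
qed

lemma subspace_hom_values:
  assumes B: "quiver_rep scale Q B" and V: "quiver_rep scale Q V"
  shows "subspace (hom_values B V i x)" "subspace (annihilated_hom_values B V i x)"
proof -
  note z = zero_morphism[OF B V]
  show "subspace (hom_values B V i x)"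
  proof (rule subspaceI)
    show "0 \<in> hom_values B V i x" unfolding hom_values_def by (intro CollectI exI[of _ "\<lambda>i x. 0"]) (simp add: z)
    show "u + v \<in> hom_values B V i x" if uv: "u \<in> hom_values B V i x" "v \<in> hom_values B V i x" for u v
    proof -
      obtain f g where fg: "morphism scale Q B V f" "u = f i x" "morphism scale Q B V g" "v = g i x"
        using uv unfolding hom_values_def by blast
      show ?thesis unfolding hom_values_def fg(2,4) using morphism_lincomb[OF B V fg(1,3), of 1] by auto
    qed
    show "scale c u \<in> hom_values B V i x" if u: "u \<in> hom_values B V i x" for c u
    proof -
      obtain f where f: "morphism scale Q B V f" "u = f i x" using u unfolding hom_values_def by blast
      show ?thesis unfolding hom_values_def f(2) using morphism_scaled[OF B V f(1), of c] by auto
    qed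
  qed
  define A where "A f \<longleftrightarrow> (\<forall>g. morphism scale Q V B g \<longrightarrow> (\<forall>j\<in>verts Q. \<forall>y\<in>vspace B j. g j (f j y) = 0))" for f :: "'v \<Rightarrow> 'b \<Rightarrow> 'b"
  have eq: "annihilated_hom_values B V i x = {f i x | f. morphism scale Q B V f \<and> A f}"
    unfolding annihilated_hom_values_def A_def ..
  have A0: "A (\<lambda>i x. 0)" unfolding A_def
  proof (intro allI impI ballI)
    fix g j assume g: "morphism scale Q V B g" and j: "j \<in> verts Q"
    show "g j 0 = 0" by (rule linear_between_zero[OF quiver_repD(1)[OF V j] morphismD(1)[OF g j]])
  qed
  have Al: "A (\<lambda>i x. f i x + scale c (f' i x))" if f: "morphism scale Q B V f" "A f" "morphism scale Q B V f'" "A f'" for f f' c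
    unfolding A_def
  proof (intro allI impI ballI)
    fix g j y assume g: "morphism scale Q V B g" and j: "j \<in> verts Q" and y: "y \<in> vspace B j"
    note L = linear_betweenD[OF morphismD(1)[OF g j]]
    have 1: "f j y \<in> vspace V j" "f' j y \<in> vspace V j"
      using morphismD(2)[OF f(1) j y] morphismD(2)[OF f(3) j y] by auto
    have 2: "scale c (f' j y) \<in> vspace V j" using subspace_scale[OF quiver_repD(1)[OF V j] 1(2)] .
    have "g j (f j y) = 0" "g j (f' j y) = 0" using f(2,4) g j y unfolding A_def by auto
    then show "g j (f j y + scale c (f' j y)) = 0" using L(2)[OF 1(1) 2] L(3)[OF 1(2)] by simp
  qed
  show "subspace (annihilated_hom_values B V i x)"
  proof (rule subspaceI)
    show "0 \<in> annihilated_hom_values B V i x" unfolding eq by (intro CollectI exI[of _ "\<lambda>i x. 0"]) (simp add: z A0)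
    show "u + v \<in> annihilated_hom_values B V i x" if uv: "u \<in> annihilated_hom_values B V i x" "v \<in> annihilated_hom_values B V i x" for u v
    proof -
      obtain f g where fg: "morphism scale Q B V f" "A f" "u = f i x" "morphism scale Q B V g" "A g" "v = g i x"
        using uv unfolding eq by blast
      show ?thesis unfolding eq fg(3,6)
        by (intro CollectI exI[of _ "\<lambda>i x. f i x + scale 1 (g i x)"] conjI morphism_lincomb[OF B V fg(1,4)] Al fg) simp
    qed
    show "scale c u \<in> annihilated_hom_values B V i x" if u: "u \<in> annihilated_hom_values B V i x" for c u
    proof -
      obtain f where f: "morphism scale Q B V f" "A f" "u = f i x" using u unfolding eq by blast
      show ?thesis unfolding eq f(3)
        by (intro CollectI exI[of _ "\<lambda>i x. 0 + scale c (f i x)"] conjI morphism_lincomb[OF B V z f(1)] Al z A0 f) simp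
    qed
  qed
qed

lemma brick_endo:
  assumes "brick U" "morphism scale Q U U f"
  shows "\<exists>c. \<forall>i\<in>verts Q. \<forall>x\<in>vspace U i. f i x = scale c x"
  using assms unfolding brick_def by blast

text \<open>Both composites are scalars, and comparing them on \<open>p i x\<close> shows that they are the same nonzero scalar.\<close>

lemma brick_isomorphic_of_composite:
  assumes B: "brick B" and U: "brick U" and p: "morphism scale Q B U p" and q: "morphism scale Q U B q"
    and i: "i \<in> verts Q" and x: "x \<in> vspace B i" and nz: "q i (p i x) \<noteq> 0"
  shows "isomorphic scale Q B U"
proof -
  have Brep: "quiver_rep scale Q B" and Urep: "quiver_rep scale Q U" using B U unfolding brick_def by auto
  obtain d where d: "\<forall>i\<in>verts Q. \<forall>x\<in>vspace B i. q i (p i x) = scale d x"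
    using brick_endo[OF B morphism_compose[OF p q]] by auto
  obtain e where e: "\<forall>i\<in>verts Q. \<forall>x\<in>vspace U i. p i (q i x) = scale e x"
    using brick_endo[OF U morphism_compose[OF q p]] by auto
  have pU: "p i x \<in> vspace U i" by (rule morphismD(2)[OF p i x])
  have d0: "d \<noteq> 0" using d i x nz by auto
  have px0: "p i x \<noteq> 0"
    using nz linear_between_zero[OF quiver_repD(1)[OF Urep i] morphismD(1)[OF q i]] by auto
  have "scale e (p i x) = p i (q i (p i x))" using e i pU by simp
  also have "\<dots> = p i (scale d x)" using d i x by simp
  also have "\<dots> = scale d (p i x)" by (rule linear_betweenD(3)[OF morphismD(1)[OF p i] x])
  finally have ed: "e = d" using px0 by simp
  have q': "morphism scale Q U B (\<lambda>i x. scale (inverse d) (q i x))" by (rule morphism_scaled[OF Urep Brep q])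
  show ?thesis unfolding isomorphic_def
  proof (rule exI[of _ p], rule exI[of _ "\<lambda>i x. scale (inverse d) (q i x)"], intro conjI ballI p q')
    fix j assume j: "j \<in> verts Q"
    show "scale (inverse d) (q j (p j y)) = y" if "y \<in> vspace B j" for y using d d0 j that by simp
    show "p j (scale (inverse d) (q j y)) = y" if y: "y \<in> vspace U j" for y
      using linear_betweenD(3)[OF morphismD(1)[OF p j] morphismD(2)[OF q j y], of "inverse d"] e ed d0 j y by simp
  qed
qed

text \<open>The values at \<open>x0\<close> of the inclusions of the summands isomorphic to \<open>B\<close> form a basis of
the space of values of all morphisms \<open>B \<rightarrow> V\<close> modulo the annihilated ones. A morphism \<open>f\<close> has
scalar components at these summands, only finitely many of them nonzero since this is decided at the single vector \<open>x0\<close>. Subtracting them leaves a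
morphism whose nonzero components all go to summands not isomorphic to \<open>B\<close>; by \<open>brick_isomorphic_of_composite\<close> no morphism back to \<open>B\<close> can have a nonzero composite with it.\<close>

lemma brick_multiplicity:
  assumes V: "quiver_rep scale Q V" and B: "brick B" and i0: "i0 \<in> verts Q" and x0: "x0 \<in> vspace B i0" "x0 \<noteq> 0"
    and ds: "direct_sum scale Q V S (\<lambda>U. U)" and bricks: "\<forall>U\<in>S. brick U"
  shows "\<exists>\<xi>. (\<forall>T c. finite T \<longrightarrow> T \<subseteq> {U\<in>S. isomorphic scale Q B U} \<longrightarrow> (\<forall>U\<in>T. c U \<noteq> 0) \<longrightarrow>
             (\<Sum>U\<in>T. scale (c U) (\<xi> U)) \<in> annihilated_hom_values B V i0 x0 \<longrightarrow> T = {}) \<and>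
           span (annihilated_hom_values B V i0 x0 \<union> \<xi> ` {U\<in>S. isomorphic scale Q B U}) = hom_values B V i0 x0"
proof -
  define I where "I = {U\<in>S. isomorphic scale Q B U}"
  have Brep: "quiver_rep scale Q B" using B unfolding brick_def by auto
  have subr: "subrep scale Q U V" if "U \<in> S" for U using ds that unfolding direct_sum_def by blast
  obtain \<pi> where \<pi>': "projections V S (\<lambda>U. U) \<pi>" using direct_sum_projections[OF V ds] by blast
  note \<pi> = projectionsD[OF \<pi>']
  have "\<forall>U\<in>I. \<exists>f g. morphism scale Q B U f \<and> morphism scale Q U B g \<and>
      (\<forall>i\<in>verts Q. (\<forall>x\<in>vspace B i. g i (f i x) = x) \<and> (\<forall>y\<in>vspace U i. f i (g i y) = y))"
    unfolding I_def isomorphic_def by simp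
  then obtain \<sigma> \<tau> where st: "\<forall>U\<in>I. morphism scale Q B U (\<sigma> U) \<and> morphism scale Q U B (\<tau> U) \<and>
      (\<forall>i\<in>verts Q. (\<forall>x\<in>vspace B i. \<tau> U i (\<sigma> U i x) = x) \<and> (\<forall>y\<in>vspace U i. \<sigma> U i (\<tau> U i y) = y))"
    by metis
  have s: "morphism scale Q B U (\<sigma> U)" and t: "morphism scale Q U B (\<tau> U)" if "U \<in> I" for U using st that by auto
  have ts: "\<tau> U i (\<sigma> U i x) = x" if "U \<in> I" "i \<in> verts Q" "x \<in> vspace B i" for U i x using st that by auto
  have stt: "\<sigma> U i (\<tau> U i x) = x" if "U \<in> I" "i \<in> verts Q" "x \<in> vspace U i" for U i x using st that by auto
  have IS: "I \<subseteq> S" unfolding I_def by auto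
  define \<xi> where "\<xi> U = \<sigma> U i0 x0" for U
  have \<xi>U: "\<xi> U \<in> vspace U i0" if "U \<in> I" for U unfolding \<xi>_def using morphismD(2)[OF s[OF that] i0 x0(1)] .
  have \<xi>V: "\<xi> U \<in> vspace V i0" if "U \<in> I" for U using subrepD(2)[OF subr i0 \<xi>U[OF that]] that IS by blast
  have sV: "morphism scale Q B V (\<sigma> U)" if "U \<in> I" for U
    using morphism_compose[OF s[OF that] subrep_inclusion[OF subr]] that IS by blast
  have subV: "subspace (vspace V i0)" by (rule quiver_repD(1)[OF V i0])
  have pi_sum: "\<pi> U i0 (\<Sum>U'\<in>T. scale (c U') (\<xi> U')) = (if U \<in> T then scale (c U) (\<xi> U) else 0)"
    if T: "finite T" "T \<subseteq> I" and U: "U \<in> S" for T U and c :: "_ \<Rightarrow> 'f"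
  proof -
    note L = morphismD(1)[OF \<pi>(1)[OF U] i0]
    have "\<pi> U i0 (\<Sum>U'\<in>T. scale (c U') (\<xi> U')) = (\<Sum>U'\<in>T. \<pi> U i0 (scale (c U') (\<xi> U')))"
      using T(2) \<xi>V by (intro linear_between_sum[OF subV L] subspace_scale[OF subV]) auto
    also have "\<dots> = (\<Sum>U'\<in>T. if U' = U then scale (c U) (\<xi> U) else 0)"
    proof (rule sum.cong[OF refl])
      fix U' assume U': "U' \<in> T"
      then have UI: "U' \<in> I" using T by blast
      have "\<pi> U i0 (scale (c U') (\<xi> U')) = scale (c U') (\<pi> U i0 (\<xi> U'))"
        by (rule linear_betweenD(3)[OF L \<xi>V[OF UI]])
      also have "\<pi> U i0 (\<xi> U') = (if U' = U then \<xi> U else 0)"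
        using \<pi>(2)[OF U i0, of "\<xi> U'"] \<pi>(3)[OF U _ _ i0 \<xi>U[OF UI]] \<xi>U[OF UI] UI IS by auto
      finally show "\<pi> U i0 (scale (c U') (\<xi> U')) = (if U' = U then scale (c U) (\<xi> U) else 0)" by auto
    qed
    also have "\<dots> = (if U \<in> T then scale (c U) (\<xi> U) else 0)" using T(1) by simp
    finally show ?thesis .
  qed
  have "T = {}" if T: "finite T" "T \<subseteq> I" "\<forall>U\<in>T. c U \<noteq> 0" "(\<Sum>U\<in>T. scale (c U) (\<xi> U)) \<in> annihilated_hom_values B V i0 x0" for T c
  proof (rule ccontr)
    assume "T \<noteq> {}"
    then obtain U where U: "U \<in> T" by blast
    then have UI: "U \<in> I" and US: "U \<in> S" using T(2) IS by auto
    obtain f where f: "morphism scale Q B V f" "(\<Sum>U\<in>T. scale (c U) (\<xi> U)) = f i0 x0"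
        "\<forall>g. morphism scale Q V B g \<longrightarrow> (\<forall>j\<in>verts Q. \<forall>y\<in>vspace B j. g j (f j y) = 0)"
      using T(4) unfolding annihilated_hom_values_def by blast
    have "morphism scale Q V B (\<lambda>i x. \<tau> U i (\<pi> U i x))" by (rule morphism_compose[OF \<pi>(1)[OF US] t[OF UI]])
    then have "\<tau> U i0 (\<pi> U i0 (f i0 x0)) = 0" using f(3) i0 x0(1) by blast
    moreover have "\<pi> U i0 (f i0 x0) = scale (c U) (\<xi> U)" unfolding f(2)[symmetric] using pi_sum[OF T(1,2) US] U by simp
    moreover have "\<tau> U i0 (scale (c U) (\<xi> U)) = scale (c U) x0"
      using linear_betweenD(3)[OF morphismD(1)[OF t[OF UI] i0] \<xi>U[OF UI]] ts[OF UI i0 x0(1)] unfolding \<xi>_def by simp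
    ultimately have "c U = 0" using x0(2) by simp
    then show False using T(3) U by blast
  qed
  moreover have "span (annihilated_hom_values B V i0 x0 \<union> \<xi> ` I) = hom_values B V i0 x0"
  proof
    have "\<xi> ` I \<subseteq> hom_values B V i0 x0" unfolding hom_values_def \<xi>_def using sV by blast
    moreover have "annihilated_hom_values B V i0 x0 \<subseteq> hom_values B V i0 x0"
      unfolding hom_values_def annihilated_hom_values_def by blast
    ultimately show "span (annihilated_hom_values B V i0 x0 \<union> \<xi> ` I) \<subseteq> hom_values B V i0 x0"
      by (intro span_minimal subspace_hom_values(1)[OF Brep V]) simp
    show "hom_values B V i0 x0 \<subseteq> span (annihilated_hom_values B V i0 x0 \<union> \<xi> ` I)"
    proof
      fix z assume "z \<in> hom_values B V i0 x0"
      then obtain f where f: "morphism scale Q B V f" "z = f i0 x0" unfolding hom_values_def by blast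
      have zV: "z \<in> vspace V i0" unfolding f(2) by (rule morphismD(2)[OF f(1) i0 x0(1)])
      obtain F where F: "finite F" "F \<subseteq> S" "\<forall>U\<in>S - F. \<pi> U i0 z = 0" using \<pi>(4)[OF i0 zV] by blast
      have "\<exists>c. \<pi> U i0 z = scale c (\<xi> U)" if U: "U \<in> I" for U
      proof -
        have US: "U \<in> S" using U IS by blast
        have "morphism scale Q B B (\<lambda>i x. \<tau> U i (\<pi> U i (f i x)))"
          by (rule morphism_compose[OF morphism_compose[OF f(1) \<pi>(1)[OF US]] t[OF U]])
        then obtain c where "\<forall>i\<in>verts Q. \<forall>x\<in>vspace B i. \<tau> U i (\<pi> U i (f i x)) = scale c x"
          using brick_endo[OF B] by blast
        then have "\<tau> U i0 (\<pi> U i0 z) = scale c x0" using f(2) i0 x0(1) by simp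
        then have "\<sigma> U i0 (\<tau> U i0 (\<pi> U i0 z)) = scale c (\<xi> U)"
          using linear_betweenD(3)[OF morphismD(1)[OF s[OF U] i0] x0(1)] unfolding \<xi>_def by simp
        then show ?thesis using stt[OF U i0 morphismD(2)[OF \<pi>(1)[OF US] i0 zV]] by auto
      qed
      then obtain c where c: "\<And>U. U \<in> I \<Longrightarrow> \<pi> U i0 z = scale (c U) (\<xi> U)" by metis
      define f' where "f' i x = f i x + (\<Sum>U\<in>F \<inter> I. scale (- c U) (\<sigma> U i x))" for i x
      have f': "morphism scale Q B V f'" unfolding f'_def
        by (rule morphism_sum[OF Brep V f(1)]) (use F(1) sV in auto)
      define z' where "z' = f' i0 x0"
      have z'eq: "z' = z + (\<Sum>U\<in>F \<inter> I. scale (- c U) (\<xi> U))" unfolding z'_def f'_def f(2) \<xi>_def ..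
      have z'V: "z' \<in> vspace V i0" unfolding z'_def by (rule morphismD(2)[OF f' i0 x0(1)])
      have sumV: "(\<Sum>U\<in>F \<inter> I. scale (- c U) (\<xi> U)) \<in> vspace V i0"
        using \<xi>V by (intro subspace_sum[OF subV] subspace_scale[OF subV]) auto
      have piz': "\<pi> U i0 z' = 0" if U: "U \<in> I" for U
      proof -
        have US: "U \<in> S" using U IS by blast
        have "\<pi> U i0 z' = \<pi> U i0 z + \<pi> U i0 (\<Sum>U\<in>F \<inter> I. scale (- c U) (\<xi> U))"
          unfolding z'eq by (rule linear_betweenD(2)[OF morphismD(1)[OF \<pi>(1)[OF US] i0] zV sumV])
        also have "\<pi> U i0 (\<Sum>U\<in>F \<inter> I. scale (- c U) (\<xi> U)) = (if U \<in> F \<inter> I then scale (- c U) (\<xi> U) else 0)"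
          by (rule pi_sum) (use F(1) US in auto)
        also have "\<pi> U i0 z + \<dots> = 0" using c[OF U] F(3) US U by auto
        finally show ?thesis .
      qed
      have "z' \<in> annihilated_hom_values B V i0 x0" unfolding annihilated_hom_values_def z'_def
      proof (intro CollectI exI[of _ f'] conjI refl f' allI impI ballI)
        fix g j y assume g: "morphism scale Q V B g" and j: "j \<in> verts Q" and y: "y \<in> vspace B j"
        obtain d where d: "\<forall>i\<in>verts Q. \<forall>x\<in>vspace B i. g i (f' i x) = scale d x"
          using brick_endo[OF B morphism_compose[OF f' g]] by auto
        show "g j (f' j y) = 0"
        proof (rule ccontr)
          assume "g j (f' j y) \<noteq> 0"
          then have "d \<noteq> 0" using d j y by auto
          then have nz: "g i0 z' \<noteq> 0" using d i0 x0 unfolding z'_def by simp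
          obtain F' where F': "finite F'" "F' \<subseteq> S" "z' = (\<Sum>U\<in>F'. \<pi> U i0 z')" using \<pi>(4)[OF i0 z'V] by blast
          have piU: "\<pi> U i0 z' \<in> vspace U i0" if "U \<in> S" for U using morphismD(2)[OF \<pi>(1)[OF that] i0 z'V] .
          have piV: "\<pi> U i0 z' \<in> vspace V i0" if "U \<in> S" for U using subrepD(2)[OF subr[OF that] i0 piU[OF that]] .
          have e2: "g i0 (\<Sum>U\<in>F'. \<pi> U i0 z') = g i0 z'" by (rule arg_cong[OF F'(3)[symmetric]])
          have e1: "g i0 (\<Sum>U\<in>F'. \<pi> U i0 z') = (\<Sum>U\<in>F'. g i0 (\<pi> U i0 z'))"
            by (rule linear_between_sum[OF subV morphismD(1)[OF g i0]]) (use F'(2) piV in auto)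
          have "(\<Sum>U\<in>F'. g i0 (\<pi> U i0 z')) \<noteq> 0" using nz unfolding e1[symmetric] e2 .
          then obtain U where U: "U \<in> F'" "g i0 (\<pi> U i0 z') \<noteq> 0" by (rule sum.not_neutral_contains_not_neutral)
          have US: "U \<in> S" using U F' by blast
          have "isomorphic scale Q B U"
          proof (rule brick_isomorphic_of_composite[OF B bspec[OF bricks US] _ _ i0 x0(1)])
            show "morphism scale Q B U (\<lambda>i x. \<pi> U i (f' i x))" by (rule morphism_compose[OF f' \<pi>(1)[OF US]])
            show "morphism scale Q U B g" using morphism_compose[OF subrep_inclusion[OF subr[OF US]] g] .
            show "g i0 (\<pi> U i0 (f' i0 x0)) \<noteq> 0" using U(2) unfolding z'_def .
          qed
          then have "U \<in> I" unfolding I_def using US by blast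
          then have "\<pi> U i0 z' = 0" by (rule piz')
          then show False using U(2) linear_between_zero[OF subV morphismD(1)[OF g i0]] by simp
        qed
      qed
      then have 1: "z' \<in> span (annihilated_hom_values B V i0 x0 \<union> \<xi> ` I)" by (intro span_base UnI1)
      have 2: "(\<Sum>U\<in>F \<inter> I. scale (- c U) (\<xi> U)) \<in> span (annihilated_hom_values B V i0 x0 \<union> \<xi> ` I)"
        by (intro span_sum span_scale span_base UnI2 imageI) blast
      have "z = z' - (\<Sum>U\<in>F \<inter> I. scale (- c U) (\<xi> U))" unfolding z'eq by simp
      then show "z \<in> span (annihilated_hom_values B V i0 x0 \<union> \<xi> ` I)" using span_diff[OF 1 2] by simp
    qed
  qed
  ultimately show ?thesis unfolding I_def[symmetric] by (intro exI[of _ \<xi>]) blast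
qed

text \<open>The multiplicity spaces of \<open>brick_multiplicity\<close> depend on \<open>V\<close> and on the isomorphism class of the brick only. The resulting bijections
for the individual classes are glued.\<close>

lemma krull_schmidt_uniqueness:
  assumes bricks: "\<And>U. indecomposable scale Q U \<Longrightarrow> brick U" and V: "quiver_rep scale Q V"
    and S: "indecomposable_decomposition scale Q V S" and T: "indecomposable_decomposition scale Q V T"
  shows "\<exists>h. bij_betw h S T \<and> (\<forall>U\<in>S. isomorphic scale Q U (h U))"
proof -
  have dS: "direct_sum scale Q V S (\<lambda>U. U)" and bS: "\<And>U. U \<in> S \<Longrightarrow> brick U"
    and dT: "direct_sum scale Q V T (\<lambda>U. U)" and bT: "\<And>U. U \<in> T \<Longrightarrow> brick U"
    using S T bricks unfolding indecomposable_decomposition_def by auto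
  have bS': "\<forall>U\<in>S. brick U" and bT': "\<forall>U\<in>T. brick U" using bS bT by blast+
  define cls where "cls U = {X. isomorphic scale Q U X}" for U
  have cls_eq: "cls U' = cls U \<longleftrightarrow> isomorphic scale Q U U'" for U U'
    unfolding cls_def using isomorphic_refl isomorphic_sym isomorphic_trans by blast
  have "\<exists>h. bij_betw h {U\<in>S. cls U = cls B} {U\<in>T. cls U = cls B}" if B: "brick B" for B
  proof -
    have Brep: "quiver_rep scale Q B" and nz: "\<not> zero_rep Q B" using B unfolding brick_def by auto
    obtain i0 x0 where x0: "i0 \<in> verts Q" "x0 \<in> vspace B i0" "x0 \<noteq> 0" by (rule nonzero_rep_witness[OF Brep nz])
    obtain \<xi> where \<xi>: "\<forall>T c. finite T \<longrightarrow> T \<subseteq> {U\<in>S. isomorphic scale Q B U} \<longrightarrow> (\<forall>U\<in>T. c U \<noteq> 0) \<longrightarrow>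
             (\<Sum>U\<in>T. scale (c U) (\<xi> U)) \<in> annihilated_hom_values B V i0 x0 \<longrightarrow> T = {}"
           "span (annihilated_hom_values B V i0 x0 \<union> \<xi> ` {U\<in>S. isomorphic scale Q B U}) = hom_values B V i0 x0"
      using brick_multiplicity[OF V B x0 dS bS'] by (elim exE conjE) (rule that)
    obtain \<eta> where \<eta>: "\<forall>T' c. finite T' \<longrightarrow> T' \<subseteq> {U\<in>T. isomorphic scale Q B U} \<longrightarrow> (\<forall>U\<in>T'. c U \<noteq> 0) \<longrightarrow>
             (\<Sum>U\<in>T'. scale (c U) (\<eta> U)) \<in> annihilated_hom_values B V i0 x0 \<longrightarrow> T' = {}"
           "span (annihilated_hom_values B V i0 x0 \<union> \<eta> ` {U\<in>T. isomorphic scale Q B U}) = hom_values B V i0 x0"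
      using brick_multiplicity[OF V B x0 dT bT'] by (elim exE conjE) (rule that)
    have "\<exists>h. bij_betw h {U\<in>S. isomorphic scale Q B U} {U\<in>T. isomorphic scale Q B U}"
    proof (rule complements_equinumerous[OF subspace_hom_values(2)[OF Brep V, of i0 x0]])
      show "F = {}" if "finite F" "F \<subseteq> {U\<in>S. isomorphic scale Q B U}" "\<forall>U\<in>F. c U \<noteq> 0"
          "(\<Sum>U\<in>F. scale (c U) (\<xi> U)) \<in> annihilated_hom_values B V i0 x0" for F c using \<xi>(1) that by blast
      show "F = {}" if "finite F" "F \<subseteq> {U\<in>T. isomorphic scale Q B U}" "\<forall>U\<in>F. c U \<noteq> 0"
          "(\<Sum>U\<in>F. scale (c U) (\<eta> U)) \<in> annihilated_hom_values B V i0 x0" for F c using \<eta>(1) that by blast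
    qed (simp add: \<xi>(2) \<eta>(2))
    then show ?thesis unfolding cls_eq .
  qed
  then obtain H where H: "\<And>B. brick B \<Longrightarrow> bij_betw (H (cls B)) {U\<in>S. cls U = cls B} {U\<in>T. cls U = cls B}"
  proof -
    assume *: "\<And>B. brick B \<Longrightarrow> \<exists>h. bij_betw h {U\<in>S. cls U = cls B} {U\<in>T. cls U = cls B}"
    assume **: "\<And>H. (\<And>B. brick B \<Longrightarrow> bij_betw (H (cls B)) {U\<in>S. cls U = cls B} {U\<in>T. cls U = cls B}) \<Longrightarrow> thesis"
    show thesis
      by (rule **[of "\<lambda>C. SOME h. bij_betw h {U\<in>S. cls U = C} {U\<in>T. cls U = C}"]) (rule someI_ex[OF *])
  qed
  define h where "h U = H (cls U) U" for U
  have hT: "h U \<in> T \<and> cls (h U) = cls U" if "U \<in> S" for U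
    using bij_betw_apply[OF H[OF bS[OF that]], of U] that unfolding h_def by auto
  have "bij_betw h S T" unfolding bij_betw_def
  proof
    show "inj_on h S"
    proof (rule inj_onI)
      fix U U' assume U: "U \<in> S" "U' \<in> S" "h U = h U'"
      then have c: "cls U = cls U'" using hT by metis
      have "inj_on (H (cls U)) {X\<in>S. cls X = cls U}" using H[OF bS[OF U(1)]] bij_betw_imp_inj_on by blast
      then show "U = U'" using U c unfolding h_def by (auto dest: inj_onD)
    qed
    show "h ` S = T"
    proof
      show "h ` S \<subseteq> T" using hT by blast
      show "T \<subseteq> h ` S"
      proof
        fix W assume W: "W \<in> T"
        have "W \<in> H (cls W) ` {U\<in>S. cls U = cls W}"
          using bij_betw_imp_surj_on[OF H[OF bT[OF W]]] W by blast
        then obtain U where "U \<in> S" "cls U = cls W" "W = H (cls W) U" by blast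
        then show "W \<in> h ` S" unfolding h_def by (intro image_eqI[of _ _ U]) auto
      qed
    qed
  qed
  moreover have "\<forall>U\<in>S. isomorphic scale Q U (h U)" using hT cls_eq by blast
  ultimately show ?thesis by blast
qed

end

section \<open>Isomorphisms and direct sums from bases\<close>

context quiver_reps
begin

text \<open>Here \<open>\<xi> i\<close> and \<open>\<eta> i\<close>, indexed by \<open>J i\<close>, are bases of the spaces of \<open>V\<close> and \<open>W\<close>. The condition on the arrow maps says that they have
the same matrices, in a form that avoids naming the matrix entries.\<close>

lemma isomorphic_by_frames:
  fixes \<xi> \<eta> :: "'v \<Rightarrow> 'k \<Rightarrow> 'b"
  assumes V: "quiver_rep scale Q V" and W: "quiver_rep scale Q W"
    and \<xi>: "\<And>i. i \<in> verts Q \<Longrightarrow> inj_on (\<xi> i) (J i) \<and> independent (\<xi> i ` J i) \<and> vspace V i = span (\<xi> i ` J i)"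
    and \<eta>: "\<And>i. i \<in> verts Q \<Longrightarrow> inj_on (\<eta> i) (J i) \<and> independent (\<eta> i ` J i) \<and> vspace W i = span (\<eta> i ` J i)"
    and arrow: "\<And>a c h. a \<in> arrows Q \<Longrightarrow> c \<in> J (fst a) \<Longrightarrow> Vector_Spaces.linear scale scale h \<Longrightarrow>
        (\<And>d. d \<in> J (snd a) \<Longrightarrow> h (\<xi> (snd a) d) = \<eta> (snd a) d) \<Longrightarrow>
        h (amap V a (\<xi> (fst a) c)) = amap W a (\<eta> (fst a) c)"
  shows "isomorphic scale Q V W"
proof -
  have ext: "\<exists>h. Vector_Spaces.linear scale scale h \<and> (\<forall>c\<in>K. h (\<alpha> c) = \<beta> c)"
    if inj: "inj_on \<alpha> K" and ind: "independent (\<alpha> ` K)" for \<alpha> \<beta> :: "'k \<Rightarrow> 'b" and K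
  proof -
    obtain h where h: "Vector_Spaces.linear scale scale h" "\<forall>x\<in>\<alpha> ` K. h x = \<beta> (inv_into K \<alpha> x)"
      using vsp.linear_independent_extend[OF ind, of "\<lambda>x. \<beta> (inv_into K \<alpha> x)"] by blast
    then show ?thesis using inj by (intro exI[of _ h]) (auto simp: inv_into_f_f)
  qed
  have "\<forall>i\<in>verts Q. \<exists>h. Vector_Spaces.linear scale scale h \<and> (\<forall>c\<in>J i. h (\<xi> i c) = \<eta> i c)"
    using ext \<xi> by blast
  then obtain f where f: "\<And>i. i \<in> verts Q \<Longrightarrow> Vector_Spaces.linear scale scale (f i)"
      "\<And>i c. i \<in> verts Q \<Longrightarrow> c \<in> J i \<Longrightarrow> f i (\<xi> i c) = \<eta> i c" by metis
  have "\<forall>i\<in>verts Q. \<exists>h. Vector_Spaces.linear scale scale h \<and> (\<forall>c\<in>J i. h (\<eta> i c) = \<xi> i c)"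
    using ext \<eta> by blast
  then obtain g where g: "\<And>i. i \<in> verts Q \<Longrightarrow> Vector_Spaces.linear scale scale (g i)"
      "\<And>i c. i \<in> verts Q \<Longrightarrow> c \<in> J i \<Longrightarrow> g i (\<eta> i c) = \<xi> i c" by metis
  have Vs: "vspace V i = span (\<xi> i ` J i)" and Ws: "vspace W i = span (\<eta> i ` J i)" if "i \<in> verts Q" for i
    using \<xi>[OF that] \<eta>[OF that] by auto
  have fW: "f i x \<in> vspace W i" and gf: "g i (f i x) = x" if i: "i \<in> verts Q" and x: "x \<in> vspace V i" for i x
  proof -
    interpret fi: Vector_Spaces.linear scale scale "f i" by (rule f(1)[OF i])
    interpret gi: Vector_Spaces.linear scale scale "g i" by (rule g(1)[OF i])
    have "x \<in> span (\<xi> i ` J i)" using x Vs[OF i] by simp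
    then have "f i x \<in> span (\<eta> i ` J i) \<and> g i (f i x) = x"
    proof (induction rule: span_induct_alt)
      case base
      show ?case by (simp add: span_zero)
    next
      case (step r b y)
      then obtain c where c: "c \<in> J i" "b = \<xi> i c" by blast
      then have "\<eta> i c \<in> span (\<eta> i ` J i)" by (intro span_base) blast
      then show ?case using step f(2)[OF i c(1)] g(2)[OF i c(1)] unfolding c(2)
        by (simp add: fi.add fi.scale gi.add gi.scale span_add span_scale)
    qed
    then show "f i x \<in> vspace W i" "g i (f i x) = x" using Ws[OF i] by auto
  qed
  have gV: "g i x \<in> vspace V i" and fg: "f i (g i x) = x" if i: "i \<in> verts Q" and x: "x \<in> vspace W i" for i x
  proof -
    interpret fi: Vector_Spaces.linear scale scale "f i" by (rule f(1)[OF i])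
    interpret gi: Vector_Spaces.linear scale scale "g i" by (rule g(1)[OF i])
    have "x \<in> span (\<eta> i ` J i)" using x Ws[OF i] by simp
    then have "g i x \<in> span (\<xi> i ` J i) \<and> f i (g i x) = x"
    proof (induction rule: span_induct_alt)
      case base
      show ?case by (simp add: span_zero)
    next
      case (step r b y)
      then obtain c where c: "c \<in> J i" "b = \<eta> i c" by blast
      then have "\<xi> i c \<in> span (\<xi> i ` J i)" by (intro span_base) blast
      then show ?case using step f(2)[OF i c(1)] g(2)[OF i c(1)] unfolding c(2)
        by (simp add: fi.add fi.scale gi.add gi.scale span_add span_scale)
    qed
    then show "g i x \<in> vspace V i" "f i (g i x) = x" using Vs[OF i] by auto
  qed
  have comm: "f (snd a) (amap V a x) = amap W a (f (fst a) x)" if a: "a \<in> arrows Q" and x: "x \<in> vspace V (fst a)" for a x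
  proof -
    have va: "fst a \<in> verts Q" "snd a \<in> verts Q" using arrow_verts[OF a] by auto
    interpret fs: Vector_Spaces.linear scale scale "f (fst a)" by (rule f(1)[OF va(1)])
    interpret ft: Vector_Spaces.linear scale scale "f (snd a)" by (rule f(1)[OF va(2)])
    note LV = linear_betweenD[OF quiver_repD(2)[OF V a]] and LW = linear_betweenD[OF quiver_repD(2)[OF W a]]
    have "x \<in> span (\<xi> (fst a) ` J (fst a))" using x Vs[OF va(1)] by simp
    then have "x \<in> vspace V (fst a) \<and> f (snd a) (amap V a x) = amap W a (f (fst a) x)"
    proof (induction rule: span_induct_alt)
      case base
      show ?case
        using linear_between_zero[OF quiver_repD(1)[OF V va(1)] quiver_repD(2)[OF V a]]
          linear_between_zero[OF quiver_repD(1)[OF W va(1)] quiver_repD(2)[OF W a]]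
          subspace_0[OF quiver_repD(1)[OF V va(1)]] by simp
    next
      case (step r b y)
      then obtain c where c: "c \<in> J (fst a)" "b = \<xi> (fst a) c" by blast
      have bV: "b \<in> vspace V (fst a)" unfolding Vs[OF va(1)] c(2) by (intro span_base imageI c)
      have rb: "scale r b \<in> vspace V (fst a)" using subspace_scale[OF quiver_repD(1)[OF V va(1)] bV] .
      have b: "f (snd a) (amap V a b) = amap W a (f (fst a) b)"
        unfolding c(2) f(2)[OF va(1) c(1)] using arrow[OF a c(1) f(1)[OF va(2)] f(2)[OF va(2)]] by simp
      have yV: "y \<in> vspace V (fst a)" and ye: "f (snd a) (amap V a y) = amap W a (f (fst a) y)" using step by auto
      have frb: "scale r (f (fst a) b) \<in> vspace W (fst a)"
        using fW[OF va(1) bV] subspace_scale[OF quiver_repD(1)[OF W va(1)]] by blast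
      have "f (snd a) (amap V a (scale r b + y)) = scale r (f (snd a) (amap V a b)) + f (snd a) (amap V a y)"
        using LV(2)[OF rb yV] LV(3)[OF bV] by (simp add: ft.add ft.scale)
      moreover have "amap W a (f (fst a) (scale r b + y)) = scale r (amap W a (f (fst a) b)) + amap W a (f (fst a) y)"
        using LW(2)[OF frb fW[OF va(1) yV]] LW(3)[OF fW[OF va(1) bV]] by (simp add: fs.add fs.scale)
      ultimately show ?case using b ye subspace_add[OF quiver_repD(1)[OF V va(1)] rb yV] by simp
    qed
    then show ?thesis ..
  qed
  have lin: "linear_between scale (vspace V i) (vspace W i) (f i)" "linear_between scale (vspace W i) (vspace V i) (g i)"
    if i: "i \<in> verts Q" for i
  proof -
    interpret fi: Vector_Spaces.linear scale scale "f i" by (rule f(1)[OF i])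
    interpret gi: Vector_Spaces.linear scale scale "g i" by (rule g(1)[OF i])
    show "linear_between scale (vspace V i) (vspace W i) (f i)"
      by (rule linear_betweenI) (auto simp: fi.add fi.scale fW[OF i])
    show "linear_between scale (vspace W i) (vspace V i) (g i)"
      by (rule linear_betweenI) (auto simp: gi.add gi.scale gV[OF i])
  qed
  have mf: "morphism scale Q V W f" by (rule morphismI[OF lin(1) comm])
  have mg: "morphism scale Q W V g"
  proof (rule morphismI[OF lin(2)])
    fix a x assume a: "a \<in> arrows Q" and x: "x \<in> vspace W (fst a)"
    have va: "fst a \<in> verts Q" "snd a \<in> verts Q" using arrow_verts[OF a] by auto
    have gx: "g (fst a) x \<in> vspace V (fst a)" by (rule gV[OF va(1) x])
    have "amap W a x = amap W a (f (fst a) (g (fst a) x))" using fg[OF va(1) x] by simp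
    also have "\<dots> = f (snd a) (amap V a (g (fst a) x))" using comm[OF a gx] by simp
    finally show "g (snd a) (amap W a x) = amap V a (g (fst a) x)"
      using gf[OF va(2) linear_betweenD(1)[OF quiver_repD(2)[OF V a] gx]] by simp
  qed
  show ?thesis unfolding isomorphic_def using mf mg gf fg by blast
qed

lemma isomorphic_dim:
  assumes V: "quiver_rep scale Q V" and iso: "isomorphic scale Q V W" and i: "i \<in> verts Q"
  shows "dim (vspace V i) = dim (vspace W i)"
proof -
  obtain f g where f: "morphism scale Q V W f" and g: "morphism scale Q W V g"
    and gf: "\<And>x. x \<in> vspace V i \<Longrightarrow> g i (f i x) = x" and fg: "\<And>y. y \<in> vspace W i \<Longrightarrow> f i (g i y) = y"
    using iso i unfolding isomorphic_def by metis
  have sV: "subspace (vspace V i)" by (rule quiver_repD(1)[OF V i])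
  obtain h where h: "Vector_Spaces.linear scale scale h" "\<forall>x\<in>vspace V i. h x = f i x"
    using linear_between_extend[OF sV morphismD(1)[OF f i]] by blast
  interpret h: Vector_Spaces.linear scale scale h by (rule h(1))
  obtain B where B: "B \<subseteq> vspace V i" "independent B" "vspace V i \<subseteq> span B" "card B = dim (vspace V i)"
    using basis_exists by metis
  have sB: "span B = vspace V i" using span_minimal[OF B(1) sV] B(3) by blast
  have inj: "inj_on h (span B)" unfolding sB
    by (rule inj_on_inverseI[of _ "g i"]) (use h(2) gf in simp)
  have ind: "independent (h ` B)" by (rule h.independent_injective_image[OF B(2) inj])
  have "span (h ` B) = h ` vspace V i" unfolding h.span_image sB ..
  also have "\<dots> = f i ` vspace V i" using h(2) by (intro image_cong) auto
  also have "\<dots> = vspace W i"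
    using morphismD(2)[OF f i] fg morphismD(2)[OF g i] by (force intro: rev_image_eqI)
  finally have "dim (vspace W i) = card (h ` B)"
    using dim_span_eq_card_independent[OF ind] by simp
  also have "\<dots> = card B" using inj span_superset inj_on_subset by (intro card_image) blast
  finally show ?thesis using B(4) by simp
qed

lemma same_dim_imp_dim_eq:
  assumes "same_dim scale U W"
  shows "dim U = dim W"
proof -
  obtain B C h where B: "independent B" "span B = U" "independent C" "span C = W" "bij_betw h B C"
    using assms unfolding same_dim_def by blast
  have "dim U = card B" using dim_span_eq_card_independent[OF B(1)] B(2) by simp
  also have "\<dots> = card C" using B(5) by (rule bij_betw_same_card)
  also have "\<dots> = dim W" using dim_span_eq_card_independent[OF B(3)] B(4) by simp
  finally show ?thesis .
qed

text \<open>The sets \<open>X i\<close> are parts of bases of the spaces of \<open>V\<close>.\<close>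

definition basis_piece :: "('v, 'b) quiver_rep \<Rightarrow> ('v \<Rightarrow> 'b set) \<Rightarrow> ('v, 'b) quiver_rep" where
  "basis_piece V X = \<lparr>vspace = \<lambda>i. span (X i), amap = amap V\<rparr>"

lemma subrep_basis_piece:
  assumes V: "quiver_rep scale Q V" and X: "\<And>i. i \<in> verts Q \<Longrightarrow> X i \<subseteq> vspace V i"
    and closed: "\<And>a x. a \<in> arrows Q \<Longrightarrow> x \<in> X (fst a) \<Longrightarrow> amap V a x \<in> span (X (snd a))"
  shows "subrep scale Q (basis_piece V X) V"
proof -
  have XV: "span (X i) \<subseteq> vspace V i" if "i \<in> verts Q" for i
    by (rule span_minimal[OF X[OF that] quiver_repD(1)[OF V that]])
  have "quiver_rep scale Q (basis_piece V X)" unfolding quiver_rep_def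
  proof (intro conjI ballI)
    show "subspace (vspace (basis_piece V X) i)" for i unfolding basis_piece_def by simp
    fix a assume a: "a \<in> arrows Q"
    have va: "fst a \<in> verts Q" using arrow_verts[OF a] by auto
    note L = linear_betweenD[OF quiver_repD(2)[OF V a]]
    show "linear_between scale (vspace (basis_piece V X) (fst a)) (vspace (basis_piece V X) (snd a)) (amap (basis_piece V X) a)"
    proof (rule linear_betweenI)
      fix x assume "x \<in> vspace (basis_piece V X) (fst a)"
      then have "x \<in> span (X (fst a))" unfolding basis_piece_def by simp
      then have "x \<in> vspace V (fst a) \<and> amap V a x \<in> span (X (snd a))"
      proof (induction rule: span_induct_alt)
        case base
        show ?case
          using linear_between_zero[OF quiver_repD(1)[OF V va] quiver_repD(2)[OF V a]]
            subspace_0[OF quiver_repD(1)[OF V va]] span_zero by simp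
      next
        case (step r b y)
        have bV: "b \<in> vspace V (fst a)" using X[OF va] step by blast
        have rb: "scale r b \<in> vspace V (fst a)" using subspace_scale[OF quiver_repD(1)[OF V va] bV] .
        have "amap V a (scale r b + y) = scale r (amap V a b) + amap V a y" using L(2)[OF rb] L(3)[OF bV] step by simp
        then show ?case using step closed[OF a step(1)] subspace_add[OF quiver_repD(1)[OF V va] rb] by (simp add: span_add span_scale)
      qed
      then show "amap (basis_piece V X) a x \<in> vspace (basis_piece V X) (snd a)" unfolding basis_piece_def by simp
    qed (use L subsetD[OF XV[OF va]] in \<open>simp_all add: basis_piece_def\<close>)
  qed
  then show ?thesis unfolding subrep_def using XV by (auto simp: basis_piece_def)
qed

lemma direct_sum_basis_pieces:
  assumes V: "quiver_rep scale Q V"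
    and basis: "\<And>i. i \<in> verts Q \<Longrightarrow> independent (\<Union>X\<in>\<X>. X i) \<and> span (\<Union>X\<in>\<X>. X i) = vspace V i"
    and disj: "\<And>i X Y. i \<in> verts Q \<Longrightarrow> X \<in> \<X> \<Longrightarrow> Y \<in> \<X> \<Longrightarrow> X \<noteq> Y \<Longrightarrow> X i \<inter> Y i = {}"
    and closed: "\<And>X a x. X \<in> \<X> \<Longrightarrow> a \<in> arrows Q \<Longrightarrow> x \<in> X (fst a) \<Longrightarrow> amap V a x \<in> span (X (snd a))"
  shows "direct_sum scale Q V \<X> (basis_piece V)"
  unfolding direct_sum_def
proof (intro conjI ballI allI impI)
  show subr: "subrep scale Q (basis_piece V X) V" if X: "X \<in> \<X>" for X
  proof (rule subrep_basis_piece[OF V _ closed[OF X]])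
    show "X i \<subseteq> vspace V i" if "i \<in> verts Q" for i
    proof -
      have "X i \<subseteq> (\<Union>X\<in>\<X>. X i)" using X by blast
      then show ?thesis using basis[OF that] span_superset[of "\<Union>X\<in>\<X>. X i"] by blast
    qed
  qed
  fix i assume i: "i \<in> verts Q"
  show "vspace V i = {\<Sum>k\<in>F. x k |F x. finite F \<and> F \<subseteq> \<X> \<and> (\<forall>k\<in>F. x k \<in> vspace (basis_piece V k) i)}" (is "_ = ?R")
  proof (intro equalityI subsetI)
    fix z assume "z \<in> vspace V i"
    then have "z \<in> span (\<Union>X\<in>\<X>. X i)" using basis[OF i] by simp
    then have "\<exists>F x. finite F \<and> F \<subseteq> \<X> \<and> (\<forall>k\<in>F. x k \<in> span (k i)) \<and> z = (\<Sum>k\<in>F. x k)"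
    proof (induction rule: span_induct_alt)
      case base
      show ?case by (intro exI[of _ "{}"]) simp
    next
      case (step r b y)
      then obtain F x where F: "finite F" "F \<subseteq> \<X>" "\<forall>k\<in>F. x k \<in> span (k i)" "y = (\<Sum>k\<in>F. x k)" by blast
      obtain X where X: "X \<in> \<X>" "b \<in> X i" using step by blast
      define x' where "x' k = (if k = X then scale r b else 0) + (if k \<in> F then x k else 0)" for k
      have "(\<Sum>k\<in>insert X F. x' k) = (\<Sum>k\<in>insert X F. if k = X then scale r b else 0) + (\<Sum>k\<in>insert X F. if k \<in> F then x k else 0)"
        unfolding x'_def by (rule sum.distrib)
      also have "(\<Sum>k\<in>insert X F. if k = X then scale r b else 0) = scale r b" using F(1) by simp
      also have "(\<Sum>k\<in>insert X F. if k \<in> F then x k else 0) = y"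
        unfolding F(4) by (rule sum.mono_neutral_cong_right) (use F in auto)
      finally have "scale r b + y = (\<Sum>k\<in>insert X F. x' k)" by simp
      moreover have "\<forall>k\<in>insert X F. x' k \<in> span (k i)"
        unfolding x'_def using F(3) X(2) by (auto intro!: span_add span_scale span_zero intro: span_base)
      ultimately show ?case using F(1,2) X(1) by (intro exI[of _ "insert X F"] exI[of _ x']) auto
    qed
    then show "z \<in> ?R" unfolding basis_piece_def by auto
  next
    fix z assume "z \<in> ?R"
    then obtain F x where F: "F \<subseteq> \<X>" "\<forall>k\<in>F. x k \<in> vspace (basis_piece V k) i" "z = (\<Sum>k\<in>F. x k)" by blast
    show "z \<in> vspace V i" unfolding F(3)
    proof (rule subspace_sum[OF quiver_repD(1)[OF V i]])
      fix k assume "k \<in> F"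
      then show "x k \<in> vspace V i" using subrepD(2)[OF subr i] F(1,2) by blast
    qed
  qed
  fix F x k
  assume F: "finite F" "F \<subseteq> \<X>" "\<forall>k\<in>F. x k \<in> vspace (basis_piece V k) i" "(\<Sum>k\<in>F. x k) = 0" "k \<in> F"
  have mem: "x l \<in> span (l i)" if "l \<in> F" for l using F(3) that unfolding basis_piece_def by simp
  have eq0: "x k + (\<Sum>l\<in>F - {k}. x l) = 0" using F(4) sum.remove[OF F(1,5), of x] by simp
  have "x k = - (\<Sum>l\<in>F - {k}. x l)" using eq0 by (rule eq_neg_iff_add_eq_0[THEN iffD2])
  also have "\<dots> \<in> span (\<Union>l\<in>F - {k}. l i)"
  proof (intro span_neg span_sum)
    fix l assume l: "l \<in> F - {k}"
    then have "l i \<subseteq> (\<Union>l\<in>F - {k}. l i)" by blast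
    then show "x l \<in> span (\<Union>l\<in>F - {k}. l i)" using mem l span_mono by blast
  qed
  finally have "x k \<in> span (k i) \<inter> span (\<Union>l\<in>F - {k}. l i)" using mem[OF F(5)] by blast
  also have "\<dots> = span (k i \<inter> (\<Union>l\<in>F - {k}. l i))"
    by (rule span_Int_of_independent[of "\<Union>X\<in>\<X>. X i"]) (use basis[OF i] F(2,5) in auto)
  also have "k i \<inter> (\<Union>l\<in>F - {k}. l i) = {}"
  proof -
    have "k i \<inter> l i = {}" if "l \<in> F - {k}" for l using disj[OF i, of k l] that F(2,5) by blast
    then show ?thesis by blast
  qed
  finally show "x k = 0" by simp
qed

text \<open>A family of nonzero summands is injective, so it can be indexed by its own members.\<close>

lemma indecomposable_decompositionI:
  assumes V: "quiver_rep scale Q V" and ds: "direct_sum scale Q V K W" and ind: "\<And>k. k \<in> K \<Longrightarrow> indecomposable scale Q (W k)"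
  shows "indecomposable_decomposition scale Q V (W ` K)"
proof -
  have subr: "subrep scale Q (W k) V" if "k \<in> K" for k using ds that unfolding direct_sum_def by blast
  obtain \<pi> where \<pi>': "projections V K W \<pi>" using direct_sum_projections[OF V ds] by blast
  note \<pi> = projectionsD[OF \<pi>']
  have inj: "inj_on W K"
  proof (rule inj_onI, rule ccontr)
    fix k l assume kl: "k \<in> K" "l \<in> K" "W k = W l" "k \<noteq> l"
    have "quiver_rep scale Q (W k)" "\<not> zero_rep Q (W k)" using ind[OF kl(1)] unfolding indecomposable_def by auto
    from nonzero_rep_witness[OF this] obtain i x where x: "i \<in> verts Q" "x \<in> vspace (W k) i" "x \<noteq> 0" .
    have "\<pi> k i x = x" by (rule \<pi>(2)[OF kl(1) x(1,2)])
    moreover have "\<pi> k i x = 0" by (rule \<pi>(3)[OF kl(1,2) _ x(1)]) (use kl x in auto)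
    ultimately show False using x(3) by simp
  qed
  show ?thesis unfolding indecomposable_decomposition_def
  proof
    show "\<forall>U\<in>W ` K. indecomposable scale Q U" using ind by blast
    show "direct_sum scale Q V (W ` K) (\<lambda>U. U)" unfolding direct_sum_def
    proof (intro conjI ballI allI impI)
      show "subrep scale Q U V" if "U \<in> W ` K" for U using that subr by blast
      fix i assume i: "i \<in> verts Q"
      have sp: "vspace V i = {\<Sum>k \<in> F. x k | F x. finite F \<and> F \<subseteq> K \<and> (\<forall>k \<in> F. x k \<in> vspace (W k) i)}"
        using ds i unfolding direct_sum_def by blast
      show "vspace V i = {\<Sum>k\<in>F. x k |F x. finite F \<and> F \<subseteq> W ` K \<and> (\<forall>k\<in>F. x k \<in> vspace k i)}" (is "_ = ?R")
      proof (intro equalityI subsetI)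
        fix z assume "z \<in> vspace V i"
        then obtain F x where F: "finite F" "F \<subseteq> K" "\<forall>k\<in>F. x k \<in> vspace (W k) i" "z = (\<Sum>k\<in>F. x k)" unfolding sp by blast
        have iF: "inj_on W F" using inj F(2) by (rule inj_on_subset)
        have "z = (\<Sum>U\<in>W ` F. x (inv_into F W U))"
          unfolding F(4) sum.reindex[OF iF] by (rule sum.cong) (auto simp: inv_into_f_f[OF iF])
        moreover have "\<forall>U\<in>W ` F. x (inv_into F W U) \<in> vspace U i" using F(3) by (auto simp: inv_into_f_f[OF iF])
        ultimately show "z \<in> ?R" using F(1,2) by (intro CollectI exI[of _ "W ` F"] exI[of _ "\<lambda>U. x (inv_into F W U)"]) auto
      next
        fix z assume "z \<in> ?R"
        then obtain F x where F: "F \<subseteq> W ` K" "\<forall>k\<in>F. x k \<in> vspace k i" "z = (\<Sum>k\<in>F. x k)" by blast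
        show "z \<in> vspace V i" unfolding F(3)
        proof (rule subspace_sum[OF quiver_repD(1)[OF V i]])
          fix U assume U: "U \<in> F"
          then obtain k where "k \<in> K" "U = W k" using F(1) by blast
          then show "x U \<in> vspace V i" using subrepD(2)[OF subr i] F(2) U by blast
        qed
      qed
      fix F x U
      assume F: "finite F" "F \<subseteq> W ` K" "\<forall>k\<in>F. x k \<in> vspace k i" "(\<Sum>k\<in>F. x k) = 0" "U \<in> F"
      define G where "G = {k\<in>K. W k \<in> F}"
      have iG: "inj_on W G" using inj by (rule inj_on_subset) (auto simp: G_def)
      have WG: "W ` G = F" using F(2) unfolding G_def by blast
      have fG: "finite G" using F(1) WG iG finite_imageD by blast
      have "(\<Sum>k\<in>G. x (W k)) = 0" using F(4) unfolding WG[symmetric] sum.reindex[OF iG] by simp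
      moreover have "\<forall>k\<in>G. x (W k) \<in> vspace (W k) i" using F(3) unfolding G_def by blast
      moreover have "G \<subseteq> K" unfolding G_def by blast
      moreover have "\<forall>F x. finite F \<longrightarrow> F \<subseteq> K \<longrightarrow> (\<forall>k \<in> F. x k \<in> vspace (W k) i) \<longrightarrow>
           (\<Sum>k \<in> F. x k) = 0 \<longrightarrow> (\<forall>k \<in> F. x k = 0)" using ds i unfolding direct_sum_def by blast
      ultimately have "\<forall>k\<in>G. x (W k) = 0" using fG by (metis (mono_tags, lifting))
      then show "x U = 0" using WG F(5) by blast
    qed
  qed
qed

end

section \<open>The quiver and its bricks\<close>

locale d_infinity = quiver_reps scale Q
  for scale :: "'f::field \<Rightarrow> 'b::ab_group_add \<Rightarrow> 'b" and Q :: "'v quiver" +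
  fixes u u' :: 'v and w :: "nat \<Rightarrow> 'v" and N :: nat
  assumes u_neq: "u \<noteq> u'" and w_inj: "inj w" and u_w: "\<And>j. u \<noteq> w j" and u'_w: "\<And>j. u' \<noteq> w j"
    and verts_eq: "verts Q = {u, u'} \<union> range w"
    and edges: "bij_betw (\<lambda>(i, j). {i, j}) (arrows Q) ({{u, w 0}, {u', w 0}} \<union> {{w j, w (Suc j)} | j. True})"
    and tail_outward: "\<And>j. N \<le> j \<Longrightarrow> (w j, w (Suc j)) \<in> arrows Q"
begin

definition out :: "nat \<Rightarrow> bool" where "out j \<longleftrightarrow> (w j, w (Suc j)) \<in> arrows Q"

text \<open>The arrows are numbered by the edges of the underlying graph: \<open>ar j\<close> lies on the edge between \<open>w j\<close> and \<open>w (j + 1)\<close>, and \<open>arm z\<close> on the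
edge between \<open>w 0\<close> and \<open>z \<in> {u, u'}\<close>.\<close>

definition ar :: "nat \<Rightarrow> 'v \<times> 'v" where
  "ar j = (if out j then (w j, w (Suc j)) else (w (Suc j), w j))"

definition arm_out :: "'v \<Rightarrow> bool" where "arm_out z \<longleftrightarrow> (w 0, z) \<in> arrows Q"

definition arm :: "'v \<Rightarrow> 'v \<times> 'v" where "arm z = (if arm_out z then (w 0, z) else (z, w 0))"

lemma w_eq [simp]: "w i = w j \<longleftrightarrow> i = j"
  using w_inj by (auto dest: injD)

lemma u_simps [simp]: "u \<noteq> u'" "u' \<noteq> u" "u \<noteq> w j" "w j \<noteq> u" "u' \<noteq> w j" "w j \<noteq> u'"
  using u_neq u_w u'_w by metis+

lemma verts_simps [simp]: "u \<in> verts Q" "u' \<in> verts Q" "w j \<in> verts Q"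
  unfolding verts_eq by auto

lemma vert_cases:
  assumes "i \<in> verts Q"
  obtains "i = u" | "i = u'" | j where "i = w j"
  using assms unfolding verts_eq by auto

lemma edge_arrow:
  assumes "{x, y} \<in> {{u, w 0}, {u', w 0}} \<union> {{w j, w (Suc j)} | j. True}"
  shows "(x, y) \<in> arrows Q \<or> (y, x) \<in> arrows Q" "x \<noteq> y \<Longrightarrow> \<not> ((x, y) \<in> arrows Q \<and> (y, x) \<in> arrows Q)"
proof -
  have "{x, y} \<in> (\<lambda>(i, j). {i, j}) ` arrows Q" using assms unfolding bij_betw_imp_surj_on[OF edges] .
  then obtain e where e: "e \<in> arrows Q" "{x, y} = (\<lambda>(i, j). {i, j}) e" by (rule imageE)
  obtain i j where ij: "e = (i, j)" by (cases e)
  have "(x = i \<and> y = j) \<or> (x = j \<and> y = i)" using e(2) unfolding ij by (simp add: doubleton_eq_iff)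
  then show "(x, y) \<in> arrows Q \<or> (y, x) \<in> arrows Q" using e(1) unfolding ij by blast
  show "\<not> ((x, y) \<in> arrows Q \<and> (y, x) \<in> arrows Q)" if xy: "x \<noteq> y"
  proof
    assume both: "(x, y) \<in> arrows Q \<and> (y, x) \<in> arrows Q"
    have "(x, y) = (y, x)"
    proof (rule inj_onD[OF bij_betw_imp_inj_on[OF edges]])
      show "(\<lambda>(i, j). {i, j}) (x, y) = (\<lambda>(i, j). {i, j}) (y, x)" unfolding prod.case by (rule insert_commute)
    qed (use both in blast)+
    then show False using xy by simp
  qed
qed

lemma ar_arrow [simp]: "ar j \<in> arrows Q"
  using edge_arrow(1)[of "w j" "w (Suc j)"] unfolding ar_def out_def by auto

lemma arm_arrow [simp]: "arm u \<in> arrows Q" "arm u' \<in> arrows Q"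
  using edge_arrow(1)[of u "w 0"] edge_arrow(1)[of u' "w 0"] unfolding arm_def arm_out_def by auto

lemma arrow_cases:
  assumes a: "a \<in> arrows Q"
  obtains "a = arm u" | "a = arm u'" | j where "a = ar j"
proof -
  obtain x y where xy: "a = (x, y)" by (cases a)
  have mem: "{x, y} \<in> {{u, w 0}, {u', w 0}} \<union> {{w j, w (Suc j)} | j. True}"
    using bij_betw_apply[OF edges a] unfolding xy prod.case .
  have one: "\<not> ((y, x) \<in> arrows Q)" if "x \<noteq> y" using edge_arrow(2)[OF mem that] a xy by blast
  consider "{x, y} = {u, w 0}" | "{x, y} = {u', w 0}" | j where "{x, y} = {w j, w (Suc j)}" using mem by blast
  then show thesis
  proof cases
    case 1
    then have "a = arm u" using xy a one unfolding arm_def arm_out_def by (auto simp: doubleton_eq_iff)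
    then show ?thesis by (rule that(1))
  next
    case 2
    then have "a = arm u'" using xy a one unfolding arm_def arm_out_def by (auto simp: doubleton_eq_iff)
    then show ?thesis by (rule that(2))
  next
    case (3 j)
    then have "a = ar j" using xy a one unfolding ar_def out_def by (auto simp: doubleton_eq_iff)
    then show ?thesis by (rule that(3))
  qed
qed

lemma tail_out: "N \<le> j \<Longrightarrow> out j"
  using tail_outward unfolding out_def .

lemma ar_simps:
  "out j \<Longrightarrow> fst (ar j) = w j" "out j \<Longrightarrow> snd (ar j) = w (Suc j)"
  "\<not> out j \<Longrightarrow> fst (ar j) = w (Suc j)" "\<not> out j \<Longrightarrow> snd (ar j) = w j"
  unfolding ar_def by auto

lemma arm_simps:
  "arm_out z \<Longrightarrow> fst (arm z) = w 0" "arm_out z \<Longrightarrow> snd (arm z) = z"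
  "\<not> arm_out z \<Longrightarrow> fst (arm z) = z" "\<not> arm_out z \<Longrightarrow> snd (arm z) = w 0"
  unfolding arm_def by auto

definition indep2 :: "'b \<Rightarrow> 'b \<Rightarrow> bool" where
  "indep2 x y \<longleftrightarrow> (\<forall>\<alpha> \<beta>. scale \<alpha> x + scale \<beta> y = 0 \<longrightarrow> \<alpha> = 0 \<and> \<beta> = 0)"

lemma in_span_pair: "v \<in> span {x, y} \<longleftrightarrow> (\<exists>\<alpha> \<beta>. v = scale \<alpha> x + scale \<beta> y)"
proof
  assume "v \<in> span {x, y}"
  then obtain k where "v - scale k x \<in> span {y}" using span_breakdown_eq[of v x "{y}"] by auto
  then obtain l where "v - scale k x = scale l y" unfolding span_singleton by blast
  then have "v = scale k x + scale l y" by (simp add: algebra_simps)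
  then show "\<exists>\<alpha> \<beta>. v = scale \<alpha> x + scale \<beta> y" by blast
next
  assume "\<exists>\<alpha> \<beta>. v = scale \<alpha> x + scale \<beta> y"
  then show "v \<in> span {x, y}" by (auto intro!: span_add span_scale intro: span_base)
qed

lemma indep2_iff: "indep2 x y \<longleftrightarrow> x \<noteq> y \<and> independent {x, y}"
proof
  assume *: "indep2 x y"
  have y0: "y \<noteq> 0" using * unfolding indep2_def by (metis add.right_neutral scale_zero_left scale_zero_right zero_neq_one)
  have xy: "x \<noteq> y"
  proof
    assume "x = y"
    then have "scale 1 x + scale (- 1) y = 0" by simp
    then show False using * unfolding indep2_def by (metis zero_neq_one)
  qed
  have "x \<notin> span {y}"
  proof
    assume "x \<in> span {y}"
    then obtain k where "x = scale k y" unfolding span_singleton by blast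
    then have "scale 1 x + scale (- k) y = 0" by simp
    then show False using * unfolding indep2_def by (metis zero_neq_one)
  qed
  then show "x \<noteq> y \<and> independent {x, y}" using xy y0 by (simp add: independent_insert)
next
  assume *: "x \<noteq> y \<and> independent {x, y}"
  then have nin: "x \<notin> span {y}" and y0: "y \<noteq> 0" by (auto simp: independent_insert)
  show "indep2 x y" unfolding indep2_def
  proof (intro allI impI)
    fix \<alpha> \<beta> assume eq: "scale \<alpha> x + scale \<beta> y = 0"
    have "\<alpha> = 0"
    proof (rule ccontr)
      assume "\<alpha> \<noteq> 0"
      have "scale \<alpha> x = scale (- \<beta>) y" using eq by (simp add: eq_neg_iff_add_eq_0)
      then have "scale (inverse \<alpha>) (scale \<alpha> x) = scale (inverse \<alpha>) (scale (- \<beta>) y)" by simp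
      then have "x = scale (inverse \<alpha>) (scale (- \<beta>) y)" using \<open>\<alpha> \<noteq> 0\<close> by simp
      then show False using nin by (metis span_base span_scale singletonI)
    qed
    then show "\<alpha> = 0 \<and> \<beta> = 0" using eq y0 by simp
  qed
qed

text \<open>The supports of roots with values in \<open>{0, 1}\<close>: the end of an arm, or an interval of the line that may be extended by ends of
arms if it starts at the branching vertex.\<close>

definition thin_support :: "'v set \<Rightarrow> bool" where
  "thin_support I \<longleftrightarrow> I = {u} \<or> I = {u'} \<or>
     (\<exists>p q Z. enat p \<le> q \<and> Z \<subseteq> {u, u'} \<and> (Z = {} \<or> p = 0) \<and> I = Z \<union> {w j | j. p \<le> j \<and> enat j \<le> q})"

lemma thin_support_cases [consumes 1]:
  assumes "thin_support I"
  obtains "I = {u}" | "I = {u'}" | p q Z where "enat p \<le> q" "Z \<subseteq> {u, u'}" "Z = {} \<or> p = 0"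
    "I = Z \<union> {w j | j. p \<le> j \<and> enat j \<le> q}"
  using assms unfolding thin_support_def
proof (elim disjE)
  assume "\<exists>p q Z. enat p \<le> q \<and> Z \<subseteq> {u, u'} \<and> (Z = {} \<or> p = 0) \<and> I = Z \<union> {w j | j. p \<le> j \<and> enat j \<le> q}"
  then show thesis by (elim exE conjE) (rule that(3))
qed (erule that(1), erule that(2))

definition thin :: "('v, 'b) quiver_rep \<Rightarrow> 'v set \<Rightarrow> bool" where
  "thin V I \<longleftrightarrow> quiver_rep scale Q V \<and> (\<exists>x. (\<forall>i\<in>verts Q. vspace V i = span {x i} \<and> (x i \<noteq> 0 \<longleftrightarrow> i \<in> I)) \<and>
     (\<forall>a\<in>arrows Q. fst a \<in> I \<longrightarrow> snd a \<in> I \<longrightarrow> amap V a (x (fst a)) = x (snd a)))"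

text \<open>A thick brick is built from two strands \<open>x\<close> and \<open>y\<close> along the line that live up to \<open>w a\<close> and \<open>w b\<close>, and
at \<open>w 0\<close> the three lines spanned by \<open>x 0\<close>, \<open>y 0\<close> and \<open>x 0 - y 0\<close> are distinguished: the line of \<open>x\<close> by the vertex at which one strand ends while the other goes on,
the other two by the arms. For the line of \<open>x\<close> to be distinguished, \<open>x\<close> has to be the strand that is killed first if the arrow there points outwards (a kernel), and
the strand that survives if it points inwards (an image).\<close>

definition thick_ends :: "enat \<Rightarrow> enat \<Rightarrow> bool" where
  "thick_ends a b \<longleftrightarrow> (\<exists>k. (out k \<and> a = enat k \<and> enat k < b) \<or> (\<not> out k \<and> b = enat k \<and> enat k < a))"

text \<open>The strands are extended by \<open>0\<close> beyond their ends. The vectors \<open>z\<close> and \<open>z'\<close> span the spaces at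
\<open>u\<close> and \<open>u'\<close>; the arm \<open>u\<close> marks the line of \<open>y 0\<close> and \<open>u'\<close> that of \<open>x 0 - y 0\<close>, as an image or as a kernel.\<close>

definition thick_frame ::
  "('v, 'b) quiver_rep \<Rightarrow> enat \<Rightarrow> enat \<Rightarrow> (nat \<Rightarrow> 'b) \<Rightarrow> (nat \<Rightarrow> 'b) \<Rightarrow> 'b \<Rightarrow> 'b \<Rightarrow> bool" where
  "thick_frame V a b x y z z' \<longleftrightarrow>
     (\<forall>j. (x j \<noteq> 0 \<longleftrightarrow> enat j \<le> a) \<and> (y j \<noteq> 0 \<longleftrightarrow> enat j \<le> b) \<and> vspace V (w j) = span {x j, y j} \<and>
        (enat j \<le> a \<longrightarrow> enat j \<le> b \<longrightarrow> indep2 (x j) (y j))) \<and>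
     z \<noteq> 0 \<and> z' \<noteq> 0 \<and> vspace V u = span {z} \<and> vspace V u' = span {z'} \<and>
     (\<forall>j. out j \<longrightarrow> amap V (ar j) (x j) = x (Suc j) \<and> amap V (ar j) (y j) = y (Suc j)) \<and>
     (\<forall>j. \<not> out j \<longrightarrow> (x (Suc j) \<noteq> 0 \<longrightarrow> amap V (ar j) (x (Suc j)) = x j) \<and>
        (y (Suc j) \<noteq> 0 \<longrightarrow> amap V (ar j) (y (Suc j)) = y j)) \<and>
     (if arm_out u then amap V (arm u) (y 0) = 0 \<and> amap V (arm u) (x 0) = z else amap V (arm u) z = y 0) \<and>
     (if arm_out u' then amap V (arm u') (y 0) = z' \<and> amap V (arm u') (x 0) = z' else amap V (arm u') z' = x 0 - y 0)"

definition thick :: "('v, 'b) quiver_rep \<Rightarrow> enat \<Rightarrow> enat \<Rightarrow> bool" where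
  "thick V a b \<longleftrightarrow> quiver_rep scale Q V \<and> (\<exists>x y z z'. thick_frame V a b x y z z')"

definition root_brick :: "('v, 'b) quiver_rep \<Rightarrow> bool" where
  "root_brick V \<longleftrightarrow> (\<exists>I. thin_support I \<and> thin V I) \<or> (\<exists>a b. thick_ends a b \<and> thick V a b)"

lemma scalar_forward:
  assumes V: "quiver_rep scale Q V" and f: "morphism scale Q V V f" and a: "a \<in> arrows Q"
    and x: "x \<in> vspace V (fst a)" "f (fst a) x = scale c x"
  shows "f (snd a) (amap V a x) = scale c (amap V a x)"
  using morphismD(3)[OF f a x(1)] x(2) linear_betweenD(3)[OF quiver_repD(2)[OF V a] x(1)] by simp

lemma scalar_backward:
  assumes V: "quiver_rep scale Q V" and f: "morphism scale Q V V f" and a: "a \<in> arrows Q"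
    and x: "x \<in> vspace V (fst a)" and y: "f (snd a) (amap V a x) = scale c (amap V a x)"
    and inj: "\<And>v. v \<in> vspace V (fst a) \<Longrightarrow> amap V a v = 0 \<Longrightarrow> v = 0"
  shows "f (fst a) x = scale c x"
proof -
  have va: "fst a \<in> verts Q" using arrow_verts[OF a] by auto
  note L = quiver_repD(2)[OF V a] and S = quiver_repD(1)[OF V va]
  have fx: "f (fst a) x \<in> vspace V (fst a)" by (rule morphismD(2)[OF f va x])
  have cx: "scale c x \<in> vspace V (fst a)" by (rule subspace_scale[OF S x])
  have "amap V a (f (fst a) x - scale c x) = amap V a (f (fst a) x) - amap V a (scale c x)"
    by (rule linear_between_diff[OF S L fx cx])
  also have "\<dots> = 0" using y morphismD(3)[OF f a x] linear_betweenD(3)[OF L x] by simp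
  finally have "f (fst a) x - scale c x = 0" using inj subspace_diff[OF S fx cx] by blast
  then show ?thesis by simp
qed

lemma scalar_on_span:
  assumes f: "linear_between scale U W f" and U: "U = span X" and X: "\<And>x. x \<in> X \<Longrightarrow> f x = scale c x" and x: "x \<in> U"
  shows "f x = scale c x"
proof -
  have S: "subspace U" using U by simp
  have "x \<in> span X" using x U by simp
  then have "x \<in> U \<and> f x = scale c x"
  proof (induction rule: span_induct_alt)
    case base
    show ?case using linear_between_zero[OF S f] subspace_0[OF S] by simp
  next
    case (step r b y)
    have b: "b \<in> U" using step U span_base by blast
    have rb: "scale r b \<in> U" by (rule subspace_scale[OF S b])
    show ?case using linear_betweenD(2)[OF f rb] linear_betweenD(3)[OF f b] X[OF step(1)] step subspace_add[OF S rb]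
      by (simp add: scale_right_distrib scale_left_commute)
  qed
  then show ?thesis ..
qed

text \<open>An endomorphism multiplies each of the vectors \<open>x i\<close> by a scalar, and the scalars at adjacent vertices of the connected support agree.\<close>

lemma thin_brick:
  assumes I: "thin_support I" and V: "thin V I"
  shows "brick V"
proof -
  have rep: "quiver_rep scale Q V" using V unfolding thin_def by blast
  obtain x where x: "\<forall>i\<in>verts Q. vspace V i = span {x i} \<and> (x i \<noteq> 0 \<longleftrightarrow> i \<in> I)"
     "\<forall>a\<in>arrows Q. fst a \<in> I \<longrightarrow> snd a \<in> I \<longrightarrow> amap V a (x (fst a)) = x (snd a)" using V unfolding thin_def by blast
  have xV: "x i \<in> vspace V i" if "i \<in> verts Q" for i using x(1) that by (simp add: span_base)
  have IV: "I \<subseteq> verts Q" using I unfolding thin_support_def by auto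
  have "I \<noteq> {}" using I unfolding thin_support_def by auto
  then obtain i0 where i0: "i0 \<in> I" "i0 \<in> verts Q" using IV by blast
  then have nz: "\<not> zero_rep Q V" using x(1) xV unfolding zero_rep_def by blast
  have "\<exists>c. \<forall>i\<in>verts Q. \<forall>v\<in>vspace V i. f i v = scale c v" if f: "morphism scale Q V V f" for f
  proof -
    have "\<exists>c. f i (x i) = scale c (x i)" if i: "i \<in> verts Q" for i
    proof -
      have "f i (x i) \<in> span {x i}" using morphismD(2)[OF f i xV[OF i]] x(1) i by simp
      then show ?thesis unfolding span_singleton by blast
    qed
    then obtain c where c: "\<And>i. i \<in> verts Q \<Longrightarrow> f i (x i) = scale (c i) (x i)" by metis
    have adj: "c (fst a) = c (snd a)" if a: "a \<in> arrows Q" and aI: "fst a \<in> I" "snd a \<in> I" for a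
    proof -
      have va: "fst a \<in> verts Q" "snd a \<in> verts Q" using arrow_verts[OF a] by auto
      have "f (snd a) (x (snd a)) = scale (c (fst a)) (x (snd a))"
        using scalar_forward[OF rep f a xV[OF va(1)] c[OF va(1)]] x(2) a aI by simp
      then have "scale (c (snd a)) (x (snd a)) = scale (c (fst a)) (x (snd a))" using c[OF va(2)] by simp
      then show ?thesis using x(1) va(2) aI(2) by auto
    qed
    have adj_ar: "c (w j) = c (w (Suc j))" if "w j \<in> I" "w (Suc j) \<in> I" for j
      using adj[of "ar j"] that by (cases "out j") (auto simp: ar_simps)
    have adj_arm: "c z = c (w 0)" if "z \<in> {u, u'}" "z \<in> I" "w 0 \<in> I" for z
      using adj[of "arm z"] that by (cases "arm_out z") (auto simp: arm_simps)
    have "\<exists>d. \<forall>i\<in>I. c i = d"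
    proof -
      show ?thesis using I
      proof (cases rule: thin_support_cases)
        case (3 p q Z)
        have wI: "w j \<in> I \<longleftrightarrow> p \<le> j \<and> enat j \<le> q" for j using 3(2,4) by auto
        have line: "c (w j) = c (w p)" if "p \<le> j" "enat j \<le> q" for j
          using that
        proof (induction j rule: dec_induct)
          case (step j)
          have "enat j \<le> q" using step.prems by (meson enat_ord_simps(1) le_SucI order.refl order.trans)
          then show ?case using step adj_ar[of j] wI by simp
        qed simp
        have arms: "c i = c (w p)" if i: "i \<in> Z" for i
        proof -
          have p0: "p = 0" using 3(3) i by blast
          have "enat 0 \<le> q" by (simp add: zero_enat_def[symmetric])
          then have "w 0 \<in> I" using wI[of 0] p0 by blast
          moreover have "i \<in> {u, u'}" "i \<in> I" using i 3(2,4) by blast+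
          ultimately show ?thesis using adj_arm[of i] p0 by blast
        qed
        have "\<forall>i\<in>I. c i = c (w p)" unfolding 3(4) using line arms by blast
        then show ?thesis by blast
      qed auto
    qed
    then obtain d where d: "\<forall>i\<in>I. c i = d" by blast
    have "f i v = scale d v" if i: "i \<in> verts Q" and v: "v \<in> vspace V i" for i v
    proof (rule scalar_on_span[OF morphismD(1)[OF f i], of "{x i}"])
      show "f i y = scale d y" if "y \<in> {x i}" for y
        using that c[OF i] d x(1) i by (cases "i \<in> I") auto
    qed (use x(1) i v in auto)
    then show ?thesis by blast
  qed
  then show ?thesis unfolding brick_def using rep nz by blast
qed

lemma injective_on_pair:
  assumes L: "linear_between scale U W f" and U: "U = span {x, y}" and ind: "indep2 (f x) (f y)" and v: "v \<in> U" "f v = 0"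
  shows "v = 0"
proof -
  have S: "subspace U" using U by simp
  have xy: "x \<in> U" "y \<in> U" using U by (auto intro: span_base)
  obtain \<alpha> \<beta> where ab: "v = scale \<alpha> x + scale \<beta> y" using v(1) unfolding U in_span_pair by blast
  have "f v = scale \<alpha> (f x) + scale \<beta> (f y)"
    unfolding ab using linear_betweenD(2)[OF L subspace_scale[OF S xy(1)] subspace_scale[OF S xy(2)]]
      linear_betweenD(3)[OF L] xy by simp
  then have "\<alpha> = 0 \<and> \<beta> = 0" using v(2) ind unfolding indep2_def by simp
  then show ?thesis using ab by simp
qed

lemma injective_on_line:
  assumes L: "linear_between scale U W f" and U: "U = span {x}" and ind: "f x \<noteq> 0" and v: "v \<in> U" "f v = 0"
  shows "v = 0"
proof -
  have "x \<in> U" using U by (auto intro: span_base)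
  moreover obtain \<alpha> where "v = scale \<alpha> x" using v(1) unfolding U span_singleton by blast
  ultimately show ?thesis using linear_betweenD(3)[OF L] v(2) ind by auto
qed

lemma enat_Suc_le: "enat (Suc j) \<le> a \<Longrightarrow> enat j \<le> a"
  by (meson enat_ord_simps(1) le_SucI order.refl order.trans)

text \<open>An endomorphism preserves the three lines at \<open>w 0\<close> spanned by \<open>x 0\<close>, \<open>y 0\<close> and \<open>x 0 - y 0\<close>, hence is a scalar there. The scalar is
propagated to the other vertices.\<close>

lemma thick_brick:
  assumes ends: "thick_ends a b" and V: "thick V a b"
  shows "brick V"
proof -
  have rep: "quiver_rep scale Q V" using V unfolding thick_def by blast
  obtain x y z z' where fr: "thick_frame V a b x y z z'" using V unfolding thick_def by blast
  have x0: "x j \<noteq> 0 \<longleftrightarrow> enat j \<le> a" and y0: "y j \<noteq> 0 \<longleftrightarrow> enat j \<le> b" and Vw: "vspace V (w j) = span {x j, y j}"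
    and ind: "enat j \<le> a \<Longrightarrow> enat j \<le> b \<Longrightarrow> indep2 (x j) (y j)" for j using fr unfolding thick_frame_def by auto
  have z: "z \<noteq> 0" "vspace V u = span {z}" and z': "z' \<noteq> 0" "vspace V u' = span {z'}"
    using fr unfolding thick_frame_def by auto
  have o: "amap V (ar j) (x j) = x (Suc j)" "amap V (ar j) (y j) = y (Suc j)" if "out j" for j
    using fr that unfolding thick_frame_def by auto
  have i: "x (Suc j) \<noteq> 0 \<Longrightarrow> amap V (ar j) (x (Suc j)) = x j" "y (Suc j) \<noteq> 0 \<Longrightarrow> amap V (ar j) (y (Suc j)) = y j" if "\<not> out j" for j
    using fr that unfolding thick_frame_def by auto
  have uo: "amap V (arm u) (y 0) = 0" "amap V (arm u) (x 0) = z" if "arm_out u" using fr that unfolding thick_frame_def by auto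
  have ui: "amap V (arm u) z = y 0" if "\<not> arm_out u" using fr that unfolding thick_frame_def by auto
  have uo': "amap V (arm u') (y 0) = z'" "amap V (arm u') (x 0) = z'" if "arm_out u'" using fr that unfolding thick_frame_def by auto
  have ui': "amap V (arm u') z' = x 0 - y 0" if "\<not> arm_out u'" using fr that unfolding thick_frame_def by auto
  have xV: "x j \<in> vspace V (w j)" and yV: "y j \<in> vspace V (w j)" for j unfolding Vw by (auto intro: span_base)
  have zV: "z \<in> vspace V u" "z' \<in> vspace V u'" using z z' by (auto intro: span_base)
  have S: "subspace (vspace V (w j))" for j unfolding Vw by simp
  have nz: "\<not> zero_rep Q V" using z zV unfolding zero_rep_def by (metis singletonD verts_simps(1))
  have ab0: "enat 0 \<le> a" "enat 0 \<le> b" by (simp_all add: zero_enat_def[symmetric])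
  note ind0 = ind[OF ab0]
  have "\<exists>c. \<forall>i\<in>verts Q. \<forall>v\<in>vspace V i. f i v = scale c v" if f: "morphism scale Q V V f" for f
  proof -
    have comb: "amap V e (scale \<alpha> v + scale \<beta> v') = scale \<alpha> (amap V e v) + scale \<beta> (amap V e v')"
      if e: "e \<in> arrows Q" and v: "v \<in> vspace V (fst e)" "v' \<in> vspace V (fst e)" for e \<alpha> \<beta> v v'
    proof -
      have Se: "subspace (vspace V (fst e))" using quiver_repD(1)[OF rep] arrow_verts[OF e] by blast
      note L = linear_betweenD[OF quiver_repD(2)[OF rep e]]
      show ?thesis using L(2)[OF subspace_scale[OF Se v(1)] subspace_scale[OF Se v(2)]] L(3)[OF v(1)] L(3)[OF v(2)] by simp
    qed
    have fco: "\<exists>\<alpha> \<beta>. f (w j) v = scale \<alpha> (x j) + scale \<beta> (y j)" if "v \<in> vspace V (w j)" for j v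
      using morphismD(2)[OF f verts_simps(3) that] unfolding Vw in_span_pair .
    have fu: "\<exists>c. f u z = scale c z" using morphismD(2)[OF f verts_simps(1) zV(1)] unfolding z(2) span_singleton by blast
    have fu': "\<exists>c. f u' z' = scale c z'" using morphismD(2)[OF f verts_simps(2) zV(2)] unfolding z'(2) span_singleton by blast
    have f0: "f i 0 = 0" if "i \<in> verts Q" for i
      using linear_between_zero[OF quiver_repD(1)[OF rep that] morphismD(1)[OF f that]] .
    have "\<exists>l. f (w 0) (y 0) = scale l (y 0)"
    proof (cases "arm_out u")
      case True
      obtain \<alpha> \<beta> where ab: "f (w 0) (y 0) = scale \<alpha> (x 0) + scale \<beta> (y 0)" using fco[OF yV] by blast
      have "scale \<alpha> z + scale \<beta> 0 = amap V (arm u) (f (w 0) (y 0))"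
        unfolding ab using comb[of "arm u" "x 0" "y 0"] xV yV uo[OF True] arm_simps[of u] True by simp
      also have "\<dots> = f u (amap V (arm u) (y 0))"
        using morphismD(3)[OF f arm_arrow(1), of "y 0"] yV arm_simps[of u] True by simp
      also have "\<dots> = 0" using uo[OF True] f0 by simp
      finally have "\<alpha> = 0" using z by simp
      then show ?thesis using ab by auto
    next
      case False
      then show ?thesis
        using fu scalar_forward[OF rep f arm_arrow(1), of z] zV arm_simps[of u] ui by auto
    qed
    then obtain l where l: "f (w 0) (y 0) = scale l (y 0)" by blast
    have "\<exists>m. f (w 0) (x 0 - y 0) = scale m (x 0 - y 0)"
    proof (cases "arm_out u'")
      case True
      have mem: "x 0 - y 0 \<in> vspace V (w 0)" by (rule subspace_diff[OF S xV yV])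
      obtain \<alpha> \<beta> where ab: "f (w 0) (x 0 - y 0) = scale \<alpha> (x 0) + scale \<beta> (y 0)" using fco[OF mem] by blast
      have "scale \<alpha> z' + scale \<beta> z' = amap V (arm u') (f (w 0) (x 0 - y 0))"
        unfolding ab using comb[of "arm u'" "x 0" "y 0"] xV yV uo'[OF True] arm_simps[of u'] True by simp
      also have "\<dots> = f u' (amap V (arm u') (x 0 - y 0))"
        using morphismD(3)[OF f arm_arrow(2), of "x 0 - y 0"] mem arm_simps[of u'] True by simp
      also have "amap V (arm u') (x 0 - y 0) = 0"
        using comb[of "arm u'" "x 0" "y 0" 1 "- 1"] xV yV uo'[OF True] arm_simps[of u'] True by simp
      also have "f u' 0 = 0" using f0 by simp
      finally have "scale (\<alpha> + \<beta>) z' = 0" by (simp add: scale_left_distrib)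
      then have "\<beta> = - \<alpha>" using z' by (simp add: eq_neg_iff_add_eq_0 add.commute)
      then have "f (w 0) (x 0 - y 0) = scale \<alpha> (x 0 - y 0)" using ab by (simp add: scale_right_diff_distrib)
      then show ?thesis by blast
    next
      case False
      then show ?thesis
        using fu' scalar_forward[OF rep f arm_arrow(2), of z'] zV arm_simps[of u'] ui' by auto
    qed
    then obtain m where m: "f (w 0) (x 0 - y 0) = scale m (x 0 - y 0)" by blast
    obtain k where k: "(out k \<and> a = enat k \<and> enat k < b) \<or> (\<not> out k \<and> b = enat k \<and> enat k < a)"
      using ends unfolding thick_ends_def by blast
    have kab: "enat k \<le> a" "enat k \<le> b" using k by auto
    (* The vertex where only one strand goes on singles out the line of x at w k, as the kernel of the next arrow or as its image. *)
    have "\<exists>n. f (w k) (x k) = scale n (x k)"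
    proof (cases "out k")
      case True
      then have ak: "a = enat k" "enat k < b" using k by auto
      have xs: "x (Suc k) = 0" using x0[of "Suc k"] ak by simp
      have ys: "y (Suc k) \<noteq> 0" using y0[of "Suc k"] ak(2) by (simp add: Suc_ile_eq)
      obtain \<alpha> \<beta> where ab: "f (w k) (x k) = scale \<alpha> (x k) + scale \<beta> (y k)" using fco[OF xV] by blast
      have "scale \<alpha> (x (Suc k)) + scale \<beta> (y (Suc k)) = amap V (ar k) (f (w k) (x k))"
        unfolding ab using comb[of "ar k" "x k" "y k"] xV yV o[OF True] ar_simps[of k] True by simp
      also have "\<dots> = f (w (Suc k)) (amap V (ar k) (x k))"
        using morphismD(3)[OF f ar_arrow, of "x k" k] xV ar_simps[of k] True by simp
      also have "\<dots> = 0" using o[OF True] xs f0 by simp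
      finally have "\<beta> = 0" using xs ys by simp
      then show ?thesis using ab by auto
    next
      case False
      then have bk: "b = enat k" "enat k < a" using k by auto
      have ys: "y (Suc k) = 0" using y0[of "Suc k"] bk by simp
      have xs: "x (Suc k) \<noteq> 0" using x0[of "Suc k"] bk(2) by (simp add: Suc_ile_eq)
      obtain \<alpha> \<beta> where "f (w (Suc k)) (x (Suc k)) = scale \<alpha> (x (Suc k)) + scale \<beta> (y (Suc k))" using fco[OF xV] by blast
      then have "f (w (Suc k)) (x (Suc k)) = scale \<alpha> (x (Suc k))" using ys by simp
      then show ?thesis
        using scalar_forward[OF rep f ar_arrow, of "x (Suc k)" k] xV ar_simps[of k] False i(1)[OF False xs] by auto
    qed
    then obtain n where n: "f (w k) (x k) = scale n (x k)" by blast
    have inj_ar: "v = 0" if "enat (Suc j) \<le> a" "enat (Suc j) \<le> b" "v \<in> vspace V (fst (ar j))" "amap V (ar j) v = 0" for j v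
    proof (cases "out j")
      case True
      show ?thesis
        by (rule injective_on_pair[OF quiver_repD(2)[OF rep ar_arrow], of j "x j" "y j"])
          (use that ind[of "Suc j"] o[OF True] ar_simps[of j] True Vw in auto)
    next
      case False
      show ?thesis
        by (rule injective_on_pair[OF quiver_repD(2)[OF rep ar_arrow], of j "x (Suc j)" "y (Suc j)"])
          (use that ind[of j] i[OF False] ar_simps[of j] False Vw x0 y0 enat_Suc_le[OF that(1)] enat_Suc_le[OF that(2)] in auto)
    qed
    (* As long as both strands are alive the arrow maps are injective, so the line of x can be traced back to w 0. *)
    have down: "f (w j) (x j) = scale n (x j)" if "j \<le> k" for j
      using that
    proof (induction j rule: inc_induct)
      case base
      show ?case by (rule n)
    next
      case (step j)
      have "enat (Suc j) \<le> enat k" using step by simp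
      then have le: "enat (Suc j) \<le> a" "enat (Suc j) \<le> b" using kab order.trans by blast+
      show ?case
      proof (cases "out j")
        case True
        show ?thesis
          using scalar_backward[OF rep f ar_arrow, of "x j" j n] inj_ar[OF le] xV ar_simps[of j] True o[OF True] step by simp
      next
        case False
        have "x (Suc j) \<noteq> 0" using x0 le by simp
        then show ?thesis
          using scalar_forward[OF rep f ar_arrow, of "x (Suc j)" j n] xV ar_simps[of j] False i(1)[OF False] step by simp
      qed
    qed
    have n0: "f (w 0) (x 0) = scale n (x 0)" using down by simp
    have "f (w 0) (x 0 - y 0) = f (w 0) (x 0) - f (w 0) (y 0)"
      by (rule linear_between_diff[OF S morphismD(1)[OF f verts_simps(3)] xV yV])
    then have "scale m (x 0 - y 0) = scale n (x 0) - scale l (y 0)" using m n0 l by simp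
    then have "scale (m - n) (x 0) + scale (l - m) (y 0) = 0"
      by (simp add: scale_right_diff_distrib scale_left_diff_distrib algebra_simps)
    then have "m - n = 0 \<and> l - m = 0" using ind0 unfolding indep2_def by blast
    then have mnl: "m = n" "l = n" by auto
    have all: "f (w j) (x j) = scale n (x j) \<and> f (w j) (y j) = scale n (y j)" for j
    proof (induction j)
      case 0
      show ?case using n0 l mnl by simp
    next
      case (Suc j)
      show ?case
      proof (cases "out j")
        case True
        show ?thesis
          using scalar_forward[OF rep f ar_arrow, of "x j" j n] scalar_forward[OF rep f ar_arrow, of "y j" j n]
            xV yV ar_simps[of j] True o[OF True] Suc by simp
      next
        case False
        have inj: "v = 0" if v: "v \<in> vspace V (w (Suc j))" "amap V (ar j) v = 0" for v
        proof (cases "enat (Suc j) \<le> a \<and> enat (Suc j) \<le> b")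
          case True
          then show ?thesis using inj_ar[of j v] v ar_simps[of j] False by simp
        next
          case nb: False
          then consider "x (Suc j) = 0" | "y (Suc j) = 0" using x0 y0 by blast
          then show ?thesis
          proof cases
            case 1
            then have sp: "vspace V (w (Suc j)) = span {y (Suc j)}" using Vw by simp
            show ?thesis
            proof (cases "y (Suc j) = 0")
              case True
              then show ?thesis using sp v by simp
            next
              case ny: False
              then have "enat j \<le> b" using y0 enat_Suc_le by blast
              then have "amap V (ar j) (y (Suc j)) \<noteq> 0" using i(2)[OF False ny] y0 by simp
              then show ?thesis
                using injective_on_line[OF quiver_repD(2)[OF rep ar_arrow], of j "y (Suc j)" v] sp v ar_simps[of j] False by simp
            qed
          next
            case 2
            then have sp: "vspace V (w (Suc j)) = span {x (Suc j)}" using Vw[of "Suc j"] by (simp add: insert_commute)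
            show ?thesis
            proof (cases "x (Suc j) = 0")
              case True
              then show ?thesis using sp v by simp
            next
              case nx: False
              then have "enat j \<le> a" using x0 enat_Suc_le by blast
              then have "amap V (ar j) (x (Suc j)) \<noteq> 0" using i(1)[OF False nx] x0 by simp
              then show ?thesis
                using injective_on_line[OF quiver_repD(2)[OF rep ar_arrow], of j "x (Suc j)" v] sp v ar_simps[of j] False by simp
            qed
          qed
        qed
        have "f (w (Suc j)) (x (Suc j)) = scale n (x (Suc j))"
        proof (cases "x (Suc j) = 0")
          case True
          then show ?thesis using f0 by simp
        next
          case nx: False
          show ?thesis
            using scalar_backward[OF rep f ar_arrow, of "x (Suc j)" j n] inj xV ar_simps[of j] False i(1)[OF False nx] Suc by simp
        qed
        moreover have "f (w (Suc j)) (y (Suc j)) = scale n (y (Suc j))"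
        proof (cases "y (Suc j) = 0")
          case True
          then show ?thesis using f0 by simp
        next
          case ny: False
          show ?thesis
            using scalar_backward[OF rep f ar_arrow, of "y (Suc j)" j n] inj yV ar_simps[of j] False i(2)[OF False ny] Suc by simp
        qed
        ultimately show ?thesis ..
      qed
    qed
    have allu: "f u z = scale n z"
    proof (cases "arm_out u")
      case True
      show ?thesis using scalar_forward[OF rep f arm_arrow(1), of "x 0" n] xV all[of 0] arm_simps[of u] True uo[OF True] by simp
    next
      case False
      have "y 0 \<noteq> 0" using y0 ab0 by simp
      then show ?thesis
        using scalar_backward[OF rep f arm_arrow(1), of z n] injective_on_line[OF quiver_repD(2)[OF rep arm_arrow(1)], of z]
          zV z all[of 0] arm_simps[of u] False ui[OF False] by simp
    qed
    have allu': "f u' z' = scale n z'"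
    proof (cases "arm_out u'")
      case True
      show ?thesis using scalar_forward[OF rep f arm_arrow(2), of "x 0" n] xV all[of 0] arm_simps[of u'] True uo'[OF True] by simp
    next
      case False
      have "x 0 - y 0 \<noteq> 0" using ind0 unfolding indep2_iff by simp
      then show ?thesis
        using scalar_backward[OF rep f arm_arrow(2), of z' n] injective_on_line[OF quiver_repD(2)[OF rep arm_arrow(2)], of z']
          zV z' m mnl arm_simps[of u'] False ui'[OF False] by simp
    qed
    have "f i v = scale n v" if iv: "i \<in> verts Q" and v: "v \<in> vspace V i" for i v
      using iv
    proof (cases rule: vert_cases)
      case 1
      show ?thesis by (rule scalar_on_span[OF morphismD(1)[OF f iv], of "{z}"]) (use 1 v z allu in auto)
    next
      case 2
      show ?thesis by (rule scalar_on_span[OF morphismD(1)[OF f iv], of "{z'}"]) (use 2 v z' allu' in auto)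
    next
      case (3 j)
      show ?thesis by (rule scalar_on_span[OF morphismD(1)[OF f iv], of "{x j, y j}"]) (use 3 v Vw all in auto)
    qed
    then show ?thesis by blast
  qed
  then show ?thesis unfolding brick_def using rep nz by blast
qed

lemma root_brick_brick: "root_brick V \<Longrightarrow> brick V"
  unfolding root_brick_def using thin_brick thick_brick by blast

end

section \<open>Root bricks and their dimensions\<close>

context d_infinity
begin

lemma root_brick_cases [consumes 1, case_names thin thick]:
  assumes "root_brick V"
  obtains I where "thin_support I" "thin V I" | a b where "thick_ends a b" "thick V a b"
  using assms unfolding root_brick_def by metis

lemma thin_isomorphic:
  assumes V: "thin V I" and W: "thin W I"
  shows "isomorphic scale Q V W"
proof -
  have rV: "quiver_rep scale Q V" and rW: "quiver_rep scale Q W" using V W unfolding thin_def by auto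
  obtain x where x: "\<forall>i\<in>verts Q. vspace V i = span {x i} \<and> (x i \<noteq> 0 \<longleftrightarrow> i \<in> I)"
     "\<forall>a\<in>arrows Q. fst a \<in> I \<longrightarrow> snd a \<in> I \<longrightarrow> amap V a (x (fst a)) = x (snd a)" using V unfolding thin_def by blast
  obtain y where y: "\<forall>i\<in>verts Q. vspace W i = span {y i} \<and> (y i \<noteq> 0 \<longleftrightarrow> i \<in> I)"
     "\<forall>a\<in>arrows Q. fst a \<in> I \<longrightarrow> snd a \<in> I \<longrightarrow> amap W a (y (fst a)) = y (snd a)" using W unfolding thin_def by blast
  define J :: "'v \<Rightarrow> unit set" where "J i = (if i \<in> I then {()} else {})" for i
  show ?thesis
  proof (rule isomorphic_by_frames[OF rV rW, of "\<lambda>i c. x i" J "\<lambda>i c. y i"])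
    show "inj_on (\<lambda>c. x i) (J i) \<and> independent ((\<lambda>c. x i) ` J i) \<and> vspace V i = span ((\<lambda>c. x i) ` J i)" if "i \<in> verts Q" for i
      using x(1) that unfolding J_def by (auto simp: independent_empty)
    show "inj_on (\<lambda>c. y i) (J i) \<and> independent ((\<lambda>c. y i) ` J i) \<and> vspace W i = span ((\<lambda>c. y i) ` J i)" if "i \<in> verts Q" for i
      using y(1) that unfolding J_def by (auto simp: independent_empty)
    fix a c h
    assume a: "a \<in> arrows Q" and c: "c \<in> J (fst a)" and h: "Vector_Spaces.linear scale scale h"
      and hx: "\<And>d. d \<in> J (snd a) \<Longrightarrow> h (x (snd a)) = y (snd a)"
    interpret h: Vector_Spaces.linear scale scale h by (rule h)
    have va: "fst a \<in> verts Q" "snd a \<in> verts Q" using arrow_verts[OF a] by auto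
    have s: "fst a \<in> I" using c unfolding J_def by (auto split: if_splits)
    show "h (amap V a (x (fst a))) = amap W a (y (fst a))"
    proof (cases "snd a \<in> I")
      case True
      then show ?thesis using x(2) y(2) a s hx unfolding J_def by auto
    next
      case False
      have "x (fst a) \<in> vspace V (fst a)" "y (fst a) \<in> vspace W (fst a)" using x(1) y(1) va by (auto intro: span_base)
      then have "amap V a (x (fst a)) \<in> vspace V (snd a)" "amap W a (y (fst a)) \<in> vspace W (snd a)"
        using linear_betweenD(1)[OF quiver_repD(2)[OF rV a]] linear_betweenD(1)[OF quiver_repD(2)[OF rW a]] by auto
      then have "amap V a (x (fst a)) = 0" "amap W a (y (fst a)) = 0" using x(1) y(1) va False by auto
      then show ?thesis by simp
    qed
  qed
qed

lemma frame_pair: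
  fixes x y :: 'b
  assumes "x \<noteq> 0 \<Longrightarrow> y \<noteq> 0 \<Longrightarrow> indep2 x y"
  defines "J \<equiv> {c. (if c then x else y) \<noteq> 0}"
  shows "inj_on (\<lambda>c. if c then x else y) J \<and> independent ((\<lambda>c. if c then x else y) ` J) \<and>
         span {x, y} = span ((\<lambda>c. if c then x else y) ` J)"
proof -
  have im: "(\<lambda>c. if c then x else y) ` J = {x, y} - {0}"
    unfolding J_def by (auto simp: image_iff)
  have "span ({x, y} - {0}) = span {x, y}" by simp
  moreover have "independent ({x, y} - {0})"
  proof (cases "x \<noteq> 0 \<and> y \<noteq> 0")
    case True
    then have "{x, y} - {0} = {x, y}" by auto
    then show ?thesis using assms(1) True unfolding indep2_iff by simp
  next
    case False
    then have "{x, y} - {0} = {} \<or> {x, y} - {0} = {x} - {0} \<or> {x, y} - {0} = {y} - {0}" by auto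
    moreover have "independent ({v} - {0})" for v by (cases "v = 0") (auto simp: independent_empty)
    ultimately show ?thesis by (metis independent_empty)
  qed
  moreover have "inj_on (\<lambda>c. if c then x else y) J"
  proof (rule inj_onI)
    fix c d assume cd: "c \<in> J" "d \<in> J" "(if c then x else y) = (if d then x else y)"
    show "c = d"
    proof (rule ccontr)
      assume "c \<noteq> d"
      then have "x \<noteq> 0" "y \<noteq> 0" "x = y" using cd unfolding J_def by (auto split: if_splits)
      then show False using assms(1) unfolding indep2_iff by blast
    qed
  qed
  ultimately show ?thesis unfolding im by simp
qed

lemma thick_isomorphic:
  assumes V: "thick V a b" and W: "thick W a b"
  shows "isomorphic scale Q V W"
proof -
  have rV: "quiver_rep scale Q V" and rW: "quiver_rep scale Q W" using V W unfolding thick_def by auto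
  obtain x y z z' where fr: "thick_frame V a b x y z z'" using V unfolding thick_def by blast
  obtain p q r r' where fs: "thick_frame W a b p q r r'" using W unfolding thick_def by blast
  define X where "X i = (if i = u then z else if i = u' then z' else x (inv w i))" for i
  define Y where "Y i = (if i = u \<or> i = u' then 0 else y (inv w i))" for i
  define P where "P i = (if i = u then r else if i = u' then r' else p (inv w i))" for i
  define R where "R i = (if i = u \<or> i = u' then 0 else q (inv w i))" for i
  have invw: "inv w (w j) = j" for j using w_inj by simp
  have XY: "X (w j) = x j" "Y (w j) = y j" "X u = z" "X u' = z'" "Y u = 0" "Y u' = 0"
      "P (w j) = p j" "R (w j) = q j" "P u = r" "P u' = r'" "R u = 0" "R u' = 0" for j
    unfolding X_def Y_def P_def R_def by (auto simp: invw)
  define J where "J i = {c. (if c then X i else Y i) \<noteq> 0}" for i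
  have J': "J i = {c. (if c then P i else R i) \<noteq> 0}" if "i \<in> verts Q" for i
    using that
  proof (cases rule: vert_cases)
    case 1 then show ?thesis using fr fs unfolding J_def thick_frame_def by (auto simp: XY)
  next
    case 2 then show ?thesis using fr fs unfolding J_def thick_frame_def by (auto simp: XY)
  next
    case (3 j) 
    have "x j \<noteq> 0 \<longleftrightarrow> p j \<noteq> 0" "y j \<noteq> 0 \<longleftrightarrow> q j \<noteq> 0" using fr fs unfolding thick_frame_def by auto
    then show ?thesis using 3 unfolding J_def by (auto simp: XY)
  qed
  have J0: "c \<in> J i \<longleftrightarrow> (if c then X i else Y i) \<noteq> 0" for i c unfolding J_def by simp
  show ?thesis
  proof (rule isomorphic_by_frames[OF rV rW, of "\<lambda>i c. if c then X i else Y i" J "\<lambda>i c. if c then P i else R i"])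
    fix i assume i: "i \<in> verts Q"
    have 1: "vspace V i = span {X i, Y i} \<and> vspace W i = span {P i, R i} \<and>
       (X i \<noteq> 0 \<longrightarrow> Y i \<noteq> 0 \<longrightarrow> indep2 (X i) (Y i)) \<and> (P i \<noteq> 0 \<longrightarrow> R i \<noteq> 0 \<longrightarrow> indep2 (P i) (R i))"
      using i
    proof (cases rule: vert_cases)
      case 1 then show ?thesis using fr fs unfolding thick_frame_def by (simp add: XY insert_commute[of _ 0])
    next
      case 2 then show ?thesis using fr fs unfolding thick_frame_def by (simp add: XY insert_commute[of _ 0])
    next
      case (3 j)
      have "vspace V (w j) = span {x j, y j}" "vspace W (w j) = span {p j, q j}"
        "x j \<noteq> 0 \<longrightarrow> y j \<noteq> 0 \<longrightarrow> indep2 (x j) (y j)" "p j \<noteq> 0 \<longrightarrow> q j \<noteq> 0 \<longrightarrow> indep2 (p j) (q j)"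
        using fr fs unfolding thick_frame_def by auto
      then show ?thesis using 3 by (simp add: XY)
    qed
    show "inj_on (\<lambda>c. if c then X i else Y i) (J i) \<and> independent ((\<lambda>c. if c then X i else Y i) ` J i) \<and>
       vspace V i = span ((\<lambda>c. if c then X i else Y i) ` J i)"
      using frame_pair[of "X i" "Y i"] 1 unfolding J_def by simp
    show "inj_on (\<lambda>c. if c then P i else R i) (J i) \<and> independent ((\<lambda>c. if c then P i else R i) ` J i) \<and>
       vspace W i = span ((\<lambda>c. if c then P i else R i) ` J i)"
      using frame_pair[of "P i" "R i"] 1 unfolding J'[OF i] by simp
  next
    fix e c h
    assume e: "e \<in> arrows Q" and c: "c \<in> J (fst e)" and h: "Vector_Spaces.linear scale scale h"
      and hx: "\<And>d. d \<in> J (snd e) \<Longrightarrow> h (if d then X (snd e) else Y (snd e)) = (if d then P (snd e) else R (snd e))"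
    interpret h: Vector_Spaces.linear scale scale h by (rule h)
    have sv: "snd e \<in> verts Q" using arrow_verts[OF e] by blast
    have hX: "h (X (snd e)) = P (snd e)"
    proof (cases "True \<in> J (snd e)")
      case True then show ?thesis using hx[of True] by simp
    next
      case False
      then have "X (snd e) = 0" "P (snd e) = 0" using J'[OF sv] J0[of True "snd e"] by auto
      then show ?thesis by simp
    qed
    have hY: "h (Y (snd e)) = R (snd e)"
    proof (cases "False \<in> J (snd e)")
      case True then show ?thesis using hx[of False] by simp
    next
      case False
      then have "Y (snd e) = 0" "R (snd e) = 0" using J'[OF sv] J0[of False "snd e"] by auto
      then show ?thesis by simp
    qed
    show "h (amap V e (if c then X (fst e) else Y (fst e))) = amap W e (if c then P (fst e) else R (fst e))"
      using e
    proof (cases rule: arrow_cases)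
      case 1
      show ?thesis
      proof (cases "arm_out u")
        case True
        have "h z = r" using hX arm_simps[of u] True 1 by (simp add: XY)
        then show ?thesis using fr fs True 1 arm_simps[of u] unfolding thick_frame_def by (auto simp: XY)
      next
        case False
        have "h (y 0) = q 0" using hY arm_simps[of u] False 1 by (simp add: XY)
        moreover have "c" using c 1 arm_simps[of u] False by (auto simp: J0 XY split: if_splits)
        ultimately show ?thesis using fr fs False 1 arm_simps[of u] unfolding thick_frame_def by (auto simp: XY)
      qed
    next
      case 2
      show ?thesis
      proof (cases "arm_out u'")
        case True
        have "h z' = r'" using hX arm_simps[of u'] True 2 by (simp add: XY)
        then show ?thesis using fr fs True 2 arm_simps[of u'] unfolding thick_frame_def by (auto simp: XY)
      next
        case False
        have "h (y 0) = q 0" "h (x 0) = p 0" using hX hY arm_simps[of u'] False 2 by (simp_all add: XY)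
        moreover have "c" using c 2 arm_simps[of u'] False by (auto simp: J0 XY split: if_splits)
        ultimately show ?thesis using fr fs False 2 arm_simps[of u'] unfolding thick_frame_def by (auto simp: XY h.diff)
      qed
    next
      case (3 j)
      show ?thesis
      proof (cases "out j")
        case True
        have "h (y (Suc j)) = q (Suc j)" "h (x (Suc j)) = p (Suc j)" using hX hY ar_simps[of j] True 3 by (simp_all add: XY)
        moreover have "amap V (ar j) (x j) = x (Suc j)" "amap V (ar j) (y j) = y (Suc j)"
            "amap W (ar j) (p j) = p (Suc j)" "amap W (ar j) (q j) = q (Suc j)"
          using fr fs True unfolding thick_frame_def by auto
        ultimately show ?thesis using True 3 ar_simps[of j] by (simp add: XY)
      next
        case False
        have hh: "h (y j) = q j" "h (x j) = p j" using hX hY ar_simps[of j] False 3 by (simp_all add: XY)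
        have cJ: "c \<in> J (w (Suc j))" using c 3 ar_simps[of j] False by simp
        then have "(if c then x (Suc j) else y (Suc j)) \<noteq> 0" unfolding J0 XY .
        moreover have "(if c then p (Suc j) else q (Suc j)) \<noteq> 0"
          using cJ unfolding J'[OF verts_simps(3)] mem_Collect_eq XY .
        moreover have "x (Suc j) \<noteq> 0 \<Longrightarrow> amap V (ar j) (x (Suc j)) = x j" "y (Suc j) \<noteq> 0 \<Longrightarrow> amap V (ar j) (y (Suc j)) = y j"
            "p (Suc j) \<noteq> 0 \<Longrightarrow> amap W (ar j) (p (Suc j)) = p j" "q (Suc j) \<noteq> 0 \<Longrightarrow> amap W (ar j) (q (Suc j)) = q j"
          using fr fs False unfolding thick_frame_def by auto
        ultimately show ?thesis using hh False 3 ar_simps[of j] by (cases c) (simp_all add: XY)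
      qed
    qed
  qed
qed

lemma thin_support_verts: "thin_support I \<Longrightarrow> I \<subseteq> verts Q"
  unfolding thin_support_def by auto

lemma thin_dim:
  assumes "thin V I" "i \<in> verts Q"
  shows "dim (vspace V i) = (if i \<in> I then 1 else 0)"
proof -
  obtain x where x: "\<forall>i\<in>verts Q. vspace V i = span {x i} \<and> (x i \<noteq> 0 \<longleftrightarrow> i \<in> I)" using assms(1) unfolding thin_def by blast
  show ?thesis
  proof (cases "i \<in> I")
    case True
    then have "independent {x i}" using x assms(2) by simp
    then show ?thesis using dim_span_eq_card_independent[of "{x i}"] x assms(2) True by simp
  next
    case False
    then have "x i = 0" "vspace V i = span {x i}" using x assms(2) by auto
    then have "vspace V i = span {}" by simp
    then show ?thesis using dim_span_eq_card_independent[OF independent_empty] False by simp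
  qed
qed

lemma thick_dim:
  assumes "thick V a b"
  shows "dim (vspace V (w j)) = of_bool (enat j \<le> a) + of_bool (enat j \<le> b)" "dim (vspace V u) = 1" "dim (vspace V u') = 1"
proof -
  obtain x y z z' where fr: "thick_frame V a b x y z z'" using assms unfolding thick_def by blast
  have d1: "dim (span {v}) = (if v = 0 then 0 else 1)" for v
    using dim_span_eq_card_independent[of "{v}"] dim_span_eq_card_independent[OF independent_empty] by auto
  show "dim (vspace V u) = 1" "dim (vspace V u') = 1" using fr d1 unfolding thick_frame_def by auto
  have h: "(x j \<noteq> 0 \<longleftrightarrow> enat j \<le> a)" "(y j \<noteq> 0 \<longleftrightarrow> enat j \<le> b)" "vspace V (w j) = span {x j, y j}"
     "enat j \<le> a \<Longrightarrow> enat j \<le> b \<Longrightarrow> indep2 (x j) (y j)" using fr unfolding thick_frame_def by auto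
  show "dim (vspace V (w j)) = of_bool (enat j \<le> a) + of_bool (enat j \<le> b)"
  proof (cases "x j \<noteq> 0 \<and> y j \<noteq> 0")
    case True
    then have "x j \<noteq> y j" "independent {x j, y j}" using h unfolding indep2_iff by auto
    then show ?thesis using True h dim_span_eq_card_independent[of "{x j, y j}"] by simp
  next
    case False
    then consider "x j = 0" | "y j = 0" by blast
    then show ?thesis
    proof cases
      case 1
      then have "vspace V (w j) = span {y j}" using h(3) by simp
      then show ?thesis using d1[of "y j"] h(1,2) 1 by (auto simp del: dim_span)
    next
      case 2
      then have "vspace V (w j) = span {x j}" using h(3) by (simp add: insert_commute)
      then show ?thesis using d1[of "x j"] h(1,2) 2 by (auto simp del: dim_span)
    qed
  qed
qed

lemma enat_eq_of_le_iff:
  assumes "\<And>j. enat j \<le> A \<longleftrightarrow> enat j \<le> B"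
  shows "A = B"
proof (rule antisym)
  have le: "A \<le> B" if imp: "\<And>j. enat j \<le> A \<Longrightarrow> enat j \<le> B" for A B
  proof (rule ccontr)
    assume "\<not> A \<le> B"
    then obtain n where n: "B = enat n" by (cases B) auto
    then have "enat (Suc n) \<le> A" using \<open>\<not> A \<le> B\<close> by (simp add: Suc_ile_eq)
    then show False using imp[of "Suc n"] n by simp
  qed
  show "A \<le> B" "B \<le> A" using assms by (auto intro: le)
qed

text \<open>The dimensions determine the smaller and the larger end, and the direction of the arrow at the smaller end decides which strand ends there.\<close>

lemma thick_ends_determined:
  assumes ends: "thick_ends a b" "thick_ends a' b'"
    and eq: "\<And>j. of_bool (enat j \<le> a) + of_bool (enat j \<le> b) = (of_bool (enat j \<le> a') + of_bool (enat j \<le> b') :: nat)"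
  shows "a = a' \<and> b = b'"
proof -
  have "(enat j \<le> a \<and> enat j \<le> b) = (enat j \<le> a' \<and> enat j \<le> b')" for j
    using eq[of j] by (auto simp: of_bool_def split: if_splits)
  then have mn: "min a b = min a' b'" by (intro enat_eq_of_le_iff) simp
  have "(enat j \<le> a \<or> enat j \<le> b) = (enat j \<le> a' \<or> enat j \<le> b')" for j
    using eq[of j] by (auto simp: of_bool_def split: if_splits)
  then have mx: "max a b = max a' b'" by (intro enat_eq_of_le_iff) (simp add: le_max_iff_disj)
  obtain k where k: "(out k \<and> a = enat k \<and> enat k < b) \<or> (\<not> out k \<and> b = enat k \<and> enat k < a)"
    using ends(1) unfolding thick_ends_def by blast
  obtain k' where k': "(out k' \<and> a' = enat k' \<and> enat k' < b') \<or> (\<not> out k' \<and> b' = enat k' \<and> enat k' < a')"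
    using ends(2) unfolding thick_ends_def by blast
  have "min a b = enat k" "min a' b' = enat k'" using k k' by (auto simp: min_def)
  then have "k = k'" using mn by simp
  then show ?thesis using k k' mx by (auto simp: max_def split: if_splits)
qed

lemma root_brick_isomorphic:
  assumes V: "root_brick V" and W: "root_brick W"
    and dims: "\<And>i. i \<in> verts Q \<Longrightarrow> dim (vspace V i) = dim (vspace W i)"
  shows "isomorphic scale Q V W"
proof -
  have no: False if A: "thin_support I" "thin A I" and B: "thick_ends a b" "thick B a b"
    and d: "\<And>i. i \<in> verts Q \<Longrightarrow> dim (vspace A i) = dim (vspace B i)" for A B I a b
  proof -
    have "enat 0 \<le> a" "enat 0 \<le> b" by (simp_all add: zero_enat_def[symmetric])
    then have "dim (vspace B (w 0)) = 2" using thick_dim(1)[OF B(2), of 0] by simp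
    moreover have "dim (vspace A (w 0)) \<le> 1" using thin_dim[OF A(2), of "w 0"] by simp
    ultimately show False using d[of "w 0"] by simp
  qed
  show ?thesis using V
  proof (cases rule: root_brick_cases)
    case (thin I)
    note V' = this
    show ?thesis using W
    proof (cases rule: root_brick_cases)
      case (thin I')
      have "i \<in> I \<longleftrightarrow> i \<in> I'" if "i \<in> verts Q" for i
        using thin_dim[OF V'(2) that] thin_dim[OF thin(2) that] dims[OF that] by (metis zero_neq_one)
      then have "I = I'" using thin_support_verts[OF V'(1)] thin_support_verts[OF thin(1)] by blast
      then show ?thesis using thin_isomorphic V'(2) thin(2) by blast
    next
      case (thick a b)
      have False by (rule no[OF V' thick]) (simp add: dims)
      then show ?thesis ..
    qed
  next
    case (thick a b)
    note V' = this
    show ?thesis using W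
    proof (cases rule: root_brick_cases)
      case (thin I)
      have False by (rule no[OF thin V']) (simp add: dims)
      then show ?thesis ..
    next
      case (thick a' b')
      have "a = a' \<and> b = b'"
      proof (rule thick_ends_determined[OF V'(1) thick(1)])
        show "of_bool (enat j \<le> a) + of_bool (enat j \<le> b) = (of_bool (enat j \<le> a') + of_bool (enat j \<le> b') :: nat)" for j
          using thick_dim(1)[OF V'(2), of j] thick_dim(1)[OF thick(2), of j] dims[of "w j"] by simp
      qed
      then show ?thesis using thick_isomorphic V'(2) thick(2) by blast
    qed
  qed
qed

lemma bij_betw_lines:
  assumes L: "linear_between scale (span {x}) (span {y}) f" and fx: "f x = y" and z: "x = 0 \<longleftrightarrow> y = 0"
  shows "bij_betw f (span {x}) (span {y})"
proof -
  have fs: "f (scale c x) = scale c y" for c using linear_betweenD(3)[OF L span_base] fx by simp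
  show ?thesis unfolding bij_betw_def
  proof
    show "inj_on f (span {x})" unfolding span_singleton using fs z by (auto intro!: inj_onI)
    show "f ` span {x} = span {y}" unfolding span_singleton image_image using fs by simp
  qed
qed

lemma FLEI_if_eventually_bij:
  assumes "\<And>i. i \<in> verts Q \<Longrightarrow> finite_dim scale (vspace V i)"
    and "\<And>j. M \<le> j \<Longrightarrow> bij_betw (amap V (ar j)) (vspace V (fst (ar j))) (vspace V (snd (ar j)))"
  shows "FLEI scale Q V"
proof -
  have "{a \<in> arrows Q. \<not> bij_betw (amap V a) (vspace V (fst a)) (vspace V (snd a))} \<subseteq> {arm u, arm u'} \<union> ar ` {..<M}"
  proof
    fix a assume "a \<in> {a \<in> arrows Q. \<not> bij_betw (amap V a) (vspace V (fst a)) (vspace V (snd a))}"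
    then have a: "a \<in> arrows Q" "\<not> bij_betw (amap V a) (vspace V (fst a)) (vspace V (snd a))" by auto
    show "a \<in> {arm u, arm u'} \<union> ar ` {..<M}"
      using a(1)
    proof (cases rule: arrow_cases)
      case (3 j)
      then have "\<not> M \<le> j" using a(2) assms(2) by blast
      then show ?thesis using 3 by auto
    qed auto
  qed
  then show ?thesis unfolding FLEI_def using assms(1) by (auto intro: finite_subset)
qed

lemma enat_eventually: "\<exists>M. \<forall>j\<ge>M. enat j \<le> q \<longleftrightarrow> enat (Suc j) \<le> q"
proof (cases q)
  case (enat n)
  then show ?thesis by (intro exI[of _ "Suc n"]) auto
qed auto

lemma finite_dim_span: "finite B \<Longrightarrow> finite_dim scale (span B)"
  unfolding finite_dim_def by blast

lemma root_brick_FLEI: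
  assumes "root_brick V"
  shows "FLEI scale Q V"
proof -
  show ?thesis using assms
  proof (cases rule: root_brick_cases)
    case 1: (thin I)
    have rep: "quiver_rep scale Q V" using 1(2) unfolding thin_def by blast
    obtain x where x: "\<forall>i\<in>verts Q. vspace V i = span {x i} \<and> (x i \<noteq> 0 \<longleftrightarrow> i \<in> I)"
      "\<forall>a\<in>arrows Q. fst a \<in> I \<longrightarrow> snd a \<in> I \<longrightarrow> amap V a (x (fst a)) = x (snd a)" using 1(2) unfolding thin_def by blast
    have "\<exists>M. \<forall>j\<ge>M. w j \<in> I \<longleftrightarrow> w (Suc j) \<in> I"
      using 1(1)
    proof (cases rule: thin_support_cases)
      case (3 p q Z)
      have wI: "w j \<in> I \<longleftrightarrow> p \<le> j \<and> enat j \<le> q" for j using 3(2,4) by auto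
      obtain M where "\<forall>j\<ge>M. enat j \<le> q \<longleftrightarrow> enat (Suc j) \<le> q" using enat_eventually by blast
      then have "w j \<in> I \<longleftrightarrow> w (Suc j) \<in> I" if "max M p \<le> j" for j
        unfolding wI using that by (metis le_SucI max.bounded_iff)
      then show ?thesis by blast
    qed auto
    then obtain M where M: "\<And>j. M \<le> j \<Longrightarrow> w j \<in> I \<longleftrightarrow> w (Suc j) \<in> I" by blast
    show ?thesis
    proof (rule FLEI_if_eventually_bij[of _ "max M N"])
      show "finite_dim scale (vspace V i)" if "i \<in> verts Q" for i using x(1) that finite_dim_span[of "{x i}"] by simp
      fix j assume j: "max M N \<le> j"
      have o: "out j" using j tail_out by simp
      have z: "x (w j) = 0 \<longleftrightarrow> x (w (Suc j)) = 0" using M[of j] j x(1) by auto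
      have sp: "vspace V (w j) = span {x (w j)}" "vspace V (w (Suc j)) = span {x (w (Suc j))}" using x(1) by auto
      have L: "linear_between scale (span {x (w j)}) (span {x (w (Suc j))}) (amap V (ar j))"
        using quiver_repD(2)[OF rep ar_arrow, of j] ar_simps[of j] o sp by simp
      have "amap V (ar j) (x (w j)) = x (w (Suc j))"
      proof (cases "x (w j) = 0")
        case True
        then show ?thesis using z linear_between_zero[OF subspace_span L] by simp
      next
        case False
        then have "w j \<in> I" "w (Suc j) \<in> I" using z x(1) verts_simps(3) by blast+
        then show ?thesis using bspec[OF x(2) ar_arrow[of j]] ar_simps(1,2)[OF o] by simp
      qed
      from bij_betw_lines[OF L this z] show "bij_betw (amap V (ar j)) (vspace V (fst (ar j))) (vspace V (snd (ar j)))"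
        using ar_simps[of j] o sp by simp
    qed
  next
    case 2: (thick a b)
    have rep: "quiver_rep scale Q V" using 2(2) unfolding thick_def by blast
    obtain x y z z' where fr: "thick_frame V a b x y z z'" using 2(2) unfolding thick_def by blast
    have x0: "x j \<noteq> 0 \<longleftrightarrow> enat j \<le> a" and y0: "y j \<noteq> 0 \<longleftrightarrow> enat j \<le> b" and Vw: "vspace V (w j) = span {x j, y j}" for j
      using fr unfolding thick_frame_def by auto
    obtain M where M: "\<forall>j\<ge>M. enat j \<le> a \<longleftrightarrow> enat (Suc j) \<le> a" using enat_eventually by blast
    obtain M' where M': "\<forall>j\<ge>M'. enat j \<le> b \<longleftrightarrow> enat (Suc j) \<le> b" using enat_eventually by blast
    obtain k where k: "a = enat k \<or> b = enat k" using 2(1) unfolding thick_ends_def by blast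
    show ?thesis
    proof (rule FLEI_if_eventually_bij[of _ "max (max M M') (max N (Suc k))"])
      show "finite_dim scale (vspace V i)" if "i \<in> verts Q" for i
        using that
      proof (cases rule: vert_cases)
        case 1 then show ?thesis using fr finite_dim_span[of "{z}"] unfolding thick_frame_def by simp
      next
        case 2 then show ?thesis using fr finite_dim_span[of "{z'}"] unfolding thick_frame_def by simp
      next
        case (3 j) then show ?thesis using Vw[of j] finite_dim_span[of "{x j, y j}"] by simp
      qed
      fix j assume j: "max (max M M') (max N (Suc k)) \<le> j"
      have o: "out j" using j tail_out by simp
      have m: "amap V (ar j) (x j) = x (Suc j)" "amap V (ar j) (y j) = y (Suc j)" using fr o unfolding thick_frame_def by auto
      have jM: "M \<le> j" "M' \<le> j" using j by auto
      have zx: "x j = 0 \<longleftrightarrow> x (Suc j) = 0" using M[rule_format, OF jM(1)] x0[of j] x0[of "Suc j"] by blast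
      have zy: "y j = 0 \<longleftrightarrow> y (Suc j) = 0" using M'[rule_format, OF jM(2)] y0[of j] y0[of "Suc j"] by blast
      have "\<not> enat j \<le> enat k" using j by simp
      then have "x j = 0 \<or> y j = 0" using k x0 y0 by blast
      then show "bij_betw (amap V (ar j)) (vspace V (fst (ar j))) (vspace V (snd (ar j)))"
      proof
        assume x: "x j = 0"
        then have sp: "vspace V (w j) = span {y j}" "vspace V (w (Suc j)) = span {y (Suc j)}" using zx Vw by auto
        have L: "linear_between scale (span {y j}) (span {y (Suc j)}) (amap V (ar j))"
          using quiver_repD(2)[OF rep ar_arrow, of j] ar_simps[of j] o sp by simp
        from bij_betw_lines[OF L m(2) zy] show ?thesis using ar_simps[of j] o sp by simp
      next
        assume y: "y j = 0"
        then have sp: "vspace V (w j) = span {x j}" "vspace V (w (Suc j)) = span {x (Suc j)}"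
          using zy Vw[of j] Vw[of "Suc j"] by (auto simp: insert_commute)
        have L: "linear_between scale (span {x j}) (span {x (Suc j)}) (amap V (ar j))"
          using quiver_repD(2)[OF rep ar_arrow, of j] ar_simps[of j] o sp by simp
        from bij_betw_lines[OF L m(1) zx] show ?thesis using ar_simps[of j] o sp by simp
      qed
    qed
  qed
qed

end

section \<open>Threads\<close>

context ambient_space
begin

text \<open>Transport of a subspace against the direction in which the line is traversed: a preimage or an image, according to the orientation of the arrow.\<close>

definition transfer :: "bool \<Rightarrow> ('b \<Rightarrow> 'b) \<Rightarrow> 'b set \<Rightarrow> 'b set \<Rightarrow> 'b set" where
  "transfer outw l P F = (if outw then {x\<in>P. l x \<in> F} else l ` F)"

text \<open>The step from an adapted basis \<open>B\<close> at one vertex to an adapted basis at the next: \<open>s b\<close> continues \<open>b\<close>, with \<open>s b = 0\<close> if \<open>b\<close> has no continuation, and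
\<open>M\<close> contains the vectors that are new. The last condition in the inward case keeps track of the chain members that contain \<open>b\<close>, as
\<open>s b = l b\<close> does in the outward case.\<close>

definition basis_step where
  "basis_step outw l P' R' B s M \<longleftrightarrow> s 0 = 0 \<and> inj_on s {b\<in>B. s b \<noteq> 0} \<and> (s ` B - {0}) \<inter> M = {} \<and>
     independent ((s ` B - {0}) \<union> M) \<and> span ((s ` B - {0}) \<union> M) = P' \<and> adapted ((s ` B - {0}) \<union> M) R' \<and>
     (if outw then \<forall>b\<in>B. s b = l b
      else (\<forall>b\<in>B. s b \<noteq> 0 \<longrightarrow> l (s b) = b) \<and> (\<forall>m\<in>M. l m = 0) \<and>
           (\<forall>b\<in>B. \<forall>F\<in>R'. b \<in> l ` F \<longrightarrow> s b \<noteq> 0 \<and> s b \<in> F))"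

lemma basis_step_exists:
  assumes R': "wchain P' R'" "{0} \<in> R'" and l: "Vector_Spaces.linear scale scale l"
    and maps: "if outw then l ` P \<subseteq> P' else l ` P' \<subseteq> P"
    and B: "independent B" "span B = P" "adapted B (transfer outw l P ` R')"
  shows "\<exists>s M. basis_step outw l P' R' B s M"
proof (cases outw)
  case True
  interpret l: Vector_Spaces.linear scale scale l by (rule l)
  have ad: "adapted B ((\<lambda>F. {x \<in> P. l x \<in> F}) ` R')" using B(3) True unfolding transfer_def by simp
  have m: "l ` P \<subseteq> P'" using maps True by simp
  obtain M where "(l ` B - {0}) \<inter> M = {} \<and> independent ((l ` B - {0}) \<union> M) \<and>
           span ((l ` B - {0}) \<union> M) = P' \<and> adapted ((l ` B - {0}) \<union> M) R'"
    using step_outward(2)[OF R' l m B(1,2) ad] by blast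
  then have "basis_step outw l P' R' B l M"
    unfolding basis_step_def using True step_outward(1)[OF R' l m B(1,2) ad] l.zero by simp
  then show ?thesis by blast
next
  case False
  have "transfer outw l P = (`) l" unfolding transfer_def using False by (auto simp: fun_eq_iff)
  then have ad: "adapted B ((`) l ` R')" using B(3) by simp
  have m: "l ` P' \<subseteq> P" using maps False by simp
  obtain s M where "s 0 = 0 \<and> (\<forall>b\<in>B. s b \<noteq> 0 \<longrightarrow> l (s b) = b) \<and> (\<forall>n\<in>M. l n = 0) \<and>
           (\<forall>b\<in>B. \<forall>F\<in>R'. b \<in> l ` F \<longrightarrow> s b \<noteq> 0 \<and> s b \<in> F) \<and>
           inj_on s {b\<in>B. s b \<noteq> 0} \<and>
           (s ` B - {0}) \<inter> M = {} \<and> independent ((s ` B - {0}) \<union> M) \<and>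
           span ((s ` B - {0}) \<union> M) = P' \<and> adapted ((s ` B - {0}) \<union> M) R'"
    using step_inward[OF R'(1) l m B(1,2) ad] by blast
  then have "basis_step outw l P' R' B s M" unfolding basis_step_def using False by simp
  then show ?thesis by blast
qed

lemma wchain_increasing:
  assumes "\<And>n. subspace (Z n)" "\<And>n. Z n \<subseteq> Z (Suc n)" "\<And>n. Z n \<subseteq> W" "subspace W"
  shows "wchain W (insert W (range (Z :: nat \<Rightarrow> 'b set)))"
  unfolding wchain_def
proof (intro conjI ballI allI impI)
  show "W \<in> insert W (range Z)" by simp
  fix F assume "F \<in> insert W (range Z)"
  then show "subspace F" "F \<subseteq> W" using assms(1,3,4) by blast+
next
  fix S assume S: "S \<subseteq> insert W (range Z)" "S \<noteq> {}"
  show "\<exists>F\<in>S. \<forall>G\<in>S. F \<subseteq> G"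
  proof (cases "\<exists>n. Z n \<in> S")
    case True
    define n where "n = (LEAST n. Z n \<in> S)"
    have n: "Z n \<in> S" unfolding n_def by (rule LeastI_ex[OF True])
    have "Z n \<subseteq> G" if G: "G \<in> S" for G
    proof (cases "G = W")
      case True then show ?thesis using assms(3) by simp
    next
      case False
      then obtain m where m: "G = Z m" using G S by blast
      then have "n \<le> m" unfolding n_def using G by (intro Least_le) simp
      then show ?thesis unfolding m by (rule lift_Suc_mono_le[of Z, OF assms(2)])
    qed
    then show ?thesis using n by blast
  next
    case False
    then have "S = {W}" using S by blast
    then show ?thesis by blast
  qed
qed

end

text \<open>The thread of a vector \<open>b\<close> that is new at the vertex with number \<open>p\<close>.\<close>

primrec thread :: "(nat \<Rightarrow> 'b \<Rightarrow> 'b::zero) \<Rightarrow> nat \<Rightarrow> 'b \<Rightarrow> nat \<Rightarrow> 'b" where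
  "thread s p b 0 = (if p = 0 then b else 0)"
| "thread s p b (Suc j) = (if p = Suc j then b else s j (thread s p b j))"

text \<open>Names for the summands: one thread, a pair of threads born at \<open>w 0\<close> and named after its first member, or a vector at the end of an arm, with \<open>True\<close> standing for \<open>u\<close>.\<close>

datatype 'b summand_label = Thread nat 'b | Pair 'b | Arm bool 'b

text \<open>The maps \<open>L a\<close> are linear extensions of the arrow maps to the whole ambient space, so that the theory of linear maps applies to them directly.\<close>

locale d_infinity_rep = d_infinity scale Q u u' w N
  for scale :: "'f::field \<Rightarrow> 'b::ab_group_add \<Rightarrow> 'b" and Q :: "'v quiver" and u u' w N +
  fixes V :: "('v, 'b) quiver_rep" and L :: "'v \<times> 'v \<Rightarrow> 'b \<Rightarrow> 'b"
  assumes rep: "quiver_rep scale Q V"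
    and L_linear: "\<And>a. a \<in> arrows Q \<Longrightarrow> Vector_Spaces.linear scale scale (L a)"
    and L_eq: "\<And>a x. a \<in> arrows Q \<Longrightarrow> x \<in> vspace V (fst a) \<Longrightarrow> L a x = amap V a x"
begin

abbreviation P :: "nat \<Rightarrow> 'b set" where "P j \<equiv> vspace V (w j)"

lemma subspace_P [simp]: "subspace (P j)"
  by (rule quiver_repD(1)[OF rep]) simp

lemma L_maps: "a \<in> arrows Q \<Longrightarrow> x \<in> vspace V (fst a) \<Longrightarrow> L a x \<in> vspace V (snd a)"
  using L_eq linear_betweenD(1)[OF quiver_repD(2)[OF rep]] by simp

lemma L_0:
  assumes "a \<in> arrows Q"
  shows "L a 0 = 0"
proof -
  interpret l: Vector_Spaces.linear scale scale "L a" by (rule L_linear[OF assms])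
  show ?thesis by (rule l.zero)
qed

definition pull_edge :: "nat \<Rightarrow> 'b set \<Rightarrow> 'b set" where
  "pull_edge j F = transfer (out j) (L (ar j)) (P j) F"

lemma pull_edge_mono: "F \<subseteq> G \<Longrightarrow> pull_edge j F \<subseteq> pull_edge j G"
  unfolding pull_edge_def transfer_def by auto

lemma pull_edge_subspace:
  assumes "subspace F"
  shows "subspace (pull_edge j F)"
proof -
  interpret l: Vector_Spaces.linear scale scale "L (ar j)" by (rule L_linear) simp
  have "{x\<in>P j. L (ar j) x \<in> F} = P j \<inter> {x. L (ar j) x \<in> F}" by blast
  moreover have "subspace (P j \<inter> {x. L (ar j) x \<in> F})"
    by (rule subspace_inter[OF subspace_P l.subspace_linear_preimage[OF assms]])
  ultimately show ?thesis unfolding pull_edge_def transfer_def using l.subspace_image[OF assms] by simp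
qed

lemma pull_edge_le: "F \<subseteq> P (Suc j) \<Longrightarrow> pull_edge j F \<subseteq> P j"
  unfolding pull_edge_def transfer_def using L_maps[OF ar_arrow[of j]] ar_simps[of j] by auto

text \<open>For \<open>G = P\<close> or \<open>G = (\<lambda>_. {0})\<close> the subspace \<open>pull n G j\<close> of \<open>V (w j)\<close> is transported from \<open>w (j + n)\<close>.\<close>

primrec pull :: "nat \<Rightarrow> (nat \<Rightarrow> 'b set) \<Rightarrow> nat \<Rightarrow> 'b set" where
  "pull 0 G j = G j"
| "pull (Suc n) G j = pull_edge j (pull n G (Suc j))"

definition chain :: "nat \<Rightarrow> 'b set set" where
  "chain j = {pull n G j | n G. G = P \<or> G = (\<lambda>_. {0})}"

lemma chain_unfold: "chain j = {{0}, P j} \<union> pull_edge j ` chain (Suc j)"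
proof (intro equalityI subsetI)
  fix F assume "F \<in> chain j"
  then obtain n G where F: "F = pull n G j" "G = P \<or> G = (\<lambda>_. {0})" unfolding chain_def by blast
  show "F \<in> {{0}, P j} \<union> pull_edge j ` chain (Suc j)"
  proof (cases n)
    case 0 then show ?thesis using F by auto
  next
    case (Suc m)
    then have "F = pull_edge j (pull m G (Suc j))" using F by simp
    moreover have "pull m G (Suc j) \<in> chain (Suc j)" unfolding chain_def using F(2) by blast
    ultimately show ?thesis by blast
  qed
next
  fix F assume "F \<in> {{0}, P j} \<union> pull_edge j ` chain (Suc j)"
  then consider "F = {0}" | "F = P j" | H where "H \<in> chain (Suc j)" "F = pull_edge j H" by blast
  then show "F \<in> chain j"
  proof cases
    case 1
    then have "F = pull 0 (\<lambda>_. {0}) j" by simp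
    then show ?thesis unfolding chain_def by blast
  next
    case 2
    then have "F = pull 0 P j" by simp
    then show ?thesis unfolding chain_def by blast
  next
    case (3 H)
    then obtain n G where "H = pull n G (Suc j)" "G = P \<or> G = (\<lambda>_. {0})" unfolding chain_def by blast
    then have "F = pull (Suc n) G j" "G = P \<or> G = (\<lambda>_. {0})" using 3 by auto
    then show ?thesis unfolding chain_def by blast
  qed
qed

text \<open>On the outward tail the transports of the full spaces are full and those of \<open>{0}\<close>
are the increasing kernels of the maps \<open>V (w j) \<rightarrow> V (w (j + n))\<close>; the remaining finitely many
steps back apply a monotone operation and add \<open>{0}\<close> and the whole space.\<close>

lemma wchain_chain: "wchain (P j) (chain j)"
proof -
  have tail: "wchain (P j) (chain j)" if j: "N \<le> j" for j
  proof -
    have full: "pull n P i = P i" if "N \<le> i" for n i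
      using that
    proof (induction n arbitrary: i)
      case (Suc n)
      have o: "out i" using Suc.prems by (rule tail_out)
      have "L (ar i) x \<in> P (Suc i)" if "x \<in> P i" for x
        using L_maps[OF ar_arrow[of i]] ar_simps[of i] o that by auto
      then have "pull_edge i (P (Suc i)) = P i" using o unfolding pull_edge_def transfer_def by auto
      then show ?case using Suc.IH[of "Suc i"] Suc.prems by simp
    qed simp
    have Zsub: "subspace (pull n (\<lambda>_. {0}) i)" for n i by (induction n arbitrary: i) (auto intro: pull_edge_subspace)
    have Zle: "pull n (\<lambda>_. {0}) i \<subseteq> P i" for n i
      by (induction n arbitrary: i) (auto simp: subspace_0 dest!: subsetD[OF pull_edge_le])
    have Zinc: "pull n (\<lambda>_. {0}) i \<subseteq> pull (Suc n) (\<lambda>_. {0}) i" for n i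
    proof (induction n arbitrary: i)
      case 0
      show ?case using subspace_0[OF pull_edge_subspace[OF subspace_single_0, of i]] by simp
    next
      case (Suc n)
      show ?case using pull_edge_mono[OF Suc[of "Suc i"], of i] by simp
    qed
    have "chain j = insert (P j) (range (\<lambda>n. pull n (\<lambda>_. {0}) j))"
    proof (intro equalityI subsetI)
      fix F assume "F \<in> chain j"
      then obtain n G where F: "F = pull n G j" "G = P \<or> G = (\<lambda>_. {0})" unfolding chain_def by blast
      then show "F \<in> insert (P j) (range (\<lambda>n. pull n (\<lambda>_. {0}) j))" using full[OF j] by auto
    next
      fix F assume "F \<in> insert (P j) (range (\<lambda>n. pull n (\<lambda>_. {0}) j))"
      then show "F \<in> chain j" using chain_unfold[of j] unfolding chain_def by blast
    qed
    then show ?thesis using wchain_increasing[of "\<lambda>n. pull n (\<lambda>_. {0}) j" "P j"] Zsub Zinc Zle by simp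
  qed
  have step: "wchain (P j) (chain j)" if IH: "wchain (P (Suc j)) (chain (Suc j))" for j
  proof -
    have 1: "wchain (pull_edge j (P (Suc j))) (pull_edge j ` chain (Suc j))"
      by (rule wchain_image_mono[OF IH]) (auto intro: pull_edge_mono[THEN subsetD] pull_edge_subspace wchain_subspace[OF IH])
    have 2: "wchain (pull_edge j (P (Suc j))) (insert {0} (pull_edge j ` chain (Suc j)))"
    proof (rule wchain_insert_bot[OF 1 subspace_single_0])
      show "{0} \<subseteq> F" if "F \<in> pull_edge j ` chain (Suc j)" for F
        using subspace_0[OF wchain_subspace[OF 1 that]] by simp
    qed
    have "wchain (P j) (insert (P j) (insert {0} (pull_edge j ` chain (Suc j))))"
      by (rule wchain_insert_top[OF 2 subspace_P pull_edge_le]) simp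
    moreover have "insert (P j) (insert {0} (pull_edge j ` chain (Suc j))) = chain j"
      unfolding chain_unfold[of j] by blast
    ultimately show ?thesis by simp
  qed
  show ?thesis
  proof (cases "N \<le> j")
    case False
    then have "j \<le> N" by simp
    then show ?thesis by (induction rule: inc_induct) (auto intro: tail step)
  qed (rule tail)
qed

lemma chain_members: "{0} \<in> chain j" "P j \<in> chain j" "F \<in> chain (Suc j) \<Longrightarrow> pull_edge j F \<in> chain j"
  unfolding chain_unfold[of j] by auto

abbreviation line_step where
  "line_step j B s M \<equiv> basis_step (out j) (L (ar j)) (P (Suc j)) (chain (Suc j)) B s M"

definition good_basis :: "nat \<Rightarrow> 'b set \<Rightarrow> bool" where
  "good_basis j B \<longleftrightarrow> independent B \<and> span B = P j \<and> adapted B (chain j)"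

lemma line_step_exists:
  assumes "good_basis j B"
  shows "\<exists>s M. line_step j B s M"
proof (rule basis_step_exists[OF wchain_chain chain_members(1) L_linear[OF ar_arrow], where P = "P j"])
  show "if out j then L (ar j) ` P j \<subseteq> P (Suc j) else L (ar j) ` P (Suc j) \<subseteq> P j"
    using L_maps[OF ar_arrow[of j]] ar_simps[of j] by auto
  have "transfer (out j) (L (ar j)) (P j) ` chain (Suc j) \<subseteq> chain j"
    using chain_members(3)[of _ j] unfolding pull_edge_def by blast
  then show "adapted B (transfer (out j) (L (ar j)) (P j) ` chain (Suc j))"
    using assms unfolding good_basis_def adapted_def by blast
qed (use assms in \<open>auto simp: good_basis_def\<close>)

lemma line_bases_exist:
  assumes B0: "good_basis 0 B0"
  shows "\<exists>B s M. B 0 = B0 \<and> (\<forall>j. good_basis j (B j) \<and> line_step j (B j) (s j) (M j) \<and> B (Suc j) = (s j ` B j - {0}) \<union> M j)"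
proof -
  have "\<exists>s M. good_basis j B \<longrightarrow> line_step j B s M" for j B using line_step_exists by blast
  then obtain s M where sM: "\<And>j B. good_basis j B \<Longrightarrow> line_step j B (s j B) (M j B)" by metis
  define B where "B = rec_nat B0 (\<lambda>j B. (s j B ` B - {0}) \<union> M j B)"
  have Bs: "B 0 = B0" "B (Suc j) = (s j (B j) ` B j - {0}) \<union> M j (B j)" for j unfolding B_def by auto
  have "good_basis j (B j)" for j
  proof (induction j)
    case 0 then show ?case using B0 Bs by simp
  next
    case (Suc j)
    then show ?case using sM[OF Suc] unfolding basis_step_def good_basis_def Bs(2) by blast
  qed
  then show ?thesis using Bs sM by (intro exI[of _ B] exI[of _ "\<lambda>j. s j (B j)"] exI[of _ "\<lambda>j. M j (B j)"]) simp
qed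

end

locale threaded_rep = d_infinity_rep scale Q u u' w N V L
  for scale :: "'f::field \<Rightarrow> 'b::ab_group_add \<Rightarrow> 'b" and Q :: "'v quiver" and u u' w N V L +
  fixes B :: "nat \<Rightarrow> 'b set" and s :: "nat \<Rightarrow> 'b \<Rightarrow> 'b" and M :: "nat \<Rightarrow> 'b set"
  assumes good: "\<And>j. good_basis j (B j)" and steps: "\<And>j. line_step j (B j) (s j) (M j)"
    and B_Suc: "\<And>j. B (Suc j) = (s j ` B j - {0}) \<union> M j"
begin

definition births :: "nat \<Rightarrow> 'b set" where
  "births p = (case p of 0 \<Rightarrow> B 0 | Suc q \<Rightarrow> M q)"

lemma births_simps [simp]: "births 0 = B 0" "births (Suc q) = M q"
  unfolding births_def by auto

lemma B_nonzero: "b \<in> B j \<Longrightarrow> b \<noteq> 0"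
  using good[of j] dependent_zero unfolding good_basis_def by blast

lemma births_subset: "births p \<subseteq> B p"
  using B_Suc by (cases p) auto

lemma s_0 [simp]: "s j 0 = 0"
  using steps[of j] unfolding basis_step_def by blast

lemma thread_before: "j < p \<Longrightarrow> thread s p b j = 0"
  by (induction j) auto

lemma thread_birth [simp]: "thread s p b p = b"
  by (cases p) auto

lemma thread_step: "p \<le> j \<Longrightarrow> thread s p b (Suc j) = s j (thread s p b j)"
  by simp

lemma thread_mem: "b \<in> births p \<Longrightarrow> thread s p b j \<noteq> 0 \<Longrightarrow> thread s p b j \<in> B j"
proof (induction j)
  case 0
  then show ?case by (auto split: if_splits)
next
  case (Suc j)
  show ?case
  proof (cases "p = Suc j")
    case True
    then show ?thesis using Suc.prems births_subset[of p] thread_birth[of p b] by (metis subsetD)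
  next
    case False
    then have eq: "thread s p b (Suc j) = s j (thread s p b j)" by simp
    then have "thread s p b j \<noteq> 0" using Suc.prems(2) s_0 by metis
    then have "thread s p b j \<in> B j" using Suc by blast
    then show ?thesis using Suc.prems(2) unfolding B_Suc eq by blast
  qed
qed

text \<open>Continuation is injective where it is nonzero and new vectors are not continuations, so distinct threads never merge.\<close>

lemma thread_inj:
  assumes "b \<in> births p" "b' \<in> births p'" "thread s p b j = thread s p' b' j" "thread s p b j \<noteq> 0"
  shows "p = p' \<and> b = b'"
  using assms(3,4)
proof (induction j)
  case 0
  then show ?case by (auto split: if_splits)
next
  case (Suc j)
  have stp: "inj_on (s j) {b\<in>B j. s j b \<noteq> 0}" "(s j ` B j - {0}) \<inter> M j = {}"
    using steps[of j] unfolding basis_step_def by auto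
  have mem: "thread s q c j \<in> B j \<and> thread s q c (Suc j) \<in> s j ` B j - {0}"
    if c: "c \<in> births q" "q \<noteq> Suc j" "thread s q c (Suc j) \<noteq> 0" for q c
  proof -
    have eq: "thread s q c (Suc j) = s j (thread s q c j)" using c(2) by simp
    then have "thread s q c j \<noteq> 0" using c(3) s_0 by metis
    then have "thread s q c j \<in> B j" using thread_mem c(1) by blast
    then show ?thesis using c(3) eq by blast
  qed
  have memM: "thread s q c (Suc j) \<in> M j" if "c \<in> births q" "q = Suc j" for q c using that by simp
  consider "p = Suc j" "p' = Suc j" | "p = Suc j" "p' \<noteq> Suc j" | "p \<noteq> Suc j" "p' = Suc j" | "p \<noteq> Suc j" "p' \<noteq> Suc j" by blast
  then show ?case
  proof cases
    case 1 then show ?thesis using Suc.prems by simp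
  next
    case 2
    have "thread s p b (Suc j) \<in> M j" by (rule memM[OF assms(1) 2(1)])
    moreover have "thread s p' b' (Suc j) \<in> s j ` B j - {0}" using mem[OF assms(2) 2(2)] Suc.prems by simp
    ultimately show ?thesis using stp(2) Suc.prems(1) by auto
  next
    case 3
    have "thread s p' b' (Suc j) \<in> M j" by (rule memM[OF assms(2) 3(2)])
    moreover have "thread s p b (Suc j) \<in> s j ` B j - {0}" using mem[OF assms(1) 3(1)] Suc.prems by simp
    ultimately show ?thesis using stp(2) Suc.prems(1) by auto
  next
    case 4
    have nz: "thread s p' b' (Suc j) \<noteq> 0" using Suc.prems by metis
    have 1: "thread s p b j \<in> B j" "thread s p' b' j \<in> B j"
      using mem[OF assms(1) 4(1) Suc.prems(2)] mem[OF assms(2) 4(2) nz] by auto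
    have 2: "s j (thread s p b j) = s j (thread s p' b' j)" "s j (thread s p b j) \<noteq> 0"
      using Suc.prems 4 by auto
    then have "thread s p b j = thread s p' b' j" using inj_onD[OF stp(1) 2(1)] 1 by auto
    then show ?thesis using Suc.IH B_nonzero[OF 1(1)] by blast
  qed
qed

lemma B_eq_threads: "B j = {thread s p b j | p b. b \<in> births p} - {0}"
proof
  show "{thread s p b j | p b. b \<in> births p} - {0} \<subseteq> B j" using thread_mem by blast
  show "B j \<subseteq> {thread s p b j | p b. b \<in> births p} - {0}"
  proof (induction j)
    case 0
    show ?case
    proof
      fix b assume b: "b \<in> B 0"
      then have "b = thread s 0 b 0" "b \<in> births 0" by auto
      then show "b \<in> {thread s p b 0 | p b. b \<in> births p} - {0}" using B_nonzero[OF b] by blast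
    qed
  next
    case (Suc j)
    show ?case
    proof
      fix b assume b: "b \<in> B (Suc j)"
      then consider "b \<in> M j" | c where "c \<in> B j" "b = s j c" unfolding B_Suc by blast
      then have "\<exists>p c. c \<in> births p \<and> b = thread s p c (Suc j)"
      proof cases
        case 1
        then show ?thesis by (intro exI[of _ "Suc j"] exI[of _ b]) simp
      next
        case (2 c)
        then obtain p d where d: "d \<in> births p" "c = thread s p d j" using Suc by blast
        have "\<not> j < p" using thread_before[of j p d] B_nonzero[OF 2(1)] d(2) by metis
        then have "b = thread s p d (Suc j)" using 2 d by simp
        then show ?thesis using d by blast
      qed
      then show "b \<in> {thread s p b (Suc j) | p b. b \<in> births p} - {0}" using B_nonzero[OF b] by blast
    qed
  qed
qed

lemma thread_arrow_out:
  assumes "out j" "b \<in> births p" "thread s p b j \<noteq> 0"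
  shows "L (ar j) (thread s p b j) = thread s p b (Suc j)"
proof -
  have "p \<le> j" using thread_before[of j p b] assms(3) by (metis not_le)
  then have "thread s p b (Suc j) = s j (thread s p b j)" by (rule thread_step)
  then show ?thesis using steps[of j] assms(1) thread_mem[OF assms(2,3)] unfolding basis_step_def by simp
qed

lemma thread_arrow_in:
  assumes "\<not> out j" "b \<in> births p" "thread s p b (Suc j) \<noteq> 0"
  shows "L (ar j) (thread s p b (Suc j)) = thread s p b j"
proof (cases "p = Suc j")
  case True
  then have "b \<in> M j" using assms(2) by simp
  then have "L (ar j) b = 0" using steps[of j] assms(1) unfolding basis_step_def by simp
  then show ?thesis using True thread_before[of j p b] by simp
next
  case False
  then have eq: "thread s p b (Suc j) = s j (thread s p b j)" by simp
  then have "thread s p b j \<noteq> 0" using assms(3) s_0 by metis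
  then have "thread s p b j \<in> B j" by (rule thread_mem[OF assms(2)])
  then show ?thesis using steps[of j] assms(1,3) unfolding eq basis_step_def by simp
qed

lemma thread_support:
  assumes "b \<in> births p"
  obtains q where "enat p \<le> q" "\<And>j. thread s p b j \<noteq> 0 \<longleftrightarrow> p \<le> j \<and> enat j \<le> q"
proof -
  have bnz: "b \<noteq> 0" using assms births_subset B_nonzero by blast
  have dead: "thread s p b (j + d) = 0" if "p \<le> j" "thread s p b j = 0" for j d
  proof (induction d)
    case (Suc d)
    have "p \<le> j + d" using that by simp
    then show ?case using Suc thread_step[of p "j + d" b] by simp
  qed (use that in simp)
  show thesis
  proof (cases "\<exists>j\<ge>p. thread s p b j = 0")
    case False
    show ?thesis
    proof (rule that[of \<infinity>])
      show "thread s p b j \<noteq> 0 \<longleftrightarrow> p \<le> j \<and> enat j \<le> \<infinity>" for j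
        using False thread_before[of j p b] by (metis enat_ord_code(3) not_le)
    qed simp
  next
    case True
    define m where "m = (LEAST j. p \<le> j \<and> thread s p b j = 0)"
    have m: "p \<le> m" "thread s p b m = 0" using LeastI_ex[OF True] unfolding m_def by auto
    have mp: "m \<noteq> p" using m(2) bnz by auto
    have alive: "thread s p b j \<noteq> 0" if "p \<le> j" "j < m" for j
      using not_less_Least[of j "\<lambda>j. p \<le> j \<and> thread s p b j = 0"] that unfolding m_def by blast
    show ?thesis
    proof (rule that[of "enat (m - 1)"])
      show "enat p \<le> enat (m - 1)" using m(1) mp by simp
      show "thread s p b j \<noteq> 0 \<longleftrightarrow> p \<le> j \<and> enat j \<le> enat (m - 1)" for j
      proof (cases "j < m")
        case True
        then show ?thesis using alive[of j] thread_before[of j p b] by (metis enat_ord_simps(1) less_Suc_eq_le not_le Suc_pred' gr_implies_not0 neq0_conv)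
      next
        case False
        then have "thread s p b j = 0" using dead[OF m, of "j - m"] by simp
        moreover have "\<not> j \<le> m - 1" using False m(1) mp by simp
        ultimately show ?thesis by simp
      qed
    qed
  qed
qed

text \<open>A chain member that contains \<open>x\<close> but not \<open>y\<close> still separates the two threads after a step, while \<open>n\<close> decreases; at \<open>n = 0\<close> separation is impossible. So one thread
ends before the other. If the arrow there points outwards, it is \<open>x\<close>, because \<open>y\<close> stays outside a subspace and thus nonzero; if it points inwards, it is \<open>y\<close>, because \<open>x\<close> lies in an image and so has
a continuation.\<close>

lemma first_death:
  assumes xy: "x \<in> births 0" "y \<in> births 0"
  shows "thread s 0 x j \<noteq> 0 \<Longrightarrow> thread s 0 y j \<noteq> 0 \<Longrightarrow> G = P \<or> G = (\<lambda>_. {0}) \<Longrightarrow>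
    thread s 0 x j \<in> pull n G j \<Longrightarrow> thread s 0 y j \<notin> pull n G j \<Longrightarrow>
    \<exists>k. thread s 0 x k \<noteq> 0 \<and> thread s 0 y k \<noteq> 0 \<and>
       ((out k \<and> thread s 0 x (Suc k) = 0 \<and> thread s 0 y (Suc k) \<noteq> 0) \<or>
        (\<not> out k \<and> thread s 0 y (Suc k) = 0 \<and> thread s 0 x (Suc k) \<noteq> 0))"
proof (induction n arbitrary: j)
  case 0
  have "thread s 0 y j \<in> P j"
    using thread_mem[OF xy(2) 0(2)] good[of j] span_base unfolding good_basis_def by blast
  then show ?case using 0 by auto
next
  case (Suc n)
  define F where "F = pull n G (Suc j)"
  have F: "F \<in> chain (Suc j)" unfolding F_def chain_def using Suc.prems(3) by blast
  have F0: "0 \<in> F" by (rule subspace_0[OF wchain_subspace[OF wchain_chain F]])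
  have xB: "thread s 0 x j \<in> B j" and yB: "thread s 0 y j \<in> B j"
    using thread_mem xy Suc.prems(1,2) by blast+
  have xP: "thread s 0 y j \<in> P j" using yB good[of j] span_base unfolding good_basis_def by blast
  have px: "thread s 0 x j \<in> pull_edge j F" and py: "thread s 0 y j \<notin> pull_edge j F" using Suc.prems(4,5) unfolding F_def by simp_all
  show ?case
  proof (cases "out j")
    case True
    have "L (ar j) (thread s 0 x j) \<in> F" using px True unfolding pull_edge_def transfer_def by simp
    then have x1: "thread s 0 x (Suc j) \<in> F" using thread_arrow_out[OF True xy(1) Suc.prems(1)] by metis
    have "L (ar j) (thread s 0 y j) \<notin> F" using py True xP unfolding pull_edge_def transfer_def by simp
    then have y1: "thread s 0 y (Suc j) \<notin> F" using thread_arrow_out[OF True xy(2) Suc.prems(2)] by metis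
    then have y2: "thread s 0 y (Suc j) \<noteq> 0" using F0 by metis
    show ?thesis
    proof (cases "thread s 0 x (Suc j) = 0")
      case x0: True
      show ?thesis using Suc.prems(1,2) x0 y2 True by blast
    next
      case False
      show ?thesis by (rule Suc.IH[OF False y2 Suc.prems(3) x1[unfolded F_def] y1[unfolded F_def]])
    qed
  next
    case False
    have "thread s 0 x j \<in> L (ar j) ` F" using px False unfolding pull_edge_def transfer_def by simp
    then have "s j (thread s 0 x j) \<noteq> 0 \<and> s j (thread s 0 x j) \<in> F"
      using steps[of j] False F xB unfolding basis_step_def by simp
    then have x1: "thread s 0 x (Suc j) \<in> F" and x2: "thread s 0 x (Suc j) \<noteq> 0" by simp_all
    show ?thesis
    proof (cases "thread s 0 y (Suc j) = 0")
      case y0: True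
      show ?thesis using Suc.prems(1,2) y0 x2 False by blast
    next
      case y2: False
      have "thread s 0 y (Suc j) \<notin> F"
      proof
        assume "thread s 0 y (Suc j) \<in> F"
        then have "thread s 0 y j \<in> L (ar j) ` F" using thread_arrow_in[OF False xy(2) y2] by (metis imageI)
        then show False using py False unfolding pull_edge_def transfer_def by simp
      qed
      then show ?thesis using Suc.IH[OF x2 y2 Suc.prems(3) x1[unfolded F_def]] unfolding F_def by blast
    qed
  qed
qed

end

section \<open>The summands of a representation\<close>

context d_infinity_rep
begin

definition arm_space :: "'v \<Rightarrow> 'b set" where
  "arm_space z = (if arm_out z then {x\<in>P 0. L (arm z) x = 0} else L (arm z) ` vspace V z)"

abbreviation arm_step where
  "arm_step z X t T \<equiv> basis_step (arm_out z) (L (arm z)) (vspace V z) {{0}, vspace V z} X t T"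

lemma arm_verts: "z \<in> {u, u'} \<Longrightarrow> arm z \<in> arrows Q \<and> z \<in> verts Q"
  by auto

lemma subspace_arm_space:
  assumes z: "z \<in> {u, u'}"
  shows "subspace (arm_space z)" "arm_space z \<subseteq> P 0"
proof -
  have a: "arm z \<in> arrows Q" and zv: "z \<in> verts Q" using arm_verts[OF z] by auto
  interpret l: Vector_Spaces.linear scale scale "L (arm z)" by (rule L_linear[OF a])
  have "{x\<in>P 0. L (arm z) x = 0} = P 0 \<inter> {x. L (arm z) x = 0}" by blast
  then show "subspace (arm_space z)"
    unfolding arm_space_def using subspace_inter[OF subspace_P l.subspace_kernel] l.subspace_image[OF quiver_repD(1)[OF rep zv]] by simp
  show "arm_space z \<subseteq> P 0"
    unfolding arm_space_def using L_maps[OF a] arm_simps[of z] by auto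
qed

lemma arm_step_exists:
  assumes z: "z \<in> {u, u'}" and X: "independent X" "span X = P 0" "arm_space z \<subseteq> span (X \<inter> arm_space z)"
  shows "\<exists>t T. arm_step z X t T"
proof -
  have a: "arm z \<in> arrows Q" and zv: "z \<in> verts Q" using arm_verts[OF z] by auto
  have sz: "subspace (vspace V z)" by (rule quiver_repD(1)[OF rep zv])
  show ?thesis
  proof (rule basis_step_exists[OF wchain_trivial[OF sz] _ L_linear[OF a] _ X(1,2)])
    show "if arm_out z then L (arm z) ` P 0 \<subseteq> vspace V z else L (arm z) ` vspace V z \<subseteq> P 0"
      using L_maps[OF a] arm_simps[of z] by auto
    have "transfer (arm_out z) (L (arm z)) (P 0) ` {{0}, vspace V z} \<subseteq> {{0}, P 0, arm_space z}"
    proof (cases "arm_out z")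
      case True
      have "{x \<in> P 0. L (arm z) x \<in> vspace V z} = P 0" using L_maps[OF a] arm_simps[of z] True by auto
      then show ?thesis using True unfolding transfer_def arm_space_def by auto
    next
      case False
      have "L (arm z) ` {0} = {0}" using L_0[OF a] by simp
      then show ?thesis using False unfolding transfer_def arm_space_def by auto
    qed
    moreover have "adapted X {{0}, P 0, arm_space z}" unfolding adapted_def
    proof (intro ballI)
      fix F assume "F \<in> {{0}, P 0, arm_space z}"
      then consider "F = {0}" | "F = P 0" | "F = arm_space z" by blast
      then show "span X \<inter> F \<subseteq> span (X \<inter> F)"
      proof cases
        case 1 then show ?thesis using span_zero by auto
      next
        case 2
        have "X \<subseteq> P 0" using X(2) span_superset by blast
        then have "X \<inter> F = X" using 2 by blast
        then show ?thesis by simp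
      next
        case 3 then show ?thesis using X(3) by blast
      qed
    qed
    ultimately show "adapted X (transfer (arm_out z) (L (arm z)) (P 0) ` {{0}, vspace V z})"
      unfolding adapted_def by blast
  qed simp
qed

lemma arm_step_nonzero:
  assumes z: "z \<in> {u, u'}" and st: "arm_step z X t T" and b: "b \<in> X" "b \<in> P 0"
  shows "t b \<noteq> 0 \<longleftrightarrow> (b \<in> arm_space z) \<noteq> arm_out z"
proof (cases "arm_out z")
  case True
  then have "t b = L (arm z) b" using st b unfolding basis_step_def by simp
  then show ?thesis using True b unfolding arm_space_def by simp
next
  case False
  have 1: "t b \<noteq> 0 \<Longrightarrow> L (arm z) (t b) = b" using st b False unfolding basis_step_def by simp
  have 2: "b \<in> L (arm z) ` vspace V z \<Longrightarrow> t b \<noteq> 0" using st b False unfolding basis_step_def by simp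
  have "t b \<in> vspace V z" if "t b \<noteq> 0"
  proof -
    have "t b \<in> span ((t ` X - {0}) \<union> T)" using that b by (intro span_base) auto
    then show ?thesis using st unfolding basis_step_def by blast
  qed
  then have "t b \<noteq> 0 \<Longrightarrow> b \<in> L (arm z) ` vspace V z" using 1 by force
  then show ?thesis using 2 False unfolding arm_space_def by auto
qed

end

text \<open>All the choices made in decomposing \<open>V\<close>. At \<open>w 0\<close> two bases are in use: the one that starts the threads is adapted to the arm \<open>u\<close>, and replacing the second
members \<open>c + \<beta> c\<close> of the pairs by \<open>\<beta> c\<close> makes it adapted to \<open>u'\<close>.\<close>

locale labelled_rep = threaded_rep scale Q u u' w N V L B s M
  for scale :: "'f::field \<Rightarrow> 'b::ab_group_add \<Rightarrow> 'b" and Q :: "'v quiver" and u u' w N V L B s M +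
  fixes S C :: "'b set" and \<beta> su su' :: "'b \<Rightarrow> 'b" and Mu Mu' :: "'b set"
  assumes B0: "B 0 = S \<union> C \<union> (\<lambda>c. c + \<beta> c) ` C"
    and f_inj: "inj_on (\<lambda>c. c + \<beta> c) C" and SC: "S \<inter> C = {}" and f_disj: "(S \<union> C) \<inter> (\<lambda>c. c + \<beta> c) ` C = {}"
    and \<beta>_inj: "inj_on \<beta> C" and \<beta>_disj: "(S \<union> C) \<inter> \<beta> ` C = {}"
    and C_arm: "\<And>c. c \<in> C \<Longrightarrow> c \<in> arm_space u \<and> c \<notin> arm_space u' \<and> \<beta> c \<in> arm_space u' \<and> \<beta> c \<notin> arm_space u"
    and C_chain: "\<And>c. c \<in> C \<Longrightarrow> \<exists>F\<in>chain 0. c + \<beta> c \<in> F \<and> c \<notin> F"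
    and su: "arm_step u (S \<union> C \<union> (\<lambda>c. c + \<beta> c) ` C) su Mu"
    and su': "arm_step u' (S \<union> C \<union> \<beta> ` C) su' Mu'"
begin

definition f :: "'b \<Rightarrow> 'b" where "f c = c + \<beta> c"

definition B' :: "'b set" where "B' = S \<union> C \<union> \<beta> ` C"

lemma f_facts: "B 0 = S \<union> C \<union> f ` C" "inj_on f C" "(S \<union> C) \<inter> f ` C = {}" "arm_step u (B 0) su Mu" "arm_step u' B' su' Mu'"
  using B0 f_inj f_disj su su' unfolding f_def B'_def by simp_all

text \<open>The summand to which a basis vector at \<open>w 0\<close> (\<open>lab0\<close>), a thread (\<open>lab\<close>) or a vector of the second basis at \<open>w 0\<close> (\<open>lab'\<close>) belongs.
The part of the bases with a given label is called a piece.\<close>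

definition lab0 :: "'b \<Rightarrow> 'b summand_label" where
  "lab0 b = (if b \<in> S then Thread 0 b else if b \<in> C then Pair b else Pair (inv_into C f b))"

definition lab :: "nat \<Rightarrow> 'b \<Rightarrow> 'b summand_label" where
  "lab p b = (if p = 0 then lab0 b else Thread p b)"

definition lab' :: "'b \<Rightarrow> 'b summand_label" where
  "lab' b = (if b \<in> S then Thread 0 b else if b \<in> C then Pair b else Pair (inv_into C \<beta> b))"

definition labels :: "'b summand_label set" where
  "labels = Thread 0 ` S \<union> {Thread (Suc p) b | p b. b \<in> M p} \<union> Pair ` C \<union> Arm True ` Mu \<union> Arm False ` Mu'"

definition piece :: "'b summand_label \<Rightarrow> 'v \<Rightarrow> 'b set" where
  "piece k i = (if i = u then ({su b | b. b \<in> B 0 \<and> lab0 b = k} - {0}) \<union> {m\<in>Mu. k = Arm True m}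
     else if i = u' then ({su' b | b. b \<in> B' \<and> lab' b = k} - {0}) \<union> {m\<in>Mu'. k = Arm False m}
     else {thread s p b (inv w i) | p b. b \<in> births p \<and> lab p b = k} - {0})"

lemma piece_simps:
  "piece k u = ({su b | b. b \<in> B 0 \<and> lab0 b = k} - {0}) \<union> {m\<in>Mu. k = Arm True m}"
  "piece k u' = ({su' b | b. b \<in> B' \<and> lab' b = k} - {0}) \<union> {m\<in>Mu'. k = Arm False m}"
  "piece k (w j) = {thread s p b j | p b. b \<in> births p \<and> lab p b = k} - {0}"
  unfolding piece_def using w_inj by auto

lemma lab0_simps:
  "b \<in> S \<Longrightarrow> lab0 b = Thread 0 b" "c \<in> C \<Longrightarrow> lab0 c = Pair c" "c \<in> C \<Longrightarrow> lab0 (f c) = Pair c"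
proof -
  show "b \<in> S \<Longrightarrow> lab0 b = Thread 0 b" unfolding lab0_def by simp
  show "lab0 c = Pair c" if "c \<in> C" using that SC unfolding lab0_def by auto
  show "lab0 (f c) = Pair c" if c: "c \<in> C"
  proof -
    have "f c \<notin> S" "f c \<notin> C" using f_facts(3) c by blast+
    then show ?thesis using inv_into_f_f[OF f_facts(2) c] unfolding lab0_def by simp
  qed
qed

lemma lab'_simps:
  "b \<in> S \<Longrightarrow> lab' b = Thread 0 b" "c \<in> C \<Longrightarrow> lab' c = Pair c" "c \<in> C \<Longrightarrow> lab' (\<beta> c) = Pair c"
proof -
  show "b \<in> S \<Longrightarrow> lab' b = Thread 0 b" unfolding lab'_def by simp
  show "lab' c = Pair c" if "c \<in> C" using that SC unfolding lab'_def by auto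
  show "lab' (\<beta> c) = Pair c" if c: "c \<in> C"
  proof -
    have "\<beta> c \<notin> S" "\<beta> c \<notin> C" using \<beta>_disj c by blast+
    then show ?thesis using inv_into_f_f[OF \<beta>_inj c] unfolding lab'_def by simp
  qed
qed

lemma B0_cases:
  assumes "b \<in> B 0"
  obtains "b \<in> S" | "b \<in> C" | c where "c \<in> C" "b = f c"
  using assms unfolding f_facts(1) by blast

lemma B'_cases:
  assumes "b \<in> B'"
  obtains "b \<in> S" | "b \<in> C" | c where "c \<in> C" "b = \<beta> c"
  using assms unfolding B'_def by blast

lemma lab0_mem: "b \<in> B 0 \<Longrightarrow> lab0 b \<in> labels"
  by (erule B0_cases) (auto simp: lab0_simps labels_def)

lemma lab'_mem: "b \<in> B' \<Longrightarrow> lab' b \<in> labels"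
  by (erule B'_cases) (auto simp: lab'_simps labels_def)

lemma lab_mem: "b \<in> births p \<Longrightarrow> lab p b \<in> labels"
proof (cases p)
  case 0
  assume "b \<in> births p"
  then show ?thesis using lab0_mem 0 by (simp add: lab_def)
next
  case (Suc q)
  assume "b \<in> births p"
  then show ?thesis using Suc by (simp add: lab_def labels_def)
qed

lemma pieces_cover:
  "(\<Union>k\<in>labels. piece k u) = (su ` B 0 - {0}) \<union> Mu"
  "(\<Union>k\<in>labels. piece k u') = (su' ` B' - {0}) \<union> Mu'"
  "(\<Union>k\<in>labels. piece k (w j)) = B j"
proof -
  have "Arm True m \<in> labels" if "m \<in> Mu" for m using that unfolding labels_def by blast
  then show "(\<Union>k\<in>labels. piece k u) = (su ` B 0 - {0}) \<union> Mu"
    unfolding piece_simps using lab0_mem by fast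
  have "Arm False m \<in> labels" if "m \<in> Mu'" for m using that unfolding labels_def by blast
  then show "(\<Union>k\<in>labels. piece k u') = (su' ` B' - {0}) \<union> Mu'"
    unfolding piece_simps using lab'_mem by fast
  show "(\<Union>k\<in>labels. piece k (w j)) = B j"
    unfolding piece_simps B_eq_threads[of j] using lab_mem by fast
qed

lemma lab0_not_Arm: "lab0 b \<noteq> Arm q m" and lab'_not_Arm: "lab' b \<noteq> Arm q m"
  unfolding lab0_def lab'_def by auto

lemma pieces_disjoint:
  assumes i: "i \<in> verts Q" and y: "y \<in> piece k i" "y \<in> piece l i"
  shows "k = l"
  using i
proof (cases rule: vert_cases)
  case 1
  have inj: "inj_on su {b\<in>B 0. su b \<noteq> 0}" and disj: "(su ` B 0 - {0}) \<inter> Mu = {}"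
    using f_facts(4) unfolding basis_step_def by auto
  have "(\<exists>b\<in>B 0. y = su b \<and> su b \<noteq> 0 \<and> lab0 b = k') \<and> y \<notin> Mu \<or> y \<in> Mu \<and> k' = Arm True y" if "y \<in> piece k' u" for k'
    using that disj unfolding piece_simps by blast
  then have d: "(\<exists>b\<in>B 0. y = su b \<and> su b \<noteq> 0 \<and> lab0 b = k) \<and> y \<notin> Mu \<or> y \<in> Mu \<and> k = Arm True y"
      "(\<exists>b\<in>B 0. y = su b \<and> su b \<noteq> 0 \<and> lab0 b = l) \<and> y \<notin> Mu \<or> y \<in> Mu \<and> l = Arm True y"
    using y 1 by blast+
  show ?thesis
  proof (cases "y \<in> Mu")
    case True then show ?thesis using d by blast
  next
    case False
    then obtain b b' where b: "b \<in> B 0" "y = su b" "su b \<noteq> 0" "lab0 b = k" "b' \<in> B 0" "y = su b'" "su b' \<noteq> 0" "lab0 b' = l"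
      using d by blast
    have "b = b'" by (rule inj_onD[OF inj]) (use b in auto)
    then show ?thesis using b by blast
  qed
next
  case 2
  have inj: "inj_on su' {b\<in>B'. su' b \<noteq> 0}" and disj: "(su' ` B' - {0}) \<inter> Mu' = {}"
    using f_facts(5) unfolding basis_step_def by auto
  have "(\<exists>b\<in>B'. y = su' b \<and> su' b \<noteq> 0 \<and> lab' b = k') \<and> y \<notin> Mu' \<or> y \<in> Mu' \<and> k' = Arm False y" if "y \<in> piece k' u'" for k'
    using that disj unfolding piece_simps by blast
  then have d: "(\<exists>b\<in>B'. y = su' b \<and> su' b \<noteq> 0 \<and> lab' b = k) \<and> y \<notin> Mu' \<or> y \<in> Mu' \<and> k = Arm False y"
      "(\<exists>b\<in>B'. y = su' b \<and> su' b \<noteq> 0 \<and> lab' b = l) \<and> y \<notin> Mu' \<or> y \<in> Mu' \<and> l = Arm False y"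
    using y 2 by blast+
  show ?thesis
  proof (cases "y \<in> Mu'")
    case True then show ?thesis using d by blast
  next
    case False
    then obtain b b' where b: "b \<in> B'" "y = su' b" "su' b \<noteq> 0" "lab' b = k" "b' \<in> B'" "y = su' b'" "su' b' \<noteq> 0" "lab' b' = l"
      using d by blast
    have "b = b'" by (rule inj_onD[OF inj]) (use b in auto)
    then show ?thesis using b by blast
  qed
next
  case (3 j)
  obtain p b p' b' where b: "y = thread s p b j" "b \<in> births p" "lab p b = k" "y \<noteq> 0"
      "y = thread s p' b' j" "b' \<in> births p'" "lab p' b' = l"
    using y unfolding 3 piece_simps by blast
  have "p = p' \<and> b = b'" by (rule thread_inj[OF b(2,6)]) (use b in auto)
  then show ?thesis using b by blast
qed

lemma pieces_basis:
  assumes "i \<in> verts Q"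
  shows "independent (\<Union>k\<in>labels. piece k i) \<and> span (\<Union>k\<in>labels. piece k i) = vspace V i"
  using assms
proof (cases rule: vert_cases)
  case 1 then show ?thesis using f_facts(4) unfolding 1 pieces_cover basis_step_def by blast
next
  case 2 then show ?thesis using f_facts(5) unfolding 2 pieces_cover basis_step_def by blast
next
  case (3 j) then show ?thesis using good[of j] unfolding 3 pieces_cover good_basis_def by blast
qed

lemma piece_w_mem: "b \<in> births p \<Longrightarrow> lab p b = k \<Longrightarrow> thread s p b j \<in> span (piece k (w j))"
proof (cases "thread s p b j = 0")
  case False
  assume "b \<in> births p" "lab p b = k"
  then show ?thesis using False unfolding piece_simps by (intro span_base) blast
qed (simp add: span_zero)

lemma su_out: "arm_out u \<Longrightarrow> b \<in> B 0 \<Longrightarrow> su b = L (arm u) b"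
  and su_in: "\<not> arm_out u \<Longrightarrow> b \<in> B 0 \<Longrightarrow> su b \<noteq> 0 \<Longrightarrow> L (arm u) (su b) = b"
  and Mu_in: "\<not> arm_out u \<Longrightarrow> m \<in> Mu \<Longrightarrow> L (arm u) m = 0"
  using f_facts(4) unfolding basis_step_def by auto

lemma su'_out: "arm_out u' \<Longrightarrow> b \<in> B' \<Longrightarrow> su' b = L (arm u') b"
  and su'_in: "\<not> arm_out u' \<Longrightarrow> b \<in> B' \<Longrightarrow> su' b \<noteq> 0 \<Longrightarrow> L (arm u') (su' b) = b"
  and Mu'_in: "\<not> arm_out u' \<Longrightarrow> m \<in> Mu' \<Longrightarrow> L (arm u') m = 0"
  using f_facts(5) unfolding basis_step_def by auto

lemma C_B: "c \<in> C \<Longrightarrow> c \<in> B 0 \<and> f c \<in> B 0 \<and> c \<in> B' \<and> \<beta> c \<in> B' \<and> \<beta> c = f c - c"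
  unfolding f_facts(1) B'_def f_def by simp

lemma S_B: "b \<in> S \<Longrightarrow> b \<in> B 0 \<and> b \<in> B'"
  unfolding f_facts(1) B'_def by simp

lemma B_P: "b \<in> B j \<Longrightarrow> b \<in> P j"
  using good[of j] span_base unfolding good_basis_def by blast

lemma Lu'_f:
  assumes o: "arm_out u'" and c: "c \<in> C"
  shows "L (arm u') (f c) = su' c" "L (arm u') c = su' c"
proof -
  interpret l: Vector_Spaces.linear scale scale "L (arm u')" by (rule L_linear[OF arm_arrow(2)])
  have "L (arm u') (\<beta> c) = 0" using C_arm[OF c] o unfolding arm_space_def by simp
  then show "L (arm u') (f c) = su' c" "L (arm u') c = su' c"
    using su'_out[OF o] C_B[OF c] unfolding f_def by (simp_all add: l.add)
qed

text \<open>Along the line an arrow maps a thread to itself. The delicate point is the arm \<open>u'\<close>, which sees the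
basis with \<open>\<beta> c\<close> instead of \<open>c + \<beta> c\<close>: if it points outwards, both members of a pair have the image of \<open>c\<close>; if it points inwards,
\<open>\<beta> c\<close> is the difference of the two members.\<close>

lemma pieces_closed:
  assumes a: "a \<in> arrows Q" and x: "x \<in> piece k (fst a)"
  shows "L a x \<in> span (piece k (snd a))"
  using a
proof (cases rule: arrow_cases)
  case (3 j)
  show ?thesis
  proof (cases "out j")
    case True
    have "x \<in> piece k (w j)" using x 3 ar_simps[of j] True by simp
    then obtain p b where b: "x = thread s p b j" "b \<in> births p" "lab p b = k" "x \<noteq> 0" unfolding piece_simps by blast
    have "L a x = thread s p b (Suc j)" unfolding 3 b(1) by (rule thread_arrow_out[OF True b(2)]) (use b in simp)
    then show ?thesis using piece_w_mem[OF b(2,3), of "Suc j"] 3 ar_simps[of j] True by simp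
  next
    case False
    have "x \<in> piece k (w (Suc j))" using x 3 ar_simps[of j] False by simp
    then obtain p b where b: "x = thread s p b (Suc j)" "b \<in> births p" "lab p b = k" "x \<noteq> 0" unfolding piece_simps by blast
    have "L a x = thread s p b j" unfolding 3 b(1) by (rule thread_arrow_in[OF False b(2)]) (use b in metis)
    then show ?thesis using piece_w_mem[OF b(2,3), of j] 3 ar_simps[of j] False by simp
  qed
next
  case 1
  show ?thesis
  proof (cases "arm_out u")
    case True
    have "x \<in> piece k (w 0)" using x 1 arm_simps[of u] True by simp
    then obtain p b where b: "x = thread s p b 0" "b \<in> births p" "lab p b = k" "x \<noteq> 0" unfolding piece_simps by blast
    then have p: "p = 0" "x = b" by (auto split: if_splits)
    have "L a x = su b" using su_out[OF True] b(2) p 1 by simp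
    moreover have "su b \<in> span (piece k u)"
    proof (cases "su b = 0")
      case False
      then show ?thesis using b p unfolding piece_simps lab_def by (intro span_base) auto
    qed (simp add: span_zero)
    ultimately show ?thesis using 1 arm_simps[of u] True by simp
  next
    case False
    have "x \<in> piece k u" using x 1 arm_simps[of u] False by simp
    then consider b where "x = su b" "b \<in> B 0" "lab0 b = k" "x \<noteq> 0" | "x \<in> Mu" unfolding piece_simps by blast
    then have "L a x \<in> span (piece k (w 0))"
    proof cases
      case (1 b)
      then have "L a x = thread s 0 b 0" using su_in[OF False] \<open>a = arm u\<close> by simp
      then show ?thesis using piece_w_mem[of b 0 k 0] 1 unfolding lab_def by simp
    next
      case 2
      then show ?thesis using Mu_in[OF False] 1 span_zero by simp
    qed
    then show ?thesis using 1 arm_simps[of u] False by simp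
  qed
next
  case 2
  show ?thesis
  proof (cases "arm_out u'")
    case True
    have "x \<in> piece k (w 0)" using x 2 arm_simps[of u'] True by simp
    then obtain p b where b: "x = thread s p b 0" "b \<in> births p" "lab p b = k" "x \<noteq> 0" unfolding piece_simps by blast
    then have p: "p = 0" "x = b" by (auto split: if_splits)
    have bB: "b \<in> B 0" using b(2) p(1) by simp
    have "\<exists>d\<in>B'. L a x = su' d \<and> lab' d = k"
      using bB
    proof (cases rule: B0_cases)
      case 1
      then show ?thesis using S_B su'_out[OF True] b(3) p 2 lab'_simps lab0_simps unfolding lab_def by (intro bexI[of _ b]) auto
    next
      case 2
      then show ?thesis using C_B su'_out[OF True] b(3) p \<open>a = arm u'\<close> lab'_simps lab0_simps unfolding lab_def by (intro bexI[of _ b]) auto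
    next
      case (3 c)
      have "k = Pair c" using lab0_simps(3)[OF 3(1)] b(3) p(1) 3(2) unfolding lab_def by simp
      then show ?thesis using C_B[OF 3(1)] Lu'_f(1)[OF True 3(1)] lab'_simps(2)[OF 3(1)] 3(2) p(2) 2 by (intro bexI[of _ c]) simp_all
    qed
    then obtain d where d: "d \<in> B'" "L a x = su' d" "lab' d = k" by blast
    have "su' d \<in> span (piece k u')"
    proof (cases "su' d = 0")
      case False
      then show ?thesis using d unfolding piece_simps by (intro span_base) auto
    qed (simp add: span_zero)
    then show ?thesis using d(2) 2 arm_simps[of u'] True by simp
  next
    case False
    have "x \<in> piece k u'" using x 2 arm_simps[of u'] False by simp
    then consider b where "x = su' b" "b \<in> B'" "lab' b = k" "x \<noteq> 0" | "x \<in> Mu'" unfolding piece_simps by blast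
    then have "L a x \<in> span (piece k (w 0))"
    proof cases
      case (1 b)
      then have Lx: "L a x = b" using su'_in[OF False] 2 by simp
      show ?thesis using 1(2)
      proof (cases rule: B'_cases)
        case s: 1
        then show ?thesis using piece_w_mem[of b 0 k 0] S_B Lx 1(3) lab0_simps lab'_simps unfolding lab_def by simp
      next
        case c: 2
        then show ?thesis using piece_w_mem[of b 0 k 0] C_B Lx 1(3) lab0_simps lab'_simps unfolding lab_def by simp
      next
        case c: (3 c)
        have k: "k = Pair c" using lab'_simps(3)[OF c(1)] 1(3) c(2) by simp
        have "f c \<in> span (piece k (w 0))" "c \<in> span (piece k (w 0))"
          using piece_w_mem[of "f c" 0 k 0] piece_w_mem[of c 0 k 0] C_B[OF c(1)] lab0_simps(2,3)[OF c(1)] k unfolding lab_def by simp_all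
        then have "f c - c \<in> span (piece k (w 0))" by (rule span_diff)
        then show ?thesis using Lx C_B[OF c(1)] c(2) by simp
      qed
    next
      case 2
      then show ?thesis using Mu'_in[OF False] \<open>a = arm u'\<close> span_zero by simp
    qed
    then show ?thesis using 2 arm_simps[of u'] False by simp
  qed
qed

lemma piece_subset:
  assumes "k \<in> labels" "i \<in> verts Q"
  shows "piece k i \<subseteq> vspace V i"
proof -
  have "piece k i \<subseteq> (\<Union>k\<in>labels. piece k i)" using assms(1) by blast
  then show ?thesis using pieces_basis[OF assms(2)] span_superset by blast
qed

lemma pieces_closed_amap:
  assumes "k \<in> labels" "a \<in> arrows Q" "x \<in> piece k (fst a)"
  shows "amap V a x \<in> span (piece k (snd a))"
  using pieces_closed[OF assms(2,3)] L_eq[OF assms(2)] piece_subset[OF assms(1)] arrow_verts[OF assms(2)] assms(3)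
  by (metis subsetD)

lemma piece_subrep:
  assumes "k \<in> labels"
  shows "subrep scale Q (basis_piece V (piece k)) V"
  by (rule subrep_basis_piece[OF rep piece_subset[OF assms] pieces_closed_amap[OF assms]])

lemma pieces_direct_sum: "direct_sum scale Q V (piece ` labels) (basis_piece V)"
proof (rule direct_sum_basis_pieces[OF rep])
  show "independent (\<Union>X\<in>piece ` labels. X i) \<and> span (\<Union>X\<in>piece ` labels. X i) = vspace V i" if "i \<in> verts Q" for i
    using pieces_basis[OF that] by simp
  show "X i \<inter> Y i = {}" if "i \<in> verts Q" "X \<in> piece ` labels" "Y \<in> piece ` labels" "X \<noteq> Y" for i X Y
    using that pieces_disjoint by blast
  show "amap V a x \<in> span (X (snd a))" if "X \<in> piece ` labels" "a \<in> arrows Q" "x \<in> X (fst a)" for X a x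
    using that pieces_closed_amap by blast
qed

lemma lab_eq_Thread0: "b \<in> births p \<Longrightarrow> d \<in> S \<Longrightarrow> lab p b = Thread 0 d \<longleftrightarrow> p = 0 \<and> b = d"
proof (cases p)
  case 0
  assume b: "b \<in> births p" and d: "d \<in> S"
  show ?thesis using b[unfolded 0, simplified]
    by (rule B0_cases) (use 0 d SC f_facts(3) in \<open>auto simp: lab_def lab0_simps\<close>)
qed (auto simp: lab_def)

lemma lab'_eq_Thread0: "b \<in> B' \<Longrightarrow> d \<in> S \<Longrightarrow> lab' b = Thread 0 d \<longleftrightarrow> b = d"
  by (erule B'_cases) (use SC \<beta>_disj in \<open>auto simp: lab'_simps\<close>)

lemma lab_eq_Pair: "b \<in> births p \<Longrightarrow> c \<in> C \<Longrightarrow> lab p b = Pair c \<longleftrightarrow> p = 0 \<and> (b = c \<or> b = f c)"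
proof (cases p)
  case 0
  assume b: "b \<in> births p" and c: "c \<in> C"
  show ?thesis using b[unfolded 0, simplified]
  proof (cases rule: B0_cases)
    case 1
    then show ?thesis using 0 c SC f_facts(3) by (auto simp: lab_def lab0_simps)
  next
    case 2
    then have "b \<noteq> f c" using f_facts(3) c by blast
    then show ?thesis using 0 2 by (simp add: lab_def lab0_simps)
  next
    case (3 d)
    then have "f d \<noteq> c" "f d = f c \<longleftrightarrow> d = c" using f_facts(2,3) c by (auto dest: inj_onD)
    then show ?thesis using 0 3 by (simp add: lab_def lab0_simps)
  qed
qed (auto simp: lab_def)

lemma lab'_eq_Pair: "b \<in> B' \<Longrightarrow> c \<in> C \<Longrightarrow> lab' b = Pair c \<longleftrightarrow> b = c \<or> b = \<beta> c"
proof -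
  assume b: "b \<in> B'" and c: "c \<in> C"
  show ?thesis using b
  proof (cases rule: B'_cases)
    case 1
    then show ?thesis using c SC \<beta>_disj by (auto simp: lab'_simps)
  next
    case 2
    then have "b \<noteq> \<beta> c" using \<beta>_disj c by blast
    then show ?thesis using 2 by (simp add: lab'_simps)
  next
    case (3 d)
    then have "\<beta> d \<noteq> c" "\<beta> d = \<beta> c \<longleftrightarrow> d = c" using \<beta>_inj \<beta>_disj c by (auto dest: inj_onD)
    then show ?thesis using 3 by (simp add: lab'_simps)
  qed
qed

lemma lab_eq_Thread_Suc: "lab p b = Thread (Suc q) d \<longleftrightarrow> p = Suc q \<and> b = d"
  unfolding lab_def lab0_def by auto

lemma amap_L:
  assumes "k \<in> labels" "a \<in> arrows Q" "x \<in> vspace (basis_piece V (piece k)) (fst a)"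
  shows "amap (basis_piece V (piece k)) a x = L a x"
proof -
  have "x \<in> vspace V (fst a)" using subrepD(2)[OF piece_subrep[OF assms(1)] _ assms(3)] arrow_verts[OF assms(2)] by blast
  then show ?thesis using L_eq[OF assms(2)] unfolding basis_piece_def by simp
qed

lemma thin_piece:
  assumes k: "k \<in> labels" and I: "I \<subseteq> verts Q"
    and x: "\<And>i. i \<in> verts Q \<Longrightarrow> piece k i = {x i} - {0}" and xI: "\<And>i. i \<in> verts Q \<Longrightarrow> x i \<noteq> 0 \<longleftrightarrow> i \<in> I"
    and arr: "\<And>a. a \<in> arrows Q \<Longrightarrow> fst a \<in> I \<Longrightarrow> snd a \<in> I \<Longrightarrow> L a (x (fst a)) = x (snd a)"
  shows "thin (basis_piece V (piece k)) I"
  unfolding thin_def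
proof (intro conjI exI[of _ x] ballI impI)
  show "quiver_rep scale Q (basis_piece V (piece k))" by (rule subrepD(1)[OF piece_subrep[OF k]])
  show sp: "vspace (basis_piece V (piece k)) i = span {x i}" if "i \<in> verts Q" for i
    using x[OF that] unfolding basis_piece_def by simp
  show "x i \<noteq> 0 \<longleftrightarrow> i \<in> I" if "i \<in> verts Q" for i by (rule xI[OF that])
  show "amap (basis_piece V (piece k)) a (x (fst a)) = x (snd a)" if "a \<in> arrows Q" "fst a \<in> I" "snd a \<in> I" for a
    using amap_L[OF k that(1), of "x (fst a)"] arr[OF that] sp[of "fst a"] I that(2) by (auto intro: span_base)
qed

definition vertexwise :: "'b \<Rightarrow> 'b \<Rightarrow> (nat \<Rightarrow> 'b) \<Rightarrow> 'v \<Rightarrow> 'b" where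
  "vertexwise y y' g i = (if i = u then y else if i = u' then y' else g (inv w i))"

lemma vertexwise_simps [simp]: "vertexwise y y' g u = y" "vertexwise y y' g u' = y'" "vertexwise y y' g (w j) = g j"
  unfolding vertexwise_def using w_inj by auto

lemma thin_thread_piece:
  assumes k: "k \<in> labels" and b: "b \<in> births p"
    and pw: "\<And>j. piece k (w j) = {thread s p b j} - {0}"
    and pu: "piece k u = {y} - {0}" and pu': "piece k u' = {y'} - {0}" and y0: "p \<noteq> 0 \<Longrightarrow> y = 0 \<and> y' = 0"
    and Lu: "y \<noteq> 0 \<Longrightarrow> if arm_out u then L (arm u) b = y else L (arm u) y = b"
    and Lu': "y' \<noteq> 0 \<Longrightarrow> if arm_out u' then L (arm u') b = y' else L (arm u') y' = b"
  shows "root_brick (basis_piece V (piece k))"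
proof -
  obtain q where q: "enat p \<le> q" "\<And>j. thread s p b j \<noteq> 0 \<longleftrightarrow> p \<le> j \<and> enat j \<le> q" using thread_support[OF b] by blast
  define Z where "Z = {i. i = u \<and> y \<noteq> 0} \<union> {i. i = u' \<and> y' \<noteq> 0}"
  define I where "I = Z \<union> {w j | j. p \<le> j \<and> enat j \<le> q}"
  have Ius: "u \<in> I \<longleftrightarrow> y \<noteq> 0" "u' \<in> I \<longleftrightarrow> y' \<noteq> 0" "w j \<in> I \<longleftrightarrow> p \<le> j \<and> enat j \<le> q" for j
    unfolding I_def Z_def by auto
  have "Z \<subseteq> {u, u'}" "Z = {} \<or> p = 0" using y0 unfolding Z_def by auto
  then have "enat p \<le> q \<and> Z \<subseteq> {u, u'} \<and> (Z = {} \<or> p = 0) \<and> I = Z \<union> {w j | j. p \<le> j \<and> enat j \<le> q}"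
    using q(1) I_def by (intro conjI)
  then have "thin_support I" unfolding thin_support_def
    by (intro disjI2 exI[of _ p] exI[of _ q] exI[of _ Z])
  moreover have "thin (basis_piece V (piece k)) I"
  proof (rule thin_piece[OF k, of _ "vertexwise y y' (thread s p b)"])
    show "I \<subseteq> verts Q" unfolding I_def Z_def by auto
    show "piece k i = {vertexwise y y' (thread s p b) i} - {0}" if "i \<in> verts Q" for i
      using that by (cases rule: vert_cases) (simp_all add: pu pu' pw)
    show "vertexwise y y' (thread s p b) i \<noteq> 0 \<longleftrightarrow> i \<in> I" if "i \<in> verts Q" for i
      using that by (cases rule: vert_cases) (simp_all add: Ius q(2))
    fix a assume a: "a \<in> arrows Q" and aI: "fst a \<in> I" "snd a \<in> I"
    show "L a (vertexwise y y' (thread s p b) (fst a)) = vertexwise y y' (thread s p b) (snd a)"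
      using a
    proof (cases rule: arrow_cases)
      case 1
      have "u \<in> I" "w 0 \<in> I" using aI 1 arm_simps[of u] by (cases "arm_out u"; simp)+
      then have "y \<noteq> 0" "thread s p b 0 = b" using Ius by auto
      then show ?thesis using Lu 1 arm_simps[of u] by (cases "arm_out u") simp_all
    next
      case 2
      have "u' \<in> I" "w 0 \<in> I" using aI 2 arm_simps[of u'] by (cases "arm_out u'"; simp)+
      then have "y' \<noteq> 0" "thread s p b 0 = b" using Ius by auto
      then show ?thesis using Lu' 2 arm_simps[of u'] by (cases "arm_out u'") simp_all
    next
      case (3 j)
      have "w j \<in> I" "w (Suc j) \<in> I" using aI 3 ar_simps[of j] by (cases "out j"; simp)+
      then have nz: "thread s p b j \<noteq> 0" "thread s p b (Suc j) \<noteq> 0" using Ius q(2) by metis+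
      show ?thesis
      proof (cases "out j")
        case True
        show ?thesis using thread_arrow_out[OF True b nz(1)] 3 ar_simps(1,2)[OF True] by (metis vertexwise_simps(3))
      next
        case False
        show ?thesis using thread_arrow_in[OF False b nz(2)] 3 ar_simps(3,4)[OF False] by (metis vertexwise_simps(3))
      qed
    qed
  qed
  ultimately show ?thesis unfolding root_brick_def by blast
qed

lemma Thread_Suc_piece:
  assumes b: "b \<in> M p"
  shows "root_brick (basis_piece V (piece (Thread (Suc p) b)))"
proof (rule thin_thread_piece[where p = "Suc p" and b = b and y = 0 and y' = 0])
  show "Thread (Suc p) b \<in> labels" using b unfolding labels_def by blast
  show "b \<in> births (Suc p)" using b by simp
  show "piece (Thread (Suc p) b) (w j) = {thread s (Suc p) b j} - {0}" for j
    unfolding piece_simps lab_eq_Thread_Suc using b by auto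
  show "piece (Thread (Suc p) b) u = {0} - {0}" "piece (Thread (Suc p) b) u' = {0} - {0}"
    unfolding piece_simps lab0_def lab'_def by auto
qed auto

lemma Thread_0_piece:
  assumes b: "b \<in> S"
  shows "root_brick (basis_piece V (piece (Thread 0 b)))"
proof (rule thin_thread_piece[where p = 0 and b = b and y = "su b" and y' = "su' b"])
  show "Thread 0 b \<in> labels" using b unfolding labels_def by blast
  show b0: "b \<in> births 0" using S_B[OF b] by simp
  have eq: "b' \<in> births p \<and> lab p b' = Thread 0 b \<longleftrightarrow> p = 0 \<and> b' = b" for p b'
    using lab_eq_Thread0[OF _ b] b0 by blast
  show "piece (Thread 0 b) (w j) = {thread s 0 b j} - {0}" for j
    unfolding piece_simps eq by auto
  have "lab0 b' = Thread 0 b \<longleftrightarrow> b' = b" if "b' \<in> B 0" for b'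
    using lab_eq_Thread0[of b' 0 b] that b unfolding lab_def by simp
  then show "piece (Thread 0 b) u = {su b} - {0}" unfolding piece_simps using S_B[OF b] by auto
  show "piece (Thread 0 b) u' = {su' b} - {0}" unfolding piece_simps using lab'_eq_Thread0[OF _ b] S_B[OF b] by auto
  show "su b \<noteq> 0 \<Longrightarrow> if arm_out u then L (arm u) b = su b else L (arm u) (su b) = b"
    using su_out su_in S_B[OF b] by simp
  show "su' b \<noteq> 0 \<Longrightarrow> if arm_out u' then L (arm u') b = su' b else L (arm u') (su' b) = b"
    using su'_out su'_in S_B[OF b] by simp
qed simp

lemma Arm_piece:
  assumes k: "k \<in> labels" and z: "z \<in> {u, u'}" and m: "m \<noteq> 0"
    and pz: "piece k z = {m}" and po: "\<And>i. i \<in> verts Q \<Longrightarrow> i \<noteq> z \<Longrightarrow> piece k i = {}"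
  shows "root_brick (basis_piece V (piece k))"
proof -
  have "thin (basis_piece V (piece k)) {z}"
  proof (rule thin_piece[OF k, of _ "\<lambda>i. if i = z then m else 0"])
    show "{z} \<subseteq> verts Q" using z by auto
    show "piece k i = {if i = z then m else 0} - {0}" if "i \<in> verts Q" for i using pz po[OF that] m by auto
    show "(if i = z then m else 0) \<noteq> 0 \<longleftrightarrow> i \<in> {z}" for i using m by simp
    fix a assume a: "a \<in> arrows Q" "fst a \<in> {z}" "snd a \<in> {z}"
    have False using a(1)
    proof (cases rule: arrow_cases)
      case 1 then show ?thesis using a z by (cases "arm_out u") (auto simp: arm_simps)
    next
      case 2 then show ?thesis using a z by (cases "arm_out u'") (auto simp: arm_simps)
    next
      case (3 j) then show ?thesis using a z by (cases "out j") (auto simp: ar_simps)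
    qed
    then show "L a (if fst a = z then m else 0) = (if snd a = z then m else 0)" ..
  qed
  moreover have "thin_support {z}" using z unfolding thin_support_def by blast
  ultimately show ?thesis unfolding root_brick_def by blast
qed

lemma lab_not_Arm: "lab p b \<noteq> Arm q m"
  unfolding lab_def using lab0_not_Arm by simp

lemma Arm_pieces:
  "m \<in> Mu \<Longrightarrow> root_brick (basis_piece V (piece (Arm True m)))"
  "m \<in> Mu' \<Longrightarrow> root_brick (basis_piece V (piece (Arm False m)))"
proof -
  assume m: "m \<in> Mu"
  have "independent ((su ` B 0 - {0}) \<union> Mu)" using f_facts(4) unfolding basis_step_def by blast
  then have "m \<noteq> 0" using m dependent_zero by blast
  show "root_brick (basis_piece V (piece (Arm True m)))"
  proof (rule Arm_piece[of _ u m])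
    show "Arm True m \<in> labels" using m unfolding labels_def by blast
    show "piece (Arm True m) u = {m}" unfolding piece_simps using lab0_not_Arm m by auto
    show "piece (Arm True m) i = {}" if "i \<in> verts Q" "i \<noteq> u" for i
      using that(1) by (cases rule: vert_cases) (use that(2) lab'_not_Arm lab_not_Arm in \<open>auto simp: piece_simps\<close>)
  qed (use \<open>m \<noteq> 0\<close> in auto)
next
  assume m: "m \<in> Mu'"
  have "independent ((su' ` B' - {0}) \<union> Mu')" using f_facts(5) unfolding basis_step_def by blast
  then have "m \<noteq> 0" using m dependent_zero by blast
  show "root_brick (basis_piece V (piece (Arm False m)))"
  proof (rule Arm_piece[of _ u' m])
    show "Arm False m \<in> labels" using m unfolding labels_def by blast
    show "piece (Arm False m) u' = {m}" unfolding piece_simps using lab'_not_Arm m by auto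
    show "piece (Arm False m) i = {}" if "i \<in> verts Q" "i \<noteq> u'" for i
      using that(1) by (cases rule: vert_cases) (use that(2) lab0_not_Arm lab_not_Arm in \<open>auto simp: piece_simps\<close>)
  qed (use \<open>m \<noteq> 0\<close> in auto)
qed

text \<open>The thread of \<open>c + \<beta> c\<close> is the strand \<open>x\<close> and that of \<open>c\<close> is the strand \<open>y\<close> of a thick brick, so that \<open>x 0 - y 0 = \<beta> c\<close>. The chain
member that separates the two vectors yields the condition on the ends by \<open>first_death\<close>.\<close>

lemma Pair_piece:
  assumes c: "c \<in> C"
  shows "root_brick (basis_piece V (piece (Pair c)))"
proof -
  define W where "W = basis_piece V (piece (Pair c))"
  have k: "Pair c \<in> labels" using c unfolding labels_def by blast
  note cB = C_B[OF c]
  have cb: "c \<in> births 0" "f c \<in> births 0" using cB by auto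
  define x where "x = thread s 0 (f c)"
  define y where "y = thread s 0 c"
  obtain a where a: "\<And>j. x j \<noteq> 0 \<longleftrightarrow> 0 \<le> j \<and> enat j \<le> a" using thread_support[OF cb(2)] unfolding x_def by metis
  obtain b where b: "\<And>j. y j \<noteq> 0 \<longleftrightarrow> 0 \<le> j \<and> enat j \<le> b" using thread_support[OF cb(1)] unfolding y_def by metis
  have x0: "x j \<noteq> 0 \<longleftrightarrow> enat j \<le> a" and y0: "y j \<noteq> 0 \<longleftrightarrow> enat j \<le> b" for j using a b by auto
  have xy0: "x 0 = f c" "y 0 = c" unfolding x_def y_def by auto
  have fnc: "f c \<noteq> c" using f_facts(3) imageI[OF c, of f] c by (metis IntI UnCI empty_iff)
  obtain F where F: "F \<in> chain 0" "f c \<in> F" "c \<notin> F" using C_chain[OF c, folded f_def] by (elim bexE conjE) (rule that)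
  obtain n G where G: "F = pull n G 0" "G = P \<or> G = (\<lambda>_. {0})" using F(1) unfolding chain_def by blast
  have nz: "f c \<noteq> 0" "c \<noteq> 0" using B_nonzero[of _ 0] cB by blast+
  have "\<exists>k. x k \<noteq> 0 \<and> y k \<noteq> 0 \<and> ((out k \<and> x (Suc k) = 0 \<and> y (Suc k) \<noteq> 0) \<or> (\<not> out k \<and> y (Suc k) = 0 \<and> x (Suc k) \<noteq> 0))"
    unfolding x_def y_def
    by (rule first_death[OF cb(2,1) _ _ G(2), of 0 n]) (use nz F G(1) in auto)
  then obtain m where m: "x m \<noteq> 0" "y m \<noteq> 0" "(out m \<and> x (Suc m) = 0 \<and> y (Suc m) \<noteq> 0) \<or> (\<not> out m \<and> y (Suc m) = 0 \<and> x (Suc m) \<noteq> 0)" by blast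
  have eqm: "A = enat m" if "enat m \<le> A" "\<not> enat (Suc m) \<le> A" for A using that by (cases A) auto
  have ltm: "enat m < A" if "enat (Suc m) \<le> A" for A using that by (simp add: Suc_ile_eq)
  have ends: "thick_ends a b" unfolding thick_ends_def
    using m(3) eqm[of a] eqm[of b] ltm[of a] ltm[of b] m(1,2) x0 y0 by metis
  have eqP: "b' \<in> births p \<and> lab p b' = Pair c \<longleftrightarrow> p = 0 \<and> (b' = c \<or> b' = f c)" for p b'
    using lab_eq_Pair[OF _ c] cb by blast
  have pw: "piece (Pair c) (w j) = {x j, y j} - {0}" for j
    unfolding piece_simps x_def y_def eqP by auto
  have lab0P: "lab0 d = Pair c \<longleftrightarrow> d = c \<or> d = f c" if "d \<in> B 0" for d
    using lab_eq_Pair[of d 0 c] that c unfolding lab_def by simp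
  have pu: "piece (Pair c) u = {su c, su (f c)} - {0}" unfolding piece_simps using lab0P cB by auto
  have pu': "piece (Pair c) u' = {su' c, su' (\<beta> c)} - {0}" unfolding piece_simps using lab'_eq_Pair[OF _ c] cB by auto
  have fcu: "f c \<notin> arm_space u"
  proof
    assume "f c \<in> arm_space u"
    then have "f c - c \<in> arm_space u" using C_arm[OF c] subspace_diff[OF subspace_arm_space(1)[of u]] by blast
    then show False using C_arm[OF c] cB by simp
  qed
  have cP: "c \<in> P 0" "f c \<in> P 0" using cB B_P by auto
  have \<beta>P: "\<beta> c \<in> P 0" using cB subspace_diff[OF subspace_P cP(2,1)] by simp
  define z where "z = (if arm_out u then su (f c) else su c)"
  define z' where "z' = (if arm_out u' then su' c else su' (\<beta> c))"
  have uu: "u \<in> {u, u'}" "u' \<in> {u, u'}" by simp_all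
  have mem: "c \<in> B 0" "f c \<in> B 0" "c \<in> B'" "\<beta> c \<in> B'" using cB by blast+
  (* The arm u continues exactly one member of the pair, and u' exactly one of c and beta c. *)
  have nzu: "su c \<noteq> 0 \<longleftrightarrow> \<not> arm_out u" "su (f c) \<noteq> 0 \<longleftrightarrow> arm_out u"
    using arm_step_nonzero[OF uu(1) f_facts(4) mem(1) cP(1)] arm_step_nonzero[OF uu(1) f_facts(4) mem(2) cP(2)]
      C_arm[OF c] fcu by blast+
  have nzu': "su' c \<noteq> 0 \<longleftrightarrow> arm_out u'" "su' (\<beta> c) \<noteq> 0 \<longleftrightarrow> \<not> arm_out u'"
    using arm_step_nonzero[OF uu(2) f_facts(5) mem(3) cP(1)] arm_step_nonzero[OF uu(2) f_facts(5) mem(4) \<beta>P]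
      C_arm[OF c] by blast+
  have zz: "z \<noteq> 0" "z' \<noteq> 0" "piece (Pair c) u = {z}" "piece (Pair c) u' = {z'}"
    unfolding pu pu' z_def z'_def using nzu nzu' by auto
  have Wsp: "vspace W (w j) = span {x j, y j}" "vspace W u = span {z}" "vspace W u' = span {z'}" for j
    unfolding W_def basis_piece_def by (simp_all add: pw zz)
  have memW: "x j \<in> vspace W (w j)" "y j \<in> vspace W (w j)" "z \<in> vspace W u" "z' \<in> vspace W u'" for j
    unfolding Wsp by (auto intro: span_base)
  note WL = amap_L[OF k, folded W_def]
  have "thick_frame W a b x y z z'" unfolding thick_frame_def
  proof (intro conjI allI impI)
    show "x j \<noteq> 0 \<longleftrightarrow> enat j \<le> a" "y j \<noteq> 0 \<longleftrightarrow> enat j \<le> b" "vspace W (w j) = span {x j, y j}" for j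
      using x0 y0 Wsp by auto
    show "indep2 (x j) (y j)" if "enat j \<le> a" "enat j \<le> b" for j
    proof -
      have nzj: "x j \<noteq> 0" "y j \<noteq> 0" using x0 y0 that by auto
      have xy: "x j \<in> B j" "y j \<in> B j" using thread_mem cb nzj unfolding x_def y_def by blast+
      have "x j \<noteq> y j"
        using thread_inj[OF cb(2,1), of j] nzj(1) fnc unfolding x_def y_def by blast
      moreover have "independent {x j, y j}" using xy good[of j] independent_mono[of "B j" "{x j, y j}"] unfolding good_basis_def by blast
      ultimately show ?thesis unfolding indep2_iff by blast
    qed
    show "z \<noteq> 0" "z' \<noteq> 0" by (fact zz)+
    show "vspace W u = span {z}" "vspace W u' = span {z'}" by (fact Wsp)+
    show "amap W (ar j) (x j) = x (Suc j)" "amap W (ar j) (y j) = y (Suc j)" if o: "out j" for j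
    proof -
      have gen: "L (ar j) (thread s 0 d j) = thread s 0 d (Suc j)" if d: "d \<in> births 0" for d
      proof (cases "thread s 0 d j = 0")
        case True then show ?thesis using L_0[OF ar_arrow] s_0 by simp
      next
        case False then show ?thesis by (rule thread_arrow_out[OF o d])
      qed
      show "amap W (ar j) (x j) = x (Suc j)" "amap W (ar j) (y j) = y (Suc j)"
        using WL[OF ar_arrow, of "x j" j] WL[OF ar_arrow, of "y j" j] memW ar_simps[of j] o gen[OF cb(1)] gen[OF cb(2)]
        unfolding x_def y_def by simp_all
    qed
    show "amap W (ar j) (x (Suc j)) = x j" if o: "\<not> out j" and nzx: "x (Suc j) \<noteq> 0" for j
      using WL[OF ar_arrow, of "x (Suc j)" j] memW(1)[of "Suc j"] ar_simps(3)[OF o] thread_arrow_in[OF o cb(2)] nzx unfolding x_def by metis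
    show "amap W (ar j) (y (Suc j)) = y j" if o: "\<not> out j" and nzy: "y (Suc j) \<noteq> 0" for j
      using WL[OF ar_arrow, of "y (Suc j)" j] memW(2)[of "Suc j"] ar_simps(3)[OF o] thread_arrow_in[OF o cb(1)] nzy unfolding y_def by metis
    show "if arm_out u then amap W (arm u) (y 0) = 0 \<and> amap W (arm u) (x 0) = z else amap W (arm u) z = y 0"
    proof (cases "arm_out u")
      case True
      then show ?thesis using WL[OF arm_arrow(1), of "x 0"] WL[OF arm_arrow(1), of "y 0"] memW(1,2)[of 0] arm_simps[of u]
          su_out[OF True] cB nzu xy0 unfolding z_def by simp
    next
      case False
      then show ?thesis using WL[OF arm_arrow(1), of z] memW(3) arm_simps[of u] su_in[OF False] cB nzu xy0 unfolding z_def by simp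
    qed
    show "if arm_out u' then amap W (arm u') (y 0) = z' \<and> amap W (arm u') (x 0) = z' else amap W (arm u') z' = x 0 - y 0"
    proof (cases "arm_out u'")
      case True
      then show ?thesis using WL[OF arm_arrow(2), of "x 0"] WL[OF arm_arrow(2), of "y 0"] memW(1,2)[of 0] arm_simps[of u']
          Lu'_f[OF True c] xy0 unfolding z'_def by simp
    next
      case False
      have z'eq: "z' = su' (\<beta> c)" unfolding z'_def using False by simp
      have "L (arm u') z' = \<beta> c" unfolding z'eq by (rule su'_in[OF False mem(4)]) (use nzu'(2) False in blast)
      moreover have "\<beta> c = x 0 - y 0" using cB xy0 by simp
      ultimately show ?thesis using WL[OF arm_arrow(2), of z'] memW(4) arm_simps(3)[OF False] False by simp
    qed
  qed
  moreover have "quiver_rep scale Q W" unfolding W_def by (rule subrepD(1)[OF piece_subrep[OF k]])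
  ultimately have "thick W a b" unfolding thick_def by blast
  then show ?thesis using ends unfolding root_brick_def W_def by blast
qed

lemma piece_root_brick:
  assumes "k \<in> labels"
  shows "root_brick (basis_piece V (piece k))"
  using assms unfolding labels_def using Thread_0_piece Thread_Suc_piece Pair_piece Arm_pieces by blast

end

section \<open>Classification of the indecomposables\<close>

context d_infinity
begin

lemma root_brick_decomposition:
  assumes rep: "quiver_rep scale Q V"
  shows "\<exists>D. indecomposable_decomposition scale Q V D \<and> (\<forall>U\<in>D. root_brick U)"
proof -
  have "\<forall>a\<in>arrows Q. \<exists>g. Vector_Spaces.linear scale scale g \<and> (\<forall>x\<in>vspace V (fst a). g x = amap V a x)"
    using linear_between_extend quiver_repD[OF rep] arrow_verts by blast
  then obtain L where L: "\<And>a. a \<in> arrows Q \<Longrightarrow> Vector_Spaces.linear scale scale (L a)"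
      "\<And>a x. a \<in> arrows Q \<Longrightarrow> x \<in> vspace V (fst a) \<Longrightarrow> L a x = amap V a x" by metis
  interpret r: d_infinity_rep scale Q u u' w N V L
    by (rule d_infinity_rep.intro[OF d_infinity_axioms], rule d_infinity_rep_axioms.intro) (fact rep L)+
  have uu: "u \<in> {u, u'}" "u' \<in> {u, u'}" by auto
  obtain S C \<beta> where
    ind: "independent (S \<union> C \<union> (\<lambda>c. c + \<beta> c) ` C)" and sp: "span (S \<union> C \<union> (\<lambda>c. c + \<beta> c) ` C) = vspace V (w 0)"
    and ad: "adapted (S \<union> C \<union> (\<lambda>c. c + \<beta> c) ` C) (r.chain 0)"
    and inj: "inj_on (\<lambda>c. c + \<beta> c) C" and SC: "S \<inter> C = {}" and disj: "(S \<union> C) \<inter> (\<lambda>c. c + \<beta> c) ` C = {}"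
    and spA: "r.arm_space u \<subseteq> span (S \<inter> r.arm_space u \<union> C)" and spB: "r.arm_space u' \<subseteq> span (S \<inter> r.arm_space u' \<union> \<beta> ` C)"
    and CAB: "\<And>c. c \<in> C \<Longrightarrow> c \<in> r.arm_space u \<and> c \<notin> r.arm_space u' \<and> \<beta> c \<in> r.arm_space u' \<and> \<beta> c \<notin> r.arm_space u"
    and sep: "\<And>c. c \<in> C \<Longrightarrow> \<exists>F\<in>r.chain 0. c + \<beta> c \<in> F \<and> c \<notin> F"
    by (rule two_subspaces_and_chain[OF r.subspace_arm_space[OF uu(1)] r.subspace_arm_space[OF uu(2)] r.wchain_chain r.chain_members(1)]) blast
  define f where "f c = c + \<beta> c" for c
  define X where "X = S \<union> C \<union> f ` C"
  have X: "independent X" "span X = vspace V (w 0)" "adapted X (r.chain 0)"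
    using ind sp ad unfolding X_def f_def by auto
  have finj: "inj_on f C" and fdisj: "(S \<union> C) \<inter> f ` C = {}" using inj disj unfolding f_def by auto
  (* The change of basis that fixes S and C and replaces c + beta c by beta c. *)
  obtain Nn where Nn: "Vector_Spaces.linear scale scale Nn" "\<forall>x\<in>X. Nn x = (if x \<in> f ` C then - inv_into C f x else 0)"
    using vsp.linear_independent_extend[OF X(1), of "\<lambda>x. if x \<in> f ` C then - inv_into C f x else 0"] by blast
  interpret Nn: Vector_Spaces.linear scale scale Nn by (rule Nn(1))
  have NnSC: "Nn x = 0" if "x \<in> S \<union> C" for x
  proof -
    have "x \<notin> f ` C" "x \<in> X" using that fdisj unfolding X_def by blast+
    then show ?thesis using Nn(2) by simp
  qed
  have Nnf: "Nn (f c) = - c" if c: "c \<in> C" for c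
  proof -
    have "f c \<in> f ` C" "f c \<in> X" using c unfolding X_def by blast+
    then show ?thesis using Nn(2) inv_into_f_f[OF finj c] by simp
  qed
  have sq: "Nn (Nn x) = 0" if xX: "x \<in> X" for x
  proof -
    consider "x \<in> S \<union> C" | c where "c \<in> C" "x = f c" using xX unfolding X_def by blast
    then show ?thesis
    proof cases
      case 1 then show ?thesis using NnSC by simp
    next
      case (2 c) then show ?thesis using Nnf[OF 2(1)] NnSC[of c] by (simp add: Nn.neg)
    qed
  qed
  define T where "T x = x + Nn x" for x
  have T: "inj_on T X" "independent (T ` X)"
    using independent_change_by_square_zero[OF X(1) Nn(1) sq] unfolding T_def by blast+
  have TSC: "T x = x" if "x \<in> S \<union> C" for x using NnSC[OF that] unfolding T_def by simp
  have Tf: "T (f c) = \<beta> c" if "c \<in> C" for c using Nnf[OF that] unfolding T_def f_def by simp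
  define X' where "X' = S \<union> C \<union> \<beta> ` C"
  have TX: "T ` X = X'"
  proof -
    have "T ` X = T ` (S \<union> C) \<union> T ` f ` C" unfolding X_def by (rule image_Un)
    also have "T ` (S \<union> C) = S \<union> C" using TSC by force
    also have "T ` f ` C = \<beta> ` C" unfolding image_image by (rule image_cong) (use Tf in auto)
    finally show ?thesis unfolding X'_def .
  qed
  have binj: "inj_on \<beta> C"
  proof (rule inj_onI)
    fix c d assume cd: "c \<in> C" "d \<in> C" "\<beta> c = \<beta> d"
    then have "T (f c) = T (f d)" using Tf by simp
    then have "f c = f d" using inj_onD[OF T(1)] cd unfolding X_def by blast
    then show "c = d" using inj_onD[OF finj] cd by blast
  qed
  have bdisj: "(S \<union> C) \<inter> \<beta> ` C = {}"
  proof (rule ccontr)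
    assume "(S \<union> C) \<inter> \<beta> ` C \<noteq> {}"
    then obtain c where c: "c \<in> C" "\<beta> c \<in> S \<union> C" by blast
    then have "T (f c) = T (\<beta> c)" using Tf TSC by simp
    moreover have "f c \<in> X" "\<beta> c \<in> X" using c unfolding X_def by blast+
    ultimately have "f c = \<beta> c" using inj_onD[OF T(1)] by blast
    then show False using c fdisj by (metis IntI empty_iff imageI)
  qed
  have X'i: "independent X'" using T(2) unfolding TX .
  have spX': "span X' = vspace V (w 0)"
  proof
    have "X \<subseteq> span X'"
    proof
      fix x assume "x \<in> X"
      then consider "x \<in> S \<union> C" | c where "c \<in> C" "x = f c" unfolding X_def by blast
      then show "x \<in> span X'"
      proof cases
        case 1 then show ?thesis unfolding X'_def by (intro span_base) blast
      next
        case (2 c)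
        have "c \<in> X'" "\<beta> c \<in> X'" unfolding X'_def using 2(1) by blast+
        then have "c \<in> span X'" "\<beta> c \<in> span X'" by (simp_all add: span_base)
        then show ?thesis unfolding 2 f_def by (rule span_add)
      qed
    qed
    then show "vspace V (w 0) \<subseteq> span X'" unfolding X(2)[symmetric] by (rule span_minimal) simp
    have CSX: "C \<subseteq> X" "S \<subseteq> X" "f ` C \<subseteq> X" unfolding X_def by blast+
    have "C \<subseteq> span X" "S \<subseteq> span X"
      using CSX(1,2) span_superset[of X] by (metis order.trans)+
    moreover have "\<beta> c \<in> span X" if c: "c \<in> C" for c
    proof -
      have "f c \<in> X" "c \<in> X" using CSX c by blast+
      then have "f c \<in> span X" "c \<in> span X" by (simp_all add: span_base)
      then have "f c - c \<in> span X" by (rule span_diff)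
      then show ?thesis unfolding f_def by simp
    qed
    ultimately have "X' \<subseteq> span X" unfolding X'_def by blast
    then show "span X' \<subseteq> vspace V (w 0)" unfolding X(2)[symmetric] by (rule span_minimal) simp
  qed
  have "S \<inter> r.arm_space u \<union> C \<subseteq> X \<inter> r.arm_space u" using CAB unfolding X_def by blast
  then have "r.arm_space u \<subseteq> span (X \<inter> r.arm_space u)" using spA span_mono by blast
  then obtain su Mu where su: "r.arm_step u X su Mu" using r.arm_step_exists[OF uu(1) X(1,2)] by blast
  have "S \<inter> r.arm_space u' \<union> \<beta> ` C \<subseteq> X' \<inter> r.arm_space u'" using CAB unfolding X'_def by blast
  then have "r.arm_space u' \<subseteq> span (X' \<inter> r.arm_space u')" using spB span_mono by blast
  then obtain su' Mu' where su': "r.arm_step u' X' su' Mu'" using r.arm_step_exists[OF uu(2) X'i spX'] by blast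
  have "r.good_basis 0 X" unfolding r.good_basis_def using X by blast
  then obtain B s M where B: "B 0 = X" "\<forall>j. r.good_basis j (B j) \<and> r.line_step j (B j) (s j) (M j) \<and> B (Suc j) = (s j ` B j - {0}) \<union> M j"
    using r.line_bases_exist by blast
  interpret t: threaded_rep scale Q u u' w N V L B s M
    by unfold_locales (use B(2) in blast)+
  interpret l: labelled_rep scale Q u u' w N V L B s M S C \<beta> su su' Mu Mu'
  proof unfold_locales
    show "B 0 = S \<union> C \<union> (\<lambda>c. c + \<beta> c) ` C" using B(1) unfolding X_def f_def .
    show "r.arm_step u (S \<union> C \<union> (\<lambda>c. c + \<beta> c) ` C) su Mu" using su unfolding X_def f_def .
    show "r.arm_step u' (S \<union> C \<union> \<beta> ` C) su' Mu'" using su' unfolding X'_def .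
  qed (fact inj SC disj binj bdisj CAB sep)+
  have "indecomposable_decomposition scale Q V (basis_piece V ` (l.piece ` l.labels))"
  proof (rule indecomposable_decompositionI[OF rep l.pieces_direct_sum])
    show "indecomposable scale Q (basis_piece V k)" if "k \<in> l.piece ` l.labels" for k
      using that l.piece_root_brick root_brick_brick brick_indecomposable by blast
  qed
  moreover have "\<forall>U\<in>basis_piece V ` (l.piece ` l.labels). root_brick U" using l.piece_root_brick by blast
  ultimately show ?thesis by blast
qed

lemma thin_cong:
  assumes "thin U I" "quiver_rep scale Q V" "\<And>i. i \<in> verts Q \<Longrightarrow> vspace V i = vspace U i"
    "\<And>a x. a \<in> arrows Q \<Longrightarrow> x \<in> vspace U (fst a) \<Longrightarrow> amap U a x = amap V a x"
  shows "thin V I"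
proof -
  obtain x where x: "\<forall>i\<in>verts Q. vspace U i = span {x i} \<and> (x i \<noteq> 0 \<longleftrightarrow> i \<in> I)"
     "\<forall>a\<in>arrows Q. fst a \<in> I \<longrightarrow> snd a \<in> I \<longrightarrow> amap U a (x (fst a)) = x (snd a)" using assms(1) unfolding thin_def by blast
  have xU: "x i \<in> vspace U i" if "i \<in> verts Q" for i using x(1) that by (auto intro: span_base)
  show ?thesis unfolding thin_def
  proof (intro conjI exI[of _ x] ballI impI assms(2))
    show "vspace V i = span {x i}" "x i \<noteq> 0 \<longleftrightarrow> i \<in> I" if "i \<in> verts Q" for i using x(1) assms(3) that by auto
    show "amap V a (x (fst a)) = x (snd a)" if "a \<in> arrows Q" "fst a \<in> I" "snd a \<in> I" for a
      using x(2) assms(4)[OF that(1) xU] arrow_verts[OF that(1)] that by metis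
  qed
qed

lemma thick_cong:
  assumes "thick U a b" "quiver_rep scale Q V" "\<And>i. i \<in> verts Q \<Longrightarrow> vspace V i = vspace U i"
    "\<And>a x. a \<in> arrows Q \<Longrightarrow> x \<in> vspace U (fst a) \<Longrightarrow> amap U a x = amap V a x"
  shows "thick V a b"
proof -
  obtain x y z z' where fr: "thick_frame U a b x y z z'" using assms(1) unfolding thick_def by blast
  have mem: "x j \<in> vspace U (w j)" "y j \<in> vspace U (w j)" "z \<in> vspace U u" "z' \<in> vspace U u'" for j
    using fr unfolding thick_frame_def by (auto intro: span_base)
  have vs: "vspace V (w j) = vspace U (w j)" "vspace V u = vspace U u" "vspace V u' = vspace U u'" for j
    by (simp_all add: assms(3))
  have aw: "amap V (ar j) v = amap U (ar j) v" if "v \<in> vspace U (fst (ar j))" for j v using assms(4)[OF ar_arrow that] by simp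
  have au: "amap V (arm u) v = amap U (arm u) v" if "v \<in> vspace U (fst (arm u))" for v using assms(4)[OF arm_arrow(1) that] by simp
  have au': "amap V (arm u') v = amap U (arm u') v" if "v \<in> vspace U (fst (arm u'))" for v using assms(4)[OF arm_arrow(2) that] by simp
  have eqs: "out j \<Longrightarrow> amap V (ar j) (x j) = amap U (ar j) (x j)" "out j \<Longrightarrow> amap V (ar j) (y j) = amap U (ar j) (y j)"
    "\<not> out j \<Longrightarrow> amap V (ar j) (x (Suc j)) = amap U (ar j) (x (Suc j))" "\<not> out j \<Longrightarrow> amap V (ar j) (y (Suc j)) = amap U (ar j) (y (Suc j))"
    "arm_out u \<Longrightarrow> amap V (arm u) (x 0) = amap U (arm u) (x 0)" "arm_out u \<Longrightarrow> amap V (arm u) (y 0) = amap U (arm u) (y 0)"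
    "\<not> arm_out u \<Longrightarrow> amap V (arm u) z = amap U (arm u) z"
    "arm_out u' \<Longrightarrow> amap V (arm u') (x 0) = amap U (arm u') (x 0)" "arm_out u' \<Longrightarrow> amap V (arm u') (y 0) = amap U (arm u') (y 0)"
    "\<not> arm_out u' \<Longrightarrow> amap V (arm u') z' = amap U (arm u') z'" for j
    using aw au au' mem ar_simps arm_simps by auto
  have "thick_frame V a b x y z z'"
    using fr unfolding thick_frame_def vs by (auto simp: eqs)
  then show ?thesis unfolding thick_def using assms(2) by blast
qed

lemma root_brick_cong:
  assumes "root_brick U" "quiver_rep scale Q V" "\<And>i. i \<in> verts Q \<Longrightarrow> vspace V i = vspace U i"
    "\<And>a x. a \<in> arrows Q \<Longrightarrow> x \<in> vspace U (fst a) \<Longrightarrow> amap U a x = amap V a x"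
  shows "root_brick V"
  using assms(1)
proof (cases rule: root_brick_cases)
  case (thin I)
  then show ?thesis using thin_cong[OF thin(2) assms(2-4)] unfolding root_brick_def by blast
next
  case (thick a b)
  then show ?thesis using thick_cong[OF thick(2) assms(2-4)] unfolding root_brick_def by blast
qed

text \<open>A decomposition of an indecomposable representation into nonzero summands has a single summand, which is everything.\<close>

lemma indecomposable_iff_root_brick: "indecomposable scale Q V \<longleftrightarrow> root_brick V"
proof
  assume "root_brick V"
  then show "indecomposable scale Q V" using root_brick_brick brick_indecomposable by blast
next
  assume ind: "indecomposable scale Q V"
  then have rep: "quiver_rep scale Q V" and nz: "\<not> zero_rep Q V" unfolding indecomposable_def by auto
  obtain D where D: "indecomposable_decomposition scale Q V D" "\<forall>U\<in>D. root_brick U"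
    using root_brick_decomposition[OF rep] by blast
  then have ds: "direct_sum scale Q V D (\<lambda>U. U)" unfolding indecomposable_decomposition_def by blast
  have "D \<noteq> {}"
  proof
    assume "D = {}"
    then have "vspace V i = {0}" if "i \<in> verts Q" for i using ds that unfolding direct_sum_def by auto
    then show False using nz unfolding zero_rep_def by blast
  qed
  then obtain U where U: "U \<in> D" by blast
  have nzU: "\<not> zero_rep Q U" using D U unfolding indecomposable_decomposition_def indecomposable_def by blast
  have subr: "subrep scale Q U V" using ds U unfolding direct_sum_def by blast
  show "root_brick V"
  proof (rule root_brick_cong[OF _ rep])
    show "root_brick U" using D(2) U by blast
    show "vspace V i = vspace U i" if "i \<in> verts Q" for i by (rule indecomposable_eq_summand[OF ind ds U nzU that])
    show "amap U a x = amap V a x" if "a \<in> arrows Q" "x \<in> vspace U (fst a)" for a x by (rule subrepD(3)[OF subr that])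
  qed
qed

theorem infinite_krull_schmidt_d_infinity: "infinite_krull_schmidt scale Q"
  unfolding infinite_krull_schmidt_def
proof (intro allI impI conjI)
  fix V assume rep: "quiver_rep scale Q V"
  show "\<exists>S. indecomposable_decomposition scale Q V S" using root_brick_decomposition[OF rep] by blast
  show "\<exists>h. bij_betw h S T \<and> (\<forall>U\<in>S. isomorphic scale Q U (h U))"
    if "indecomposable_decomposition scale Q V S" "indecomposable_decomposition scale Q V T" for S T
    by (rule krull_schmidt_uniqueness[OF _ rep that]) (simp add: indecomposable_iff_root_brick root_brick_brick)
qed

theorem unique_type_d_infinity: "unique_type scale Q"
  unfolding unique_type_def indecomposable_iff_root_brick
  using root_brick_isomorphic same_dim_imp_dim_eq by blast

end

section \<open>The Tits form\<close>

definition eventually_const_from :: "nat \<Rightarrow> (nat \<Rightarrow> int) \<Rightarrow> bool" where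
  "eventually_const_from M g \<longleftrightarrow> (\<forall>j\<ge>M. g (Suc j) = g j)"

text \<open>The value at \<open>M\<close> itself counts as the last step, as if the function dropped to \<open>0\<close> after infinitely many vertices.\<close>

definition descent :: "nat \<Rightarrow> (nat \<Rightarrow> int) \<Rightarrow> nat \<Rightarrow> int" where
  "descent M g j = (if j < M then g j - g (Suc j) else g M)"

text \<open>The last vertex of a step function on the line that is constant from \<open>M\<close> on and whose step has number \<open>i\<close>. The step with number \<open>M\<close> stands for a
function that never drops.\<close>

definition endpoint :: "nat \<Rightarrow> nat \<Rightarrow> enat" where
  "endpoint M i = (if i = M then \<infinity> else enat i)"

lemma const_tail:
  assumes "eventually_const_from M g" "M \<le> j"
  shows "g j = g M"
  using assms(2) by (induction rule: dec_induct) (use assms(1) in \<open>auto simp: eventually_const_from_def\<close>)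

lemma eq_of_descents:
  assumes g: "eventually_const_from M g" and h: "eventually_const_from M h"
    and d: "\<And>j. j \<le> M \<Longrightarrow> descent M g j = descent M h j"
  shows "g j = h j"
proof -
  have gM: "g M = h M" using d[of M] unfolding descent_def by simp
  show ?thesis
  proof (cases "j \<le> M")
    case True
    then show ?thesis
    proof (induction rule: inc_induct)
      case (step k)
      then show ?case using d[of k] unfolding descent_def by simp
    qed (rule gM)
  next
    case False
    then show ?thesis using const_tail[OF g, of j] const_tail[OF h, of j] gM by simp
  qed
qed

lemma endpoint_le: "i \<le> M \<Longrightarrow> enat j \<le> endpoint M i \<longleftrightarrow> i = M \<or> j \<le> i"
  unfolding endpoint_def by simp

lemma two_steps:
  fixes \<alpha> \<beta> :: int
  assumes "i \<le> M" "k \<le> M"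
  defines "h \<equiv> \<lambda>j. \<alpha> * of_bool (enat j \<le> endpoint M i) + \<beta> * of_bool (enat j \<le> endpoint M k)"
  shows "eventually_const_from M h" "j \<le> M \<Longrightarrow> descent M h j = \<alpha> * of_bool (j = i) + \<beta> * of_bool (j = k)"
proof -
  have 1: "of_bool (enat (Suc j) \<le> endpoint M l) = (of_bool (enat j \<le> endpoint M l) :: int)" if "l \<le> M" "M \<le> j" for l j
    using that by (auto simp: endpoint_le)
  show "eventually_const_from M h" unfolding eventually_const_from_def h_def using 1 assms by simp
  have 2: "(if j < M then of_bool (enat j \<le> endpoint M l) - of_bool (enat (Suc j) \<le> endpoint M l) else of_bool (enat M \<le> endpoint M l)) = (of_bool (j = l) :: int)"
    if "l \<le> M" "j \<le> M" for l j
    using that by (auto simp: endpoint_le)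
  show "descent M h j = \<alpha> * of_bool (j = i) + \<beta> * of_bool (j = k)" if "j \<le> M"
  proof (cases "j < M")
    case True
    define A B where "A l = (of_bool (enat l \<le> endpoint M i) :: int)" and "B l = (of_bool (enat l \<le> endpoint M k) :: int)" for l
    have "A j - A (Suc j) = of_bool (j = i)" "B j - B (Suc j) = of_bool (j = k)"
      using 2[OF assms(1) that] 2[OF assms(2) that] True unfolding A_def B_def by simp_all
    moreover have "descent M h j = \<alpha> * (A j - A (Suc j)) + \<beta> * (B j - B (Suc j))"
      unfolding descent_def h_def A_def[symmetric] B_def[symmetric] using True by (simp add: algebra_simps)
    ultimately show ?thesis by simp
  next
    case False
    then show ?thesis unfolding descent_def h_def using 2[OF assms(1) that] 2[OF assms(2) that] by simp
  qed
qed

definition descent_norm :: "nat \<Rightarrow> (nat \<Rightarrow> int) \<Rightarrow> int" where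
  "descent_norm M g = (\<Sum>j\<le>M. (descent M g j)\<^sup>2)"

text \<open>Completing squares along the line.\<close>

lemma sum_squares_by_descents:
  "2 * ((\<Sum>j\<le>M. (g j)\<^sup>2) - (\<Sum>j<M. g j * g (Suc j))) = (g 0)\<^sup>2 + descent_norm M g"
proof -
  have "descent_norm M g = (\<Sum>j<M. (g j - g (Suc j))\<^sup>2) + (g M)\<^sup>2"
    unfolding descent_norm_def descent_def lessThan_Suc_atMost[symmetric] by simp
  moreover have "2 * ((\<Sum>j\<le>M. (g j)\<^sup>2) - (\<Sum>j<M. g j * g (Suc j))) = (g 0)\<^sup>2 + ((\<Sum>j<M. (g j - g (Suc j))\<^sup>2) + (g M)\<^sup>2)"
  proof (induction M)
    case (Suc M)
    then show ?case by (simp add: power2_eq_square algebra_simps)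
  qed simp
  ultimately show ?thesis by simp
qed

lemma descent_norm_two_steps:
  assumes "i \<le> M" "k \<le> M" "\<And>j. j \<le> M \<Longrightarrow> descent M g j = \<alpha> * of_bool (j = i) + \<beta> * of_bool (j = k)"
  shows "descent_norm M g = (if i = k then (\<alpha> + \<beta>)\<^sup>2 else \<alpha>\<^sup>2 + \<beta>\<^sup>2)"
proof -
  have "descent_norm M g = (\<Sum>j\<le>M. (\<alpha> * of_bool (j = i) + \<beta> * of_bool (j = k))\<^sup>2)"
    unfolding descent_norm_def by (rule sum.cong) (simp_all add: assms(3))
  also have "\<dots> = (\<Sum>j\<le>M. (if j = i then \<alpha>\<^sup>2 else 0) + (if j = k then \<beta>\<^sup>2 else 0) + (if j = i then if i = k then 2 * \<alpha> * \<beta> else 0 else 0))"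
    by (rule sum.cong) (auto simp: power2_eq_square algebra_simps)
  also have "\<dots> = \<alpha>\<^sup>2 + \<beta>\<^sup>2 + (if i = k then 2 * \<alpha> * \<beta> else 0)"
    unfolding sum.distrib using assms(1,2) by simp
  finally show ?thesis by (auto simp: power2_eq_square algebra_simps)
qed

lemma unit_sum_of_squares:
  fixes d :: "nat \<Rightarrow> int"
  assumes "finite A" "(\<Sum>j\<in>A. (d j)\<^sup>2) = 1"
  obtains i where "i \<in> A" "\<bar>d i\<bar> = 1" "\<forall>j\<in>A. j \<noteq> i \<longrightarrow> d j = 0"
proof -
  obtain i where i: "i \<in> A" "d i \<noteq> 0"
  proof (rule ccontr)
    assume "\<not> thesis"
    then have "\<forall>j\<in>A. d j = 0" using that by blast
    then show False using assms(2) by simp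
  qed
  have "(\<Sum>j\<in>A. (d j)\<^sup>2) = (d i)\<^sup>2 + (\<Sum>j\<in>A - {i}. (d j)\<^sup>2)" by (rule sum.remove[OF assms(1) i(1)])
  moreover have "(d i)\<^sup>2 \<ge> 1" using i(2) by (simp add: int_one_le_iff_zero_less)
  moreover have ge: "(\<Sum>j\<in>A - {i}. (d j)\<^sup>2) \<ge> 0" by (intro sum_nonneg) simp
  ultimately have "(d i)\<^sup>2 = 1" and z: "(\<Sum>j\<in>A - {i}. (d j)\<^sup>2) = 0" using assms(2) by linarith+
  then have "\<bar>d i\<bar> = 1" by (metis abs_1 abs_power2 power2_eq_1_iff abs_minus_cancel)
  moreover have "d j = 0" if "j \<in> A" "j \<noteq> i" for j
    using z assms(1) that by (subst (asm) sum_nonneg_eq_0_iff) auto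
  ultimately show thesis using that i(1) by blast
qed

lemma two_sum_of_squares:
  fixes d :: "nat \<Rightarrow> int"
  assumes "finite A" "(\<Sum>j\<in>A. (d j)\<^sup>2) = 2"
  obtains i k where "i \<in> A" "k \<in> A" "i < k" "\<bar>d i\<bar> = 1" "\<bar>d k\<bar> = 1" "\<forall>j\<in>A. j \<noteq> i \<longrightarrow> j \<noteq> k \<longrightarrow> d j = 0"
proof -
  obtain i where i: "i \<in> A" "d i \<noteq> 0"
  proof (rule ccontr)
    assume "\<not> thesis"
    then have "\<forall>j\<in>A. d j = 0" using that by blast
    then show False using assms(2) by simp
  qed
  have eq: "(\<Sum>j\<in>A. (d j)\<^sup>2) = (d i)\<^sup>2 + (\<Sum>j\<in>A - {i}. (d j)\<^sup>2)" by (rule sum.remove[OF assms(1) i(1)])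
  moreover have ge: "(\<Sum>j\<in>A - {i}. (d j)\<^sup>2) \<ge> 0" by (intro sum_nonneg) simp
  ultimately have le2: "(d i)\<^sup>2 \<le> 2" using assms(2) by linarith
  have ai: "\<bar>d i\<bar> = 1"
  proof (rule ccontr)
    assume "\<bar>d i\<bar> \<noteq> 1"
    then have "\<bar>d i\<bar> \<ge> 2" using i(2) by linarith
    then have "2\<^sup>2 \<le> \<bar>d i\<bar>\<^sup>2" by (intro power_mono) auto
    then show False using le2 by simp
  qed
  then have "(d i)\<^sup>2 = 1" by (metis one_power2 power2_abs)
  then have "(\<Sum>j\<in>A - {i}. (d j)\<^sup>2) = 1" using eq assms(2) by linarith
  from unit_sum_of_squares[OF finite_Diff[OF assms(1)] this]
  obtain k where k: "k \<in> A - {i}" "\<bar>d k\<bar> = 1" "\<forall>j\<in>A - {i}. j \<noteq> k \<longrightarrow> d j = 0" .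
  show thesis
  proof (cases "i < k")
    case True
    show ?thesis by (rule that[of i k]) (use i k ai True in auto)
  next
    case False
    show ?thesis by (rule that[of k i]) (use i k ai False in auto)
  qed
qed

context d_infinity
begin

definition full :: "nat \<Rightarrow> 'v quiver" where
  "full M = \<lparr>verts = {u, u'} \<union> w ` {..M}, arrows = {arm u, arm u'} \<union> ar ` {..<M}\<rparr>"

lemma ar_inj: "inj ar"
proof (rule injI)
  fix i j assume "ar i = ar j"
  then have "{fst (ar i), snd (ar i)} = {fst (ar j), snd (ar j)}" by simp
  moreover have "{fst (ar k), snd (ar k)} = {w k, w (Suc k)}" for k unfolding ar_def by auto
  ultimately have "{w i, w (Suc i)} = {w j, w (Suc j)}" by simp
  then show "i = j" by (auto simp: doubleton_eq_iff)
qed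

lemma arm_distinct: "arm u \<noteq> arm u'" "arm u \<noteq> ar j" "arm u' \<noteq> ar j"
  unfolding arm_def ar_def by auto

lemma quiver_full: "quiver (full M)"
  unfolding quiver_def full_def arm_def ar_def by auto

lemma subquiver_full: "subquiver (full M) Q"
  unfolding subquiver_def using quiver_full by (auto simp: full_def)

abbreviation adjacency :: "'v quiver \<Rightarrow> ('v \<times> 'v) set" where
  "adjacency Q' \<equiv> arrows Q' \<union> (arrows Q')\<inverse>"

lemma adjacency_sym: "(x, y) \<in> (adjacency Q')\<^sup>* \<Longrightarrow> (y, x) \<in> (adjacency Q')\<^sup>*"
  by (rule symD[OF sym_rtrancl]) (auto intro!: symI)

lemma adjacency_ar: "ar j \<in> arrows Q' \<Longrightarrow> (w j, w (Suc j)) \<in> adjacency Q'"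
  unfolding ar_def by (auto split: if_splits)

lemma adjacency_arm: "arm z \<in> arrows Q' \<Longrightarrow> (z, w 0) \<in> adjacency Q'"
  unfolding arm_def by (auto split: if_splits)

lemma components_connected:
  assumes "\<And>x. x \<in> verts Q' \<Longrightarrow> (x, w 0) \<in> (adjacency Q')\<^sup>*" "D \<in> components Q'"
  shows "D = verts Q'"
proof -
  have all: "(x, y) \<in> (adjacency Q')\<^sup>*" if "x \<in> verts Q'" "y \<in> verts Q'" for x y
    using rtrancl_trans[OF assms(1)[OF that(1)] adjacency_sym[OF assms(1)[OF that(2)]]] .
  obtain x where x: "x \<in> verts Q'" "D = {(i, j) \<in> verts Q' \<times> verts Q'. (i, j) \<in> (adjacency Q')\<^sup>*} `` {x}"
    using assms(2) unfolding components_def by (auto elim!: quotientE)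
  then show ?thesis using all by auto
qed

lemma connected_line:
  assumes "\<And>j. j < K \<Longrightarrow> ar j \<in> arrows Q'" "j \<le> K"
  shows "(w j, w 0) \<in> (adjacency Q')\<^sup>*"
  using assms(2)
proof (induction j)
  case (Suc j)
  have "(w (Suc j), w j) \<in> adjacency Q'" using adjacency_ar[OF assms(1)[of j]] Suc.prems by auto
  then show ?case using Suc by (meson Suc_leD converse_rtrancl_into_rtrancl)
qed simp

lemma full_connected: "x \<in> verts (full M) \<Longrightarrow> (x, w 0) \<in> (adjacency (full M))\<^sup>*"
proof -
  assume x: "x \<in> verts (full M)"
  have a: "arm u \<in> arrows (full M)" "arm u' \<in> arrows (full M)" "\<And>j. j < M \<Longrightarrow> ar j \<in> arrows (full M)"
    unfolding full_def by auto
  consider "x = u" | "x = u'" | j where "j \<le> M" "x = w j" using x unfolding full_def by auto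
  then show ?thesis
  proof cases
    case 1 then show ?thesis using adjacency_arm[OF a(1)] by blast
  next
    case 2 then show ?thesis using adjacency_arm[OF a(2)] by blast
  next
    case (3 j) then show ?thesis using connected_line[OF a(3)] by blast
  qed
qed

lemma Q_connected: "x \<in> verts Q \<Longrightarrow> (x, w 0) \<in> (adjacency Q)\<^sup>*"
proof (erule vert_cases)
  show "x = u \<Longrightarrow> ?thesis" using adjacency_arm[OF arm_arrow(1)] by blast
  show "x = u' \<Longrightarrow> ?thesis" using adjacency_arm[OF arm_arrow(2)] by blast
  show "x = w j \<Longrightarrow> ?thesis" for j using connected_line[of j Q j] ar_arrow by blast
qed

lemma full_IC: "full M \<in> finite_IC_subquivers Q"
proof -
  have "IC (full M) Q" unfolding IC_def using components_connected[OF full_connected] by blast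
  moreover have "finite (verts (full M))" "finite (arrows (full M))" unfolding full_def by auto
  ultimately show ?thesis unfolding finite_IC_subquivers_def using subquiver_full by blast
qed

text \<open>An IC subquiver of the connected quiver is connected. If it contains the branching vertex and \<open>w K\<close>, it must contain every edge in between, since
removing an edge of a tree separates its two ends.\<close>

lemma IC_superset_full:
  assumes Q': "Q' \<in> finite_IC_subquivers Q" and sub: "subquiver (full M) Q'"
  shows "\<exists>K\<ge>M. verts Q' = verts (full K) \<and> arrows Q' = arrows (full K)"
proof -
  have q: "quiver Q'" "verts Q' \<subseteq> verts Q" "arrows Q' \<subseteq> arrows Q" and fin: "finite (verts Q')" and ic: "IC Q' Q"
    using Q' unfolding finite_IC_subquivers_def subquiver_def by auto
  have fullsub: "verts (full M) \<subseteq> verts Q'" "arrows (full M) \<subseteq> arrows Q'" using sub unfolding subquiver_def by auto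
  have Qc: "verts Q \<in> components Q"
  proof -
    define r where "r = {(i, j) \<in> verts Q \<times> verts Q. (i, j) \<in> (adjacency Q)\<^sup>*}"
    have "r `` {w 0} \<in> components Q" unfolding components_def r_def[symmetric] by (rule quotientI) simp
    then show ?thesis using components_connected[OF Q_connected] by metis
  qed
  have conn: "(x, y) \<in> (adjacency Q')\<^sup>*" if xy: "x \<in> verts Q'" "y \<in> verts Q'" for x y
  proof -
    define r where "r = {(i, j) \<in> verts Q' \<times> verts Q'. (i, j) \<in> (adjacency Q')\<^sup>*}"
    have "r `` {x} \<in> components Q'" "r `` {y} \<in> components Q'"
      unfolding components_def r_def[symmetric] by (auto intro!: quotientI xy)
    moreover have "r `` {x} \<subseteq> verts Q" "r `` {y} \<subseteq> verts Q" unfolding r_def using q(2) by auto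
    ultimately have "r `` {x} = r `` {y}" using ic Qc unfolding IC_def by blast
    moreover have "y \<in> r `` {y}" unfolding r_def using xy by auto
    ultimately have "(x, y) \<in> r" by blast
    then show ?thesis unfolding r_def by blast
  qed
  define J where "J = {j. w j \<in> verts Q'}"
  have finJ: "finite J"
    unfolding J_def using finite_vimageI[OF fin w_inj] by (simp add: vimage_def)
  have MJ: "M \<in> J" unfolding J_def using fullsub(1) unfolding full_def by auto
  define K where "K = Max J"
  have KJ: "K \<in> J" and le: "\<And>j. j \<in> J \<Longrightarrow> j \<le> K" unfolding K_def using Max_in[OF finJ] MJ Max_ge[OF finJ] by auto
  have arK: "ar j \<in> arrows Q'" if j: "j < K" for j
  proof (rule ccontr)
    assume n: "ar j \<notin> arrows Q'"
    (* Without the edge after w j nothing leads out of this part of the tree. *)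
    define S where "S = {u, u'} \<union> w ` {..j}"
    have closed: "b \<in> S" if ab: "(a, b) \<in> adjacency Q'" and aS: "a \<in> S" for a b
    proof -
      obtain e where e: "e \<in> arrows Q'" "e = (a, b) \<or> e = (b, a)" using ab by blast
      have "e \<in> arrows Q" using e q(3) by blast
      then show ?thesis
      proof (cases rule: arrow_cases)
        case 1 then show ?thesis using e(2) unfolding arm_def S_def by (auto split: if_splits)
      next
        case 2 then show ?thesis using e(2) unfolding arm_def S_def by (auto split: if_splits)
      next
        case (3 i)
        then have ij: "i \<noteq> j" using e(1) n by blast
        have "w i \<in> S \<longleftrightarrow> i \<le> j" "w (Suc i) \<in> S \<longleftrightarrow> Suc i \<le> j" unfolding S_def by auto
        moreover have "(a = w i \<and> b = w (Suc i)) \<or> (a = w (Suc i) \<and> b = w i)" using e(2) 3 unfolding ar_def by (auto split: if_splits)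
        ultimately show ?thesis using aS ij by auto
      qed
    qed
    have "u \<in> verts Q'" using fullsub(1) unfolding full_def by auto
    then have "(u, w K) \<in> (adjacency Q')\<^sup>*" using conn KJ unfolding J_def by blast
    then have "w K \<in> S"
    proof (induction rule: rtrancl_induct)
      case base show ?case unfolding S_def by simp
    next
      case (step y z) then show ?case using closed by blast
    qed
    then show False using j unfolding S_def by auto
  qed
  have "verts Q' = verts (full K)"
  proof
    show "verts Q' \<subseteq> verts (full K)"
    proof
      fix x assume x: "x \<in> verts Q'"
      then have "x \<in> verts Q" using q(2) by blast
      then show "x \<in> verts (full K)"
      proof (cases rule: vert_cases)
        case (3 j) then show ?thesis using le[of j] x unfolding J_def full_def by auto
      qed (auto simp: full_def)
    qed
    have "w j \<in> verts Q'" if "j \<le> K" for j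
    proof (cases "j = K")
      case True then show ?thesis using KJ unfolding J_def by simp
    next
      case False
      then have "ar j \<in> arrows Q'" using arK that by simp
      then have "ar j \<in> verts Q' \<times> verts Q'" using q(1) unfolding quiver_def by blast
      then show ?thesis unfolding ar_def by (auto split: if_splits)
    qed
    moreover have "u \<in> verts Q'" "u' \<in> verts Q'" using fullsub(1) unfolding full_def by auto
    ultimately show "verts (full K) \<subseteq> verts Q'" unfolding full_def by auto
  qed
  moreover have "arrows Q' = arrows (full K)"
  proof
    show "arrows Q' \<subseteq> arrows (full K)"
    proof
      fix a assume a: "a \<in> arrows Q'"
      then have "a \<in> arrows Q" using q(3) by blast
      then show "a \<in> arrows (full K)"
      proof (cases rule: arrow_cases)
        case (3 j)
        have "ar j \<in> verts Q' \<times> verts Q'" using q(1) a 3 unfolding quiver_def by blast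
        then have "w (Suc j) \<in> verts Q'" unfolding ar_def by (auto split: if_splits)
        then have "Suc j \<le> K" using le unfolding J_def by blast
        then show ?thesis using 3 unfolding full_def by auto
      qed (auto simp: full_def)
    qed
    show "arrows (full K) \<subseteq> arrows Q'" using arK fullsub(2) unfolding full_def by auto
  qed
  moreover have "M \<le> K" using le[OF MJ] .
  ultimately show ?thesis by blast
qed

lemma finite_subset_full:
  assumes Q': "Q' \<in> finite_IC_subquivers Q"
  shows "\<exists>K. \<forall>K'\<ge>K. subquiver Q' (full K')"
proof -
  have q: "quiver Q'" "verts Q' \<subseteq> verts Q" "arrows Q' \<subseteq> arrows Q" and fin: "finite (verts Q')"
    using Q' unfolding finite_IC_subquivers_def subquiver_def by auto
  have "finite {j. w j \<in> verts Q'}" using finite_vimageI[OF fin w_inj] by (simp add: vimage_def)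
  then obtain K where K: "\<And>j. w j \<in> verts Q' \<Longrightarrow> j \<le> K" using finite_nat_set_iff_bounded_le by (metis mem_Collect_eq)
  have "subquiver Q' (full K')" if K': "K \<le> K'" for K'
    unfolding subquiver_def
  proof (intro conjI q(1) subsetI)
    fix x assume x: "x \<in> verts Q'"
    then have "x \<in> verts Q" using q(2) by blast
    then show "x \<in> verts (full K')"
    proof (cases rule: vert_cases)
      case (3 j) then show ?thesis using K[of j] x K' unfolding full_def by auto
    qed (auto simp: full_def)
  next
    fix a assume a: "a \<in> arrows Q'"
    then have "a \<in> arrows Q" using q(3) by blast
    then show "a \<in> arrows (full K')"
    proof (cases rule: arrow_cases)
      case (3 j)
      have "ar j \<in> verts Q' \<times> verts Q'" using q(1) a 3 unfolding quiver_def by blast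
      then have "w (Suc j) \<in> verts Q'" unfolding ar_def by (auto split: if_splits)
      then have "Suc j \<le> K'" using K K' by fastforce
      then show ?thesis using 3 unfolding full_def by auto
    qed (auto simp: full_def)
  qed
  then show ?thesis by blast
qed

text \<open>Needed for the uniqueness of limits: the finite IC subquivers are directed, with the full segments as a cofinal family.\<close>

lemma finite_IC_at_top_not_bot: "finite_IC_at_top Q \<noteq> bot"
  unfolding finite_IC_at_top_def
proof (rule INF_filter_not_bot)
  fix X assume X: "X \<subseteq> finite_IC_subquivers Q" "finite X"
  have "\<forall>Q'\<in>X. \<exists>K. \<forall>K'\<ge>K. subquiver Q' (full K')" using finite_subset_full X(1) by blast
  then obtain k where k: "\<And>Q' K'. Q' \<in> X \<Longrightarrow> k Q' \<le> K' \<Longrightarrow> subquiver Q' (full K')" by metis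
  define K where "K = Max (insert 0 (k ` X))"
  have "subquiver Q' (full K)" if "Q' \<in> X" for Q'
    by (rule k[OF that]) (use X(2) that in \<open>auto simp: K_def\<close>)
  then have "full K \<in> (\<Inter>Q'\<in>X. {Q''\<in>finite_IC_subquivers Q. subquiver Q' Q''})" using full_IC by blast
  then show "(INF Q'\<in>X. principal {Q''\<in>finite_IC_subquivers Q. subquiver Q' Q''}) \<noteq> bot"
    unfolding INF_principal_finite[OF X(2)] principal_eq_bot_iff by blast
qed

definition line_form :: "nat \<Rightarrow> ('v \<Rightarrow> int) \<Rightarrow> int" where
  "line_form M n = (n u)\<^sup>2 + (n u')\<^sup>2 - (n u + n u') * n (w 0) + ((\<Sum>j\<le>M. (n (w j))\<^sup>2) - (\<Sum>j<M. n (w j) * n (w (Suc j))))"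

lemma tits_full:
  assumes "verts Q' = verts (full K)" "arrows Q' = arrows (full K)"
  shows "finite_tits_form Q' n = line_form K n"
proof -
  have "(\<Sum>i\<in>verts Q'. (n i)\<^sup>2) = (n u)\<^sup>2 + ((n u')\<^sup>2 + (\<Sum>i\<in>w ` {..K}. (n i)\<^sup>2))"
    unfolding assms full_def by (auto simp: image_iff)
  also have "(\<Sum>i\<in>w ` {..K}. (n i)\<^sup>2) = (\<Sum>j\<le>K. (n (w j))\<^sup>2)"
    by (subst sum.reindex) (auto intro: inj_on_subset[OF w_inj])
  finally have 1: "(\<Sum>i\<in>verts Q'. (n i)\<^sup>2) = (n u)\<^sup>2 + ((n u')\<^sup>2 + (\<Sum>j\<le>K. (n (w j))\<^sup>2))" .
  have p: "n (fst (arm z)) * n (snd (arm z)) = n z * n (w 0)" for z unfolding arm_def by auto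
  have p': "n (fst (ar j)) * n (snd (ar j)) = n (w j) * n (w (Suc j))" for j unfolding ar_def by auto
  have nin: "arm u \<notin> insert (arm u') (ar ` {..<K})" "arm u' \<notin> ar ` {..<K}" using arm_distinct by auto
  have "(\<Sum>a\<in>arrows Q'. n (fst a) * n (snd a)) = n u * n (w 0) + (n u' * n (w 0) + (\<Sum>a\<in>ar ` {..<K}. n (fst a) * n (snd a)))"
    unfolding assms full_def using nin by (simp add: p)
  also have "(\<Sum>a\<in>ar ` {..<K}. n (fst a) * n (snd a)) = (\<Sum>j<K. n (w j) * n (w (Suc j)))"
    by (subst sum.reindex) (auto intro: inj_on_subset[OF ar_inj] simp: p')
  finally show ?thesis unfolding finite_tits_form_def line_form_def 1 by (simp add: algebra_simps)
qed

lemma line_form_stable: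
  assumes "eventually_const_from M (\<lambda>j. n (w j))" "M \<le> K"
  shows "line_form K n = line_form M n"
  using assms(2)
proof (induction rule: dec_induct)
  case (step k)
  have "n (w (Suc k)) = n (w k)" using assms(1) step(1) unfolding eventually_const_from_def by simp
  then show ?case using step unfolding line_form_def by (simp add: power2_eq_square)
qed simp

text \<open>The net of finite Tits forms is eventually constant: a new vertex contributes \<open>c\<^sup>2\<close> and its edge \<open>- c\<^sup>2\<close>, where \<open>c\<close> is the eventual value.\<close>

lemma has_tits_form_iff:
  assumes "eventually_const_from M (\<lambda>j. n (w j))"
  shows "has_tits_form Q n t \<longleftrightarrow> t = ereal (real_of_int (line_form M n))"
proof -
  have "eventually (\<lambda>Q'. ereal (real_of_int (finite_tits_form Q' n)) = ereal (real_of_int (line_form M n))) (finite_IC_at_top Q)"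
    unfolding finite_IC_at_top_def
  proof (rule eventually_INF1[OF full_IC[of M]])
    show "\<forall>\<^sub>F Q' in principal {Q'' \<in> finite_IC_subquivers Q. subquiver (full M) Q''}.
       ereal (real_of_int (finite_tits_form Q' n)) = ereal (real_of_int (line_form M n))"
      unfolding eventually_principal
    proof
      fix Q' assume "Q' \<in> {Q'' \<in> finite_IC_subquivers Q. subquiver (full M) Q''}"
      then obtain K where K: "M \<le> K" "verts Q' = verts (full K)" "arrows Q' = arrows (full K)"
        using IC_superset_full by blast
      then show "ereal (real_of_int (finite_tits_form Q' n)) = ereal (real_of_int (line_form M n))"
        using tits_full[OF K(2,3)] line_form_stable[where n = n, OF assms K(1)] by simp
    qed
  qed
  then have lim: "has_tits_form Q n (ereal (real_of_int (line_form M n)))"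
    unfolding has_tits_form_def by (rule tendsto_eventually)
  show ?thesis
  proof
    assume "has_tits_form Q n t"
    then show "t = ereal (real_of_int (line_form M n))"
      using lim tendsto_unique[OF finite_IC_at_top_not_bot] unfolding has_tits_form_def by blast
  qed (use lim in simp)
qed

lemma root_space_iff:
  "n \<in> root_space Q \<longleftrightarrow> n \<in> verts Q \<rightarrow>\<^sub>E UNIV \<and> (\<exists>M. eventually_const_from M (\<lambda>j. n (w j)))"
proof -
  have ne: "n (fst (ar j)) \<noteq> n (snd (ar j)) \<longleftrightarrow> n (w (Suc j)) \<noteq> n (w j)" for j unfolding ar_def by auto
  have "finite {a\<in>arrows Q. n (fst a) \<noteq> n (snd a)} \<longleftrightarrow> (\<exists>M. eventually_const_from M (\<lambda>j. n (w j)))"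
  proof
    assume "finite {a\<in>arrows Q. n (fst a) \<noteq> n (snd a)}"
    then have "finite (ar -` {a\<in>arrows Q. n (fst a) \<noteq> n (snd a)})" by (rule finite_vimageI[OF _ ar_inj])
    then have "finite {j. n (w (Suc j)) \<noteq> n (w j)}" by (simp add: vimage_def ne)
    from finite_nat_set_iff_bounded[THEN iffD1, OF this]
    obtain M where M: "\<forall>j\<in>{j. n (w (Suc j)) \<noteq> n (w j)}. j < M" ..
    have "n (w (Suc j)) = n (w j)" if "M \<le> j" for j
    proof (rule ccontr)
      assume "n (w (Suc j)) \<noteq> n (w j)"
      then have "j < M" using M by blast
      then show False using that by simp
    qed
    then show "\<exists>M. eventually_const_from M (\<lambda>j. n (w j))" unfolding eventually_const_from_def by blast
  next
    assume "\<exists>M. eventually_const_from M (\<lambda>j. n (w j))"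
    then obtain M where M: "\<And>j. M \<le> j \<Longrightarrow> n (w (Suc j)) = n (w j)" unfolding eventually_const_from_def by blast
    have "{a\<in>arrows Q. n (fst a) \<noteq> n (snd a)} \<subseteq> {arm u, arm u'} \<union> ar ` {..<M}"
    proof
      fix a assume "a \<in> {a\<in>arrows Q. n (fst a) \<noteq> n (snd a)}"
      then have a: "a \<in> arrows Q" "n (fst a) \<noteq> n (snd a)" by auto
      show "a \<in> {arm u, arm u'} \<union> ar ` {..<M}" using a(1)
      proof (cases rule: arrow_cases)
        case (3 j)
        then have "\<not> M \<le> j" using a(2) ne M by blast
        then show ?thesis using 3 by auto
      qed auto
    qed
    then show "finite {a\<in>arrows Q. n (fst a) \<noteq> n (snd a)}" by (rule finite_subset) simp
  qed
  then show ?thesis unfolding root_space_def by blast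
qed

lemma positive_roots_iff:
  "n \<in> positive_roots Q \<longleftrightarrow> n \<in> verts Q \<rightarrow>\<^sub>E UNIV \<and> (\<forall>i\<in>verts Q. 0 \<le> n i) \<and>
     (\<exists>M. eventually_const_from M (\<lambda>j. n (w j)) \<and> line_form M n = 1)"
proof
  assume n: "n \<in> positive_roots Q"
  then obtain M where M: "eventually_const_from M (\<lambda>j. n (w j))" and e: "n \<in> verts Q \<rightarrow>\<^sub>E UNIV"
    unfolding positive_roots_def root_space_iff by blast
  have "has_tits_form Q n 1" using n unfolding positive_roots_def by blast
  then have "1 = ereal (real_of_int (line_form M n))" using has_tits_form_iff[OF M] by blast
  then have "line_form M n = 1" unfolding one_ereal_def by simp
  then show "n \<in> verts Q \<rightarrow>\<^sub>E UNIV \<and> (\<forall>i\<in>verts Q. 0 \<le> n i) \<and>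
     (\<exists>M. eventually_const_from M (\<lambda>j. n (w j)) \<and> line_form M n = 1)" using M e n unfolding positive_roots_def by blast
next
  assume n: "n \<in> verts Q \<rightarrow>\<^sub>E UNIV \<and> (\<forall>i\<in>verts Q. 0 \<le> n i) \<and>
     (\<exists>M. eventually_const_from M (\<lambda>j. n (w j)) \<and> line_form M n = 1)"
  then obtain M where M: "eventually_const_from M (\<lambda>j. n (w j))" "line_form M n = 1" by blast
  have "has_tits_form Q n 1" unfolding has_tits_form_iff[OF M(1)] M(2) one_ereal_def by simp
  then show "n \<in> positive_roots Q" unfolding positive_roots_def root_space_iff using n by blast
qed

lemma four_line_form:
  "4 * line_form M n = (2 * n u - n (w 0))\<^sup>2 + (2 * n u' - n (w 0))\<^sup>2 + 2 * descent_norm M (\<lambda>j. n (w j))"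
proof -
  have "2 * ((\<Sum>j\<le>M. (n (w j))\<^sup>2) - (\<Sum>j<M. n (w j) * n (w (Suc j)))) = (n (w 0))\<^sup>2 + descent_norm M (\<lambda>j. n (w j))"
    by (rule sum_squares_by_descents)
  then show ?thesis unfolding line_form_def by (simp add: power2_eq_square algebra_simps)
qed

end

section \<open>Roots are the dimension vectors of root bricks\<close>

lemma endpoints_exist:
  obtains M i k where "i \<le> M" "k \<le> M" "a = endpoint M i" "b = endpoint M k"
proof -
  have "\<exists>x. \<forall>M\<ge>x. \<exists>i\<le>M. a = endpoint M i" for a
  proof (cases a)
    case (enat x)
    have "\<exists>i\<le>M. a = endpoint M i" if "Suc x \<le> M" for M
      using that enat by (intro exI[of _ x]) (auto simp: endpoint_def)
    then show ?thesis by blast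
  next
    case infinity
    have "\<exists>i\<le>M. a = endpoint M i" for M using infinity by (intro exI[of _ M]) (auto simp: endpoint_def)
    then show ?thesis by blast
  qed
  then obtain x y where x: "\<forall>M\<ge>x. \<exists>i\<le>M. a = endpoint M i" and y: "\<forall>M\<ge>y. \<exists>i\<le>M. b = endpoint M i" by metis
  obtain i where "i \<le> max x y" "a = endpoint (max x y) i" using x by (meson max.cobounded1)
  moreover obtain k where "k \<le> max x y" "b = endpoint (max x y) k" using y by (meson max.cobounded2)
  ultimately show thesis using that by blast
qed

lemma odd_square_ge_one: "(2 * x - 1)\<^sup>2 \<ge> (1::int)"
proof -
  have "2 * x - 1 \<noteq> 0" by presburger
  then show ?thesis by (simp add: int_one_le_iff_zero_less)
qed

lemma odd_square_one: "(2 * x - 1)\<^sup>2 = (1::int) \<longleftrightarrow> x = 0 \<or> x = 1"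
  by (auto simp: power2_eq_1_iff)

context d_infinity
begin

definition thin_vector :: "'v set \<Rightarrow> 'v \<Rightarrow> int" where
  "thin_vector I = (\<lambda>i\<in>verts Q. of_bool (i \<in> I))"

definition thick_vector :: "enat \<Rightarrow> enat \<Rightarrow> 'v \<Rightarrow> int" where
  "thick_vector a b = (\<lambda>i\<in>verts Q. if i \<in> {u, u'} then 1
     else of_bool (enat (inv w i) \<le> a) + of_bool (enat (inv w i) \<le> b))"

lemma thick_vector_simps [simp]:
  "thick_vector a b u = 1" "thick_vector a b u' = 1"
  "thick_vector a b (w j) = of_bool (enat j \<le> a) + of_bool (enat j \<le> b)"
  unfolding thick_vector_def using w_inj by simp_all

lemma thin_vector_simps: "i \<in> verts Q \<Longrightarrow> thin_vector I i = of_bool (i \<in> I)"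
  unfolding thin_vector_def by simp

lemma vector_eqI:
  assumes "n \<in> verts Q \<rightarrow>\<^sub>E UNIV" "m \<in> verts Q \<rightarrow>\<^sub>E UNIV" "n u = m u" "n u' = m u'" "\<And>j. n (w j) = m (w j)"
  shows "n = m"
proof (rule PiE_ext[OF assms(1,2)])
  show "n i = m i" if "i \<in> verts Q" for i using that by (cases rule: vert_cases) (simp_all add: assms)
qed

lemma vectors_extensional: "thin_vector I \<in> verts Q \<rightarrow>\<^sub>E UNIV" "thick_vector a b \<in> verts Q \<rightarrow>\<^sub>E UNIV"
  unfolding thin_vector_def thick_vector_def by auto

lemma zero_le_enat: "enat 0 \<le> q"
  by (simp add: zero_enat_def[symmetric])

text \<open>A common form of all roots: on the line each of them is a combination of two step functions with coefficients \<open>0\<close>, \<open>1\<close> or \<open>-1\<close>.\<close>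

lemma root_of_profile:
  assumes n: "n \<in> verts Q \<rightarrow>\<^sub>E UNIV" "\<forall>i\<in>verts Q. 0 \<le> n i"
    and ik: "i \<le> M" "k \<le> M"
    and prof: "\<And>j. n (w j) = \<alpha> * of_bool (enat j \<le> endpoint M i) + \<beta> * of_bool (enat j \<le> endpoint M k)"
    and val: "(2 * n u - (\<alpha> + \<beta>))\<^sup>2 + (2 * n u' - (\<alpha> + \<beta>))\<^sup>2 + 2 * (if i = k then (\<alpha> + \<beta>)\<^sup>2 else \<alpha>\<^sup>2 + \<beta>\<^sup>2) = 4"
  shows "n \<in> positive_roots Q"
proof -
  have g: "(\<lambda>j. n (w j)) = (\<lambda>j. \<alpha> * of_bool (enat j \<le> endpoint M i) + \<beta> * of_bool (enat j \<le> endpoint M k))"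
    by (rule ext) (rule prof)
  have const: "eventually_const_from M (\<lambda>j. n (w j))" unfolding g by (rule two_steps(1)[OF ik])
  have "descent_norm M (\<lambda>j. n (w j)) = (if i = k then (\<alpha> + \<beta>)\<^sup>2 else \<alpha>\<^sup>2 + \<beta>\<^sup>2)"
    unfolding g by (rule descent_norm_two_steps[OF ik two_steps(2)[OF ik]])
  moreover have "n (w 0) = \<alpha> + \<beta>" unfolding prof using zero_le_enat by simp
  ultimately have "4 * line_form M n = 4" unfolding four_line_form using val by simp
  then show ?thesis unfolding positive_roots_iff using n const by auto
qed

lemma thin_vector_root:
  assumes "thin_support I"
  shows "thin_vector I \<in> positive_roots Q"
proof -
  have nn: "\<forall>i\<in>verts Q. 0 \<le> thin_vector I i" by (simp add: thin_vector_simps)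
  note ext = vectors_extensional(1)[of I]
  show ?thesis using assms
  proof (cases rule: thin_support_cases)
    case 1
    show ?thesis
      by (rule root_of_profile[OF ext nn, of 0 0 0 0 0]) (simp_all add: thin_vector_simps 1)
  next
    case 2
    show ?thesis
      by (rule root_of_profile[OF ext nn, of 0 0 0 0 0]) (simp_all add: thin_vector_simps 2)
  next
    case (3 p q Z)
    have wI: "thin_vector I (w j) = of_bool (p \<le> j \<and> enat j \<le> q)" for j
      unfolding thin_vector_simps[OF verts_simps(3)] 3(4) using 3(2) by auto
    have uI: "thin_vector I z = of_bool (z \<in> Z)" if "z \<in> {u, u'}" for z
      using that 3(2,4) by (auto simp: thin_vector_simps)
    show ?thesis
    proof (cases p)
      case 0
      obtain M i k where ik: "i \<le> M" "k \<le> M" "q = endpoint M i" "q = endpoint M k" by (rule endpoints_exist)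
      show ?thesis
      proof (rule root_of_profile[OF ext nn ik(1) ik(1), of 1 0])
        show "thin_vector I (w j) = 1 * of_bool (enat j \<le> endpoint M i) + 0 * of_bool (enat j \<le> endpoint M i)" for j
          unfolding wI using 0 ik(3) by simp
      qed (simp add: uI)
    next
      case (Suc p')
      then have Z: "Z = {}" using 3(3) by simp
      have lt: "enat p' < q" using 3(1) Suc by (simp add: Suc_ile_eq)
      obtain M i k where ik: "i \<le> M" "k \<le> M" "q = endpoint M i" "enat p' = endpoint M k" by (rule endpoints_exist)
      have "i \<noteq> k" using lt ik by auto
      have wj: "thin_vector I (w j) = 1 * of_bool (enat j \<le> endpoint M i) + - 1 * of_bool (enat j \<le> endpoint M k)" for j
      proof -
        have "enat j \<le> enat p' \<Longrightarrow> enat j \<le> q" using lt by (meson less_imp_le order.trans)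
        moreover have "Suc p' \<le> j \<longleftrightarrow> \<not> enat j \<le> enat p'" by (simp add: not_le Suc_le_eq)
        ultimately show ?thesis unfolding wI ik(3)[symmetric] ik(4)[symmetric] Suc
          by (cases "enat j \<le> enat p'"; cases "enat j \<le> q") simp_all
      qed
      show ?thesis
        by (rule root_of_profile[OF ext nn ik(1,2) wj]) (use \<open>i \<noteq> k\<close> Z in \<open>simp add: uI\<close>)
    qed
  qed
qed

lemma thick_vector_root:
  assumes "thick_ends a b"
  shows "thick_vector a b \<in> positive_roots Q"
proof -
  have nn: "\<forall>i\<in>verts Q. 0 \<le> thick_vector a b i" unfolding thick_vector_def by simp
  obtain M i k where ik: "i \<le> M" "k \<le> M" "a = endpoint M i" "b = endpoint M k" by (rule endpoints_exist)
  have "a \<noteq> b" using assms unfolding thick_ends_def by auto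
  then have "i \<noteq> k" using ik by auto
  then show ?thesis
    by (intro root_of_profile[OF vectors_extensional(2) nn ik(1,2), of 1 1]) (simp_all add: ik(3,4))
qed

text \<open>By \<open>four_line_form\<close> the sum of the squared descents is \<open>0\<close>, \<open>1\<close> or \<open>2\<close>. With sum \<open>0\<close> the line vanishes and one arm carries a \<open>1\<close>. With sum \<open>1\<close> the line is an interval from \<open>w 0\<close> on.
With sum \<open>2\<close> there are two unit steps, and nonnegativity leaves an interval that starts after \<open>w 0\<close> (up, then down) or
a function with values \<open>2\<close>, \<open>1\<close>, \<open>0\<close> (down twice).\<close>

lemma root_cases:
  assumes n: "n \<in> positive_roots Q"
  shows "(\<exists>I. thin_support I \<and> n = thin_vector I) \<or> (\<exists>a b. thick_ends a b \<and> n = thick_vector a b)"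
proof -
  obtain M where ext: "n \<in> verts Q \<rightarrow>\<^sub>E UNIV" and nn: "\<forall>i\<in>verts Q. 0 \<le> n i"
    and M: "eventually_const_from M (\<lambda>j. n (w j))" and lf: "line_form M n = 1" using n unfolding positive_roots_iff by blast
  define g where "g j = n (w j)" for j
  have gM: "eventually_const_from M g" using M unfolding g_def .
  have g0: "0 \<le> g j" for j using nn unfolding g_def by simp
  have xy0: "0 \<le> n u" "0 \<le> n u'" using nn by simp_all
  have four: "4 = (2 * n u - g 0)\<^sup>2 + (2 * n u' - g 0)\<^sup>2 + 2 * descent_norm M g"
    using four_line_form[of M n] lf unfolding g_def by simp
  have S0: "0 \<le> descent_norm M g" unfolding descent_norm_def by (intro sum_nonneg) simp
  have sq: "0 \<le> (2 * n u - g 0)\<^sup>2" "0 \<le> (2 * n u' - g 0)\<^sup>2" by simp_all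
  have "descent_norm M g \<le> 2" using four sq by linarith
  then consider "descent_norm M g = 0" | "descent_norm M g = 1" | "descent_norm M g = 2" using S0 by linarith
  then show ?thesis
  proof cases
    case 1
    have "\<forall>j\<in>{..M}. (descent M g j)\<^sup>2 = 0"
      using 1 unfolding descent_norm_def by (subst (asm) sum_nonneg_eq_0_iff) auto
    then have d0: "descent M g j = 0" if "j \<le> M" for j using that by simp
    have h: "eventually_const_from M (\<lambda>j. 0)" unfolding eventually_const_from_def by simp
    have gz: "g j = 0" for j by (rule eq_of_descents[OF gM h]) (use d0 in \<open>auto simp: descent_def\<close>)
    have s: "(n u)\<^sup>2 + (n u')\<^sup>2 = 1" using four 1 gz by (simp add: power_mult_distrib)
    have uv: "(n u = 1 \<and> n u' = 0) \<or> (n u = 0 \<and> n u' = 1)"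
    proof -
      have "n u \<le> 1" 
      proof (rule ccontr)
        assume "\<not> n u \<le> 1"
        then have "2\<^sup>2 \<le> (n u)\<^sup>2" by (intro power_mono) auto
        then show False using s zero_le_power2[of "n u'"] by simp
      qed
      moreover have "n u' \<le> 1"
      proof (rule ccontr)
        assume "\<not> n u' \<le> 1"
        then have "2\<^sup>2 \<le> (n u')\<^sup>2" by (intro power_mono) auto
        then show False using s zero_le_power2[of "n u"] by simp
      qed
      ultimately have "(n u = 0 \<or> n u = 1) \<and> (n u' = 0 \<or> n u' = 1)" using xy0 by linarith
      then show ?thesis using s by auto
    qed
    then show ?thesis
    proof
      assume "n u = 1 \<and> n u' = 0"
      then have "n = thin_vector {u}"
        by (intro vector_eqI[OF ext vectors_extensional(1)]) (use gz in \<open>simp_all add: thin_vector_simps g_def\<close>)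
      then show ?thesis unfolding thin_support_def by blast
    next
      assume "n u = 0 \<and> n u' = 1"
      then have "n = thin_vector {u'}"
        by (intro vector_eqI[OF ext vectors_extensional(1)]) (use gz in \<open>simp_all add: thin_vector_simps g_def\<close>)
      then show ?thesis unfolding thin_support_def by blast
    qed
  next
    case 2
    obtain i where i: "i \<in> {..M}" "\<bar>descent M g i\<bar> = 1" "\<forall>j\<in>{..M}. j \<noteq> i \<longrightarrow> descent M g j = 0"
      by (rule unit_sum_of_squares[OF finite_atMost 2[unfolded descent_norm_def]])
    define \<alpha> where "\<alpha> = descent M g i"
    have iM: "i \<le> M" using i(1) by simp
    have d\<alpha>: "descent M g j = \<alpha> * of_bool (j = i) + 0 * of_bool (j = i)" if "j \<le> M" for j
      using i(3) that unfolding \<alpha>_def by (cases "j = i") simp_all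
    have gj: "g j = \<alpha> * of_bool (enat j \<le> endpoint M i) + 0 * of_bool (enat j \<le> endpoint M i)" for j
    proof (rule eq_of_descents[OF gM two_steps(1)[OF iM iM]])
      show "descent M g j = descent M (\<lambda>j. \<alpha> * of_bool (enat j \<le> endpoint M i) + 0 * of_bool (enat j \<le> endpoint M i)) j" if "j \<le> M" for j
        unfolding two_steps(2)[OF iM iM that] by (rule d\<alpha>[OF that])
    qed
    have "g 0 = \<alpha>" unfolding gj using zero_le_enat by simp
    then have \<alpha>1: "\<alpha> = 1" using g0[of 0] i(2) unfolding \<alpha>_def by linarith
    have g00: "g 0 = 1" using \<open>g 0 = \<alpha>\<close> \<alpha>1 by simp
    have "(2 * n u - 1)\<^sup>2 + (2 * n u' - 1)\<^sup>2 = 2" using four 2 g00 by simp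
    then have "(2 * n u - 1)\<^sup>2 = 1" "(2 * n u' - 1)\<^sup>2 = 1" using odd_square_ge_one[of "n u"] odd_square_ge_one[of "n u'"] by linarith+
    then have uv: "n u = 0 \<or> n u = 1" "n u' = 0 \<or> n u' = 1" unfolding odd_square_one by blast+
    define Z where "Z = {z\<in>{u, u'}. n z = 1}"
    define I where "I = Z \<union> {w j | j. 0 \<le> j \<and> enat j \<le> endpoint M i}"
    have ZI: "u \<in> I \<longleftrightarrow> n u = 1" "u' \<in> I \<longleftrightarrow> n u' = 1" "w j \<in> I \<longleftrightarrow> enat j \<le> endpoint M i" for j
      unfolding I_def Z_def by auto
    have "enat 0 \<le> endpoint M i \<and> Z \<subseteq> {u, u'} \<and> (Z = {} \<or> (0::nat) = 0) \<and> I = Z \<union> {w j | j. 0 \<le> j \<and> enat j \<le> endpoint M i}"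
      using zero_le_enat unfolding I_def Z_def by auto
    then have "thin_support I" unfolding thin_support_def by (intro disjI2 exI[of _ 0] exI[of _ "endpoint M i"] exI[of _ Z])
    moreover have "n = thin_vector I"
    proof (rule vector_eqI[OF ext vectors_extensional(1)])
      show "n u = thin_vector I u" using uv by (auto simp: thin_vector_simps ZI)
      show "n u' = thin_vector I u'" using uv by (auto simp: thin_vector_simps ZI)
      show "n (w j) = thin_vector I (w j)" for j using gj[of j] \<alpha>1 unfolding g_def by (simp add: thin_vector_simps ZI)
    qed
    ultimately show ?thesis by blast
  next
    case 3
    have "(2 * n u - g 0)\<^sup>2 = 0" "(2 * n u' - g 0)\<^sup>2 = 0" using four 3 sq by linarith+
    then have xg: "2 * n u = g 0" "2 * n u' = g 0" by simp_all
    obtain i k where ik: "i \<in> {..M}" "k \<in> {..M}" "i < k" "\<bar>descent M g i\<bar> = 1" "\<bar>descent M g k\<bar> = 1"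
      "\<forall>j\<in>{..M}. j \<noteq> i \<longrightarrow> j \<noteq> k \<longrightarrow> descent M g j = 0"
      by (rule two_sum_of_squares[OF finite_atMost 3[unfolded descent_norm_def]])
    define \<alpha> \<beta> where "\<alpha> = descent M g i" and "\<beta> = descent M g k"
    have iM: "i \<le> M" "k \<le> M" using ik(1,2) by simp_all
    have d\<alpha>: "descent M g j = \<alpha> * of_bool (j = i) + \<beta> * of_bool (j = k)" if "j \<le> M" for j
      using ik(3,6) that unfolding \<alpha>_def \<beta>_def by (cases "j = i"; cases "j = k") simp_all
    have gj: "g j = \<alpha> * of_bool (enat j \<le> endpoint M i) + \<beta> * of_bool (enat j \<le> endpoint M k)" for j
    proof (rule eq_of_descents[OF gM two_steps(1)[OF iM]])
      show "descent M g j = descent M (\<lambda>j. \<alpha> * of_bool (enat j \<le> endpoint M i) + \<beta> * of_bool (enat j \<le> endpoint M k)) j" if "j \<le> M" for j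
        unfolding two_steps(2)[OF iM that] by (rule d\<alpha>[OF that])
    qed
    have ei: "endpoint M i = enat i" using ik(3) iM unfolding endpoint_def by simp
    have ek: "enat i < endpoint M k" using ik(3) unfolding endpoint_def by simp
    have "enat k \<le> endpoint M k" unfolding endpoint_def by simp
    then have "g k = \<beta>" unfolding gj ei using ik(3) by simp
    then have \<beta>1: "\<beta> = 1" using g0[of k] ik(5) unfolding \<beta>_def by linarith
    have g00: "g 0 = \<alpha> + 1" unfolding gj \<beta>1 using zero_le_enat by simp
    have "\<alpha> = 1 \<or> \<alpha> = - 1" using ik(4) unfolding \<alpha>_def by linarith
    then show ?thesis
    proof
      assume \<alpha>1: "\<alpha> = 1"
      have uv: "n u = 1" "n u' = 1" using xg g00 \<alpha>1 by simp_all
      have nw: "n (w j) = of_bool (enat j \<le> enat i) + of_bool (enat j \<le> endpoint M k)" for j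
        using gj[of j] \<alpha>1 \<beta>1 ei unfolding g_def by simp
      show ?thesis
      proof (cases "out i")
        case True
        have "thick_ends (enat i) (endpoint M k)" unfolding thick_ends_def using True ek by blast
        moreover have "n = thick_vector (enat i) (endpoint M k)"
          by (rule vector_eqI[OF ext vectors_extensional(2)]) (simp_all add: uv nw)
        ultimately show ?thesis by blast
      next
        case False
        have "thick_ends (endpoint M k) (enat i)" unfolding thick_ends_def using False ek by blast
        moreover have "n = thick_vector (endpoint M k) (enat i)"
          by (rule vector_eqI[OF ext vectors_extensional(2)]) (simp_all add: uv nw)
        ultimately show ?thesis by blast
      qed
    next
      assume \<alpha>1: "\<alpha> = - 1"
      have uv: "n u = 0" "n u' = 0" using xg g00 \<alpha>1 by simp_all
      define I where "I = {} \<union> {w j | j. Suc i \<le> j \<and> enat j \<le> endpoint M k}"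
      have wI: "u \<notin> I" "u' \<notin> I" "w j \<in> I \<longleftrightarrow> Suc i \<le> j \<and> enat j \<le> endpoint M k" for j
        unfolding I_def by auto
      have "enat (Suc i) \<le> endpoint M k \<and> {} \<subseteq> {u, u'} \<and> (({}::'v set) = {} \<or> Suc i = 0) \<and> I = {} \<union> {w j | j. Suc i \<le> j \<and> enat j \<le> endpoint M k}"
        using ek unfolding I_def by (simp add: Suc_ile_eq)
      then have "thin_support I" unfolding thin_support_def by (intro disjI2 exI[of _ "Suc i"] exI[of _ "endpoint M k"] exI[of _ "{}"])
      moreover have "n = thin_vector I"
      proof (rule vector_eqI[OF ext vectors_extensional(1)])
        show "n u = thin_vector I u" "n u' = thin_vector I u'" using uv wI by (simp_all add: thin_vector_simps)
        show "n (w j) = thin_vector I (w j)" for j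
        proof -
          have "enat j \<le> enat i \<Longrightarrow> enat j \<le> endpoint M k" using ek by (meson less_imp_le order.trans)
          moreover have "Suc i \<le> j \<longleftrightarrow> \<not> enat j \<le> enat i" by (simp add: not_le Suc_le_eq)
          ultimately show ?thesis unfolding gj[of j, unfolded g_def] thin_vector_simps[OF verts_simps(3)] wI(3) \<alpha>1 \<beta>1 ei
            by (cases "enat j \<le> enat i"; cases "enat j \<le> endpoint M k") simp_all
        qed
      qed
      ultimately show ?thesis by blast
    qed
  qed
qed

lemma dim_vector_thin: "thin V I \<Longrightarrow> dim_vector scale Q V = thin_vector I"
  unfolding dim_vector_def thin_vector_def using thin_dim by (auto intro!: restrict_ext)

lemma dim_vector_thick:
  assumes "thick V a b"
  shows "dim_vector scale Q V = thick_vector a b"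
  unfolding dim_vector_def thick_vector_def
proof (rule restrict_ext)
  show "int (dim (vspace V i)) = (if i \<in> {u, u'} then 1 else of_bool (enat (inv w i) \<le> a) + of_bool (enat (inv w i) \<le> b))"
    if "i \<in> verts Q" for i
    using that
  proof (cases rule: vert_cases)
    case (3 j)
    then show ?thesis using thick_dim(1)[OF assms, of j] w_inj by simp
  qed (use thick_dim(2,3)[OF assms] in simp_all)
qed

lemma thin_exists:
  fixes b :: 'b
  assumes b: "b \<noteq> 0"
  shows "\<exists>V. thin V I"
proof -
  define V :: "('v, 'b) quiver_rep" where
    "V = \<lparr>vspace = \<lambda>i. span {if i \<in> I then b else 0}, amap = \<lambda>a x. if fst a \<in> I \<and> snd a \<in> I then x else 0\<rparr>"
  have "quiver_rep scale Q V" unfolding quiver_rep_def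
  proof (intro conjI ballI)
    show "subspace (vspace V i)" for i unfolding V_def by simp
    show "linear_between scale (vspace V (fst a)) (vspace V (snd a)) (amap V a)" for a
      by (rule linear_betweenI) (auto simp: V_def span_zero)
  qed
  then have "thin V I" unfolding thin_def using b
    by (intro conjI exI[of _ "\<lambda>i. if i \<in> I then b else 0"]) (auto simp: V_def)
  then show ?thesis by blast
qed

text \<open>The strands are the constant vectors \<open>p\<close> and \<open>q\<close>, cut off at the ends. An inward arrow of the line is the identity, and the other arrow maps are
given by their values on \<open>p\<close> and \<open>q\<close>.\<close>

lemma thick_exists:
  assumes ind: "indep2 p q"
  shows "\<exists>V. thick V a b"
proof -
  define x where "x j = (if enat j \<le> a then p else 0)" for j
  define y where "y j = (if enat j \<le> b then q else 0)" for j
  have pq: "p \<noteq> q" "independent {p, q}" using ind unfolding indep2_iff by auto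
  then have nz: "p \<noteq> 0" "q \<noteq> 0" using dependent_zero by blast+
  have "\<exists>h. Vector_Spaces.linear scale scale h \<and> h p = v \<and> h q = v'" for v v'
    using vsp.linear_independent_extend[OF pq(2), of "\<lambda>c. if c = p then v else v'"] pq(1) by auto
  then obtain H where H: "\<And>v v'. Vector_Spaces.linear scale scale (H v v')" "\<And>v v'. H v v' p = v" "\<And>v v'. H v v' q = v'" by metis
  define sp where "sp i = (if i \<in> {u, u'} then span {p} else span {x (inv w i), y (inv w i)})" for i
  define T where "T e = (if e = arm u then (if arm_out u then H p 0 else H (y 0) 0)
     else if e = arm u' then (if arm_out u' then H p p else H (x 0 - y 0) 0)
     else if out (inv ar e) then H (x (Suc (inv ar e))) (y (Suc (inv ar e))) else (\<lambda>v. v))" for e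
  define V :: "('v, 'b) quiver_rep" where "V = \<lparr>vspace = sp, amap = T\<rparr>"
  have spw: "sp (w j) = span {x j, y j}" "sp u = span {p}" "sp u' = span {p}" for j
    unfolding sp_def using w_inj by simp_all
  have Tar: "T (ar j) = (if out j then H (x (Suc j)) (y (Suc j)) else (\<lambda>v. v))" for j
    unfolding T_def using arm_distinct(2,3)[of j, symmetric] by (simp add: inv_f_f[OF ar_inj])
  have Tu: "T (arm u) = (if arm_out u then H p 0 else H (y 0) 0)"
    and Tu': "T (arm u') = (if arm_out u' then H p p else H (x 0 - y 0) 0)"
    unfolding T_def using arm_distinct(1)[symmetric] by simp_all
  have idl: "Vector_Spaces.linear scale scale (\<lambda>v. v)" using module_hom_ident[unfolded module_hom_iff_linear] .
  have H0: "H v v' 0 = 0" for v v'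
  proof -
    interpret h: Vector_Spaces.linear scale scale "H v v'" by (rule H(1))
    show ?thesis by (rule h.zero)
  qed
  have x0: "x 0 = p" "y 0 = q" unfolding x_def y_def using zero_le_enat by auto
  have Hx: "H (x (Suc j)) v' (x j) = x (Suc j)" "H v (y (Suc j)) (y j) = y (Suc j)" for j v v'
    using enat_Suc_le[of j a] enat_Suc_le[of j b] unfolding x_def y_def by (auto simp: H H0)
  have lin: "Vector_Spaces.linear scale scale (T e)" if "e \<in> arrows Q" for e
    using that by (cases rule: arrow_cases) (simp_all add: Tar Tu Tu' H(1) idl)
  have gens: "T e v \<in> sp (snd e)" if e: "e \<in> arrows Q" and v: "v \<in> (if fst e \<in> {u, u'} then {p} else {x (inv w (fst e)), y (inv w (fst e))})" for e v
    using e
  proof (cases rule: arrow_cases)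
    case 1
    show ?thesis
    proof (cases "arm_out u")
      case True
      then show ?thesis using v 1 arm_simps[of u] w_inj by (auto simp: Tu spw x0 H span_zero intro: span_base)
    next
      case False
      then show ?thesis using v 1 arm_simps[of u] by (auto simp: Tu spw H intro: span_base)
    qed
  next
    case 2
    show ?thesis
    proof (cases "arm_out u'")
      case True
      then show ?thesis using v 2 arm_simps[of u'] w_inj by (auto simp: Tu' spw x0 H intro: span_base)
    next
      case False
      then show ?thesis using v 2 arm_simps[of u'] by (auto simp: Tu' spw H intro!: span_diff intro: span_base)
    qed
  next
    case (3 j)
    show ?thesis
    proof (cases "out j")
      case True
      then show ?thesis using v 3 ar_simps[of j] w_inj by (auto simp: Tar spw Hx intro: span_base)
    next
      case False
      have "x (Suc j) = 0 \<or> x (Suc j) = x j" "y (Suc j) = 0 \<or> y (Suc j) = y j"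
        using enat_Suc_le[of j a] enat_Suc_le[of j b] unfolding x_def y_def by auto
      then have "x (Suc j) \<in> span {x j, y j}" "y (Suc j) \<in> span {x j, y j}" by (auto simp: span_zero intro: span_base)
      then show ?thesis using v False 3 ar_simps[of j] w_inj by (auto simp: Tar spw)
    qed
  qed
  have rep: "quiver_rep scale Q V" unfolding quiver_rep_def
  proof (intro conjI ballI)
    show "subspace (vspace V i)" for i unfolding V_def sp_def by simp
    fix e assume e: "e \<in> arrows Q"
    interpret h: Vector_Spaces.linear scale scale "T e" by (rule lin[OF e])
    have spf: "sp (fst e) = span (if fst e \<in> {u, u'} then {p} else {x (inv w (fst e)), y (inv w (fst e))})"
      unfolding sp_def by simp
    have subs: "subspace (sp (snd e))" unfolding sp_def by simp
    have "T e ` sp (fst e) \<subseteq> sp (snd e)"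
      unfolding spf h.span_image[symmetric] by (rule span_minimal[OF _ subs]) (use gens[OF e] in blast)
    then show "linear_between scale (vspace V (fst e)) (vspace V (snd e)) (amap V e)"
      unfolding V_def by (intro linear_betweenI) (auto simp: h.add h.scale)
  qed
  have "thick_frame V a b x y p p" unfolding thick_frame_def
  proof (intro conjI allI impI)
    show "x j \<noteq> 0 \<longleftrightarrow> enat j \<le> a" "y j \<noteq> 0 \<longleftrightarrow> enat j \<le> b" "vspace V (w j) = span {x j, y j}" for j
      using nz spw unfolding x_def y_def V_def by auto
    show "indep2 (x j) (y j)" if "enat j \<le> a" "enat j \<le> b" for j using ind that unfolding x_def y_def by simp
    show "amap V (ar j) (x j) = x (Suc j)" "amap V (ar j) (y j) = y (Suc j)" if "out j" for j
      using that unfolding V_def by (simp_all add: Tar Hx)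
    show "amap V (ar j) (x (Suc j)) = x j" if "\<not> out j" "x (Suc j) \<noteq> 0" for j
      using that enat_Suc_le[of j a] unfolding V_def by (auto simp: Tar x_def split: if_splits)
    show "amap V (ar j) (y (Suc j)) = y j" if "\<not> out j" "y (Suc j) \<noteq> 0" for j
      using that enat_Suc_le[of j b] unfolding V_def by (auto simp: Tar y_def split: if_splits)
    show "if arm_out u then amap V (arm u) (y 0) = 0 \<and> amap V (arm u) (x 0) = p else amap V (arm u) p = y 0"
      unfolding V_def by (simp add: Tu x0 H)
    show "if arm_out u' then amap V (arm u') (y 0) = p \<and> amap V (arm u') (x 0) = p else amap V (arm u') p = x 0 - y 0"
      unfolding V_def by (simp add: Tu' x0 H)
  qed (use nz spw in \<open>simp_all add: V_def\<close>)
  then have "thick V a b" unfolding thick_def using rep by blast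
  then show ?thesis by blast
qed

lemma indep2_exists:
  assumes "\<not> finite_dim scale UNIV"
  shows "\<exists>p q. indep2 p q"
proof -
  obtain X where X: "independent X" "UNIV \<subseteq> span X" using maximal_independent_subset[of UNIV] by blast
  have "infinite X" using assms X(2) unfolding finite_dim_def by blast
  then obtain p where p: "p \<in> X" by fastforce
  have "infinite (X - {p})" using \<open>infinite X\<close> by simp
  then obtain q where q: "q \<in> X - {p}" using infinite_imp_nonempty[of "X - {p}"] by auto
  have "{p, q} \<subseteq> X" using p q by simp
  then have "independent {p, q}" by (rule independent_mono[OF X(1)])
  moreover have "p \<noteq> q" using q by blast
  ultimately show ?thesis unfolding indep2_iff by blast
qed

lemma root_brick_dim_vector:
  "root_brick V \<Longrightarrow> dim_vector scale Q V \<in> positive_roots Q"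
  by (erule root_brick_cases) (simp_all add: dim_vector_thin dim_vector_thick thin_vector_root thick_vector_root)

lemma root_brick_exists:
  assumes "\<not> finite_dim scale UNIV" "n \<in> positive_roots Q"
  shows "\<exists>V. root_brick V \<and> dim_vector scale Q V = n"
proof -
  obtain p q where pq: "indep2 p q" using indep2_exists[OF assms(1)] by blast
  then have p: "p \<noteq> 0" unfolding indep2_iff using dependent_zero by blast
  show ?thesis using root_cases[OF assms(2)]
  proof
    assume "\<exists>I. thin_support I \<and> n = thin_vector I"
    then obtain I where I: "thin_support I" "n = thin_vector I" by blast
    obtain V where V: "thin V I" using thin_exists[OF p] by blast
    have "root_brick V" unfolding root_brick_def using I(1) V by blast
    then show ?thesis using dim_vector_thin[OF V] I(2) by blast
  next
    assume "\<exists>a b. thick_ends a b \<and> n = thick_vector a b"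
    then obtain a b where ab: "thick_ends a b" "n = thick_vector a b" by blast
    obtain V where V: "thick V a b" using thick_exists[OF pq] by blast
    have "root_brick V" unfolding root_brick_def using ab(1) V by blast
    then show ?thesis using dim_vector_thick[OF V] ab(2) by blast
  qed
qed

theorem dim_vector_bijection:
  assumes inf: "\<not> finite_dim scale UNIV"
  shows "bij_betw (class_dim_vector scale Q) (indecomposable_classes scale Q) (positive_roots Q)"
proof -
  define r where "r = {(V, W). indecomposable scale Q V \<and> indecomposable scale Q W \<and> isomorphic scale Q V W}"
  have classes: "indecomposable_classes scale Q = {V. indecomposable scale Q V} // r"
    unfolding indecomposable_classes_def r_def ..
  have dims: "dim_vector scale Q V = dim_vector scale Q W" if "(V, W) \<in> r" for V W
    unfolding dim_vector_def
  proof (rule restrict_ext)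
    have "quiver_rep scale Q V" "isomorphic scale Q V W" using that unfolding r_def indecomposable_def by auto
    then show "int (dim (vspace V i)) = int (dim (vspace W i))" if "i \<in> verts Q" for i
      using isomorphic_dim that by simp
  qed
  have cdv: "class_dim_vector scale Q (r `` {V}) = dim_vector scale Q V" if "indecomposable scale Q V" for V
  proof -
    have "V \<in> r `` {V}" using that isomorphic_refl unfolding r_def by blast
    moreover have "dim_vector scale Q X = dim_vector scale Q V" if "X \<in> r `` {V}" for X
      using dims[of V X] that by simp
    ultimately have "dim_vector scale Q ` (r `` {V}) = {dim_vector scale Q V}" by blast
    then show ?thesis unfolding class_dim_vector_def by simp
  qed
  have eqv: "r `` {V} = r `` {W}" if V: "indecomposable scale Q V" and W: "indecomposable scale Q W"
    and d: "dim_vector scale Q V = dim_vector scale Q W" for V W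
  proof -
    have "dim (vspace V i) = dim (vspace W i)" if "i \<in> verts Q" for i
      using fun_cong[OF d, of i] that unfolding dim_vector_def by simp
    then have iso: "isomorphic scale Q V W"
      using root_brick_isomorphic V W unfolding indecomposable_iff_root_brick by blast
    have "isomorphic scale Q V X \<longleftrightarrow> isomorphic scale Q W X" for X
      using iso isomorphic_sym isomorphic_trans by blast
    then show ?thesis unfolding r_def using V W by blast
  qed
  show ?thesis unfolding bij_betw_def classes
  proof
    show "inj_on (class_dim_vector scale Q) ({V. indecomposable scale Q V} // r)"
    proof (rule inj_onI)
      fix A B assume A: "A \<in> {V. indecomposable scale Q V} // r" and B: "B \<in> {V. indecomposable scale Q V} // r"
        and eq: "class_dim_vector scale Q A = class_dim_vector scale Q B"
      obtain V where V: "indecomposable scale Q V" "A = r `` {V}" using A by (auto elim: quotientE)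
      obtain W where W: "indecomposable scale Q W" "B = r `` {W}" using B by (auto elim: quotientE)
      show "A = B" using eqv[OF V(1) W(1)] eq cdv[OF V(1)] cdv[OF W(1)] V(2) W(2) by simp
    qed
    show "class_dim_vector scale Q ` ({V. indecomposable scale Q V} // r) = positive_roots Q"
    proof (intro equalityI subsetI)
      fix n assume "n \<in> class_dim_vector scale Q ` ({V. indecomposable scale Q V} // r)"
      then obtain V where V: "indecomposable scale Q V" "n = class_dim_vector scale Q (r `` {V})" by (auto elim!: quotientE)
      then show "n \<in> positive_roots Q"
        using cdv[OF V(1)] root_brick_dim_vector[OF indecomposable_iff_root_brick[THEN iffD1, OF V(1)]] by simp
    next
      fix n assume "n \<in> positive_roots Q"
      then obtain V where V: "root_brick V" "dim_vector scale Q V = n" using root_brick_exists[OF inf] by blast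
      then have ind: "indecomposable scale Q V" unfolding indecomposable_iff_root_brick by blast
      have "r `` {V} \<in> {V. indecomposable scale Q V} // r" by (rule quotientI) (simp add: ind)
      then show "n \<in> class_dim_vector scale Q ` ({V. indecomposable scale Q V} // r)"
        using cdv[OF ind] V(2) by (metis imageI)
    qed
  qed
qed

end

text \<open>The line itself, read from \<open>w 0\<close>, is an infinite journey; only finitely many of its arrows point back to its source.\<close>

lemma d_infinity_exists:
  fixes Q :: "'v quiver"
    and scale :: "'f::field \<Rightarrow> 'b::ab_group_add \<Rightarrow> 'b"
  assumes vs: "vector_space scale" and type: "type_D_infinity Q" and outward: "eventually_outward Q"
  shows "\<exists>u u' w N. d_infinity scale Q u u' w N"
proof -
  obtain u u' v where Q: "quiver Q" "u \<noteq> u'" "inj_on v {1::nat..}" "u \<notin> v ` {1..}" "u' \<notin> v ` {1..}"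
      "verts Q = {u, u'} \<union> v ` {1..}"
    and edges: "bij_betw (\<lambda>(i, j). {i, j}) (arrows Q) ({{u, v 1}, {u', v 1}} \<union> {{v j, v (j + 1)} | j. 1 \<le> j})"
    using type unfolding type_D_infinity_def by (elim conjE exE) (rule that)
  define w where "w j = v (Suc j)" for j
  have rw: "v ` {1..} = range w"
  proof -
    have "{1..} = range Suc" by (auto simp: image_iff) (metis Suc_le_D)
    then show ?thesis unfolding w_def by (simp add: image_image)
  qed
  have winj: "inj w" unfolding w_def by (rule injI) (use inj_onD[OF Q(3)] in force)
  have es: "{{v j, v (j + 1)} | j. 1 \<le> j} = {{w j, w (Suc j)} | j. True}"
  proof (intro equalityI subsetI)
    fix e assume "e \<in> {{v j, v (j + 1)} | j. 1 \<le> j}"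
    then obtain j where j: "1 \<le> j" "e = {v j, v (j + 1)}" by blast
    then obtain i where "j = Suc i" by (cases j) auto
    then show "e \<in> {{w j, w (Suc j)} | j. True}" using j unfolding w_def by auto
  next
    fix e assume "e \<in> {{w j, w (Suc j)} | j. True}"
    then obtain j where "e = {v (Suc j), v (Suc j + 1)}" unfolding w_def by auto
    then show "e \<in> {{v j, v (j + 1)} | j. 1 \<le> j}" by (intro CollectI exI[of _ "Suc j"]) simp
  qed
  have edges': "bij_betw (\<lambda>(i, j). {i, j}) (arrows Q) ({{u, w 0}, {u', w 0}} \<union> {{w j, w (Suc j)} | j. True})"
    using edges unfolding es w_def by simp
  define e where "e k = (if (w k, w (Suc k)) \<in> arrows Q then (w k, w (Suc k)) else (w (Suc k), w k))" for k
  have e_arrow: "e k \<in> arrows Q" for k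
  proof -
    have "{w k, w (Suc k)} \<in> (\<lambda>(i, j). {i, j}) ` arrows Q"
      unfolding bij_betw_imp_surj_on[OF edges'] by blast
    then obtain a where a: "a \<in> arrows Q" "{w k, w (Suc k)} = (\<lambda>(i, j). {i, j}) a" by (rule imageE)
    obtain i j where ij: "a = (i, j)" by (cases a)
    have "(w k = i \<and> w (Suc k) = j) \<or> (w k = j \<and> w (Suc k) = i)" using a(2) unfolding ij by (simp add: doubleton_eq_iff)
    then show ?thesis using a(1) unfolding ij e_def by auto
  qed
  have e_inj: "inj e"
  proof (rule injI)
    fix i j assume "e i = e j"
    then have "{fst (e i), snd (e i)} = {fst (e j), snd (e j)}" by simp
    moreover have "{fst (e k), snd (e k)} = {w k, w (Suc k)}" for k unfolding e_def by auto
    ultimately have "{w i, w (Suc i)} = {w j, w (Suc j)}" by simp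
    then have "(i = j \<and> Suc i = Suc j) \<or> (i = Suc j \<and> Suc i = j)"
      unfolding doubleton_eq_iff inj_eq[OF winj] .
    then show "i = j" by auto
  qed
  have "journey Q \<infinity> w e" unfolding journey_def
  proof (intro conjI allI impI)
    show "w k \<in> verts Q" for k unfolding Q(6) rw by simp
    show "inj_on w {k. enat k \<le> \<infinity>}" "inj_on e {k. enat k < \<infinity>}" using winj e_inj by (auto intro: inj_on_subset)
    show "e k \<in> arrows Q" for k by (rule e_arrow)
    show "e k = (w k, w (Suc k)) \<or> e k = (w (Suc k), w k)" for k unfolding e_def by simp
  qed
  then have fin: "finite {e k | k. enat k < \<infinity> \<and> e k = (w (Suc k), w k)}" using outward unfolding eventually_outward_def by blast
  have "e ` {k. e k = (w (Suc k), w k)} \<subseteq> {e k | k. enat k < \<infinity> \<and> e k = (w (Suc k), w k)}"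
  proof
    fix a assume "a \<in> e ` {k. e k = (w (Suc k), w k)}"
    then obtain k where "e k = (w (Suc k), w k)" "a = e k" by blast
    then show "a \<in> {e k | k. enat k < \<infinity> \<and> e k = (w (Suc k), w k)}"
      by (intro CollectI exI[of _ k]) simp
  qed
  then have "finite (e ` {k. e k = (w (Suc k), w k)})" using fin by (rule finite_subset)
  then have "finite {k. e k = (w (Suc k), w k)}" by (rule finite_imageD) (rule inj_on_subset[OF e_inj subset_UNIV])
  from finite_nat_set_iff_bounded[THEN iffD1, OF this]
  obtain N where N: "\<forall>k\<in>{k. e k = (w (Suc k), w k)}. k < N" ..
  have tail: "(w j, w (Suc j)) \<in> arrows Q" if "N \<le> j" for j
  proof (rule ccontr)
    assume "(w j, w (Suc j)) \<notin> arrows Q"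
    then have "e j = (w (Suc j), w j)" unfolding e_def by simp
    then show False using N that by auto
  qed
  interpret vs: vector_space scale by (rule vs)
  have "d_infinity scale Q u u' w N"
  proof (intro d_infinity.intro quiver_reps.intro ambient_space.intro vs quiver_reps_axioms.intro d_infinity_axioms.intro)
    show "quiver Q" "u \<noteq> u'" "inj w" by (fact Q winj)+
    show "u \<noteq> w j" "u' \<noteq> w j" for j using Q(4,5) unfolding rw by auto
    show "verts Q = {u, u'} \<union> range w" using Q(6) unfolding rw .
  qed (fact edges' tail)+
  then show ?thesis by blast
qed

theorem theorem1:
  fixes Q :: "'v quiver"
    and scale :: "'f::field \<Rightarrow> 'b::ab_group_add \<Rightarrow> 'b"
  assumes "vector_space scale"
    and "type_D_infinity Q"
    and "eventually_outward Q"
  shows "unique_type scale Q \<and>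
    infinite_krull_schmidt scale Q \<and>
    (\<forall>V. indecomposable scale Q V \<longrightarrow> FLEI scale Q V) \<and>
    (\<not> finite_dim scale UNIV \<longrightarrow>
      bij_betw (class_dim_vector scale Q) (indecomposable_classes scale Q) (positive_roots Q))"
proof -
  obtain u u' w N where "d_infinity scale Q u u' w N" using d_infinity_exists[OF assms] by blast
  then interpret d_infinity scale Q u u' w N .
  show ?thesis
    using unique_type_d_infinity infinite_krull_schmidt_d_infinity dim_vector_bijection
      root_brick_FLEI indecomposable_iff_root_brick by blast
qed

end
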